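(* Let the setting described in the context hold. Assume in addition that $V_B^n\subset H^1(\Omega)$ for some positive integer $n$, and that for some $\eta\in(0,1]$ one has $V_A^{2r}\subset H^\eta(\Omega)$, $f\in L^2(0,T;H^\eta(\Omega))$ and $\phi_0\in H^\eta(\Omega)$. Let $(\phi,\mu)$ with $\phi\in H^1(0,T;H)$ and $\mu\in L^2(0,T;V_A^{2r})$ be a solution of the limiting problem $$(\partial_t\phi(t),v)+(A^r\mu(t),A^rv)=0\quad\text{for every } v\in V_A^r \text{ and a.a. } t\in(0,T),$$ $$\tau(\partial_t\phi(t),\phi(t)-v)+(\phi(t)-P\phi(t),\phi(t)-v)+\int_\Omega\hat\beta(\phi(t))+(\pi(\phi(t))-f(t),\phi(t)-v)\le(\mu(t),\phi(t)-v)+\int_\Omega\hat\beta(v)$$ for every $v\in H$ and a.a. $t\in(0,T)$, and $\phi(0)=\phi_0$. Then $\phi\in L^2(0,T;H^\eta(\Omega))$, and there exists $\xi\in L^2(0,T;H)$ with $\xi\in\beta(\phi)$ a.e. in $\Omega\times(0,T)$ and $$\tau\partial_t\phi+\phi-P\phi+\xi+\pi(\phi)=\mu+f\quad\text{a.e. in }\Omega\times(0,T).$$ In particular, if $\beta$ is single-valued, the second component $\mu$ of a solution of the limiting problem (with the given data $f,\phi_0$) is unique as well.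
   Context: $\Omega\subset\mathbb{R}^3$ is a bounded, connected, smooth open set, $H:=L^2(\Omega)$ with norm $\|\cdot\|$ and inner product $(\cdot,\cdot)$, $T>0$; $H^\eta(\Omega)$ denotes the usual Sobolev space. $A:D(A)\subset H\to H$ and $B:D(B)\subset H\to H$ are unbounded, monotone, selfadjoint linear operators with compact resolvents; $\{\lambda_j\}$, $\{\lambda'_j\}$ are the nondecreasing sequences of their eigenvalues (nonnegative, tending to $+\infty$) with complete orthonormal eigenvector systems $\{e_j\}$, $\{e'_j\}$. For $s>0$, $A^sv:=\sum_j\lambda_j^s(v,e_j)e_j$ on $V_A^s:=D(A^s)=\{v\in H:\sum_j|\lambda_j^s(v,e_j)|^2<\infty\}$, and analogously $B^s$ on $V_B^s:=D(B^s)$. $P:H\to H$ is the orthogonal projection onto $\ker B$. $r,\sigma_0,\tau$ are fixed positive numbers. Standing structural assumptions: either $\lambda_1>0$, or $0=\lambda_1<\lambda_2$ and $e_1$ is constant; if $\lambda_1=0$, constant functions belong to $V_B^\sigma$ for $\sigma\in(0,\sigma_0)$. $F=\hat\beta+\hat\pi$, with $\hat\beta:\mathbb{R}\to[0,+\infty]$ convex, proper, lower semicontinuous, $\hat\beta(0)=0$; $\hat\pi:\mathbb{R}\to\mathbb{R}$ of class $C^1$ with Lipschitz continuous derivative $\pi:=\hat\pi'$; $\liminf_{|s|\to\infty}s^{-2}F(s)>0$; $\beta:=\partial\hat\beta$ (maximal monotone graph in $\mathbb{R}\times\mathbb{R}$). Standing assumption on the initial datum: $\hat\beta(\phi_0)\in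 L^1(\Omega)$. Convention: $\int_\Omega\hat\beta(v):=+\infty$ if $\hat\beta(v)\notin L^1(\Omega)$. *)

theory Defs
  imports "HOL-Analysis.Analysis"
begin

type_synonym pt = "real^3"

definition pd :: "'a::euclidean_space \<Rightarrow> ('a \<Rightarrow> real) \<Rightarrow> 'a \<Rightarrow> real" where
  "pd i g x = deriv (\<lambda>t. g (x + t *\<^sub>R i)) 0"

text \<open>C-infinity on S: all iterated partial derivatives exist and are continuous on S.\<close>
definition Cinf_on :: "'a::euclidean_space set \<Rightarrow> ('a \<Rightarrow> real) \<Rightarrow> bool" where
  "Cinf_on S f \<longleftrightarrow> (\<exists>F. f \<in> F \<and> (\<forall>g\<in>F. continuous_on S g \<and>
      (\<forall>i\<in>Basis. \<exists>h\<in>F. \<forall>x\<in>S. ((\<lambda>t. g (x + t *\<^sub>R i)) has_real_derivative h x) (at 0))))"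

definition test_fun :: "'a::euclidean_space set \<Rightarrow> ('a \<Rightarrow> real) \<Rightarrow> bool" where
  "test_fun S \<psi> \<longleftrightarrow> Cinf_on UNIV \<psi> \<and> compact (closure {x. \<psi> x \<noteq> 0})
      \<and> closure {x. \<psi> x \<noteq> 0} \<subseteq> S"

definition smooth_domain :: "pt set \<Rightarrow> bool" where
  "smooth_domain \<Omega> \<longleftrightarrow> open \<Omega> \<and> bounded \<Omega> \<and> connected \<Omega> \<and> \<Omega> \<noteq> {} \<and>
     (\<forall>p\<in>frontier \<Omega>. \<exists>U g. open U \<and> p \<in> U \<and> Cinf_on U g \<and>
        (\<forall>x\<in>U. \<exists>i\<in>Basis. pd i g x \<noteq> 0) \<and> \<Omega> \<inter> U = {x\<in>U. g x < 0})"

definition L2 :: "pt set \<Rightarrow> (pt \<Rightarrow> real) \<Rightarrow> bool" where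
  "L2 \<Omega> u \<longleftrightarrow> u \<in> borel_measurable (lebesgue_on \<Omega>) \<and> integrable (lebesgue_on \<Omega>) (\<lambda>x. (u x)\<^sup>2)"

definition ip :: "pt set \<Rightarrow> (pt \<Rightarrow> real) \<Rightarrow> (pt \<Rightarrow> real) \<Rightarrow> real" where
  "ip \<Omega> u v = (LINT x|lebesgue_on \<Omega>. u x * v x)"

definition nsq :: "pt set \<Rightarrow> (pt \<Rightarrow> real) \<Rightarrow> real" where
  "nsq \<Omega> u = ip \<Omega> u u"

definition orthonormal_complete :: "pt set \<Rightarrow> (nat \<Rightarrow> pt \<Rightarrow> real) \<Rightarrow> bool" where
  "orthonormal_complete \<Omega> e \<longleftrightarrow> (\<forall>j. L2 \<Omega> (e j)) \<and>
     (\<forall>i j. ip \<Omega> (e i) (e j) = (if i = j then 1 else 0)) \<and>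
     (\<forall>v. L2 \<Omega> v \<and> (\<forall>j. ip \<Omega> v (e j) = 0) \<longrightarrow> (AE x in lebesgue_on \<Omega>. v x = 0))"

text \<open>Spectral data (eigenvalues with multiplicity, index 0 = first eigenvalue) of a monotone
  selfadjoint operator with compact resolvent.\<close>
definition spectral :: "pt set \<Rightarrow> (nat \<Rightarrow> real) \<Rightarrow> (nat \<Rightarrow> pt \<Rightarrow> real) \<Rightarrow> bool" where
  "spectral \<Omega> lam e \<longleftrightarrow> mono lam \<and> (\<forall>j. 0 \<le> lam j) \<and> filterlim lam at_top sequentially
      \<and> orthonormal_complete \<Omega> e"

definition Vsp :: "pt set \<Rightarrow> (nat \<Rightarrow> real) \<Rightarrow> (nat \<Rightarrow> pt \<Rightarrow> real) \<Rightarrow> real \<Rightarrow> (pt \<Rightarrow> real) set" where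
  "Vsp \<Omega> lam e s = {v. L2 \<Omega> v \<and> summable (\<lambda>j. (lam j powr s * ip \<Omega> v (e j))\<^sup>2)}"

text \<open>squared graph norm of V^s (infinite outside V^s)\<close>
definition Vnsq :: "pt set \<Rightarrow> (nat \<Rightarrow> real) \<Rightarrow> (nat \<Rightarrow> pt \<Rightarrow> real) \<Rightarrow> real \<Rightarrow> (pt \<Rightarrow> real) \<Rightarrow> ennreal" where
  "Vnsq \<Omega> lam e s v = (if L2 \<Omega> v then ennreal (nsq \<Omega> v) + (\<Sum>j. ennreal ((lam j powr s * ip \<Omega> v (e j))\<^sup>2))
                        else \<infinity>)"

definition Apow :: "pt set \<Rightarrow> (nat \<Rightarrow> real) \<Rightarrow> (nat \<Rightarrow> pt \<Rightarrow> real) \<Rightarrow> real \<Rightarrow> (pt \<Rightarrow> real) \<Rightarrow> (pt \<Rightarrow> real)" where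
  "Apow \<Omega> lam e s v = (SOME w. L2 \<Omega> w \<and>
      (\<lambda>N. nsq \<Omega> (\<lambda>x. w x - (\<Sum>j<N. lam j powr s * ip \<Omega> v (e j) * e j x))) \<longlonglongrightarrow> 0)"

definition kerOp :: "pt set \<Rightarrow> (nat \<Rightarrow> real) \<Rightarrow> (nat \<Rightarrow> pt \<Rightarrow> real) \<Rightarrow> (pt \<Rightarrow> real) set" where
  "kerOp \<Omega> lam e = {v \<in> Vsp \<Omega> lam e 1. AE x in lebesgue_on \<Omega>. Apow \<Omega> lam e 1 v x = 0}"

definition orth_proj :: "pt set \<Rightarrow> (pt \<Rightarrow> real) set \<Rightarrow> (pt \<Rightarrow> real) \<Rightarrow> (pt \<Rightarrow> real)" where
  "orth_proj \<Omega> K v = (SOME w. w \<in> K \<and> (\<forall>u\<in>K. ip \<Omega> (\<lambda>x. v x - w x) u = 0))"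

definition weak_partial :: "pt set \<Rightarrow> (pt \<Rightarrow> real) \<Rightarrow> pt \<Rightarrow> (pt \<Rightarrow> real) \<Rightarrow> bool" where
  "weak_partial \<Omega> u i g \<longleftrightarrow> (\<forall>\<psi>. test_fun \<Omega> \<psi> \<longrightarrow>
      (LINT x|lebesgue_on \<Omega>. u x * pd i \<psi> x) = - (LINT x|lebesgue_on \<Omega>. g x * \<psi> x))"

text \<open>squared H^eta norm (H^1 norm for eta = 1, Sobolev-Slobodeckij norm for 0 < eta < 1);
  infinite outside H^eta\<close>
definition sob_nsq :: "pt set \<Rightarrow> real \<Rightarrow> (pt \<Rightarrow> real) \<Rightarrow> ennreal" where
  "sob_nsq \<Omega> \<eta> u =
    (if \<eta> = 1 then
       (if L2 \<Omega> u \<and> (\<forall>i\<in>Basis. \<exists>g. L2 \<Omega> g \<and> weak_partial \<Omega> u i g)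
        then ennreal (nsq \<Omega> u + (\<Sum>i\<in>Basis. nsq \<Omega> (SOME g. L2 \<Omega> g \<and> weak_partial \<Omega> u i g)))
        else \<infinity>)
     else
       (if L2 \<Omega> u
        then ennreal (nsq \<Omega> u) + (\<integral>\<^sup>+x. (\<integral>\<^sup>+y. ennreal ((u x - u y)\<^sup>2 / (norm (x - y) powr (3 + 2 * \<eta>)))
                 \<partial>lebesgue_on \<Omega>) \<partial>lebesgue_on \<Omega>)
        else \<infinity>))"

definition inH :: "pt set \<Rightarrow> real \<Rightarrow> (pt \<Rightarrow> real) \<Rightarrow> bool" where
  "inH \<Omega> \<eta> u \<longleftrightarrow> sob_nsq \<Omega> \<eta> u < \<infinity>"

definition L2T :: "pt set \<Rightarrow> real \<Rightarrow> (real \<Rightarrow> pt \<Rightarrow> real) \<Rightarrow> bool" where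
  "L2T \<Omega> T u \<longleftrightarrow> (\<lambda>(t,x). u t x) \<in> borel_measurable (lebesgue_on ({0<..<T} \<times> \<Omega>)) \<and>
      integrable (lebesgue_on ({0<..<T} \<times> \<Omega>)) (\<lambda>(t,x). (u t x)\<^sup>2)"

text \<open>L2(0,T;X) for a space X given by a squared norm N (infinite outside X)\<close>
definition L2T_X :: "pt set \<Rightarrow> real \<Rightarrow> ((pt \<Rightarrow> real) \<Rightarrow> ennreal) \<Rightarrow> (real \<Rightarrow> pt \<Rightarrow> real) \<Rightarrow> bool" where
  "L2T_X \<Omega> T N u \<longleftrightarrow> L2T \<Omega> T u \<and> (AE t in lebesgue_on {0<..<T}. N (u t) < \<infinity>) \<and>
      (\<lambda>t. N (u t)) \<in> borel_measurable (lebesgue_on {0<..<T}) \<and>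
      (\<integral>\<^sup>+t. N (u t) \<partial>lebesgue_on {0<..<T}) < \<infinity>"

definition time_deriv :: "pt set \<Rightarrow> real \<Rightarrow> (real \<Rightarrow> pt \<Rightarrow> real) \<Rightarrow> (real \<Rightarrow> pt \<Rightarrow> real) \<Rightarrow> bool" where
  "time_deriv \<Omega> T u du \<longleftrightarrow> L2T \<Omega> T u \<and> L2T \<Omega> T du \<and>
     (\<forall>\<zeta> v. test_fun {0<..<T} \<zeta> \<and> L2 \<Omega> v \<longrightarrow>
        (LINT t|lebesgue_on {0<..<T}. ip \<Omega> (u t) v * deriv \<zeta> t)
          = - (LINT t|lebesgue_on {0<..<T}. ip \<Omega> (du t) v * \<zeta> t))"

text \<open>u(0) = u0: value at 0 of the continuous representative, i.e. essential limit in H\<close>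
definition init_val :: "pt set \<Rightarrow> real \<Rightarrow> (real \<Rightarrow> pt \<Rightarrow> real) \<Rightarrow> (pt \<Rightarrow> real) \<Rightarrow> bool" where
  "init_val \<Omega> T u u0 \<longleftrightarrow> (\<exists>N \<in> null_sets lborel.
      ((\<lambda>t. nsq \<Omega> (\<lambda>x. u t x - u0 x)) \<longlongrightarrow> 0) (at 0 within ({0<..<T} - N)))"

definition bhat_ok :: "(real \<Rightarrow> ereal) \<Rightarrow> bool" where
  "bhat_ok bh \<longleftrightarrow> (\<forall>s. 0 \<le> bh s) \<and> (\<exists>s. bh s \<noteq> \<infinity>) \<and> bh 0 = 0 \<and>
     (\<forall>x y \<theta>. 0 < \<theta> \<and> \<theta> < 1 \<longrightarrow>
        bh (\<theta> * x + (1 - \<theta>) * y) \<le> ereal \<theta> * bh x + ereal (1 - \<theta>) * bh y) \<and>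
     (\<forall>c. closed {s. bh s \<le> ereal c})"

definition subdiff :: "(real \<Rightarrow> ereal) \<Rightarrow> real \<Rightarrow> real \<Rightarrow> bool" where
  "subdiff bh x y \<longleftrightarrow> bh x \<noteq> \<infinity> \<and> (\<forall>z. bh x + ereal (y * (z - x)) \<le> bh z)"

text \<open>int_Omega bh(v), := +infinity if bh(v) not in L1\<close>
definition intB :: "pt set \<Rightarrow> (real \<Rightarrow> ereal) \<Rightarrow> (pt \<Rightarrow> real) \<Rightarrow> ereal" where
  "intB \<Omega> bh v = enn2ereal (\<integral>\<^sup>+x. e2ennreal (bh (v x)) \<partial>lebesgue_on \<Omega>)"

definition limsol ::
  "pt set \<Rightarrow> real \<Rightarrow> (nat \<Rightarrow> real) \<Rightarrow> (nat \<Rightarrow> pt \<Rightarrow> real) \<Rightarrow> (nat \<Rightarrow> real) \<Rightarrow> (nat \<Rightarrow> pt \<Rightarrow> real)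
   \<Rightarrow> real \<Rightarrow> real \<Rightarrow> (real \<Rightarrow> ereal) \<Rightarrow> (real \<Rightarrow> real) \<Rightarrow> (real \<Rightarrow> pt \<Rightarrow> real) \<Rightarrow> (pt \<Rightarrow> real)
   \<Rightarrow> (real \<Rightarrow> pt \<Rightarrow> real) \<Rightarrow> (real \<Rightarrow> pt \<Rightarrow> real) \<Rightarrow> (real \<Rightarrow> pt \<Rightarrow> real) \<Rightarrow> bool" where
  "limsol \<Omega> T lam e lam' e' r \<tau> bh \<pi> f \<phi>0 \<phi> d\<phi> \<mu> \<longleftrightarrow>
     time_deriv \<Omega> T \<phi> d\<phi> \<and>
     L2T_X \<Omega> T (Vnsq \<Omega> lam e (2 * r)) \<mu> \<and>
     (\<forall>v \<in> Vsp \<Omega> lam e r. AE t in lebesgue_on {0<..<T}.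
        ip \<Omega> (d\<phi> t) v + ip \<Omega> (Apow \<Omega> lam e r (\<mu> t)) (Apow \<Omega> lam e r v) = 0) \<and>
     (\<forall>v. L2 \<Omega> v \<longrightarrow> (AE t in lebesgue_on {0<..<T}.
        ereal (\<tau> * ip \<Omega> (d\<phi> t) (\<lambda>x. \<phi> t x - v x)
               + ip \<Omega> (\<lambda>x. \<phi> t x - orth_proj \<Omega> (kerOp \<Omega> lam' e') (\<phi> t) x) (\<lambda>x. \<phi> t x - v x))
        + intB \<Omega> bh (\<phi> t)
        + ereal (ip \<Omega> (\<lambda>x. \<pi> (\<phi> t x) - f t x) (\<lambda>x. \<phi> t x - v x))
        \<le> ereal (ip \<Omega> (\<mu> t) (\<lambda>x. \<phi> t x - v x)) + intB \<Omega> bh v)) \<and>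
     init_val \<Omega> T \<phi> \<phi>0"

end

theory Submission
  imports Defs
begin

text \<open>
  Testing the variational inequality with a countable dense set of functions, and then with functions
  modified on small sets, turns it into the pointwise inclusion with \<open>\<xi> = \<mu> + f - \<tau> \<partial>\<^sub>t\<phi> - \<phi> + P\<phi> - \<pi>(\<phi>)\<close>.
  For almost every \<open>x\<close> this is a scalar differential inclusion in \<open>t\<close> with forcing \<open>\<mu> + f + P\<phi>\<close>, and by
  monotonicity of \<open>\<beta>\<close> and Gronwall's lemma \<open>|\<phi>(t, x) - \<phi>(t, y)|\<^sup>2\<close> is controlled by the same differences of
  \<open>\<phi>\<^sub>0\<close> and of the forcing in \<open>L\<^sup>2(0, T)\<close>. Integrating against the kernel that defines the \<open>H\<^sup>\<eta>\<close> seminorm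
  (for \<open>\<eta> = 1\<close>, difference quotients) gives the regularity: \<open>\<mu>\<close> is handled by the continuous
  embedding of \<open>V\<^sub>A\<^sup>2\<^sup>r\<close>, and \<open>P\<phi>\<close> lies in the finite-dimensional kernel of \<open>B\<close>, which is contained in \<open>H\<^sup>1\<close>.
  For uniqueness, \<open>\<integral>\<^sub>0\<^sup>s (\<mu>\<^sub>1 - \<mu>\<^sub>2, \<phi>\<^sub>1 - \<phi>\<^sub>2) \<le> 0\<close> mode by mode, so \<open>\<phi>\<^sub>1 = \<phi>\<^sub>2\<close> by Gronwall; a single-valued
  \<open>\<beta>\<close> then gives \<open>\<mu> = \<tau> \<partial>\<^sub>t\<phi>\<close> for the differences, and \<open>\<partial>\<^sub>t\<phi> + A\<^sup>2\<^sup>r\<mu> = 0\<close> forces \<open>\<mu>\<^sub>1 = \<mu>\<^sub>2\<close>.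
\<close>

section \<open>Square-integrable functions\<close>

text \<open>Three obstacles shape the development. The hypothesis on V_A^(2r) is only an inclusion
  of sets, whereas the estimate for \<mu> has to be integrated in time, so a norm bound must be
  extracted from the inclusion. The H^\<eta> norm has two unrelated forms, a double integral for
  \<eta> < 1 and weak derivatives for \<eta> = 1; together with the L^2 norm both are controlled,
  from above and below, by weighted integrals of squared differences u(X) - u(Y), so that one
  estimate serves both. Finally the kernel of B is known to lie in H^1, so that for \<eta> < 1 the
  embedding of H^1 into H^\<eta> has to be proved, and the smooth boundary enters there through
  local charts. The comparison of two points x, y follows them over the whole time interval, while
  the equations hold in x only for almost every t. Hence the Borel representatives on (0,T) x
  \<Omega>, the joint measurability of the inclusion and the exchange of almost-everywhere
  quantifiers. The Gronwall constant depends on \<tau>, T and the Lipschitz constant of \<pi>, but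
  not on the points, so the pointwise estimate can be integrated against any kernel.\<close>

definition l2 :: "'a measure \<Rightarrow> ('a \<Rightarrow> real) \<Rightarrow> bool" where
  "l2 M u \<longleftrightarrow> u \<in> borel_measurable M \<and> integrable M (\<lambda>x. (u x)\<^sup>2)"

definition inn :: "'a measure \<Rightarrow> ('a \<Rightarrow> real) \<Rightarrow> ('a \<Rightarrow> real) \<Rightarrow> real" where
  "inn M u v = (LINT x|M. u x * v x)"

abbreviation sqnorm :: "'a measure \<Rightarrow> ('a \<Rightarrow> real) \<Rightarrow> real" where
  "sqnorm M u \<equiv> inn M u u"

text \<open>Extended-valued squared norm: it makes sense before integrability is known, so
  membership in L^2 can be proved by bounding it (\<open>l2_iff_sqn\<close>).\<close>

definition sqn :: "'a measure \<Rightarrow> ('a \<Rightarrow> real) \<Rightarrow> ennreal" where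
  "sqn M u = (\<integral>\<^sup>+x. ennreal ((u x)\<^sup>2) \<partial>M)"

definition l2conv :: "'a measure \<Rightarrow> (nat \<Rightarrow> 'a \<Rightarrow> real) \<Rightarrow> ('a \<Rightarrow> real) \<Rightarrow> bool" where
  "l2conv M U u \<longleftrightarrow> (\<forall>n. l2 M (U n)) \<and> l2 M u \<and>
     (\<lambda>n. sqnorm M (\<lambda>x. U n x - u x)) \<longlonglongrightarrow> 0"

lemma l2_meas: "l2 M u \<Longrightarrow> u \<in> borel_measurable M"
  by (simp add: l2_def)

lemma l2_iff_sqn: "l2 M u \<longleftrightarrow> u \<in> borel_measurable M \<and> sqn M u < \<infinity>"
  unfolding l2_def sqn_def
  by (auto simp: integrable_iff_bounded)

lemma sqn_eq: "l2 M u \<Longrightarrow> sqn M u = ennreal (sqnorm M u)"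
  unfolding l2_def sqn_def inn_def
  by (simp add: nn_integral_eq_integral power2_eq_square)

lemma inn_nonneg: "0 \<le> sqnorm M u"
  unfolding inn_def by simp

lemma inn_commute: "inn M u v = inn M v u"
  unfolding inn_def by (simp add: mult.commute)

lemma l2_mult: assumes "l2 M u" "l2 M v" shows "integrable M (\<lambda>x. u x * v x)"
proof (rule Bochner_Integration.integrable_bound)
  show "integrable M (\<lambda>x. (u x)\<^sup>2 + (v x)\<^sup>2)" using assms by (auto simp: l2_def)
  show "(\<lambda>x. u x * v x) \<in> borel_measurable M" using assms by (auto simp: l2_def)
  have "\<bar>a * b\<bar> \<le> a\<^sup>2 + b\<^sup>2" for a b :: real
  proof -
    have "0 \<le> (\<bar>a\<bar> - \<bar>b\<bar>)\<^sup>2 + a\<^sup>2 + b\<^sup>2" by simp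
    then show ?thesis by (simp add: power2_diff abs_mult)
  qed
  then show "AE x in M. norm (u x * v x) \<le> norm ((u x)\<^sup>2 + (v x)\<^sup>2)" by auto
qed

lemma l2_scale: "l2 M u \<Longrightarrow> l2 M (\<lambda>x. c * u x)"
  by (auto simp: l2_def power_mult_distrib)

lemma l2_zero: "l2 M (\<lambda>x. 0)"
  by (simp add: l2_def)

lemma l2_add: assumes "l2 M u" "l2 M v" shows "l2 M (\<lambda>x. u x + v x)"
proof -
  have "integrable M (\<lambda>x. (u x)\<^sup>2 + (v x)\<^sup>2 + 2 * (u x * v x))"
    using assms l2_mult[OF assms] by (auto simp: l2_def)
  then show ?thesis using assms by (auto simp: l2_def power2_sum algebra_simps)
qed

lemma l2_diff: assumes "l2 M u" "l2 M v" shows "l2 M (\<lambda>x. u x - v x)"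
  using l2_add[OF assms(1) l2_scale[OF assms(2), of "-1"]] by simp

lemma l2_sum: "finite A \<Longrightarrow> (\<And>j. j \<in> A \<Longrightarrow> l2 M (u j)) \<Longrightarrow> l2 M (\<lambda>x. \<Sum>j\<in>A. u j x)"
  by (induction rule: finite_induct) (auto simp: l2_zero l2_add)

lemma l2_lincomb: "(\<And>j. l2 M (e j)) \<Longrightarrow> finite A \<Longrightarrow> l2 M (\<lambda>x. \<Sum>j\<in>A. c j * e j x)"
  by (rule l2_sum) (auto intro: l2_scale)

lemma l2_cong_AE:
  assumes "l2 M u" "v \<in> borel_measurable M" "AE x in M. u x = v x" shows "l2 M v"
proof -
  have "integrable M (\<lambda>x. (u x)\<^sup>2) \<longleftrightarrow> integrable M (\<lambda>x. (v x)\<^sup>2)"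
    using assms by (intro integrable_cong_AE) (auto simp: l2_def)
  then show ?thesis using assms by (auto simp: l2_def)
qed

lemma l2_dominated:
  assumes "l2 M u" "v \<in> borel_measurable M" "AE x in M. \<bar>v x\<bar> \<le> \<bar>u x\<bar>" shows "l2 M v"
proof -
  have "integrable M (\<lambda>x. (v x)\<^sup>2)"
    by (rule Bochner_Integration.integrable_bound[of M "\<lambda>x. (u x)\<^sup>2"])
       (use assms in \<open>auto simp: l2_def elim!: eventually_mono dest: abs_le_square_iff[THEN iffD1]\<close>)
  then show ?thesis using assms by (simp add: l2_def)
qed

lemma inn_cong_AE:
  assumes "u \<in> borel_measurable M" "u' \<in> borel_measurable M"
    "v \<in> borel_measurable M" "v' \<in> borel_measurable M"
    "AE x in M. u x = u' x" "AE x in M. v x = v' x"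
  shows "inn M u v = inn M u' v'"
  unfolding inn_def using assms by (intro integral_cong_AE) auto

lemma inn_add_left: assumes "l2 M u" "l2 M v" "l2 M w"
  shows "inn M (\<lambda>x. u x + v x) w = inn M u w + inn M v w"
  unfolding inn_def using l2_mult[OF assms(1,3)] l2_mult[OF assms(2,3)]
  by (simp add: algebra_simps)

lemma inn_diff_left: assumes "l2 M u" "l2 M v" "l2 M w"
  shows "inn M (\<lambda>x. u x - v x) w = inn M u w - inn M v w"
  unfolding inn_def using l2_mult[OF assms(1,3)] l2_mult[OF assms(2,3)]
  by (simp add: algebra_simps)

lemma inn_scale_left: "inn M (\<lambda>x. c * u x) w = c * inn M u w"
  unfolding inn_def by (simp add: mult.assoc)

lemma inn_scale_right: "inn M w (\<lambda>x. c * u x) = c * inn M w u"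
  using inn_scale_left inn_commute by metis

lemma inn_add_right: assumes "l2 M u" "l2 M v" "l2 M w"
  shows "inn M w (\<lambda>x. u x + v x) = inn M w u + inn M w v"
  using inn_add_left[OF assms] by (simp add: inn_commute)

lemma inn_diff_right: assumes "l2 M u" "l2 M v" "l2 M w"
  shows "inn M w (\<lambda>x. u x - v x) = inn M w u - inn M w v"
  using inn_diff_left[OF assms] by (simp add: inn_commute)

lemma inn_sum_left: assumes "finite A" "\<And>j. j \<in> A \<Longrightarrow> l2 M (u j)" "l2 M w"
  shows "inn M (\<lambda>x. \<Sum>j\<in>A. u j x) w = (\<Sum>j\<in>A. inn M (u j) w)"
  using assms
proof (induction rule: finite_induct)
  case empty then show ?case by (simp add: inn_def)
next
  case (insert j A)
  then show ?case using inn_add_left[of M "u j" "\<lambda>x. \<Sum>j\<in>A. u j x" w] by (simp add: l2_sum)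
qed

lemma inn_lincomb_left: assumes "\<And>j. l2 M (e j)" "finite A" "l2 M w"
  shows "inn M (\<lambda>x. \<Sum>j\<in>A. c j * e j x) w = (\<Sum>j\<in>A. c j * inn M (e j) w)"
  using inn_sum_left[of A M "\<lambda>j x. c j * e j x" w] assms by (simp add: l2_scale inn_scale_left)

lemma inn_add_sq: assumes "l2 M u" "l2 M v"
  shows "sqnorm M (\<lambda>x. u x + v x) = sqnorm M u + 2 * inn M u v + sqnorm M v"
  using assms by (simp add: inn_add_left inn_add_right l2_add inn_commute)

lemma inn_diff_sq: assumes "l2 M u" "l2 M v"
  shows "sqnorm M (\<lambda>x. u x - v x) = sqnorm M u - 2 * inn M u v + sqnorm M v"
  using assms by (simp add: inn_diff_left inn_diff_right l2_diff inn_commute)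

text \<open>Discriminant of the nonnegative quadratic t -> |u + t v|^2. The elements are functions
  rather than classes, so a \<open>v\<close> of norm zero need not vanish and is treated separately:
  a nonconstant affine function of t cannot stay nonnegative.\<close>

lemma inn_CS: assumes "l2 M u" "l2 M v" shows "(inn M u v)\<^sup>2 \<le> sqnorm M u * sqnorm M v"
proof -
  have q: "0 \<le> sqnorm M u + 2 * t * inn M u v + t\<^sup>2 * sqnorm M v" for t
    using inn_add_sq[OF assms(1) l2_scale[OF assms(2), of t]]
      inn_nonneg[of M "\<lambda>x. u x + t * v x"]
    by (simp add: inn_scale_left inn_scale_right power2_eq_square algebra_simps)
  show ?thesis
  proof (cases "sqnorm M v = 0")
    case True
    have "inn M u v = 0"
    proof (rule ccontr)
      assume n: "inn M u v \<noteq> 0"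
      \<comment> \<open>At this t the affine function takes the value -1.\<close>
      show False using q[of "- (sqnorm M u + 1) / (2 * inn M u v)"] n True by (simp add: field_simps)
    qed
    then show ?thesis using True by simp
  next
    case False
    then have "0 < sqnorm M v" using inn_nonneg[of M v] by simp
    then show ?thesis using q[of "- inn M u v / sqnorm M v"]
      by (simp add: field_simps power2_eq_square)
  qed
qed

lemma inn_CS_abs: assumes "l2 M u" "l2 M v"
  shows "\<bar>inn M u v\<bar> \<le> sqrt (sqnorm M u) * sqrt (sqnorm M v)"
  using inn_CS[OF assms] real_le_rsqrt[of "\<bar>inn M u v\<bar>" "sqnorm M u * sqnorm M v"]
  by (simp add: real_sqrt_mult)

lemma inn_add_le: assumes "l2 M u" "l2 M v"
  shows "sqnorm M (\<lambda>x. u x + v x) \<le> 2 * sqnorm M u + 2 * sqnorm M v"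
  using inn_add_sq[OF assms] inn_diff_sq[OF assms] inn_nonneg[of M "\<lambda>x. u x - v x"] by simp

lemma inn_diff_le: assumes "l2 M u" "l2 M v"
  shows "sqnorm M (\<lambda>x. u x - v x) \<le> 2 * sqnorm M u + 2 * sqnorm M v"
  using inn_add_sq[OF assms] inn_diff_sq[OF assms] inn_nonneg[of M "\<lambda>x. u x + v x"] by simp

lemma inn_zero_AE: assumes "l2 M u" "sqnorm M u = 0" shows "AE x in M. u x = 0"
proof -
  have "integrable M (\<lambda>x. u x * u x)" using l2_mult assms by blast
  then have "AE x in M. u x * u x = 0"
    using assms(2) integral_nonneg_eq_0_iff_AE[of M "\<lambda>x. u x * u x"] by (simp add: inn_def)
  then show ?thesis by simp
qed

lemma inn_AE_zero: "AE x in M. u x = 0 \<Longrightarrow> inn M u v = 0"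
  unfolding inn_def by (rule integral_eq_zero_AE) auto

lemma inn_swap_sign: "sqnorm M (\<lambda>x. u x - v x) = sqnorm M (\<lambda>x. v x - u x)"
  unfolding inn_def by (intro Bochner_Integration.integral_cong) (auto simp: algebra_simps)

subsection \<open>Convergence and completeness\<close>

lemma l2conv_AE_subseq:
  assumes "l2conv M U u"
  shows "\<exists>r::nat\<Rightarrow>nat. strict_mono r \<and> (AE x in M. (\<lambda>n. U (r n) x) \<longlonglongrightarrow> u x)"
proof -
  have l: "l2 M (\<lambda>x. U n x - u x)" for n using assms by (auto simp: l2conv_def l2_diff)
  have "\<exists>r::nat\<Rightarrow>nat. strict_mono r \<and> (AE x in M. (\<lambda>n. (U (r n) x - u x)\<^sup>2) \<longlonglongrightarrow> 0)"
    using l assms by (intro tendsto_L1_AE_subseq)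
       (auto simp: l2_def l2conv_def inn_def power2_eq_square)
  then obtain r :: "nat \<Rightarrow> nat" where r: "strict_mono r"
    "AE x in M. (\<lambda>n. (U (r n) x - u x)\<^sup>2) \<longlonglongrightarrow> 0" by blast
  have "(\<lambda>n. U (r n) x) \<longlonglongrightarrow> u x" if "(\<lambda>n. (U (r n) x - u x)\<^sup>2) \<longlonglongrightarrow> 0" for x
  proof -
    have "(\<lambda>n. sqrt ((U (r n) x - u x)\<^sup>2)) \<longlonglongrightarrow> sqrt 0" by (intro tendsto_intros that)
    then have "(\<lambda>n. U (r n) x - u x) \<longlonglongrightarrow> 0" by (simp add: tendsto_rabs_zero_iff)
    then show ?thesis by (rule LIM_zero_cancel)
  qed
  then show ?thesis using r by (auto elim!: eventually_mono)
qed

lemma l2conv_subseq: "l2conv M U u \<Longrightarrow> strict_mono r \<Longrightarrow> l2conv M (\<lambda>n. U (r n)) u"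
  unfolding l2conv_def using LIMSEQ_subseq_LIMSEQ[of "\<lambda>n. sqnorm M (\<lambda>x. U n x - u x)" 0 r]
  by (auto simp: o_def)

lemma sqn_Fatou:
  assumes "\<And>n. U n \<in> borel_measurable M" "AE x in M. (\<lambda>n. U n x) \<longlonglongrightarrow> u x" "\<And>n. sqn M (U n) \<le> C"
  shows "sqn M u \<le> C"
proof -
  have "sqn M u = (\<integral>\<^sup>+x. liminf (\<lambda>n. ennreal ((U n x)\<^sup>2)) \<partial>M)"
    unfolding sqn_def
  proof (rule nn_integral_cong_AE)
    show "AE x in M. ennreal ((u x)\<^sup>2) = liminf (\<lambda>n. ennreal ((U n x)\<^sup>2))"
      using assms(2)
    proof eventually_elim
      case (elim x)
      have "(\<lambda>n. ennreal ((U n x)\<^sup>2)) \<longlonglongrightarrow> ennreal ((u x)\<^sup>2)"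
        by (intro tendsto_intros elim)
      from lim_imp_Liminf[OF _ this] show ?case by (metis trivial_limit_sequentially)
    qed
  qed
  also have "\<dots> \<le> liminf (\<lambda>n. sqn M (U n))"
    unfolding sqn_def using assms(1) by (intro nn_integral_liminf) auto
  also have "\<dots> \<le> C"
    using Liminf_le[of sequentially "\<lambda>n. sqn M (U n)" C] assms(3) by (simp add: Liminf_le)
  finally show ?thesis .
qed

lemma inn_tendsto: assumes "l2conv M U u" "l2 M v" shows "(\<lambda>n. inn M (U n) v) \<longlonglongrightarrow> inn M u v"
proof -
  have l: "\<And>n. l2 M (U n)" "l2 M u" "(\<lambda>n. sqnorm M (\<lambda>x. U n x - u x)) \<longlonglongrightarrow> 0"
    using assms by (auto simp: l2conv_def)
  have "(\<lambda>n. inn M (U n) v - inn M u v) \<longlonglongrightarrow> 0"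
  proof (rule Lim_null_comparison)
    show "\<forall>\<^sub>F n in sequentially. norm (inn M (U n) v - inn M u v) \<le>
       sqrt (sqnorm M (\<lambda>x. U n x - u x)) * sqrt (sqnorm M v)"
      using inn_CS_abs[OF l2_diff[OF l(1,2)] assms(2)] l assms(2)
      by (simp add: inn_diff_left)
    have "(\<lambda>n. sqrt (sqnorm M (\<lambda>x. U n x - u x)) * sqrt (sqnorm M v)) \<longlonglongrightarrow> sqrt 0 * sqrt (sqnorm M v)"
      by (intro tendsto_intros l(3))
    then show "(\<lambda>n. sqrt (sqnorm M (\<lambda>x. U n x - u x)) * sqrt (sqnorm M v)) \<longlonglongrightarrow> 0" by simp
  qed
  then show ?thesis by (rule LIM_zero_cancel)
qed

lemma inn_self_tendsto: assumes "l2conv M U u" shows "(\<lambda>n. sqnorm M (U n)) \<longlonglongrightarrow> sqnorm M u"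
proof -
  have l: "\<And>n. l2 M (U n)" "l2 M u" "(\<lambda>n. sqnorm M (\<lambda>x. U n x - u x)) \<longlonglongrightarrow> 0"
    using assms by (auto simp: l2conv_def)
  have "(\<lambda>n. sqnorm M (\<lambda>x. U n x - u x) + 2 * inn M (U n) u - sqnorm M u)
     \<longlonglongrightarrow> 0 + 2 * sqnorm M u - sqnorm M u"
    by (intro tendsto_intros l(3) inn_tendsto[OF assms l(2)])
  then show ?thesis using l by (simp add: inn_diff_sq)
qed

lemma l2conv_from_weak:
  assumes "\<And>n. l2 M (U n)" "l2 M u" "(\<lambda>n. inn M (U n) u) \<longlonglongrightarrow> sqnorm M u"
    "(\<lambda>n. sqnorm M (U n)) \<longlonglongrightarrow> sqnorm M u"
  shows "l2conv M U u"
proof -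
  have "(\<lambda>n. sqnorm M (U n) - 2 * inn M (U n) u + sqnorm M u) \<longlonglongrightarrow> sqnorm M u - 2 * sqnorm M u + sqnorm M u"
    by (intro tendsto_intros assms)
  then show ?thesis using assms by (simp add: l2conv_def inn_diff_sq)
qed

text \<open>Completeness for functions on an arbitrary measure space. A rapidly convergent
  subsequence converges almost everywhere, its pointwise limit is measurable, and Fatou's lemma
  compares every \<open>U m\<close> with that limit, so the whole sequence converges.\<close>

lemma Riesz_Fischer:
  assumes l: "\<And>n. l2 M (U n)"
    and C: "\<And>\<epsilon>. \<epsilon> > 0 \<Longrightarrow> \<exists>N. \<forall>m\<ge>N. \<forall>n\<ge>N. sqnorm M (\<lambda>x. U m x - U n x) < \<epsilon>"
  shows "\<exists>u. l2conv M U u"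
proof -
  have "\<exists>N. \<forall>m\<ge>N. \<forall>n\<ge>N. sqnorm M (\<lambda>x. U m x - U n x) < (1/4)^k" for k :: nat
    by (rule C) simp
  then obtain N where N: "\<And>k m n. m \<ge> N k \<Longrightarrow> n \<ge> N k \<Longrightarrow>
      sqnorm M (\<lambda>x. U m x - U n x) < (1/4)^k" by metis
  \<comment> \<open>The partial sums dominate \<open>N k\<close>, and the extra summand
    \<open>k\<close> makes the sequence strictly increasing.\<close>
  define r where "r k = k + (\<Sum>i\<le>k. N i)" for k
  have rN: "N k \<le> r k" for k unfolding r_def
    by (rule trans_le_add2, rule member_le_sum) auto
  have rmono: "strict_mono r" unfolding strict_mono_Suc_iff r_def by auto
  define d where "d k x = U (r (Suc k)) x - U (r k) x" for k x
  have dl: "l2 M (d k)" for k unfolding d_def by (intro l2_diff l)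
  note [measurable] = l2_meas[OF dl] l2_meas[OF l]
  have dk: "sqn M (d k) \<le> ennreal ((1/4)^k)" for k
  proof -
    have "sqnorm M (d k) < (1/4)^k" unfolding d_def
      using rN[of k] rmono by (intro N) (auto simp: strict_mono_Suc_iff intro: order_trans less_imp_le)
    then show ?thesis by (simp add: sqn_eq[OF dl] ennreal_leI)
  qed
  have "(\<integral>\<^sup>+x. (\<Sum>k. ennreal (2^k * (d k x)\<^sup>2)) \<partial>M) = (\<Sum>k. ennreal (2^k) * sqn M (d k))"
    unfolding sqn_def
    by (subst nn_integral_suminf) (auto simp: ennreal_mult nn_integral_cmult)
  also have "\<dots> \<le> (\<Sum>k. ennreal ((1/2)^k))"
  proof (rule suminf_le)
    fix k
    have "ennreal (2^k) * sqn M (d k) \<le> ennreal (2^k) * ennreal ((1/4)^k)"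
      by (intro mult_left_mono dk) auto
    also have "\<dots> = ennreal ((1/2)^k)" by (subst ennreal_mult[symmetric]) (auto simp flip: power_mult_distrib)
    finally show "ennreal (2^k) * sqn M (d k) \<le> ennreal ((1/2)^k)" .
  qed auto
  also have "\<dots> = ennreal (\<Sum>k. (1/2)^k)"
    by (rule suminf_ennreal2) (auto intro: summable_geometric)
  finally have "(\<integral>\<^sup>+x. (\<Sum>k. ennreal (2^k * (d k x)\<^sup>2)) \<partial>M) \<noteq> \<infinity>"
    by (auto simp: top_unique)
  then have "AE x in M. (\<Sum>k. ennreal (2^k * (d k x)\<^sup>2)) \<noteq> \<infinity>"
    by (intro nn_integral_PInf_AE) auto
  then have cv: "AE x in M. (\<lambda>k. U (r k) x) \<longlonglongrightarrow> lim (\<lambda>k. U (r k) x)"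
  proof eventually_elim
    case (elim x)
    then have s1: "summable (\<lambda>k. 2^k * (d k x)\<^sup>2)"
      by (intro summable_suminf_not_top) auto
    \<comment> \<open>The weights 2^k replace a finite-measure argument: either |d_k| is at most
      2^(-k), or 1 \<le> 2^k |d_k| and then |d_k| \<le> 2^k d_k^2. The second kind of term is
      summable almost everywhere because the norms of d_k^2 decay like 4^(-k).\<close>
    have "summable (\<lambda>k. d k x)"
    proof (rule summable_comparison_test')
      show "summable (\<lambda>k. 2^k * (d k x)\<^sup>2 + (1/2)^k)"
        using s1 by (intro summable_add) auto
      fix k :: nat assume "k \<ge> 0"
      have p: "(2::real)^k > 0" "(2::real)^k * (1/2)^k = 1" by (auto simp flip: power_mult_distrib)
      have "\<bar>d k x\<bar> = \<bar>d k x\<bar> * ((2::real)^k * (1/2)^k)" using p by simp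
      show "norm (d k x) \<le> 2^k * (d k x)\<^sup>2 + (1/2)^k"
      proof (cases "\<bar>d k x\<bar> \<le> (1/2)^k")
        case True then show ?thesis using p(1) by (simp add: add_increasing)
      next
        case False
        then have "1 \<le> 2^k * \<bar>d k x\<bar>" using p
          by (metis mult_le_cancel_left_pos less_imp_le not_le)
        then have "\<bar>d k x\<bar> * 1 \<le> \<bar>d k x\<bar> * (2^k * \<bar>d k x\<bar>)" by (intro mult_left_mono) auto
        also have "\<dots> = 2^k * (d k x)\<^sup>2" by (simp add: power2_eq_square abs_mult_self_eq algebra_simps)
        finally show ?thesis by (simp add: add_increasing2)
      qed
    qed
    then have "summable (\<lambda>k. U (r (Suc k)) x - U (r k) x)" by (simp add: d_def)
    then obtain s where "(\<lambda>k. U (r (Suc k)) x - U (r k) x) sums s" by (auto simp: summable_def)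
    then have "(\<lambda>n. \<Sum>k<n. U (r (Suc k)) x - U (r k) x) \<longlonglongrightarrow> s" by (simp add: sums_def)
    then have "(\<lambda>n. U (r n) x - U (r 0) x) \<longlonglongrightarrow> s"
      by (simp add: sum_lessThan_telescope[of "\<lambda>k. U (r k) x"])
    then have "(\<lambda>n. U (r n) x - U (r 0) x + U (r 0) x) \<longlonglongrightarrow> s + U (r 0) x" by (intro tendsto_intros)
    then have "convergent (\<lambda>n. U (r n) x)" by (auto simp: convergent_def)
    then show ?case by (simp add: convergent_LIMSEQ_iff)
  qed
  define u where "u x = lim (\<lambda>k. U (r k) x)" for x
  have um[measurable]: "u \<in> borel_measurable M" unfolding u_def by measurable
  \<comment> \<open>A Cauchy bound for indices beyond \<open>K\<close> passes to the pointwise limit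
    by Fatou; it yields both membership of \<open>u\<close> in L^2 and convergence.\<close>
  have bd: "sqn M (\<lambda>x. U m x - u x) \<le> ennreal \<epsilon>"
    if e: "\<And>n. n \<ge> K \<Longrightarrow> sqnorm M (\<lambda>x. U m x - U n x) < \<epsilon>" for m K \<epsilon>
  proof (rule sqn_Fatou[where U="\<lambda>k x. U m x - U (r (k + K)) x"])
    show "AE x in M. (\<lambda>k. U m x - U (r (k + K)) x) \<longlonglongrightarrow> U m x - u x"
      using cv
    proof eventually_elim
      case (elim x)
      then have "(\<lambda>k. U (r (k + K)) x) \<longlonglongrightarrow> u x" unfolding u_def
        by (rule LIMSEQ_ignore_initial_segment)
      then show ?case by (intro tendsto_intros)
    qed
    fix k
    have "r (k + K) \<ge> K" using seq_suble[OF rmono, of "k+K"] by simp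
    then have "sqnorm M (\<lambda>x. U m x - U (r (k + K)) x) < \<epsilon>" by (rule e)
    then show "sqn M (\<lambda>x. U m x - U (r (k + K)) x) \<le> ennreal \<epsilon>"
      by (simp add: sqn_eq l2_diff l ennreal_leI)
  qed simp
  have ul: "l2 M u"
  proof -
    obtain K where K: "\<And>n. n \<ge> K \<Longrightarrow> sqnorm M (\<lambda>x. U K x - U n x) < 1"
      using C[of 1] by auto
    have "sqn M (\<lambda>x. U K x - u x) \<le> ennreal 1" by (rule bd) (rule K)
    then have "sqn M (\<lambda>x. U K x - u x) < \<infinity>" by (simp add: le_less_trans)
    then have "l2 M (\<lambda>x. U K x - u x)" by (simp add: l2_iff_sqn)
    from l2_diff[OF l[of K] this] show ?thesis by simp
  qed
  have "(\<lambda>n. sqnorm M (\<lambda>x. U n x - u x)) \<longlonglongrightarrow> 0"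
  proof (rule LIMSEQ_I)
    fix \<epsilon> :: real assume e: "\<epsilon> > 0"
    then obtain K where K: "\<And>m n. m \<ge> K \<Longrightarrow> n \<ge> K \<Longrightarrow> sqnorm M (\<lambda>x. U m x - U n x) < \<epsilon>/2"
      using C[of "\<epsilon>/2"] by auto
    have "sqnorm M (\<lambda>x. U m x - u x) < \<epsilon>" if "m \<ge> K" for m
    proof -
      have "sqn M (\<lambda>x. U m x - u x) \<le> ennreal (\<epsilon>/2)" by (rule bd) (rule K[OF that])
      then have "sqnorm M (\<lambda>x. U m x - u x) \<le> \<epsilon>/2"
        using e by (simp add: sqn_eq l2_diff l ul)
      then show ?thesis using e by simp
    qed
    then show "\<exists>no. \<forall>n\<ge>no. norm (sqnorm M (\<lambda>x. U n x - u x) - 0) < \<epsilon>"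
      using inn_nonneg[of M] by auto
  qed
  then show ?thesis using l ul by (auto simp: l2conv_def)
qed

subsection \<open>Complete orthonormal systems\<close>

locale onb =
  fixes M :: "'a measure" and e :: "nat \<Rightarrow> 'a \<Rightarrow> real"
  assumes e_l2: "l2 M (e j)"
    and e_on: "inn M (e i) (e j) = (if i = j then 1 else 0)"
    and e_compl: "l2 M v \<Longrightarrow> (\<And>j. inn M v (e j) = 0) \<Longrightarrow> AE x in M. v x = 0"
begin

lemma lincomb_l2: "finite A \<Longrightarrow> l2 M (\<lambda>x. \<Sum>j\<in>A. c j * e j x)"
  by (rule l2_lincomb[OF e_l2])

lemma lincomb_coef: "finite A \<Longrightarrow> inn M (\<lambda>x. \<Sum>j\<in>A. c j * e j x) (e k) = (if k \<in> A then c k else 0)"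
  by (simp add: inn_lincomb_left e_l2 e_on if_distrib[of "(*) _"] cong: if_cong)

lemma lincomb_inn: "finite A \<Longrightarrow> l2 M v \<Longrightarrow> inn M (\<lambda>x. \<Sum>j\<in>A. c j * e j x) v = (\<Sum>j\<in>A. c j * inn M v (e j))"
  by (subst inn_lincomb_left) (auto simp: e_l2 intro!: sum.cong inn_commute)

lemma lincomb_sq: "finite A \<Longrightarrow>
  sqnorm M (\<lambda>x. \<Sum>j\<in>A. c j * e j x) = (\<Sum>j\<in>A. (c j)\<^sup>2)"
  by (subst lincomb_inn) (auto simp: lincomb_l2 lincomb_coef power2_eq_square)

lemma series_conv:
  assumes "summable (\<lambda>j. (c j)\<^sup>2)"
  shows "\<exists>w. l2conv M (\<lambda>N x. \<Sum>j<N. c j * e j x) w"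
proof (rule Riesz_Fischer)
  show "l2 M (\<lambda>x. \<Sum>j<n. c j * e j x)" for n by (simp add: lincomb_l2)
  fix \<epsilon> :: real assume "\<epsilon> > 0"
  then obtain N where N: "\<And>m n. m \<ge> N \<Longrightarrow> norm (\<Sum>j=m..<n. (c j)\<^sup>2) < \<epsilon>"
    using assms unfolding summable_Cauchy by blast
  have df: "sqnorm M (\<lambda>x. (\<Sum>j<m. c j * e j x) - (\<Sum>j<n. c j * e j x)) < \<epsilon>" if "N \<le> n" "n \<le> m" for m n
  proof -
    have "(\<Sum>j<m. c j * e j x) - (\<Sum>j<n. c j * e j x) = (\<Sum>j\<in>{n..<m}. c j * e j x)" for x
      using that(2) by (simp add: sum_diff_nat_ivl[of 0 n m "\<lambda>j. c j * e j x"] lessThan_atLeast0)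
    then show ?thesis using lincomb_sq[of "{n..<m}" c] N[OF that(1), of m] by (simp add: sum_nonneg)
  qed
  show "\<exists>N. \<forall>m\<ge>N. \<forall>n\<ge>N. sqnorm M (\<lambda>x. (\<Sum>j<m. c j * e j x) - (\<Sum>j<n. c j * e j x)) < \<epsilon>"
  proof (intro exI allI impI)
    fix m n assume "N \<le> m" "N \<le> n"
    then show "sqnorm M (\<lambda>x. (\<Sum>j<m. c j * e j x) - (\<Sum>j<n. c j * e j x)) < \<epsilon>"
      using df[of n m] df[of m n]
        inn_swap_sign[of M "\<lambda>x. \<Sum>j<m. c j * e j x" "\<lambda>x. \<Sum>j<n. c j * e j x"]
      by (cases "n \<le> m") auto
  qed
qed

lemma series_coef:
  assumes "l2conv M (\<lambda>N x. \<Sum>j<N. c j * e j x) w" shows "inn M w (e k) = c k"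
proof -
  have "(\<lambda>N. inn M (\<lambda>x. \<Sum>j<N. c j * e j x) (e k)) \<longlonglongrightarrow> inn M w (e k)"
    by (rule inn_tendsto[OF assms e_l2])
  moreover have "(\<lambda>N. inn M (\<lambda>x. \<Sum>j<N. c j * e j x) (e k)) \<longlonglongrightarrow> c k"
    by (rule tendsto_eventually, rule eventually_sequentiallyI[of "Suc k"]) (simp add: lincomb_coef)
  ultimately show ?thesis by (rule LIMSEQ_unique)
qed

lemma bessel: assumes "l2 M v" shows "summable (\<lambda>j. (inn M v (e j))\<^sup>2)"
proof (rule summableI_nonneg_bounded)
  fix n
  let ?s = "\<lambda>x. \<Sum>j<n. inn M v (e j) * e j x"
  have "inn M ?s v = (\<Sum>j<n. (inn M v (e j))\<^sup>2)"
    using assms by (simp add: lincomb_inn power2_eq_square)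
  then show "(\<Sum>j<n. (inn M v (e j))\<^sup>2) \<le> sqnorm M v"
    using inn_diff_sq[OF assms lincomb_l2[of "{..<n}"], of "\<lambda>j. inn M v (e j)"]
      inn_nonneg[of M "\<lambda>x. v x - ?s x"]
    by (simp add: lincomb_sq inn_commute[of M v ?s])
qed auto

text \<open>By Bessel and completeness of L^2 the series has some limit; its coefficients are those
  of \<open>v\<close>, and completeness of the system identifies the two almost everywhere.\<close>

lemma fourier_conv: assumes "l2 M v" shows "l2conv M (\<lambda>N x. \<Sum>j<N. inn M v (e j) * e j x) v"
proof -
  obtain w where w: "l2conv M (\<lambda>N x. \<Sum>j<N. inn M v (e j) * e j x) w"
    using series_conv[OF bessel[OF assms]] by blast
  have wl: "l2 M w" using w by (simp add: l2conv_def)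
  have "AE x in M. v x - w x = 0"
    using series_coef[OF w] by (intro e_compl) (auto simp: l2_diff assms wl inn_diff_left e_l2)
  then have ae: "AE x in M. w x = v x" by auto
  note [measurable] = l2_meas[OF assms] l2_meas[OF wl] l2_meas[OF e_l2]
  have "sqnorm M (\<lambda>x. (\<Sum>j<N. inn M v (e j) * e j x) - w x)
     = sqnorm M (\<lambda>x. (\<Sum>j<N. inn M v (e j) * e j x) - v x)" for N
    by (rule inn_cong_AE) (use ae in auto)
  then show ?thesis using w assms by (simp add: l2conv_def)
qed

lemma parseval: assumes "l2 M u" "l2 M v" shows "(\<lambda>j. inn M u (e j) * inn M v (e j)) sums inn M u v"
  using inn_tendsto[OF fourier_conv[OF assms(1)] assms(2)] assms
  by (simp add: sums_def lincomb_inn)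

lemma parseval_sq: assumes "l2 M u" shows "(\<lambda>j. (inn M u (e j))\<^sup>2) sums sqnorm M u"
  using parseval[OF assms assms] by (simp add: power2_eq_square)

lemma AE_eq_coef:
  assumes "l2 M u" "l2 M v" "\<And>j. inn M u (e j) = inn M v (e j)" shows "AE x in M. u x = v x"
proof -
  have "AE x in M. u x - v x = 0"
    using assms by (intro e_compl) (auto simp: l2_diff inn_diff_left e_l2)
  then show ?thesis by auto
qed

lemma riesz_coef:
  assumes s: "summable (\<lambda>j. (c j)\<^sup>2)"
  shows "\<exists>w. l2 M w \<and> (\<forall>j. inn M w (e j) = c j) \<and> sqnorm M w = (\<Sum>j. (c j)\<^sup>2)"
proof -
  obtain w where w: "l2conv M (\<lambda>N x. \<Sum>j<N. c j * e j x) w" using series_conv[OF s] by blast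
  then have "l2 M w" "\<And>j. inn M w (e j) = c j" using series_coef by (auto simp: l2conv_def)
  then show ?thesis using parseval_sq[of w] by (auto simp: sums_iff)
qed

text \<open>Norm convergence is forced by convergence of coefficients and norms, so strong convergence
  is visible in countably many real coordinates.\<close>

lemma l2conv_from_coef:
  assumes U: "\<And>n. l2 M (U n)" and u: "l2 M u"
    and c: "\<And>j. (\<lambda>n. inn M (U n) (e j)) \<longlonglongrightarrow> inn M u (e j)"
    and s: "(\<lambda>n. sqnorm M (U n)) \<longlonglongrightarrow> sqnorm M u"
  shows "l2conv M U u"
proof (rule l2conv_from_weak[OF U u _ s])
  obtain K where "\<And>n. norm (sqnorm M (U n)) \<le> K"
    using convergent_imp_Bseq[OF convergentI[OF s]] unfolding Bseq_def by blast
  then have K: "sqnorm M (U n) \<le> K" for n by (metis abs_le_D1 real_norm_def)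
  have K0: "0 \<le> K" using inn_nonneg K order_trans by blast
  show "(\<lambda>n. inn M (U n) u) \<longlonglongrightarrow> sqnorm M u"
  proof (rule LIMSEQ_I)
    fix \<epsilon> :: real assume e: "\<epsilon> > 0"
    let ?s = "\<lambda>N x. \<Sum>j<N. inn M u (e j) * e j x"
    have fc: "l2conv M ?s u" by (rule fourier_conv[OF u])
    \<comment> \<open>Chosen so that truncating the Fourier series of \<open>u\<close> changes each
      of the inner products below by at most \<epsilon>/3; the summand 1 keeps the denominator
      positive.\<close>
    define \<delta> where "\<delta> = \<epsilon> / (3 * (1 + sqrt K + sqrt (sqnorm M u)))"
    have d: "\<delta> > 0" unfolding \<delta>_def using e K0 inn_nonneg[of M u]
      by (intro divide_pos_pos mult_pos_pos add_pos_nonneg) auto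
    have "(\<lambda>N. sqrt (sqnorm M (\<lambda>x. ?s N x - u x))) \<longlonglongrightarrow> sqrt 0"
      using fc unfolding l2conv_def by (intro tendsto_intros) auto
    then have "\<forall>\<^sub>F N in sequentially. sqrt (sqnorm M (\<lambda>x. ?s N x - u x)) < \<delta>"
      using d by (intro order_tendstoD(2)[where y=0]) auto
    then obtain N where N: "sqrt (sqnorm M (\<lambda>x. ?s N x - u x)) < \<delta>"
      by (auto dest: eventually_happens)
    have sl: "l2 M (?s N)" by (rule lincomb_l2) simp
    have "(\<lambda>n. inn M (?s N) (U n)) \<longlonglongrightarrow> inn M (?s N) u"
      using tendsto_sum[of "{..<N}" "\<lambda>j n. inn M u (e j) * inn M (U n) (e j)"
          "\<lambda>j. inn M u (e j) * inn M u (e j)" sequentially] tendsto_mult[OF tendsto_const c]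
      by (subst (1 2) lincomb_inn) (auto simp: U u)
    from LIMSEQ_D[OF this, of "\<epsilon>/3"] e
    obtain n0 where n0: "\<And>n. n \<ge> n0 \<Longrightarrow> norm (inn M (?s N) (U n) - inn M (?s N) u) < \<epsilon>/3"
      by auto
    have tail: "\<bar>inn M (?s N) v - inn M u v\<bar> \<le> \<epsilon>/3" if v: "l2 M v" "sqrt (sqnorm M v) \<le> sqrt K + sqrt (sqnorm M u)" for v
    proof -
      have "\<bar>inn M (?s N) v - inn M u v\<bar> \<le> \<delta> * (1 + sqrt K + sqrt (sqnorm M u))"
      proof -
        have "sqrt (sqnorm M (\<lambda>x. ?s N x - u x)) * sqrt (sqnorm M v)
            \<le> \<delta> * (1 + sqrt K + sqrt (sqnorm M u))"
          by (rule mult_mono) (use N d v(2) inn_nonneg[of M v] in auto)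
        then show ?thesis
          using inn_CS_abs[OF l2_diff[OF sl u] v(1)] inn_diff_left[OF sl u v(1)] by linarith
      qed
      also have "\<dots> = \<epsilon>/3"
      proof -
        have "1 + sqrt K + sqrt (sqnorm M u) > 0" using K0 inn_nonneg[of M u]
          by (intro add_pos_nonneg) auto
        moreover have "\<epsilon> / (3 * z) * z = \<epsilon> / 3" if "z > 0" for z using that by simp
        ultimately show ?thesis unfolding \<delta>_def by blast
      qed
      finally show ?thesis .
    qed
    have "\<bar>inn M (U n) u - inn M u u\<bar> < \<epsilon>" if "n \<ge> n0" for n
    proof -
      have "\<bar>inn M (?s N) (U n) - inn M u (U n)\<bar> \<le> \<epsilon>/3"
        using K[of n] inn_nonneg[of M u] by (intro tail U) (simp add: add_increasing2)
      moreover have "\<bar>inn M (?s N) u - inn M u u\<bar> \<le> \<epsilon>/3"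
        using K0 by (intro tail u) simp
      ultimately show ?thesis using n0[OF that] inn_commute[of M u "U n"] by (simp only: real_norm_def)
    qed
    then show "\<exists>no. \<forall>n\<ge>no. norm (inn M (U n) u - sqnorm M u) < \<epsilon>" by auto
  qed
qed

end

section \<open>Smooth functions\<close>

inductive_set alg :: "('a \<Rightarrow> real) set \<Rightarrow> ('a \<Rightarrow> real) set" for G where
  alg_base: "g \<in> G \<Longrightarrow> g \<in> alg G"
| alg_const: "(\<lambda>x. c) \<in> alg G"
| alg_add: "f \<in> alg G \<Longrightarrow> g \<in> alg G \<Longrightarrow> (\<lambda>x. f x + g x) \<in> alg G"
| alg_mult: "f \<in> alg G \<Longrightarrow> g \<in> alg G \<Longrightarrow> (\<lambda>x. f x * g x) \<in> alg G"

text \<open>The coinduction principle for \<^const>\<open>Cinf_on\<close>: derivatives of generators need only be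
  polynomials in the generators.\<close>

lemma alg_Cinf:
  assumes cont: "\<And>g. g \<in> G \<Longrightarrow> continuous_on S g"
    and der: "\<And>g i. g \<in> G \<Longrightarrow> i \<in> Basis \<Longrightarrow>
        \<exists>h\<in>alg G. \<forall>x\<in>S. ((\<lambda>t. g (x + t *\<^sub>R i)) has_real_derivative h x) (at 0)"
    and f: "f \<in> alg G"
  shows "Cinf_on S f"
  unfolding Cinf_on_def
proof (intro exI[of _ "alg G"] conjI f ballI)
  show "continuous_on S g" if "g \<in> alg G" for g
    using that by induction (auto intro: cont continuous_intros)
  show "\<exists>h\<in>alg G. \<forall>x\<in>S. ((\<lambda>t. g (x + t *\<^sub>R i)) has_real_derivative h x) (at 0)"
    if "g \<in> alg G" "i \<in> Basis" for g i
    using that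
  proof induction
    case (alg_base g) then show ?case by (rule der)
  next
    case (alg_const c) then show ?case by (intro bexI[of _ "\<lambda>x. 0"]) (auto intro: alg.alg_const)
  next
    case (alg_add f g)
    then obtain hf hg where "hf \<in> alg G" "hg \<in> alg G"
      "\<forall>x\<in>S. ((\<lambda>t. f (x + t *\<^sub>R i)) has_real_derivative hf x) (at 0)"
      "\<forall>x\<in>S. ((\<lambda>t. g (x + t *\<^sub>R i)) has_real_derivative hg x) (at 0)" by blast
    then show ?case
      by (intro bexI[of _ "\<lambda>x. hf x + hg x"]) (auto intro!: derivative_eq_intros alg.alg_add)
  next
    case (alg_mult f g)
    then obtain hf hg where "hf \<in> alg G" "hg \<in> alg G"
      "\<forall>x\<in>S. ((\<lambda>t. f (x + t *\<^sub>R i)) has_real_derivative hf x) (at 0)"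
      "\<forall>x\<in>S. ((\<lambda>t. g (x + t *\<^sub>R i)) has_real_derivative hg x) (at 0)" by blast
    then show ?case using alg_mult
      by (intro bexI[of _ "\<lambda>x. hf x * g x + f x * hg x"])
         (auto intro!: derivative_eq_intros alg.alg_add alg.alg_mult simp: algebra_simps)
  qed
qed

lemma Cinf_cont: "Cinf_on S f \<Longrightarrow> continuous_on S f"
  unfolding Cinf_on_def by blast

lemma Cinf_deriv: assumes "Cinf_on S f" "i \<in> Basis"
  shows "\<exists>h. Cinf_on S h \<and> (\<forall>x\<in>S. ((\<lambda>t. f (x + t *\<^sub>R i)) has_real_derivative h x) (at 0))"
proof -
  obtain F where F: "f \<in> F" "\<forall>g\<in>F. continuous_on S g \<and>
      (\<forall>i\<in>Basis. \<exists>h\<in>F. \<forall>x\<in>S. ((\<lambda>t. g (x + t *\<^sub>R i)) has_real_derivative h x) (at 0))"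
    using assms(1) unfolding Cinf_on_def by blast
  then obtain h where "h \<in> F" "\<forall>x\<in>S. ((\<lambda>t. f (x + t *\<^sub>R i)) has_real_derivative h x) (at 0)"
    using assms(2) by blast
  then show ?thesis unfolding Cinf_on_def using F(2) by blast
qed

lemma Cinf_pd: assumes "Cinf_on S f" "i \<in> Basis"
  shows "\<And>x. x \<in> S \<Longrightarrow> ((\<lambda>t. f (x + t *\<^sub>R i)) has_real_derivative pd i f x) (at 0)"
    and "continuous_on S (pd i f)"
proof -
  obtain h where h: "Cinf_on S h" "\<forall>x\<in>S. ((\<lambda>t. f (x + t *\<^sub>R i)) has_real_derivative h x) (at 0)"
    using Cinf_deriv[OF assms] by blast
  then have e: "pd i f x = h x" if "x \<in> S" for x
    using that unfolding pd_def by (intro DERIV_imp_deriv) auto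
  then show "\<And>x. x \<in> S \<Longrightarrow> ((\<lambda>t. f (x + t *\<^sub>R i)) has_real_derivative pd i f x) (at 0)"
    using h by simp
  show "continuous_on S (pd i f)"
    using Cinf_cont[OF h(1)] e by (simp cong: continuous_on_cong)
qed

lemma Cinf_line:
  assumes "Cinf_on S f" "i \<in> Basis" "x + s *\<^sub>R i \<in> S"
  shows "((\<lambda>t. f (x + t *\<^sub>R i)) has_real_derivative pd i f (x + s *\<^sub>R i)) (at s)"
proof -
  have "((\<lambda>t. f ((x + s *\<^sub>R i) + t *\<^sub>R i)) has_real_derivative pd i f (x + s *\<^sub>R i)) (at (s - s))"
    using Cinf_pd(1)[OF assms] by simp
  then have "((\<lambda>t. f ((x + s *\<^sub>R i) + (t - s) *\<^sub>R i)) has_real_derivative pd i f (x + s *\<^sub>R i)) (at s)"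
    using DERIV_shift[of "\<lambda>t. f ((x + s *\<^sub>R i) + (t - s) *\<^sub>R i)" _ 0 s] by simp
  then show ?thesis by (simp add: algebra_simps)
qed

text \<open>Taking all smooth functions as generators turns the coinduction principle into closure
  under sums and products.\<close>

lemma Cinf_alg: assumes "f \<in> alg {f. Cinf_on S f}" shows "Cinf_on S f"
proof (rule alg_Cinf[OF _ _ assms])
  show "continuous_on S g" if "g \<in> {f. Cinf_on S f}" for g using that Cinf_cont by blast
  show "\<exists>h\<in>alg {f. Cinf_on S f}. \<forall>x\<in>S. ((\<lambda>t. g (x + t *\<^sub>R i)) has_real_derivative h x) (at 0)"
    if "g \<in> {f. Cinf_on S f}" "i \<in> Basis" for g i
    using Cinf_deriv[of S g i] that by (auto intro: alg_base)
qed

lemma Cinf_add: "Cinf_on S f \<Longrightarrow> Cinf_on S g \<Longrightarrow> Cinf_on S (\<lambda>x. f x + g x)"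
  by (rule Cinf_alg) (auto intro: alg.intros)

lemma Cinf_scale: "Cinf_on S f \<Longrightarrow> Cinf_on S (\<lambda>x. c * f x)"
  by (rule Cinf_alg) (auto intro!: alg_mult alg_const intro: alg_base)

text \<open>The whole family that witnesses smoothness is translated, not just the one
  function.\<close>

lemma Cinf_shift: assumes "Cinf_on UNIV f" shows "Cinf_on UNIV (\<lambda>x. f (x + h))"
proof -
  obtain F where F: "f \<in> F" "\<forall>g\<in>F. continuous_on UNIV g \<and>
      (\<forall>i\<in>Basis. \<exists>h\<in>F. \<forall>x\<in>UNIV. ((\<lambda>t. g (x + t *\<^sub>R i)) has_real_derivative h x) (at 0))"
    using assms unfolding Cinf_on_def by blast
  have c: "continuous_on UNIV (\<lambda>x. g (x + h))" if "g \<in> F" for g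
    by (rule continuous_on_compose2[of UNIV g]) (use F(2) that in \<open>auto intro!: continuous_intros\<close>)
  have d: "\<exists>k\<in>F. \<forall>x. ((\<lambda>t. g (x + t *\<^sub>R i + h)) has_real_derivative k (x + h)) (at 0)"
    if g: "g \<in> F" "i \<in> Basis" for g i
  proof -
    obtain k where k: "k \<in> F" "\<And>x. ((\<lambda>t. g (x + t *\<^sub>R i)) has_real_derivative k x) (at 0)"
      using F(2) g by blast
    have "((\<lambda>t. g (x + t *\<^sub>R i + h)) has_real_derivative k (x + h)) (at 0)" for x
      using k(2)[of "x + h"] by (simp add: algebra_simps)
    then show ?thesis using k(1) by blast
  qed
  show ?thesis unfolding Cinf_on_def
  proof (intro exI[of _ "(\<lambda>g x. g (x + h)) ` F"] conjI)
    show "(\<lambda>x. f (x + h)) \<in> (\<lambda>g x. g (x + h)) ` F" using F(1) by blast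
    show "\<forall>g\<in>(\<lambda>g x. g (x + h)) ` F. continuous_on UNIV g \<and> (\<forall>i\<in>Basis. \<exists>h\<in>(\<lambda>g x. g (x + h)) ` F.
        \<forall>x\<in>UNIV. ((\<lambda>t. g (x + t *\<^sub>R i)) has_real_derivative h x) (at 0))"
      using c d by fastforce
  qed
qed

subsection \<open>Bump functions\<close>

text \<open>The classical function exp(-1/s), multiplied by powers of 1/s. The extra index is there
  because differentiation leads from one member of the family to a combination of two others, so the
  family generates an algebra closed under derivatives.\<close>

definition flat :: "nat \<Rightarrow> real \<Rightarrow> real" where
  "flat m s = (if s > 0 then inverse s ^ m * exp (- inverse s) else 0)"

lemma flat_tendsto_0: "((\<lambda>s. flat m s) \<longlongrightarrow> 0) (at 0)"
proof -
  have "((\<lambda>s. flat m s) \<longlongrightarrow> 0) (at_right 0)"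
  proof -
    have "((\<lambda>s::real. inverse s ^ m / exp (inverse s)) \<longlongrightarrow> 0) (at_right 0)"
      by (rule filterlim_compose[OF tendsto_power_div_exp_0 filterlim_inverse_at_top_right])
    then show ?thesis
      by (rule Lim_transform_eventually)
         (auto simp: eventually_at_right_less flat_def exp_minus divide_inverse intro: eventually_at_right_less[THEN eventually_mono])
  qed
  moreover have "((\<lambda>s. flat m s) \<longlongrightarrow> 0) (at_left 0)"
    by (rule tendsto_eventually)
       (auto simp: flat_def intro!: eventually_at_leftI[of "-1"])
  ultimately show ?thesis by (simp add: filterlim_at_split)
qed

lemma flat_deriv: "(flat m has_real_derivative (flat (m + 2) s - real m * flat (m + 1) s)) (at s)"
proof -
  consider "s > 0" | "s < 0" | "s = 0" by linarith
  then show ?thesis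
  proof cases
    case 1
    have "((\<lambda>s. inverse s ^ m * exp (- inverse s)) has_real_derivative
       (flat (m + 2) s - real m * flat (m + 1) s)) (at s)"
    proof -
      have p: "((\<lambda>s. inverse s ^ m) has_real_derivative - real m * inverse s ^ (m + 1)) (at s)"
        using DERIV_power[OF DERIV_inverse[of s UNIV], of m] 1 by (cases m) (auto simp: algebra_simps)
      have q: "((\<lambda>s. exp (- inverse s)) has_real_derivative (inverse s)\<^sup>2 * exp (- inverse s)) (at s)"
        using 1 by (auto intro!: derivative_eq_intros simp: power2_eq_square)
      from DERIV_mult[OF p q] show ?thesis
        using 1 by (simp add: flat_def power_add power2_eq_square algebra_simps)
    qed
    then show ?thesis
      by (rule DERIV_cong_ev[THEN iffD1, rotated -1])
         (use 1 in \<open>auto simp: flat_def intro!: eventually_mono[OF eventually_gt_at_top] eventually_nhds_in_open[of "{0<..}", THEN eventually_mono]\<close>)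
  next
    case 2
    have "((\<lambda>s. 0) has_real_derivative (flat (m + 2) s - real m * flat (m + 1) s)) (at s)"
      using 2 by (simp add: flat_def)
    then show ?thesis
      by (rule DERIV_cong_ev[THEN iffD1, rotated -1])
         (use 2 in \<open>auto simp: flat_def intro!: eventually_nhds_in_open[of "{..<0}", THEN eventually_mono]\<close>)
  next
    case 3
    \<comment> \<open>The difference quotient of \<open>flat m\<close> at 0 is exactly
      \<open>flat (Suc m)\<close>, which tends to 0; this value also agrees with the general formula
      for the derivative, since every \<open>flat k\<close> vanishes at 0.\<close>
    have "((\<lambda>h. (flat m (0 + h) - flat m 0) / h) \<longlongrightarrow> 0) (at 0)"
      by (rule Lim_transform_eventually[OF flat_tendsto_0[of "Suc m"]])
         (auto simp: flat_def field_simps)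
    then show ?thesis using 3 by (simp add: DERIV_def flat_def)
  qed
qed

lemma flat_le_1: "0 \<le> flat 0 s" "flat 0 s \<le> 1"
  by (auto simp: flat_def)

text \<open>Each factor depends on (x_i - a_i)(b_i - x_i), which for a nonempty box is positive
  exactly between the two faces. The factor \<open>Suc n\<close> drives exp(-1/(n+1)c) to 1, so the
  bumps increase towards the indicator of the box.\<close>

definition bump :: "nat \<Rightarrow> 'a::euclidean_space \<Rightarrow> 'a \<Rightarrow> 'a \<Rightarrow> real" where
  "bump n a b x = (\<Prod>i\<in>Basis. flat 0 (real (Suc n) * ((x \<bullet> i - a \<bullet> i) * (b \<bullet> i - x \<bullet> i))))"

text \<open>The coordinate functions are needed besides the flat factors because the chain rule
  produces the polynomial q + p - 2 x_i.\<close>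

definition bump_gens :: "('a::euclidean_space \<Rightarrow> real) set" where
  "bump_gens = {\<lambda>x. flat m (c * ((x \<bullet> i - p) * (q - x \<bullet> i))) | m c p q i. i \<in> Basis} \<union>
     {\<lambda>x. x \<bullet> i | i. i \<in> Basis}"

lemma flat_cont: "continuous_on UNIV (flat m)"
  using flat_deriv DERIV_isCont continuous_at_imp_continuous_on by blast

lemma bump_Cinf: "Cinf_on UNIV (bump n a b)"
proof (rule alg_Cinf[where G=bump_gens])
  show "continuous_on UNIV g" if "g \<in> bump_gens" for g :: "'a \<Rightarrow> real"
    using that unfolding bump_gens_def
    by (auto intro!: continuous_intros continuous_on_compose2[OF flat_cont])
  show "\<exists>h\<in>alg bump_gens. \<forall>x\<in>UNIV. ((\<lambda>t. g (x + t *\<^sub>R j)) has_real_derivative h x) (at 0)"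
    if "g \<in> bump_gens" "j \<in> Basis" for g and j :: 'a
  proof -
    from that(1) consider (1) m c p q i where "i \<in> Basis" "g = (\<lambda>x. flat m (c * ((x \<bullet> i - p) * (q - x \<bullet> i))))"
      | (2) i where "i \<in> Basis" "g = (\<lambda>x. x \<bullet> i)" unfolding bump_gens_def by blast
    then show ?thesis
    proof cases
      case 1
      let ?F = "\<lambda>m (x::'a). flat m (c * ((x \<bullet> i - p) * (q - x \<bullet> i)))"
      let ?h = "\<lambda>x. (?F (m + 2) x + (- real m) * ?F (m + 1) x) *
          (c * (j \<bullet> i) * (q + p + (-2) * (x \<bullet> i)))"
      have a: "?F k \<in> alg bump_gens" for k using 1(1) by (intro alg_base) (auto simp: bump_gens_def)
      have "(\<lambda>x::'a. x \<bullet> i) \<in> alg bump_gens" using 1(1) by (intro alg_base) (auto simp: bump_gens_def)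
      then have "?h \<in> alg bump_gens"
        by (intro alg_mult alg_add a alg_const)
      moreover have "((\<lambda>t. g (x + t *\<^sub>R j)) has_real_derivative ?h x) (at 0)" for x
      proof -
        have "((\<lambda>t. c * (((x + t *\<^sub>R j) \<bullet> i - p) * (q - (x + t *\<^sub>R j) \<bullet> i))) has_real_derivative
            c * (j \<bullet> i) * (q + p + (-2) * (x \<bullet> i))) (at 0)"
          by (auto intro!: derivative_eq_intros simp: inner_add_left algebra_simps)
        from DERIV_chain2[OF _ this, of "flat m"] flat_deriv[of m]
        show ?thesis unfolding 1(2) by simp
      qed
      ultimately show ?thesis by (intro bexI[of _ ?h] ballI)
    next
      case 2
      have "((\<lambda>t. (x + t *\<^sub>R j) \<bullet> i) has_real_derivative j \<bullet> i) (at 0)" for x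
        by (auto intro!: derivative_eq_intros simp: inner_add_left)
      then show ?thesis unfolding 2(2) by (intro bexI[of _ "\<lambda>x. j \<bullet> i"]) (auto intro: alg_const)
    qed
  qed
  have "(\<lambda>x. \<Prod>i\<in>A. flat 0 (real (Suc n) * ((x \<bullet> i - a \<bullet> i) * (b \<bullet> i - x \<bullet> i)))) \<in> alg bump_gens"
    if "A \<subseteq> Basis" for A
    using finite_subset[OF that finite_Basis] that
  proof (induction A)
    case empty then show ?case by (simp add: alg_const)
  next
    case (insert i A)
    have "(\<lambda>x. flat 0 (real (Suc n) * ((x \<bullet> i - a \<bullet> i) * (b \<bullet> i - x \<bullet> i)))) \<in> alg bump_gens"
      using insert.prems by (intro alg_base) (unfold bump_gens_def, blast)
    from alg_mult[OF this insert.IH] insert show ?case by simp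
  qed
  then show "bump n a b \<in> alg bump_gens" unfolding bump_def by (simp add: fun_eq_iff bump_def)
qed

lemma bump_bounds: "0 \<le> bump n a b x" "bump n a b x \<le> 1"
  unfolding bump_def by (auto intro!: prod_nonneg prod_le_1 simp: flat_le_1)

lemma bump_outside: assumes ne: "box a b \<noteq> {}" and "x \<notin> box a b" shows "bump n a b x = 0"
proof -
  obtain i where i: "i \<in> Basis" "\<not> (a \<bullet> i < x \<bullet> i \<and> x \<bullet> i < b \<bullet> i)" using assms by (auto simp: mem_box)
  \<comment> \<open>With the faces in the wrong order the product (x_i - a_i)(b_i - x_i) would be
    positive between them, hence the appeal to nonemptiness of the box.\<close>
  have ab: "a \<bullet> i < b \<bullet> i" using ne i(1) by (simp add: box_ne_empty)
  have "(x \<bullet> i - a \<bullet> i) * (b \<bullet> i - x \<bullet> i) \<le> 0"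
  proof (cases "x \<bullet> i \<le> a \<bullet> i")
    case True then show ?thesis using ab by (intro mult_nonpos_nonneg) auto
  next
    case False then show ?thesis using i(2) ab by (intro mult_nonneg_nonpos) auto
  qed
  then have "\<not> 0 < real (Suc n) * ((x \<bullet> i - a \<bullet> i) * (b \<bullet> i - x \<bullet> i))"
    by (simp add: not_less mult_nonneg_nonpos)
  then have "flat 0 (real (Suc n) * ((x \<bullet> i - a \<bullet> i) * (b \<bullet> i - x \<bullet> i))) = 0"
    unfolding flat_def by simp
  then show ?thesis unfolding bump_def using i(1) by (intro prod_zero) auto
qed

lemma bump_tendsto: assumes ne: "box a b \<noteq> {}"
  shows "(\<lambda>n. bump n a b x) \<longlonglongrightarrow> indicator (box a b) x"
proof (cases "x \<in> box a b")
  case True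
  have "(\<lambda>n. flat 0 (real (Suc n) * ((x \<bullet> i - a \<bullet> i) * (b \<bullet> i - x \<bullet> i)))) \<longlonglongrightarrow> 1" if i: "i \<in> Basis" for i
  proof -
    let ?c = "(x \<bullet> i - a \<bullet> i) * (b \<bullet> i - x \<bullet> i)"
    have c: "?c > 0" using True i by (auto simp: mem_box)
    have "(\<lambda>n. exp (- (inverse (real (Suc n)) * inverse ?c))) \<longlonglongrightarrow> exp (- (0 * inverse ?c))"
      by (intro tendsto_intros LIMSEQ_inverse_real_of_nat)
    moreover have "flat 0 (real (Suc n) * ?c) = exp (- (inverse (real (Suc n)) * inverse ?c))" for n
      using c by (simp add: flat_def)
    ultimately show ?thesis by simp
  qed
  then have "(\<lambda>n. bump n a b x) \<longlonglongrightarrow> (\<Prod>i\<in>(Basis::'a set). 1)"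
    unfolding bump_def by (intro tendsto_prod)
  then show ?thesis using True by simp
next
  case False then show ?thesis by (simp add: bump_outside[OF ne])
qed

lemma bump_test: assumes "box a b \<noteq> {}" "cbox a b \<subseteq> S" shows "test_fun S (bump n a b)"
proof -
  have "closure {x. bump n a b x \<noteq> 0} \<subseteq> cbox a b"
    using bump_outside[OF assms(1)] box_subset_cbox[of a b] by (intro closure_minimal) auto
  moreover from this have "compact (closure {x. bump n a b x \<noteq> 0})"
    by (intro compact_closure[THEN iffD2] bounded_subset[OF bounded_cbox[of a b]])
       (meson closure_subset order_trans)
  ultimately show ?thesis unfolding test_fun_def using bump_Cinf assms(2) by blast
qed

subsection \<open>Test functions\<close>

lemma test_fun_add: assumes "test_fun S f" "test_fun S g" shows "test_fun S (\<lambda>x. f x + g x)"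
proof -
  let ?K = "closure {x. f x \<noteq> 0} \<union> closure {x. g x \<noteq> 0}"
  have K: "compact ?K" "?K \<subseteq> S" using assms by (auto simp: test_fun_def)
  have "closure {x. f x + g x \<noteq> 0} \<subseteq> closure ({x. f x \<noteq> 0} \<union> {x. g x \<noteq> 0})" by (rule closure_mono) auto
  then have *: "closure {x. f x + g x \<noteq> 0} \<subseteq> ?K" by simp
  then have "compact (closure {x. f x + g x \<noteq> 0})"
    using compact_Int_closed[OF K(1) closed_closure[of "{x. f x + g x \<noteq> 0}"]] by (simp add: Int_absorb1)
  then show ?thesis using assms * K(2) unfolding test_fun_def by (auto intro: Cinf_add)
qed

lemma test_fun_scale: assumes "test_fun S f" shows "test_fun S (\<lambda>x. c * f x)"
proof -
  have *: "closure {x. c * f x \<noteq> 0} \<subseteq> closure {x. f x \<noteq> 0}" by (rule closure_mono) auto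
  then have "compact (closure {x. c * f x \<noteq> 0})"
    using assms compact_Int_closed[OF _ closed_closure, of "closure {x. f x \<noteq> 0}" "{x. c * f x \<noteq> 0}"]
    unfolding test_fun_def by (simp only: Int_absorb1)
  then show ?thesis using assms * unfolding test_fun_def by (auto intro: Cinf_scale)
qed

lemma test_fun_zero: "test_fun S (\<lambda>x. 0)"
proof -
  have "Cinf_on UNIV (\<lambda>x::'a. 0)" by (rule Cinf_alg) (rule alg_const)
  then show ?thesis by (simp add: test_fun_def)
qed

lemma test_fun_cont: "test_fun S f \<Longrightarrow> continuous_on UNIV f"
  unfolding test_fun_def by (blast dest: Cinf_cont)

lemma test_fun_mono: "test_fun S f \<Longrightarrow> S \<subseteq> S' \<Longrightarrow> test_fun S' f"
  unfolding test_fun_def by blast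

lemma cont_compact_support_bounded:
  fixes f :: "'a::euclidean_space \<Rightarrow> real"
  assumes "continuous_on UNIV f" "compact K" "\<And>x. x \<notin> K \<Longrightarrow> f x = 0"
  shows "\<exists>C\<ge>0. \<forall>x. \<bar>f x\<bar> \<le> C * indicator K x"
proof -
  have "bounded (f ` K)"
    using assms by (meson compact_continuous_image compact_imp_bounded continuous_on_subset subset_UNIV)
  then obtain C where "\<forall>x\<in>K. \<bar>f x\<bar> \<le> C" unfolding bounded_iff by auto
  then show ?thesis using assms(3)
    by (intro exI[of _ "max C 0"]) (auto simp: indicator_def le_max_iff_disj)
qed

lemma indicator_integrable_lebesgue_on:
  assumes "W \<in> sets lebesgue" "compact (K :: 'a::euclidean_space set)"
  shows "integrable (lebesgue_on W) (indicator K :: 'a \<Rightarrow> real)"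
proof -
  have "integrable lebesgue (indicator K :: 'a \<Rightarrow> real)"
    using lmeasurable_compact[OF assms(2)] by (intro integrable_real_indicator) (auto simp: fmeasurable_def)
  then show ?thesis using assms(1)
    using integrable_mult_indicator[of W lebesgue "indicator K :: 'a \<Rightarrow> real"]
    by (simp add: integrable_restrict_space)
qed

lemma cont_compact_support_l2:
  fixes f :: "'a::euclidean_space \<Rightarrow> real"
  assumes "continuous_on UNIV f" "compact K" "\<And>x. x \<notin> K \<Longrightarrow> f x = 0" "W \<in> sets lebesgue"
  shows "l2 (lebesgue_on W) f"
proof -
  obtain C where C: "C \<ge> 0" "\<And>x. \<bar>f x\<bar> \<le> C * indicator K x"
    using cont_compact_support_bounded[OF assms(1-3)] by blast
  have m: "(indicator K :: 'a \<Rightarrow> real) \<in> borel_measurable (lebesgue_on W)"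
    by (rule borel_measurable_integrable[OF indicator_integrable_lebesgue_on[OF assms(4,2)]])
  have "l2 (lebesgue_on W) (\<lambda>x. C * indicator K x)"
    using indicator_integrable_lebesgue_on[OF assms(4,2)] m
    by (intro l2_scale) (simp add: l2_def power2_eq_square flip: indicator_inter_arith)
  moreover have "f \<in> borel_measurable (lebesgue_on W)"
    using borel_measurable_continuous_onI[OF assms(1)]
    by (intro measurable_restrict_space1) (simp add: measurable_completion)
  ultimately show ?thesis by (rule l2_dominated) (use C in \<open>auto intro!: AE_I2 order_trans[OF C(2)]\<close>)
qed

lemma closure_support: "x \<notin> closure {x. f x \<noteq> 0} \<Longrightarrow> f x = 0"
  using subsetD[OF closure_subset, of x "{x. f x \<noteq> 0}"] by auto

lemma test_fun_l2: "test_fun S f \<Longrightarrow> W \<in> sets lebesgue \<Longrightarrow> l2 (lebesgue_on W) f"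
  by (rule cont_compact_support_l2[where K="closure {x. f x \<noteq> 0}"])
     (auto simp: test_fun_def Cinf_cont intro: closure_support)

lemma pd_outside: assumes "x \<notin> closure {x. f x \<noteq> 0}" shows "pd i f x = 0"
proof -
  have "open (- closure {x. f x \<noteq> 0})" by (simp add: open_Compl)
  then obtain r where r: "r > 0" "ball x r \<subseteq> - closure {x. f x \<noteq> 0}"
    using assms by (meson ComplI openE)
  have "f (x + t *\<^sub>R i) = 0" if "\<bar>t\<bar> * norm i < r" for t
  proof -
    have "x + t *\<^sub>R i \<in> ball x r" using that by (simp add: dist_norm)
    then have "x + t *\<^sub>R i \<notin> closure {x. f x \<noteq> 0}" using r(2) by blast
    then show ?thesis by (rule closure_support)
  qed
  moreover have "\<forall>\<^sub>F t in nhds 0. \<bar>t\<bar> * norm i < r"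
  proof -
    have "((\<lambda>t::real. \<bar>t\<bar> * norm i) \<longlongrightarrow> \<bar>0\<bar> * norm i) (nhds 0)"
      by (intro tendsto_intros) (simp add: filterlim_ident)
    then show ?thesis using r(1) by (intro order_tendstoD(2)) auto
  qed
  ultimately have "\<forall>\<^sub>F t in nhds 0. f (x + t *\<^sub>R i) = 0" by (auto elim: eventually_mono)
  then have "((\<lambda>t. f (x + t *\<^sub>R i)) has_real_derivative 0) (at 0)"
    by (subst DERIV_cong_ev[where g="\<lambda>t. 0"]) auto
  then show ?thesis unfolding pd_def by (rule DERIV_imp_deriv)
qed

lemma test_fun_pd_l2: assumes "test_fun S f" "i \<in> Basis" "W \<in> sets lebesgue"
  shows "l2 (lebesgue_on W) (pd i f)"
  by (rule cont_compact_support_l2[where K="closure {x. f x \<noteq> 0}"])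
     (use assms in \<open>auto simp: test_fun_def intro: Cinf_pd(2) pd_outside\<close>)

section \<open>Density of test functions\<close>

lemma l2conv_dominated:
  assumes [measurable]: "\<And>n. U n \<in> borel_measurable M" "u \<in> borel_measurable M"
    and w: "l2 M w" and b: "\<And>n. AE x in M. \<bar>U n x\<bar> \<le> \<bar>w x\<bar>" and c: "AE x in M. (\<lambda>n. U n x) \<longlonglongrightarrow> u x"
  shows "l2conv M U u"
proof -
  have bu: "AE x in M. \<bar>u x\<bar> \<le> \<bar>w x\<bar>"
  proof -
    have "AE x in M. \<forall>n. \<bar>U n x\<bar> \<le> \<bar>w x\<bar>" using b by (simp add: AE_all_countable)
    then show ?thesis using c
    proof eventually_elim
      case (elim x)
      from elim(2) have "(\<lambda>n. \<bar>U n x\<bar>) \<longlonglongrightarrow> \<bar>u x\<bar>" by (rule tendsto_rabs)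
      then show ?case by (rule LIMSEQ_le_const2) (use elim(1) in auto)
    qed
  qed
  have l: "l2 M (U n)" "l2 M u" for n using l2_dominated[OF w] b bu by auto
  have "(\<lambda>n. LINT x|M. (U n x - u x)\<^sup>2) \<longlonglongrightarrow> (LINT x|M. 0)"
  proof (rule integral_dominated_convergence[where w="\<lambda>x. 4 * (w x)\<^sup>2"])
    show "integrable M (\<lambda>x. 4 * (w x)\<^sup>2)" using w by (simp add: l2_def)
    show "AE x in M. (\<lambda>n. (U n x - u x)\<^sup>2) \<longlonglongrightarrow> 0" using c
    proof eventually_elim
      case (elim x)
      then have "(\<lambda>n. (U n x - u x)\<^sup>2) \<longlonglongrightarrow> (u x - u x)\<^sup>2" by (intro tendsto_intros)
      then show ?case by simp
    qed
    fix n show "AE x in M. norm ((U n x - u x)\<^sup>2) \<le> 4 * (w x)\<^sup>2" using b[of n] bu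
    proof eventually_elim
      case (elim x)
      then have "\<bar>U n x - u x\<bar> \<le> \<bar>2 * w x\<bar>" by linarith
      then have "(U n x - u x)\<^sup>2 \<le> (2 * w x)\<^sup>2" by (rule abs_le_square_iff[THEN iffD1])
      then show ?case by (simp add: power_mult_distrib)
    qed
  qed auto
  then show ?thesis using l by (simp add: l2conv_def inn_def power2_eq_square)
qed

definition approx :: "'a::euclidean_space set \<Rightarrow> ('a \<Rightarrow> real) set" where
  "approx W = {v. l2 (lebesgue_on W) v \<and> (\<forall>\<epsilon>>0. \<exists>\<psi>. test_fun W \<psi> \<and>
     sqnorm (lebesgue_on W) (\<lambda>x. v x - \<psi> x) < \<epsilon>)}"

lemma approx_limit:
  assumes W: "W \<in> sets lebesgue" and U: "\<And>n. U n \<in> approx W" and c: "l2conv (lebesgue_on W) U v"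
  shows "v \<in> approx W"
  unfolding approx_def
proof (intro CollectI conjI allI impI)
  show v: "l2 (lebesgue_on W) v" using c by (simp add: l2conv_def)
  fix \<epsilon> :: real assume e: "\<epsilon> > 0"
  let ?M = "lebesgue_on W"
  have "(\<lambda>n. sqnorm ?M (\<lambda>x. U n x - v x)) \<longlonglongrightarrow> 0" using c by (simp add: l2conv_def)
  then have "\<forall>\<^sub>F n in sequentially. sqnorm ?M (\<lambda>x. U n x - v x) < \<epsilon>/4"
    using e by (intro order_tendstoD(2)) auto
  then obtain n where n: "sqnorm ?M (\<lambda>x. U n x - v x) < \<epsilon>/4"
    by (auto dest: eventually_happens)
  obtain \<psi> where p: "test_fun W \<psi>" "sqnorm ?M (\<lambda>x. U n x - \<psi> x) < \<epsilon>/4"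
  proof -
    have "\<epsilon>/4 > 0" using e by simp
    then show ?thesis using U[of n] that unfolding approx_def by blast
  qed
  have u: "l2 ?M (U n)" using U[of n] by (simp add: approx_def)
  have pl: "l2 ?M \<psi>" by (rule test_fun_l2[OF p(1) W])
  have "sqnorm ?M (\<lambda>x. (U n x - \<psi> x) - (U n x - v x)) < \<epsilon>"
    using inn_diff_le[OF l2_diff[OF u pl] l2_diff[OF u v]] n p(2) by linarith
  then have "sqnorm ?M (\<lambda>x. v x - \<psi> x) < \<epsilon>" by simp
  then show "\<exists>\<psi>. test_fun W \<psi> \<and> sqnorm ?M (\<lambda>x. v x - \<psi> x) < \<epsilon>" using p(1) by blast
qed

lemma approx_test: "W \<in> sets lebesgue \<Longrightarrow> test_fun W \<psi> \<Longrightarrow> \<psi> \<in> approx W"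
  unfolding approx_def by (auto simp: test_fun_l2 inn_def intro!: exI[of _ \<psi>])

lemma approx_add: assumes W: "W \<in> sets lebesgue" and u: "u \<in> approx W" and v: "v \<in> approx W"
  shows "(\<lambda>x. u x + v x) \<in> approx W"
  unfolding approx_def
proof (intro CollectI conjI allI impI)
  let ?M = "lebesgue_on W"
  have l: "l2 ?M u" "l2 ?M v" using u v by (auto simp: approx_def)
  then show "l2 ?M (\<lambda>x. u x + v x)" by (rule l2_add)
  fix \<epsilon> :: real assume e: "\<epsilon> > 0"
  then have "\<epsilon>/4 > 0" by simp
  then obtain f g where f: "test_fun W f" "sqnorm ?M (\<lambda>x. u x - f x) < \<epsilon>/4"
    and g: "test_fun W g" "sqnorm ?M (\<lambda>x. v x - g x) < \<epsilon>/4"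
    using u v unfolding approx_def by blast
  have "sqnorm ?M (\<lambda>x. (u x - f x) + (v x - g x)) < \<epsilon>"
    using inn_add_le[OF l2_diff[OF l(1) test_fun_l2[OF f(1) W]] l2_diff[OF l(2) test_fun_l2[OF g(1) W]]]
      f(2) g(2) by linarith
  then have "sqnorm ?M (\<lambda>x. u x + v x - (f x + g x)) < \<epsilon>"
    by (simp add: algebra_simps)
  then show "\<exists>\<psi>. test_fun W \<psi> \<and> sqnorm ?M (\<lambda>x. u x + v x - \<psi> x) < \<epsilon>"
    using test_fun_add[OF f(1) g(1)] by blast
qed

lemma approx_scale: assumes W: "W \<in> sets lebesgue" and u: "u \<in> approx W"
  shows "(\<lambda>x. c * u x) \<in> approx W"
  unfolding approx_def
proof (intro CollectI conjI allI impI)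
  let ?M = "lebesgue_on W"
  show "l2 ?M (\<lambda>x. c * u x)" using u by (auto simp: approx_def l2_scale)
  fix \<epsilon> :: real assume e: "\<epsilon> > 0"
  have c1: "c\<^sup>2 + 1 > 0" by (simp add: add_nonneg_pos)
  then have "\<epsilon>/(c\<^sup>2 + 1) > 0" using e by simp
  then obtain f where f: "test_fun W f" "sqnorm ?M (\<lambda>x. u x - f x) < \<epsilon>/(c\<^sup>2+1)"
    using u unfolding approx_def by blast
  have "sqnorm ?M (\<lambda>x. c * u x - c * f x) = c\<^sup>2 * sqnorm ?M (\<lambda>x. u x - f x)"
    by (simp add: inn_scale_left inn_scale_right power2_eq_square flip: right_diff_distrib)
  also have "\<dots> \<le> (c\<^sup>2 + 1) * sqnorm ?M (\<lambda>x. u x - f x)"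
    by (intro mult_right_mono inn_nonneg) auto
  also have "\<dots> < \<epsilon>" using f(2) c1 by (simp add: pos_less_divide_eq mult.commute)
  finally show "\<exists>\<psi>. test_fun W \<psi> \<and> sqnorm ?M (\<lambda>x. c * u x - \<psi> x) < \<epsilon>"
    using test_fun_scale[OF f(1)] by blast
qed

lemma approx_sum: assumes W: "W \<in> sets lebesgue" and "finite A" "\<And>k. k \<in> A \<Longrightarrow> u k \<in> approx W"
  shows "(\<lambda>x. \<Sum>k\<in>A. u k x) \<in> approx W"
  using assms(2,3)
  by (induction rule: finite_induct) (auto simp: approx_test[OF W test_fun_zero] approx_add[OF W])

text \<open>Induction over the Borel sets generated by the intersection-stable family of boxes.
  Everything is intersected with one fixed box whose closure lies in \<open>W\<close>: this keeps
  the measures finite and supplies the dominating function for countable disjoint unions.\<close>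

lemma approx_indicator:
  fixes W :: "'a::euclidean_space set"
  assumes W: "W \<in> sets lebesgue" and ab: "cbox a b \<subseteq> W" and A: "A \<in> sets borel"
  shows "(indicator (A \<inter> box a b) :: 'a \<Rightarrow> real) \<in> approx W"
proof -
  let ?M = "lebesgue_on W"
  have wl: "l2 ?M (indicator (cbox a b))"
    using indicator_integrable_lebesgue_on[OF W compact_cbox[of a b]]
    by (simp add: l2_def power2_eq_square borel_measurable_integrable flip: indicator_inter_arith)
  have im[measurable]: "(indicator X :: 'a \<Rightarrow> real) \<in> borel_measurable ?M" if "X \<in> sets borel" for X
    using that by (intro measurable_restrict_space1 measurable_completion) simp
  have bx: "(indicator (box c d) :: 'a \<Rightarrow> real) \<in> approx W" if "cbox c d \<subseteq> W" for c d
  proof (cases "box c d = {}")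
    case True
    then have "(indicator (box c d) :: 'a \<Rightarrow> real) = (\<lambda>x. 0)" by auto
    then show ?thesis by (simp add: approx_test[OF W test_fun_zero])
  next
    case False
    have wl': "l2 ?M (indicator (cbox c d))"
      using indicator_integrable_lebesgue_on[OF W compact_cbox[of c d]]
      by (simp add: l2_def power2_eq_square borel_measurable_integrable flip: indicator_inter_arith)
    show ?thesis
    proof (rule approx_limit[OF W])
      show "bump n c d \<in> approx W" for n by (intro approx_test W bump_test False that)
      show "l2conv ?M (\<lambda>n. bump n c d) (indicator (box c d))"
      proof (rule l2conv_dominated[OF _ _ wl'])
        show "bump n c d \<in> borel_measurable ?M" for n
          by (rule l2_meas, rule test_fun_l2[OF bump_test W]) (use False that in auto)
        show "AE x in ?M. \<bar>bump n c d x\<bar> \<le> \<bar>indicator (cbox c d) x\<bar>" for n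
        proof (intro AE_I2)
          fix x show "\<bar>bump n c d x\<bar> \<le> \<bar>indicator (cbox c d) x\<bar>"
            using bump_bounds[of n c d x] bump_outside[OF False, of x n] box_subset_cbox[of c d]
            by (cases "x \<in> box c d") (auto simp: indicator_def)
        qed
      qed (auto intro: bump_tendsto[OF False])
    qed
  qed
  have "Int_stable (range (\<lambda>(a, b). box a b :: 'a set))"
    by (auto simp: Int_stable_def box_Int_box)
  moreover have "(range (\<lambda>(a, b). box a b :: 'a set)) \<subseteq> Pow UNIV" by auto
  moreover have "A \<in> sigma_sets UNIV (range (\<lambda>(a, b). box a b))"
    using A unfolding borel_eq_box by simp
  ultimately show ?thesis
  proof (induction rule: sigma_sets_induct_disjoint)
    case (basic A)
    then obtain c d where "A = box c d" by auto
    moreover have "cbox c d \<inter> cbox a b \<subseteq> W" using ab by blast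
    ultimately show ?case using bx by (simp add: box_Int_box Int_interval)
  next
    case empty then show ?case by (simp add: approx_test[OF W test_fun_zero])
  next
    case (compl A)
    \<comment> \<open>Complements are taken relative to the fixed box, whose own indicator is
      already approximable.\<close>
    have e: "(indicator ((UNIV - A) \<inter> box a b) :: 'a \<Rightarrow> real) = (\<lambda>x. indicator (box a b) x + (-1) * indicator (A \<inter> box a b) x)"
      by (auto simp: indicator_def)
    show ?case unfolding e by (intro approx_add approx_scale W bx ab compl)
  next
    case (union A)
    then have Ab: "A n \<in> sets borel" for n unfolding borel_eq_box by auto
    have part: "(\<lambda>x. \<Sum>k<n. indicator (A k \<inter> box a b) x) = (indicator ((\<Union>k<n. A k) \<inter> box a b) :: 'a \<Rightarrow> real)" for n
    proof
      fix x
      have "disjoint_family_on (\<lambda>k. A k \<inter> box a b) {..<n}"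
        using union(1) by (auto simp: disjoint_family_on_def)
      then have "indicator (\<Union>k<n. A k \<inter> box a b) x = (\<Sum>k<n. indicator (A k \<inter> box a b) x :: real)"
        by (intro indicator_UN_disjoint) auto
      moreover have "(\<Union>k<n. A k \<inter> box a b) = (\<Union>k<n. A k) \<inter> box a b" by blast
      ultimately show "(\<Sum>k<n. indicator (A k \<inter> box a b) x) = (indicator ((\<Union>k<n. A k) \<inter> box a b) x :: real)" by simp
    qed
    show ?case
    proof (rule approx_limit[OF W])
      show "(\<lambda>x. \<Sum>k<n. indicator (A k \<inter> box a b) x) \<in> approx W" for n
        using union by (intro approx_sum W) auto
      show "l2conv ?M (\<lambda>n x. \<Sum>k<n. indicator (A k \<inter> box a b) x) (indicator ((\<Union>i. A i) \<inter> box a b))"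
        unfolding part
      proof (rule l2conv_dominated[OF _ _ wl])
        show "(indicator ((\<Union>k<n. A k) \<inter> box a b) :: 'a \<Rightarrow> real) \<in> borel_measurable ?M" for n
          using Ab by (intro im sets.Int sets.finite_UN) auto
        show "(indicator ((\<Union>k. A k) \<inter> box a b) :: 'a \<Rightarrow> real) \<in> borel_measurable ?M"
          using Ab by (intro im sets.Int sets.countable_UN) auto
        show "AE x in ?M. \<bar>indicator ((\<Union>k<n. A k) \<inter> box a b) x\<bar> \<le> \<bar>indicator (cbox a b) x :: real\<bar>" for n
          using box_subset_cbox[of a b] by (intro AE_I2) (auto simp: indicator_def)
        show "AE x in ?M. (\<lambda>n. indicator ((\<Union>k<n. A k) \<inter> box a b) x :: real) \<longlonglongrightarrow> indicator ((\<Union>i. A i) \<inter> box a b) x"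
        proof (intro AE_I2)
          fix x
          show "(\<lambda>n. indicator ((\<Union>k<n. A k) \<inter> box a b) x :: real) \<longlonglongrightarrow> indicator ((\<Union>i. A i) \<inter> box a b) x"
          proof (cases "x \<in> (\<Union>i. A i) \<inter> box a b")
            case True
            then obtain i where "x \<in> A i" by blast
            then show ?thesis using True
              by (intro tendsto_eventually eventually_sequentiallyI[of "Suc i"]) (auto simp: indicator_def)
          next
            case False then show ?thesis by (auto simp: indicator_def)
          qed
        qed
      qed
    qed
  qed
qed

text \<open>Translation, composition and Fubini arguments below are carried out for Borel functions
  on the whole space, while the data are only Lebesgue measurable on \<open>W\<close>; this is the
  passage between the two.\<close>

lemma borel_rep:
  fixes u :: "'a::euclidean_space \<Rightarrow> real"
  assumes W: "W \<in> sets borel" and u: "u \<in> borel_measurable (lebesgue_on W)"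
  shows "\<exists>u'\<in>borel_measurable borel. (\<forall>x. x \<notin> W \<longrightarrow> u' x = 0) \<and> (AE x in lebesgue_on W. u x = u' x)"
proof -
  have W': "W \<in> sets lebesgue" using W by (simp add: sets_completionI_sets)
  have "(\<lambda>x. if x \<in> W then u x else 0) \<in> borel_measurable lebesgue"
    by (rule borel_measurable_if_I[OF u W'])
  from completion_ex_borel_measurable_real[OF this] obtain g where
    g: "g \<in> borel_measurable lborel" "AE x in lborel. (if x \<in> W then u x else 0) = g x" by blast
  have "AE x in lebesgue. (if x \<in> W then u x else 0) = g x" by (rule AE_completion[OF g(2)])
  then have "AE x in lebesgue_on W. u x = indicator W x * g x"
    using W' by (subst AE_restrict_space_iff) (auto simp: indicator_def elim!: eventually_mono)
  moreover have "(\<lambda>x. indicator W x * g x) \<in> borel_measurable borel" using g(1) W by simp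
  ultimately show ?thesis by (intro bexI[of _ "\<lambda>x. indicator W x * g x"]) auto
qed

lemma borel_meas_lebesgue_on: "f \<in> borel_measurable borel \<Longrightarrow> f \<in> borel_measurable (lebesgue_on W)"
  by (intro measurable_restrict_space1) (simp add: measurable_completion)

text \<open>Simple functions converge to \<open>v\<close> pointwise and are dominated by 2|v|, so
  the result for indicators extends by dominated convergence.\<close>

lemma approx_box:
  fixes W :: "'a::euclidean_space set"
  assumes W: "W \<in> sets lebesgue" and ab: "cbox a b \<subseteq> W" and v[measurable]: "v \<in> borel_measurable borel"
    and vl: "l2 (lebesgue_on W) (\<lambda>x. v x * indicator (box a b) x)"
  shows "(\<lambda>x. v x * indicator (box a b) x) \<in> approx W"
proof -
  let ?M = "lebesgue_on W"
  obtain F where F: "\<And>i. simple_function borel (F i)" "\<And>x. (\<lambda>i. F i x) \<longlonglongrightarrow> v x"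
    "\<And>i x. dist (F i x) 0 \<le> 2 * dist (v x) 0"
    using borel_measurable_implies_sequence_metric[OF v, of 0] by auto
  have Fm[measurable]: "F i \<in> borel_measurable borel" for i by (rule borel_measurable_simple_function[OF F(1)])
  show ?thesis
  proof (rule approx_limit[OF W])
    fix i
    have e: "F i x * indicator (box a b) x = (\<Sum>y \<in> F i ` UNIV. y * indicator (F i -` {y} \<inter> box a b) x)" for x
    proof -
      have "F i x = (\<Sum>y \<in> F i ` UNIV. indicator (F i -` {y}) x * y)"
        by (rule simple_function_indicator_representation_banach[OF F(1), of x i,
              unfolded space_borel Int_UNIV_right real_scaleR_def, OF UNIV_I])
      then have "F i x * indicator (box a b) x = (\<Sum>y \<in> F i ` UNIV. indicator (F i -` {y}) x * y) * indicator (box a b) x"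
        by (rule arg_cong)
      also have "\<dots> = (\<Sum>y \<in> F i ` UNIV. y * indicator (F i -` {y} \<inter> box a b) x)"
        unfolding sum_distrib_right by (intro sum.cong) (auto simp: indicator_def)
      finally show ?thesis .
    qed
    have "F i -` {y} \<in> sets borel" for y using measurable_sets[OF Fm, of "{y}" i] by simp
    then show "(\<lambda>x. F i x * indicator (box a b) x) \<in> approx W" unfolding e
      using simple_functionD(1)[OF F(1)[of i]]
      by (intro approx_sum approx_scale approx_indicator W ab) auto
  next
    show "l2conv ?M (\<lambda>i x. F i x * indicator (box a b) x) (\<lambda>x. v x * indicator (box a b) x)"
    proof (rule l2conv_dominated[OF _ _ l2_scale[OF vl, of 2]])
      show "(\<lambda>x. F i x * indicator (box a b) x) \<in> borel_measurable ?M" for i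
        by (rule borel_meas_lebesgue_on) measurable
      show "(\<lambda>x. v x * indicator (box a b) x) \<in> borel_measurable ?M"
        by (rule borel_meas_lebesgue_on) measurable
      show "AE x in ?M. \<bar>F i x * indicator (box a b) x\<bar> \<le> \<bar>2 * (v x * indicator (box a b) x)\<bar>" for i
        using F(3)[of i] by (intro AE_I2) (auto simp: indicator_def abs_mult)
      show "AE x in ?M. (\<lambda>i. F i x * indicator (box a b) x) \<longlonglongrightarrow> v x * indicator (box a b) x"
        by (intro AE_I2 tendsto_intros F(2))
    qed
  qed
qed

text \<open>An open set is a countable union of closed boxes. The function is approximated on finite
  unions of the open boxes, which exhaust \<open>W\<close> up to the boundary faces, a null
  set.\<close>

theorem test_dense:
  fixes W :: "'a::euclidean_space set"
  assumes oW: "open W" and vl: "l2 (lebesgue_on W) v"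
  shows "\<exists>\<psi>. (\<forall>n. test_fun W (\<psi> n)) \<and> l2conv (lebesgue_on W) \<psi> v"
proof -
  let ?M = "lebesgue_on W"
  have W: "W \<in> sets lebesgue" "W \<in> sets borel" using oW by auto
  obtain g where g[measurable]: "g \<in> borel_measurable borel" and gv: "AE x in ?M. v x = g x"
    using borel_rep[OF W(2) l2_meas[OF vl]] by blast
  have gl: "l2 ?M g" by (rule l2_cong_AE[OF vl borel_meas_lebesgue_on[OF g] gv])
  obtain D where D: "countable D" "D \<subseteq> Pow W" "\<And>X. X \<in> D \<Longrightarrow> \<exists>a b. X = cbox a b" "\<Union>D = W"
    using open_countable_Union_open_cbox[OF oW] by metis
  have "insert {} D \<noteq> {}" by simp
  \<comment> \<open>Adding the empty set makes the enumeration meaningful even if there are no boxes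
    at all.\<close>
  define X where "X = from_nat_into (insert {} D)"
  have X: "X k \<in> insert {} D" "range X = insert {} D" for k
    using from_nat_into[of "insert {} D" k] range_from_nat_into[of "insert {} D"] D(1) by (auto simp: X_def)
  have "\<exists>a b. X k = cbox a b" for k
    using X(1)[of k] D(3) by (cases "X k = {}") (auto intro: exI[of _ 1] exI[of _ 0] simp: empty_as_interval)
  then obtain a b where ab: "\<And>k. X k = cbox (a k) (b k)" by metis
  have abW: "cbox (a k) (b k) \<subseteq> W" for k using X(1)[of k] D(2) ab[of k] by auto
  define V where "V n = (\<Union>k<n. box (a k) (b k))" for n
  have Vm[measurable]: "V n \<in> sets borel" for n unfolding V_def by auto
  have cut: "l2 ?M (\<lambda>x. g x * indicator S x)" if "S \<in> sets borel" for S
    by (rule l2_dominated[OF gl]) (use that in \<open>auto intro!: borel_meas_lebesgue_on AE_I2 simp: abs_mult indicator_def\<close>)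
  have ap: "(\<lambda>x. g x * indicator (V n) x) \<in> approx W" for n
  proof (induction n)
    case 0 then show ?case by (simp add: V_def approx_test[OF W(1) test_fun_zero])
  next
    case (Suc n)
    \<comment> \<open>The boxes may overlap, so the part already covered by \<open>V n\<close> is
      removed from the next one before it is added.\<close>
    have e: "g x * indicator (V (Suc n)) x = g x * indicator (V n) x + (g x * indicator (- V n) x) * indicator (box (a n) (b n)) x" for x
      unfolding V_def by (auto simp: indicator_def lessThan_Suc)
    have "l2 ?M (\<lambda>x. (g x * indicator (- V n) x) * indicator (box (a n) (b n)) x)"
      using cut[of "- V n \<inter> box (a n) (b n)"] by (simp add: indicator_inter_arith mult.assoc)
    then show ?case unfolding e by (intro approx_add W(1) Suc approx_box abW) auto
  qed
  have "AE x in ?M. x \<in> (\<Union>n. V n)"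
  proof -
    have "negligible (\<Union>k. cbox (a k) (b k) - box (a k) (b k))"
      by (intro negligible_countable_Union) (auto intro: negligible_frontier_interval)
    then have "AE x in lebesgue. x \<notin> (\<Union>k. cbox (a k) (b k) - box (a k) (b k))"
      using AE_not_in negligible_iff_null_sets by blast
    moreover have "x \<in> (\<Union>n. V n)" if "x \<in> W" "x \<notin> (\<Union>k. cbox (a k) (b k) - box (a k) (b k))" for x
    proof -
      have "x \<in> \<Union>(range X)" using that(1) D(4) X(2) by auto
      then obtain k where "x \<in> cbox (a k) (b k)" using ab by auto
      then have "x \<in> V (Suc k)" using that(2) by (auto simp: V_def)
      then show ?thesis by blast
    qed
    ultimately show ?thesis using W(1)
      by (subst AE_restrict_space_iff) (auto elim!: eventually_mono)
  qed
  then have lim: "AE x in ?M. (\<lambda>n. g x * indicator (V n) x) \<longlonglongrightarrow> v x" using gv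
  proof eventually_elim
    case (elim x)
    then obtain i where "x \<in> V i" by blast
    then have "x \<in> V n" if "n \<ge> i" for n using that unfolding V_def by force
    then show ?case using elim(2)
      by (intro tendsto_eventually eventually_sequentiallyI[of i]) auto
  qed
  have "v \<in> approx W"
  proof (rule approx_limit[OF W(1) ap])
    show "l2conv ?M (\<lambda>n x. g x * indicator (V n) x) v"
    proof (rule l2conv_dominated[OF _ _ gl _ lim])
      show "(\<lambda>x. g x * indicator (V n) x) \<in> borel_measurable ?M" for n by (rule l2_meas[OF cut]) simp
      show "v \<in> borel_measurable ?M" by (rule l2_meas[OF vl])
      show "AE x in ?M. \<bar>g x * indicator (V n) x\<bar> \<le> \<bar>g x\<bar>" for n
        by (intro AE_I2) (auto simp: indicator_def)
    qed
  qed
  then have "\<forall>n. \<exists>\<psi>. test_fun W \<psi> \<and> sqnorm ?M (\<lambda>x. v x - \<psi> x) < inverse (real (Suc n))"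
    unfolding approx_def by auto
  then obtain \<psi> where p: "\<And>n. test_fun W (\<psi> n)"
    "\<And>n. sqnorm ?M (\<lambda>x. v x - \<psi> n x) < inverse (real (Suc n))" by metis
  have "(\<lambda>n. sqnorm ?M (\<lambda>x. \<psi> n x - v x)) \<longlonglongrightarrow> 0"
    by (rule tendsto_sandwich[OF _ _ tendsto_const LIMSEQ_inverse_real_of_nat])
       (use p(2) in \<open>auto simp: inn_nonneg inn_swap_sign[of ?M _ v] less_imp_le\<close>)
  then have "l2conv ?M \<psi> v" using vl test_fun_l2[OF p(1) W(1)] by (auto simp: l2conv_def)
  then show ?thesis using p(1) by blast
qed

text \<open>The L^2 norm can be read off from pairings with test functions: let test functions tend
  to \<open>D\<close> itself in the assumed bound, and divide by the norm of
  \<open>D\<close>.\<close>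

lemma test_dual:
  fixes W :: "'a::euclidean_space set"
  assumes oW: "open W" and D: "l2 (lebesgue_on W) D" and K: "0 \<le> K"
    and b: "\<And>\<psi>. test_fun W \<psi> \<Longrightarrow> \<bar>inn (lebesgue_on W) D \<psi>\<bar> \<le> K * sqrt (sqnorm (lebesgue_on W) \<psi>)"
  shows "sqnorm (lebesgue_on W) D \<le> K\<^sup>2"
proof -
  let ?M = "lebesgue_on W"
  obtain \<psi> where p: "\<And>n. test_fun W (\<psi> n)" "l2conv ?M \<psi> D" using test_dense[OF oW D] by blast
  have "(\<lambda>n. inn ?M (\<psi> n) D) \<longlonglongrightarrow> sqnorm ?M D" by (rule inn_tendsto[OF p(2) D])
  moreover have "(\<lambda>n. K * sqrt (sqnorm ?M (\<psi> n))) \<longlonglongrightarrow> K * sqrt (sqnorm ?M D)"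
    by (intro tendsto_intros inn_self_tendsto[OF p(2)])
  ultimately have "sqnorm ?M D \<le> K * sqrt (sqnorm ?M D)"
  proof (rule LIMSEQ_le, intro exI allI impI)
    fix n show "inn ?M (\<psi> n) D \<le> K * sqrt (sqnorm ?M (\<psi> n))"
      using b[OF p(1), of n] inn_commute[of ?M D "\<psi> n"] by linarith
  qed
  then have "sqrt (sqnorm ?M D) * sqrt (sqnorm ?M D) \<le> K * sqrt (sqnorm ?M D)"
    using inn_nonneg[of ?M D] by simp
  then have "sqrt (sqnorm ?M D) \<le> K"
  proof (cases "sqnorm ?M D = 0")
    case False
    then have "sqrt (sqnorm ?M D) > 0" using inn_nonneg[of ?M D] by simp
    with \<open>sqrt (sqnorm ?M D) * sqrt (sqnorm ?M D) \<le> K * sqrt (sqnorm ?M D)\<close> show ?thesis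
      by (rule mult_right_le_imp_le)
  qed (use K in simp)
  then show ?thesis using power_mono[of "sqrt (sqnorm ?M D)" K 2] inn_nonneg[of ?M D] by simp
qed

lemma test_fundamental:
  fixes W :: "'a::euclidean_space set"
  assumes oW: "open W" and D: "l2 (lebesgue_on W) D"
    and b: "\<And>\<psi>. test_fun W \<psi> \<Longrightarrow> inn (lebesgue_on W) D \<psi> = 0"
  shows "AE x in lebesgue_on W. D x = 0"
proof (rule inn_zero_AE[OF D])
  show "sqnorm (lebesgue_on W) D = 0"
    using test_dual[OF oW D, of 0] b inn_nonneg[of "lebesgue_on W" D] by simp
qed

section \<open>Difference quotients and weak derivatives\<close>

lemma L2_eq: "L2 \<Omega> = l2 (lebesgue_on \<Omega>)"
  by (simp add: fun_eq_iff L2_def l2_def)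

lemma ip_eq: "ip \<Omega> = inn (lebesgue_on \<Omega>)"
  by (simp add: fun_eq_iff ip_def inn_def)

lemma nsq_eq: "nsq \<Omega> u = sqnorm (lebesgue_on \<Omega>) u"
  by (simp add: nsq_def ip_eq)

section \<open>Restricted Lebesgue measure expressed through \<open>lborel\<close>, and
  translations\<close>

lemma AE_lebesgue_on_iff:
  "W \<in> sets borel \<Longrightarrow> (AE x in lebesgue_on W. P x) \<longleftrightarrow> (AE x in lborel. x \<in> W \<longrightarrow> P x)"
  by (subst AE_restrict_space_iff) (auto simp: sets_completionI_sets AE_completion_iff)

lemma nn_integral_lebesgue_on:
  assumes "W \<in> sets borel"
  shows "(\<integral>\<^sup>+x. f x \<partial>lebesgue_on W) = (\<integral>\<^sup>+x. indicator W x * f x \<partial>lborel)"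
  using assms
  by (subst nn_integral_restrict_space)
     (auto simp: sets_completionI_sets nn_integral_completion mult.commute)

lemma integral_lebesgue_on:
  fixes f :: "'a::euclidean_space \<Rightarrow> real"
  assumes "W \<in> sets borel" "f \<in> borel_measurable borel"
  shows "(LINT x|lebesgue_on W. f x) = (LINT x|lborel. indicator W x * f x)"
  using assms by (subst integral_restrict_space) (auto simp: sets_completionI_sets integral_completion)

lemma integrable_lebesgue_on:
  fixes f :: "'a::euclidean_space \<Rightarrow> real"
  assumes "W \<in> sets borel" "f \<in> borel_measurable borel"
  shows "integrable (lebesgue_on W) f \<longleftrightarrow> integrable lborel (\<lambda>x. indicator W x * f x)"
  using assms by (subst integrable_restrict_space) (auto simp: sets_completionI_sets integrable_completion)

lemma nn_integral_shift:
  fixes f :: "'a::euclidean_space \<Rightarrow> ennreal"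
  assumes [measurable]: "f \<in> borel_measurable borel"
  shows "(\<integral>\<^sup>+x. f (x + h) \<partial>lborel) = (\<integral>\<^sup>+x. f x \<partial>lborel)"
proof -
  have "(\<integral>\<^sup>+x. f x \<partial>lborel) = (\<integral>\<^sup>+x. f x \<partial>distr lborel borel (\<lambda>x. h + x))"
    using lborel_distr_plus[of h] by simp
  also have "\<dots> = (\<integral>\<^sup>+x. f (x + h) \<partial>lborel)"
    by (subst nn_integral_distr) (auto simp: add.commute)
  finally show ?thesis by simp
qed

lemma integral_shift:
  fixes f :: "'a::euclidean_space \<Rightarrow> real"
  assumes [measurable]: "f \<in> borel_measurable borel"
  shows "(LINT x|lborel. f (x + h)) = (LINT x|lborel. f x)"
proof -
  have "(LINT x|lborel. f x) = (LINT x|distr lborel borel (\<lambda>x. h + x). f x)"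
    using lborel_distr_plus[of h] by simp
  also have "\<dots> = (LINT x|lborel. f (x + h))"
    by (subst integral_distr) (auto simp: add.commute)
  finally show ?thesis by simp
qed

text \<open>Since \<Omega> need not be convex, weak derivatives control an increment only where the
  entire segment of translation remains inside \<Omega>.\<close>

definition segset :: "'a::real_normed_vector set \<Rightarrow> 'a \<Rightarrow> 'a set" where
  "segset \<Omega> h = {x. \<forall>t\<in>{0..1}. x + t *\<^sub>R h \<in> \<Omega>}"

lemma segset_start: "x \<in> segset \<Omega> h \<Longrightarrow> x \<in> \<Omega>"
  unfolding segset_def by (auto dest: bspec[of _ _ 0])

lemma segset_end: "x \<in> segset \<Omega> h \<Longrightarrow> x + h \<in> \<Omega>"
  unfolding segset_def by (auto dest: bspec[of _ _ 1])

text \<open>The complement is the Minkowski sum of a closed set, the complement of \<Omega>, and a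
  compact segment, hence closed.\<close>

lemma open_segset: assumes "open \<Omega>" shows "open (segset \<Omega> h)"
proof -
  have "- segset \<Omega> h = (\<Union>x\<in>- \<Omega>. \<Union>y\<in>(\<lambda>t. - (t *\<^sub>R h)) ` {0..1}. {x + y})"
  proof (intro equalityI subsetI)
    fix x assume "x \<in> - segset \<Omega> h"
    then obtain t where "t \<in> {0..1}" "x + t *\<^sub>R h \<in> - \<Omega>" by (auto simp: segset_def)
    moreover have "x = (x + t *\<^sub>R h) + - (t *\<^sub>R h)" by simp
    ultimately show "x \<in> (\<Union>x\<in>- \<Omega>. \<Union>y\<in>(\<lambda>t. - (t *\<^sub>R h)) ` {0..1}. {x + y})" by blast
  next
    fix x assume "x \<in> (\<Union>x\<in>- \<Omega>. \<Union>y\<in>(\<lambda>t. - (t *\<^sub>R h)) ` {0..1}. {x + y})"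
    then obtain y t where t: "y \<notin> \<Omega>" "t \<in> {0..1}" "x = y + - (t *\<^sub>R h)" by blast
    then have "x + t *\<^sub>R h \<notin> \<Omega>" by simp
    then show "x \<in> - segset \<Omega> h" using t(2) unfolding segset_def by blast
  qed
  moreover have "closed (\<Union>x\<in>- \<Omega>. \<Union>y\<in>(\<lambda>t. - (t *\<^sub>R h)) ` {0..1}. {x + y})"
    using assms by (intro closed_compact_sums compact_continuous_image continuous_intros) auto
  ultimately show ?thesis by (simp add: open_closed)
qed

lemma test_fun_pd_bounded:
  assumes "test_fun S f" "i \<in> Basis" shows "\<exists>C\<ge>0. \<forall>x. \<bar>pd i f x\<bar> \<le> C"
proof -
  obtain C where C: "C \<ge> 0" "\<And>x. \<bar>pd i f x\<bar> \<le> C * indicator (closure {x. f x \<noteq> 0}) x"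
    using cont_compact_support_bounded[of "pd i f" "closure {x. f x \<noteq> 0}"] assms
    by (auto simp: test_fun_def intro: Cinf_pd(2) pd_outside)
  have "\<bar>pd i f x\<bar> \<le> C" for x
    using C(1) C(2)[of x] by (cases "x \<in> closure {x. f x \<noteq> 0}") auto
  then show ?thesis using C(1) by blast
qed

lemma Cinf_lipschitz_line:
  assumes f: "Cinf_on UNIV f" "i \<in> Basis" and C: "\<And>x. \<bar>pd i f x\<bar> \<le> C"
  shows "\<bar>f (x + s *\<^sub>R i) - f x\<bar> \<le> C * \<bar>s\<bar>"
proof -
  have "norm (f (x + s *\<^sub>R i) - f (x + 0 *\<^sub>R i)) \<le> C * norm (s - 0)"
  proof (rule field_differentiable_bound[of UNIV "\<lambda>t. f (x + t *\<^sub>R i)" "\<lambda>t. pd i f (x + t *\<^sub>R i)"])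
    show "((\<lambda>t. f (x + t *\<^sub>R i)) has_field_derivative pd i f (x + z *\<^sub>R i)) (at z within UNIV)" for z
      using Cinf_line[OF f, of x z] by simp
    show "norm (pd i f (x + z *\<^sub>R i)) \<le> C" for z using C by simp
  qed auto
  then show ?thesis by simp
qed

lemma shifted_cont_l2:
  assumes "test_fun S \<psi>" "W \<in> sets lebesgue" shows "l2 (lebesgue_on W) (\<lambda>y. \<psi> (y + h))"
proof (rule cont_compact_support_l2[OF _ _ _ assms(2)])
  let ?K = "(\<lambda>x. x - h) ` closure {x. \<psi> x \<noteq> 0}"
  show "continuous_on UNIV (\<lambda>y. \<psi> (y + h))"
    by (rule continuous_on_compose2[OF test_fun_cont[OF assms(1)]]) (auto intro!: continuous_intros)
  show "compact ?K" using assms(1)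
    by (intro compact_continuous_image) (auto simp: test_fun_def intro!: continuous_intros)
  fix x assume "x \<notin> ?K"
  then have "x + h \<notin> closure {x. \<psi> x \<noteq> 0}" by (auto simp: image_iff)
  then show "\<psi> (x + h) = 0" by (rule closure_support)
qed

lemma test_fun_shift:
  assumes "test_fun S \<psi>" "\<And>x. x \<in> closure {x. \<psi> x \<noteq> 0} \<Longrightarrow> x - h \<in> S'"
  shows "test_fun S' (\<lambda>y. \<psi> (y + h))"
proof -
  let ?K = "(\<lambda>x. x - h) ` closure {x. \<psi> x \<noteq> 0}"
  have K: "compact ?K" using assms(1)
    by (intro compact_continuous_image) (auto simp: test_fun_def intro!: continuous_intros)
  have "x \<in> ?K" if "\<psi> (x + h) \<noteq> 0" for x
    using that closure_support[of "x + h" \<psi>] by (intro image_eqI[of _ _ "x + h"]) auto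
  then have *: "closure {x. \<psi> (x + h) \<noteq> 0} \<subseteq> ?K"
    by (intro closure_minimal compact_imp_closed K) auto
  then have "compact (closure {x. \<psi> (x + h) \<noteq> 0})"
    using compact_Int_closed[OF K closed_closure[of "{x. \<psi> (x + h) \<noteq> 0}"]] by (simp add: Int_absorb1)
  then show ?thesis using assms * unfolding test_fun_def by (auto intro: Cinf_shift)
qed

lemma l2_bounded_integrable:
  assumes "bounded \<Omega>" "\<Omega> \<in> sets borel" "l2 (lebesgue_on \<Omega>) u"
  shows "integrable (lebesgue_on \<Omega>) u"
proof -
  have "l2 (lebesgue_on \<Omega>) (\<lambda>x. 1)"
  proof -
    obtain K where K: "compact K" "\<Omega> \<subseteq> K" using assms(1)
      by (meson bounded_closure closure_subset compact_closure)
    have "integrable (lebesgue_on \<Omega>) (indicator K :: 'a \<Rightarrow> real)"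
      using assms(2) K(1) by (intro indicator_integrable_lebesgue_on) auto
    then have "integrable (lebesgue_on \<Omega>) (\<lambda>x. 1 :: real)"
      by (rule Bochner_Integration.integrable_cong[THEN iffD1, rotated 2]) (use K(2) in auto)
    then show ?thesis by (simp add: l2_def)
  qed
  from l2_mult[OF assms(3) this] show ?thesis by simp
qed

text \<open>Differentiation under the integral sign; the domain is bounded, so constants dominate.\<close>

lemma translate_deriv_0:
  fixes \<Omega> :: "'a::euclidean_space set"
  assumes Om: "bounded \<Omega>" "open \<Omega>" and u: "l2 (lebesgue_on \<Omega>) u"
    and p: "test_fun S \<psi>" and i: "i \<in> Basis"
  shows "((\<lambda>r. inn (lebesgue_on \<Omega>) u (\<lambda>y. \<psi> (y + r *\<^sub>R i))) has_real_derivative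
      inn (lebesgue_on \<Omega>) u (pd i \<psi>)) (at 0)"
  unfolding DERIV_def tendsto_at_iff_sequentially
proof (intro allI impI)
  let ?M = "lebesgue_on \<Omega>"
  have Ob: "\<Omega> \<in> sets borel" "\<Omega> \<in> sets lebesgue" using Om(2) by auto
  fix X :: "nat \<Rightarrow> real" assume X: "\<forall>n. X n \<in> UNIV - {0}" "X \<longlonglongrightarrow> 0"
  obtain C where C: "C \<ge> 0" "\<And>x. \<bar>pd i \<psi> x\<bar> \<le> C" using test_fun_pd_bounded[OF p i] by blast
  have Ci: "Cinf_on UNIV \<psi>" using p by (simp add: test_fun_def)
  have l: "l2 ?M (\<lambda>y. \<psi> (y + r *\<^sub>R i))" for r by (rule shifted_cont_l2[OF p Ob(2)])
  note [measurable] = l2_meas[OF u] l2_meas[OF l] l2_meas[OF test_fun_l2[OF p Ob(2)]]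
     l2_meas[OF test_fun_pd_l2[OF p i Ob(2)]]
  have "(\<lambda>n. LINT y|?M. u y * ((\<psi> (y + X n *\<^sub>R i) - \<psi> y) / X n)) \<longlonglongrightarrow> (LINT y|?M. u y * pd i \<psi> y)"
  proof (rule integral_dominated_convergence[where w="\<lambda>y. C * \<bar>u y\<bar>"])
    show "integrable ?M (\<lambda>y. C * \<bar>u y\<bar>)"
      using l2_bounded_integrable[OF Om(1) Ob(1) u] by simp
    show "AE y in ?M. (\<lambda>n. u y * ((\<psi> (y + X n *\<^sub>R i) - \<psi> y) / X n)) \<longlonglongrightarrow> u y * pd i \<psi> y"
    proof (intro AE_I2 tendsto_mult tendsto_const)
      fix y
      have "((\<lambda>h. (\<psi> (y + h *\<^sub>R i) - \<psi> y) / h) \<longlongrightarrow> pd i \<psi> y) (at 0)"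
        using Cinf_pd(1)[OF Ci i, of y] unfolding DERIV_def by simp
      then show "(\<lambda>n. (\<psi> (y + X n *\<^sub>R i) - \<psi> y) / X n) \<longlonglongrightarrow> pd i \<psi> y"
        using X unfolding tendsto_at_iff_sequentially by (auto simp: o_def)
    qed
    show "AE y in ?M. norm (u y * ((\<psi> (y + X n *\<^sub>R i) - \<psi> y) / X n)) \<le> C * \<bar>u y\<bar>" for n
    proof (intro AE_I2)
      fix y
      have "\<bar>(\<psi> (y + X n *\<^sub>R i) - \<psi> y) / X n\<bar> \<le> C"
        using Cinf_lipschitz_line[OF Ci i C(2), of y "X n"] X(1) by (simp add: pos_divide_le_eq)
      from mult_left_mono[OF this, of "\<bar>u y\<bar>"]
      show "norm (u y * ((\<psi> (y + X n *\<^sub>R i) - \<psi> y) / X n)) \<le> C * \<bar>u y\<bar>"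
        by (simp add: abs_mult mult.commute)
    qed
  qed measurable
  moreover have "(LINT y|?M. u y * ((\<psi> (y + X n *\<^sub>R i) - \<psi> y) / X n))
      = (inn ?M u (\<lambda>y. \<psi> (y + X n *\<^sub>R i)) - inn ?M u \<psi>) / X n" for n
  proof -
    have "(LINT y|?M. u y * ((\<psi> (y + X n *\<^sub>R i) - \<psi> y) / X n))
        = (LINT y|?M. inverse (X n) * (u y * \<psi> (y + X n *\<^sub>R i) - u y * \<psi> y))"
      by (intro Bochner_Integration.integral_cong) (auto simp: field_simps)
    also have "\<dots> = (inn ?M u (\<lambda>y. \<psi> (y + X n *\<^sub>R i)) - inn ?M u \<psi>) / X n"
      using l2_mult[OF u l] l2_mult[OF u test_fun_l2[OF p Ob(2)]]
      by (simp add: inn_def divide_inverse mult.commute)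
    finally show ?thesis .
  qed
  ultimately have "(\<lambda>n. (inn ?M u (\<lambda>y. \<psi> (y + X n *\<^sub>R i)) - inn ?M u \<psi>) / X n) \<longlonglongrightarrow> inn ?M u (pd i \<psi>)"
    by (simp only: inn_def)
  then show "((\<lambda>h. (inn ?M u (\<lambda>y. \<psi> (y + (0 + h) *\<^sub>R i)) - inn ?M u (\<lambda>y. \<psi> (y + 0 *\<^sub>R i))) / h) \<circ> X)
     \<longlonglongrightarrow> inn ?M u (pd i \<psi>)"
    by (simp add: o_def)
qed

lemma translate_deriv:
  fixes \<Omega> :: "'a::euclidean_space set"
  assumes Om: "bounded \<Omega>" "open \<Omega>" and u: "l2 (lebesgue_on \<Omega>) u"
    and p: "test_fun UNIV \<psi>" and i: "i \<in> Basis"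
  shows "((\<lambda>r. inn (lebesgue_on \<Omega>) u (\<lambda>y. \<psi> (y + r *\<^sub>R i))) has_real_derivative
      inn (lebesgue_on \<Omega>) u (pd i (\<lambda>y. \<psi> (y + s *\<^sub>R i)))) (at s)"
proof -
  let ?g = "\<lambda>r. inn (lebesgue_on \<Omega>) u (\<lambda>y. \<psi> (y + r *\<^sub>R i))"
  have p': "test_fun UNIV (\<lambda>y. \<psi> (y + s *\<^sub>R i))" by (rule test_fun_shift[OF p]) simp
  have "((\<lambda>r. ?g (s + r)) has_real_derivative
      inn (lebesgue_on \<Omega>) u (pd i (\<lambda>y. \<psi> (y + s *\<^sub>R i)))) (at 0)"
    using translate_deriv_0[OF Om u p' i] by (simp add: algebra_simps)
  then show ?thesis using DERIV_shift[of ?g _ 0 s] by (simp add: add.commute)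
qed

text \<open>Moving the difference quotient from \<open>u\<close> to the test function.\<close>

lemma shift_identity:
  fixes \<Omega> :: "'a::euclidean_space set"
  assumes Om: "open \<Omega>" and um[measurable]: "u \<in> borel_measurable borel" and u: "l2 (lebesgue_on \<Omega>) u"
    and p: "test_fun (segset \<Omega> h) \<psi>"
  shows "l2 (lebesgue_on (segset \<Omega> h)) (\<lambda>x. u (x + h) - u x)"
    and "inn (lebesgue_on (segset \<Omega> h)) (\<lambda>x. u (x + h) - u x) \<psi>
      = inn (lebesgue_on \<Omega>) u (\<lambda>y. \<psi> (y - h)) - inn (lebesgue_on \<Omega>) u \<psi>"
proof -
  let ?W = "segset \<Omega> h"
  have oW: "open ?W" by (rule open_segset[OF Om])
  have [measurable]: "?W \<in> sets borel" "\<Omega> \<in> sets borel" using oW Om by auto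
  have Wl: "?W \<in> sets lebesgue" "\<Omega> \<in> sets lebesgue" using oW Om by auto
  have pm[measurable]: "\<psi> \<in> borel_measurable borel"
    using test_fun_cont[OF p] by (simp add: borel_measurable_continuous_onI)
  have s1: "sqn (lebesgue_on \<Omega>) u < \<infinity>" using u by (simp add: l2_iff_sqn)
  have "sqn (lebesgue_on ?W) (\<lambda>x. u (x + h)) = (\<integral>\<^sup>+x. indicator ?W x * ennreal ((u (x + h))\<^sup>2) \<partial>lborel)"
    unfolding sqn_def by (rule nn_integral_lebesgue_on) simp
  also have "\<dots> \<le> (\<integral>\<^sup>+x. indicator \<Omega> (x + h) * ennreal ((u (x + h))\<^sup>2) \<partial>lborel)"
    by (intro nn_integral_mono mult_right_mono) (auto simp: indicator_def segset_end)
  also have "\<dots> = (\<integral>\<^sup>+x. indicator \<Omega> x * ennreal ((u x)\<^sup>2) \<partial>lborel)"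
    by (rule nn_integral_shift[of "\<lambda>x. indicator \<Omega> x * ennreal ((u x)\<^sup>2)"]) measurable
  also have "\<dots> = sqn (lebesgue_on \<Omega>) u"
    unfolding sqn_def by (rule nn_integral_lebesgue_on[symmetric]) simp
  finally have l1: "l2 (lebesgue_on ?W) (\<lambda>x. u (x + h))"
    using s1 by (auto simp: l2_iff_sqn intro!: borel_meas_lebesgue_on)
  have "sqn (lebesgue_on ?W) u \<le> sqn (lebesgue_on \<Omega>) u"
    unfolding sqn_def using segset_start[of _ \<Omega> h]
    by (subst (1 2) nn_integral_lebesgue_on) (auto intro!: nn_integral_mono mult_right_mono simp: indicator_def)
  then have l3: "l2 (lebesgue_on ?W) u"
    using s1 by (auto simp: l2_iff_sqn intro!: borel_meas_lebesgue_on)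
  show "l2 (lebesgue_on ?W) (\<lambda>x. u (x + h) - u x)" by (rule l2_diff[OF l1 l3])
  have z: "\<psi> x = 0" if "x \<notin> ?W" for x
    using that p closure_support[of x \<psi>] unfolding test_fun_def by blast
  have pl: "l2 (lebesgue_on ?W) \<psi>" by (rule test_fun_l2[OF p Wl(1)])
  have "inn (lebesgue_on ?W) (\<lambda>x. u (x + h)) \<psi> = (LINT x|lborel. indicator ?W x * (u (x + h) * \<psi> x))"
    unfolding inn_def by (rule integral_lebesgue_on) auto
  also have "\<dots> = (LINT x|lborel. u (x + h) * \<psi> (x + h - h))"
    by (intro Bochner_Integration.integral_cong) (auto simp: indicator_def z)
  also have "\<dots> = (LINT x|lborel. u x * \<psi> (x - h))"
    by (rule integral_shift[of "\<lambda>x. u x * \<psi> (x - h)"]) measurable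
  also have "\<dots> = (LINT x|lborel. indicator \<Omega> x * (u x * \<psi> (x - h)))"
    using z segset_end[of _ \<Omega> h]
    by (intro Bochner_Integration.integral_cong) (auto simp: indicator_def, metis diff_add_cancel)
  also have "\<dots> = inn (lebesgue_on \<Omega>) u (\<lambda>y. \<psi> (y - h))"
    unfolding inn_def by (rule integral_lebesgue_on[symmetric]) auto
  finally have a: "inn (lebesgue_on ?W) (\<lambda>x. u (x + h)) \<psi> = inn (lebesgue_on \<Omega>) u (\<lambda>y. \<psi> (y - h))" .
  have "inn (lebesgue_on ?W) u \<psi> = (LINT x|lborel. indicator ?W x * (u x * \<psi> x))"
    unfolding inn_def by (rule integral_lebesgue_on) auto
  also have "\<dots> = (LINT x|lborel. indicator \<Omega> x * (u x * \<psi> x))"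
    using z segset_start[of _ \<Omega> h] by (intro Bochner_Integration.integral_cong) (auto simp: indicator_def)
  also have "\<dots> = inn (lebesgue_on \<Omega>) u \<psi>"
    unfolding inn_def by (rule integral_lebesgue_on[symmetric]) auto
  finally have b: "inn (lebesgue_on ?W) u \<psi> = inn (lebesgue_on \<Omega>) u \<psi>" .
  show "inn (lebesgue_on ?W) (\<lambda>x. u (x + h) - u x) \<psi>
      = inn (lebesgue_on \<Omega>) u (\<lambda>y. \<psi> (y - h)) - inn (lebesgue_on \<Omega>) u \<psi>"
    using inn_diff_left[OF l1 l3 pl] a b by simp
qed

lemma inn_shift_le:
  fixes \<Omega> W :: "'a::euclidean_space set"
  assumes "open \<Omega>" "open W" and p: "test_fun W \<psi>"
  shows "sqnorm (lebesgue_on \<Omega>) (\<lambda>y. \<psi> (y + h)) \<le> sqnorm (lebesgue_on W) \<psi>"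
proof -
  have [measurable]: "W \<in> sets borel" "\<Omega> \<in> sets borel" using assms by auto
  have Wl: "W \<in> sets lebesgue" "\<Omega> \<in> sets lebesgue" using assms by auto
  have pm[measurable]: "\<psi> \<in> borel_measurable borel"
    using test_fun_cont[OF p] by (simp add: borel_measurable_continuous_onI)
  have z: "\<psi> x = 0" if "x \<notin> W" for x
    using that p closure_support[of x \<psi>] unfolding test_fun_def by blast
  have "sqn (lebesgue_on \<Omega>) (\<lambda>y. \<psi> (y + h)) = (\<integral>\<^sup>+x. indicator \<Omega> x * ennreal ((\<psi> (x + h))\<^sup>2) \<partial>lborel)"
    unfolding sqn_def by (rule nn_integral_lebesgue_on) simp
  also have "\<dots> \<le> (\<integral>\<^sup>+x. ennreal ((\<psi> (x + h))\<^sup>2) \<partial>lborel)"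
    by (intro nn_integral_mono) (auto simp: indicator_def)
  also have "\<dots> = (\<integral>\<^sup>+x. ennreal ((\<psi> x)\<^sup>2) \<partial>lborel)"
    by (rule nn_integral_shift[of "\<lambda>x. ennreal ((\<psi> x)\<^sup>2)"]) measurable
  also have "\<dots> = (\<integral>\<^sup>+x. indicator W x * ennreal ((\<psi> x)\<^sup>2) \<partial>lborel)"
    by (intro nn_integral_cong) (auto simp: indicator_def z)
  also have "\<dots> = sqn (lebesgue_on W) \<psi>"
    unfolding sqn_def by (rule nn_integral_lebesgue_on[symmetric]) simp
  finally show ?thesis
    using sqn_eq[OF shifted_cont_l2[OF p Wl(2)]] sqn_eq[OF test_fun_l2[OF p Wl(1)]]
    by (simp add: inn_nonneg)
qed

text \<open>Proved by duality, without approximating \<open>u\<close> by smooth functions. Paired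
  with a test function, the increment of \<open>u\<close> becomes the increment of r -> (u, \<psi>(.
  + r i)), whose derivative is -(g, \<psi>(. + r i)) along the segment of shifts in question; the
  mean value inequality and \<open>test_dual\<close> finish. The dimension is left open because the
  same estimate is used on a time interval.\<close>

lemma difference_quotient_general:
  fixes \<Omega> :: "'a::euclidean_space set"
  assumes Om: "open \<Omega>" "bounded \<Omega>" and um: "u \<in> borel_measurable borel" and u': "l2 (lebesgue_on \<Omega>) u"
    and g': "l2 (lebesgue_on \<Omega>) g" and i: "i \<in> Basis"
    and wp: "\<And>\<psi>. test_fun \<Omega> \<psi> \<Longrightarrow> inn (lebesgue_on \<Omega>) u (pd i \<psi>) = - inn (lebesgue_on \<Omega>) g \<psi>"
  shows "(\<integral>\<^sup>+x. indicator (segset \<Omega> (s *\<^sub>R i)) x * ennreal ((u (x + s *\<^sub>R i) - u x)\<^sup>2) \<partial>lborel)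
    \<le> ennreal (s\<^sup>2 * sqnorm (lebesgue_on \<Omega>) g)"
proof -
  let ?h = "s *\<^sub>R i" let ?W = "segset \<Omega> ?h" let ?D = "\<lambda>x. u (x + ?h) - u x"
  let ?M = "lebesgue_on \<Omega>"
  have oW: "open ?W" by (rule open_segset[OF Om(1)])
  have Dl: "l2 (lebesgue_on ?W) ?D"
    by (rule shift_identity(1)[OF Om(1) um u' test_fun_zero])
  have bd: "\<bar>inn (lebesgue_on ?W) ?D \<psi>\<bar> \<le> (\<bar>s\<bar> * sqrt (sqnorm ?M g)) * sqrt (sqnorm (lebesgue_on ?W) \<psi>)"
    if p: "test_fun ?W \<psi>" for \<psi>
  proof -
    have pU: "test_fun UNIV \<psi>" by (rule test_fun_mono[OF p]) simp
    let ?H = "\<lambda>r. inn ?M u (\<lambda>y. \<psi> (y + r *\<^sub>R i))"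
    let ?B = "sqrt (sqnorm ?M g) * sqrt (sqnorm (lebesgue_on ?W) \<psi>)"
    have eq: "?H (- s) - ?H 0 = inn (lebesgue_on ?W) ?D \<psi>"
      using shift_identity(2)[OF Om(1) um u' p] by simp
    have "norm (?H (- s) - ?H 0) \<le> ?B * norm (- s - 0)"
    proof (rule field_differentiable_bound[of "closed_segment 0 (- s)" ?H
          "\<lambda>r. inn ?M u (pd i (\<lambda>y. \<psi> (y + r *\<^sub>R i)))"])
      fix r assume "r \<in> closed_segment 0 (- s)"
      then obtain t where t: "0 \<le> t" "t \<le> 1" "r = - (t * s)"
        by (auto simp: closed_segment_def)
      show "(?H has_field_derivative inn ?M u (pd i (\<lambda>y. \<psi> (y + r *\<^sub>R i)))) (at r within closed_segment 0 (- s))"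
        by (rule has_field_derivative_at_within[OF translate_deriv[OF Om(2,1) u' pU i]])
      \<comment> \<open>Every intermediate translate is an admissible test function on \<Omega>:
        this is what the support of \<psi> lying in \<open>segset\<close> provides.\<close>
      have ts: "test_fun \<Omega> (\<lambda>y. \<psi> (y + r *\<^sub>R i))"
      proof (rule test_fun_shift[OF p])
        fix x assume "x \<in> closure {x. \<psi> x \<noteq> 0}"
        then have "x \<in> ?W" using p by (auto simp: test_fun_def)
        then have "x + t *\<^sub>R ?h \<in> \<Omega>" using t by (auto simp: segset_def)
        then show "x - r *\<^sub>R i \<in> \<Omega>" using t(3) by simp
      qed
      have "inn ?M u (pd i (\<lambda>y. \<psi> (y + r *\<^sub>R i))) = - inn ?M g (\<lambda>y. \<psi> (y + r *\<^sub>R i))"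
        by (rule wp[OF ts])
      moreover have "\<bar>inn ?M g (\<lambda>y. \<psi> (y + r *\<^sub>R i))\<bar> \<le> ?B"
        using inn_CS_abs[OF g' test_fun_l2[OF ts, of \<Omega>]] Om(1)
          mult_left_mono[OF real_sqrt_le_mono[OF inn_shift_le[OF Om(1) oW p, of "r *\<^sub>R i"]], of "sqrt (sqnorm ?M g)"]
        by (force simp: inn_nonneg)
      ultimately show "norm (inn ?M u (pd i (\<lambda>y. \<psi> (y + r *\<^sub>R i)))) \<le> ?B" by simp
    qed auto
    then show ?thesis unfolding eq by (simp add: mult_ac)
  qed
  have "sqnorm (lebesgue_on ?W) ?D \<le> (\<bar>s\<bar> * sqrt (sqnorm ?M g))\<^sup>2"
    by (rule test_dual[OF oW Dl _ bd]) (simp_all add: inn_nonneg)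
  then have "sqnorm (lebesgue_on ?W) ?D \<le> s\<^sup>2 * sqnorm ?M g"
    by (simp add: power_mult_distrib inn_nonneg)
  then have "sqn (lebesgue_on ?W) ?D \<le> ennreal (s\<^sup>2 * sqnorm ?M g)"
    using sqn_eq[OF Dl] by (simp add: ennreal_leI)
  then show ?thesis unfolding sqn_def using oW by (subst (asm) nn_integral_lebesgue_on) auto
qed

lemma difference_quotient_le:
  assumes "open \<Omega>" "bounded \<Omega>" "u \<in> borel_measurable borel" "L2 \<Omega> u"
    "L2 \<Omega> g" "weak_partial \<Omega> u i g" "i \<in> Basis"
  shows "(\<integral>\<^sup>+x. indicator (segset \<Omega> (s *\<^sub>R i)) x * ennreal ((u (x + s *\<^sub>R i) - u x)\<^sup>2) \<partial>lborel)
    \<le> ennreal (s\<^sup>2 * nsq \<Omega> g)"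
  unfolding nsq_eq
  by (rule difference_quotient_general) (use assms in \<open>auto simp: L2_eq weak_partial_def inn_def\<close>)

text \<open>The Sobolev norm selects a weak derivative by choice; uniqueness transfers a bound for
  any weak derivative to the selected one.\<close>

lemma weak_partial_unique:
  assumes "open \<Omega>" "L2 \<Omega> g" "L2 \<Omega> g'" "weak_partial \<Omega> u i g" "weak_partial \<Omega> u i g'"
  shows "AE x in lebesgue_on \<Omega>. g x = g' x"
proof -
  have l: "l2 (lebesgue_on \<Omega>) g" "l2 (lebesgue_on \<Omega>) g'" using assms by (auto simp: L2_eq)
  have "AE x in lebesgue_on \<Omega>. g x - g' x = 0"
  proof (rule test_fundamental[OF assms(1) l2_diff[OF l]])
    fix \<psi> assume p: "test_fun \<Omega> \<psi>"
    have "(LINT x|lebesgue_on \<Omega>. u x * pd i \<psi> x) = - inn (lebesgue_on \<Omega>) g \<psi>"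
      "(LINT x|lebesgue_on \<Omega>. u x * pd i \<psi> x) = - inn (lebesgue_on \<Omega>) g' \<psi>"
      using assms(4,5) p unfolding weak_partial_def inn_def by blast+
    then have "inn (lebesgue_on \<Omega>) g \<psi> = inn (lebesgue_on \<Omega>) g' \<psi>" by linarith
    then show "inn (lebesgue_on \<Omega>) (\<lambda>x. g x - g' x) \<psi> = 0"
      using inn_diff_left[OF l test_fun_l2[OF p]] assms(1) by simp
  qed
  then show ?thesis by auto
qed

section \<open>Riesz representation of functionals given on test functions\<close>

lemma l2conv_add: assumes "l2conv M U u" "l2conv M V v"
  shows "l2conv M (\<lambda>n x. U n x + V n x) (\<lambda>x. u x + v x)"
proof -
  have l: "l2 M (U n)" "l2 M (V n)" "l2 M u" "l2 M v" for n using assms by (auto simp: l2conv_def)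
  have "(\<lambda>n. sqnorm M (\<lambda>x. (U n x + V n x) - (u x + v x))) \<longlonglongrightarrow> 0"
  proof (rule tendsto_sandwich[OF _ _ tendsto_const])
    show "\<forall>\<^sub>F n in sequentially. sqnorm M (\<lambda>x. (U n x + V n x) - (u x + v x))
       \<le> 2 * sqnorm M (\<lambda>x. U n x - u x) + 2 * sqnorm M (\<lambda>x. V n x - v x)"
      using inn_add_le[OF l2_diff[OF l(1,3)] l2_diff[OF l(2,4)]]
      by (intro always_eventually allI) (simp add: algebra_simps)
    have "(\<lambda>n. 2 * sqnorm M (\<lambda>x. U n x - u x) + 2 * sqnorm M (\<lambda>x. V n x - v x)) \<longlonglongrightarrow> 2 * 0 + 2 * 0"
      using assms unfolding l2conv_def by (intro tendsto_intros) auto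
    then show "(\<lambda>n. 2 * sqnorm M (\<lambda>x. U n x - u x) + 2 * sqnorm M (\<lambda>x. V n x - v x)) \<longlonglongrightarrow> 0" by simp
  qed (simp add: inn_nonneg)
  then show ?thesis using l by (simp add: l2conv_def l2_add)
qed

lemma l2conv_scale: assumes "l2conv M U u" shows "l2conv M (\<lambda>n x. c * U n x) (\<lambda>x. c * u x)"
proof -
  have "sqnorm M (\<lambda>x. c * U n x - c * u x)
      = (c * c) * sqnorm M (\<lambda>x. U n x - u x)" for n
    unfolding right_diff_distrib[symmetric] inn_scale_left inn_scale_right by simp
  moreover have "(\<lambda>n. (c * c) * sqnorm M (\<lambda>x. U n x - u x)) \<longlonglongrightarrow> (c * c) * 0"
    using assms unfolding l2conv_def by (intro tendsto_intros) auto
  ultimately show ?thesis using assms by (simp add: l2conv_def l2_scale)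
qed

lemma l2conv_const: "l2 M u \<Longrightarrow> l2conv M (\<lambda>n. u) u"
  by (simp add: l2conv_def inn_def)

lemma l2conv_sum: assumes "finite A" "\<And>j. j \<in> A \<Longrightarrow> l2conv M (U j) (u j)"
  shows "l2conv M (\<lambda>n x. \<Sum>j\<in>A. U j n x) (\<lambda>x. \<Sum>j\<in>A. u j x)"
  using assms
  by (induction rule: finite_induct) (auto intro: l2conv_add l2conv_const l2_zero)

lemma test_fun_sum: assumes "finite A" "\<And>j. j \<in> A \<Longrightarrow> test_fun S (f j)"
  shows "test_fun S (\<lambda>x. \<Sum>j\<in>A. f j x)"
  using assms by (induction rule: finite_induct) (auto intro: test_fun_add test_fun_zero)

text \<open>The functional has no value at the basis functions, which need not be test functions.
  Its coefficients are therefore defined as limits along test functions tending to each basis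
  function; the bound makes them square summable, and the representing function is the corresponding
  Fourier series.\<close>

lemma riesz_test:
  fixes W :: "'b::euclidean_space set" and l :: "('b \<Rightarrow> real) \<Rightarrow> real"
  assumes oW: "open W" and onb: "onb (lebesgue_on W) f" and K: "0 \<le> K"
    and add: "\<And>\<psi> \<theta>. test_fun W \<psi> \<Longrightarrow> test_fun W \<theta> \<Longrightarrow> l (\<lambda>x. \<psi> x + \<theta> x) = l \<psi> + l \<theta>"
    and scale: "\<And>c \<psi>. test_fun W \<psi> \<Longrightarrow> l (\<lambda>x. c * \<psi> x) = c * l \<psi>"
    and bound: "\<And>\<psi>. test_fun W \<psi> \<Longrightarrow> \<bar>l \<psi>\<bar> \<le> K * sqrt (sqnorm (lebesgue_on W) \<psi>)"
  shows "\<exists>g. l2 (lebesgue_on W) g \<and> sqnorm (lebesgue_on W) g \<le> K\<^sup>2 \<and>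
     (\<forall>\<psi>. test_fun W \<psi> \<longrightarrow> l \<psi> = inn (lebesgue_on W) g \<psi>)"
proof -
  let ?M = "lebesgue_on W"
  interpret onb ?M f by (rule onb)
  have Wl: "W \<in> sets lebesgue" using oW by auto
  have "\<forall>j. \<exists>\<psi>. (\<forall>n. test_fun W (\<psi> n)) \<and> l2conv ?M \<psi> (f j)"
    using test_dense[OF oW e_l2] by blast
  then obtain \<psi> where t: "\<And>j n. test_fun W (\<psi> j n)" and cv: "\<And>j. l2conv ?M (\<psi> j) (f j)" by metis
  have lz: "l (\<lambda>x. 0) = 0" using scale[OF test_fun_zero, of 0] by simp
  have lsum: "l (\<lambda>x. \<Sum>j\<in>A. c j * g j x) = (\<Sum>j\<in>A. c j * l (g j))"
    if "finite A" "\<And>j. j \<in> A \<Longrightarrow> test_fun W (g j)" for A :: "nat set" and c g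
    using that
    by (induction rule: finite_induct) (simp_all add: lz add scale test_fun_scale test_fun_sum)
  have ldiff: "l (\<lambda>x. a x - b x) = l a - l b" if "test_fun W a" "test_fun W b" for a b
    using add[OF that(1) test_fun_scale[OF that(2), of "-1"]] scale[OF that(2), of "-1"] by simp
  have tdiff: "test_fun W (\<lambda>x. a x - b x)" if "test_fun W a" "test_fun W b" for a b
    using test_fun_add[OF that(1) test_fun_scale[OF that(2), of "-1"]] by simp
  have bound2: "(l g)\<^sup>2 \<le> K\<^sup>2 * sqnorm ?M g" if "test_fun W g" for g
    using power_mono[OF bound[OF that], of 2] by (simp add: power_mult_distrib inn_nonneg)
  have conv: "convergent (\<lambda>n. l (\<psi> j n))" for j
  proof -
    have "Cauchy (\<lambda>n. l (\<psi> j n))"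
    proof (rule metric_CauchyI)
      fix \<epsilon> :: real assume e: "\<epsilon> > 0"
      have l: "l2 ?M (\<psi> j n)" for n by (rule test_fun_l2[OF t Wl])
      \<comment> \<open>The summand 1 keeps the quotient meaningful when \<open>K\<close> is
        0.\<close>
      define z where "z = \<epsilon>\<^sup>2 / (K\<^sup>2 + 1)"
      have e2: "z / 4 > 0" unfolding z_def using e by (intro divide_pos_pos mult_pos_pos) (auto simp: add_nonneg_pos)
      have "(\<lambda>n. sqnorm ?M (\<lambda>x. \<psi> j n x - f j x)) \<longlonglongrightarrow> 0"
        using cv[of j] by (simp add: l2conv_def)
      from LIMSEQ_D[OF this e2] obtain N where N: "\<And>n. n \<ge> N \<Longrightarrow>
          sqnorm ?M (\<lambda>x. \<psi> j n x - f j x) < z / 4"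
        by (auto simp: inn_nonneg)
      have "dist (l (\<psi> j m)) (l (\<psi> j n)) < \<epsilon>" if mn: "m \<ge> N" "n \<ge> N" for m n
      proof -
        let ?d = "\<lambda>x. \<psi> j m x - \<psi> j n x"
        have "sqnorm ?M (\<lambda>x. (\<psi> j m x - f j x) - (\<psi> j n x - f j x))
            < z"
          using inn_diff_le[OF l2_diff[OF l e_l2] l2_diff[OF l e_l2], of m j n j] N[OF mn(1)] N[OF mn(2)]
          by linarith
        then have d: "sqnorm ?M ?d < \<epsilon>\<^sup>2 / (K\<^sup>2 + 1)" by (simp add: z_def)
        have k1: "K\<^sup>2 + 1 > 0" by (simp add: add_nonneg_pos)
        have "(l ?d)\<^sup>2 \<le> K\<^sup>2 * sqnorm ?M ?d" by (rule bound2[OF tdiff[OF t t]])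
        also have "\<dots> \<le> (K\<^sup>2 + 1) * sqnorm ?M ?d" by (intro mult_right_mono inn_nonneg) auto
        also have "\<dots> < \<epsilon>\<^sup>2" using d k1 by (simp add: pos_less_divide_eq mult.commute)
        finally have "\<bar>l ?d\<bar>\<^sup>2 < \<epsilon>\<^sup>2" by simp
        then have "\<bar>l ?d\<bar> < \<epsilon>" by (rule power2_less_imp_less) (use e in simp)
        then show ?thesis by (simp add: dist_real_def ldiff t)
      qed
      then show "\<exists>M. \<forall>m\<ge>M. \<forall>n\<ge>M. dist (l (\<psi> j m)) (l (\<psi> j n)) < \<epsilon>" by blast
    qed
    then show ?thesis by (simp add: Cauchy_convergent_iff)
  qed
  define c where "c j = lim (\<lambda>n. l (\<psi> j n))" for j
  have c: "(\<lambda>n. l (\<psi> j n)) \<longlonglongrightarrow> c j" for j using conv[of j] by (simp add: c_def convergent_LIMSEQ_iff)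
  \<comment> \<open>The limiting form of the bound: it holds as if the functional had already been
    extended to finite combinations of basis functions. Used once with the zero test function, to
    bound the coefficients, and once with Fourier partial sums, to identify the functional.\<close>
  have cb: "(l \<theta> - (\<Sum>j<N. a j * c j))\<^sup>2 \<le> K\<^sup>2 * sqnorm ?M (\<lambda>x. \<theta> x - (\<Sum>j<N. a j * f j x))"
    if p: "test_fun W \<theta>" for \<theta> a N
  proof (rule LIMSEQ_le)
    let ?U = "\<lambda>n x. \<Sum>j<N. a j * \<psi> j n x"
    have tU: "test_fun W (?U n)" for n by (intro test_fun_sum test_fun_scale t) auto
    have cU: "l2conv ?M ?U (\<lambda>x. \<Sum>j<N. a j * f j x)" by (intro l2conv_sum l2conv_scale cv) auto
    have cD: "l2conv ?M (\<lambda>n x. \<theta> x + (-1) * ?U n x) (\<lambda>x. \<theta> x + (-1) * (\<Sum>j<N. a j * f j x))"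
      by (intro l2conv_add l2conv_scale cU l2conv_const test_fun_l2[OF p Wl])
    show "(\<lambda>n. (l \<theta> - (\<Sum>j<N. a j * l (\<psi> j n)))\<^sup>2) \<longlonglongrightarrow> (l \<theta> - (\<Sum>j<N. a j * c j))\<^sup>2"
      by (intro tendsto_intros c)
    show "(\<lambda>n. K\<^sup>2 * sqnorm ?M (\<lambda>x. \<theta> x - ?U n x))
       \<longlonglongrightarrow> K\<^sup>2 * sqnorm ?M (\<lambda>x. \<theta> x - (\<Sum>j<N. a j * f j x))"
      using inn_self_tendsto[OF cD] by (intro tendsto_intros) simp
    show "\<exists>N'. \<forall>n\<ge>N'. (l \<theta> - (\<Sum>j<N. a j * l (\<psi> j n)))\<^sup>2 \<le> K\<^sup>2 * sqnorm ?M (\<lambda>x. \<theta> x - ?U n x)"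
    proof (intro exI allI impI)
      fix n
      have "l (\<lambda>x. \<theta> x - ?U n x) = l \<theta> - (\<Sum>j<N. a j * l (\<psi> j n))"
        using ldiff[OF p tU] lsum[of "{..<N}" "\<lambda>j. \<psi> j n" a] t by simp
      then show "(l \<theta> - (\<Sum>j<N. a j * l (\<psi> j n)))\<^sup>2 \<le> K\<^sup>2 * sqnorm ?M (\<lambda>x. \<theta> x - ?U n x)"
        using bound2[OF tdiff[OF p tU], of n] by (simp only:)
    qed
  qed
  have part: "(\<Sum>j<N. (c j)\<^sup>2) \<le> K\<^sup>2" for N
  proof -
    let ?S = "\<Sum>j<N. (c j)\<^sup>2"
    \<comment> \<open>Choosing the coefficients \<open>c\<close> themselves as weights gives S^2
      \<le> K^2 S for the partial sum S of squares.\<close>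
    have "(\<Sum>j<N. c j * c j)\<^sup>2 \<le> K\<^sup>2 * sqnorm ?M (\<lambda>x. 0 - (\<Sum>j<N. c j * f j x))"
      using cb[OF test_fun_zero, of c N] lz by simp
    also have "sqnorm ?M (\<lambda>x. 0 - (\<Sum>j<N. c j * f j x)) = ?S"
      using lincomb_sq[of "{..<N}" c] by (simp add: inn_def)
    finally have "?S * ?S \<le> K\<^sup>2 * ?S" by (simp add: power2_eq_square)
    moreover have "?S \<ge> 0" by (simp add: sum_nonneg)
    ultimately show ?thesis by (cases "?S = 0") (auto simp: mult_le_cancel_right)
  qed
  have s: "summable (\<lambda>j. (c j)\<^sup>2)" by (rule summableI_nonneg_bounded[OF _ part]) simp
  obtain g where g: "l2 ?M g" "\<And>j. inn ?M g (f j) = c j" "sqnorm ?M g = (\<Sum>j. (c j)\<^sup>2)"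
    using riesz_coef[OF s] by blast
  have "sqnorm ?M g \<le> K\<^sup>2" unfolding g(3) by (rule suminf_le_const[OF s part])
  moreover have "l \<theta> = inn ?M g \<theta>" if p: "test_fun W \<theta>" for \<theta>
  proof -
    have pl: "l2 ?M \<theta>" by (rule test_fun_l2[OF p Wl])
    let ?a = "\<lambda>j. inn ?M \<theta> (f j)"
    have "(\<lambda>N. (l \<theta> - (\<Sum>j<N. ?a j * c j))\<^sup>2) \<longlonglongrightarrow> 0"
    proof (rule tendsto_sandwich[OF _ _ tendsto_const])
      show "\<forall>\<^sub>F N in sequentially. (l \<theta> - (\<Sum>j<N. ?a j * c j))\<^sup>2 \<le>
          K\<^sup>2 * sqnorm ?M (\<lambda>x. \<theta> x - (\<Sum>j<N. ?a j * f j x))"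
        by (intro always_eventually allI cb p)
      have "(\<lambda>N. K\<^sup>2 * sqnorm ?M (\<lambda>x. \<theta> x - (\<Sum>j<N. ?a j * f j x))) \<longlonglongrightarrow> K\<^sup>2 * 0"
        using fourier_conv[OF pl] unfolding l2conv_def
        by (intro tendsto_intros) (subst inn_swap_sign, simp)
      then show "(\<lambda>N. K\<^sup>2 * sqnorm ?M (\<lambda>x. \<theta> x - (\<Sum>j<N. ?a j * f j x))) \<longlonglongrightarrow> 0" by simp
    qed simp
    moreover have "(\<lambda>N. (l \<theta> - (\<Sum>j<N. ?a j * c j))\<^sup>2) \<longlonglongrightarrow> (l \<theta> - inn ?M \<theta> g)\<^sup>2"
      using parseval[OF pl g(1)] unfolding sums_def g(2) by (intro tendsto_intros)
    ultimately have "(l \<theta> - inn ?M \<theta> g)\<^sup>2 = 0" by (rule LIMSEQ_unique[rotated])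
    then show ?thesis by (simp add: inn_commute[of ?M g \<theta>])
  qed
  ultimately show ?thesis using g(1) by blast
qed

section \<open>Weak derivatives recovered from bounded difference quotients\<close>

lemma pd_add: assumes "Cinf_on UNIV f" "Cinf_on UNIV g" "i \<in> Basis"
  shows "pd i (\<lambda>x. f x + g x) = (\<lambda>x. pd i f x + pd i g x)"
proof
  show "pd i (\<lambda>x. f x + g x) x = pd i f x + pd i g x" for x
    using Cinf_pd(1)[OF assms(1,3), of x] Cinf_pd(1)[OF assms(2,3), of x]
    unfolding pd_def[of i "\<lambda>x. f x + g x"] by (intro DERIV_imp_deriv DERIV_add) auto
qed

lemma pd_scale: assumes "Cinf_on UNIV f" "i \<in> Basis"
  shows "pd i (\<lambda>x. c * f x) = (\<lambda>x. c * pd i f x)"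
proof
  show "pd i (\<lambda>x. c * f x) x = c * pd i f x" for x
    using Cinf_pd(1)[OF assms, of x]
    unfolding pd_def[of i "\<lambda>x. c * f x"] by (intro DERIV_imp_deriv DERIV_cmult) auto
qed

text \<open>The functional \<psi> -> -(u, pd i \<psi>) is a limit of pairings of \<psi> with
  difference quotients of \<open>u\<close>, hence bounded by sqrt C times the norm of \<psi>. Its
  Riesz representative is the weak derivative and inherits the bound C. The orthonormal system is
  only the tool for the representation.\<close>

lemma difference_quotient_converse:
  assumes Om: "open \<Omega>" "bounded \<Omega>" and um: "u \<in> borel_measurable borel" and u: "L2 \<Omega> u"
    and i: "i \<in> Basis" and onb: "onb (lebesgue_on \<Omega>) f" and C: "0 \<le> C"
    and dq: "\<And>s. 0 < s \<Longrightarrow> s < 1 \<Longrightarrow>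
      (\<integral>\<^sup>+x. indicator (segset \<Omega> (s *\<^sub>R i)) x * ennreal ((u (x + s *\<^sub>R i) - u x)\<^sup>2) \<partial>lborel) \<le> ennreal (s\<^sup>2 * C)"
  shows "\<exists>g. L2 \<Omega> g \<and> weak_partial \<Omega> u i g \<and> nsq \<Omega> g \<le> C"
proof -
  let ?M = "lebesgue_on \<Omega>"
  note u' = u[unfolded L2_eq]
  have Ol: "\<Omega> \<in> sets lebesgue" using Om by auto
  let ?l = "\<lambda>\<psi>. - inn ?M u (pd i \<psi>)"
  have "\<exists>g. l2 ?M g \<and> sqnorm ?M g \<le> (sqrt C)\<^sup>2 \<and> (\<forall>\<psi>. test_fun \<Omega> \<psi> \<longrightarrow> ?l \<psi> = inn ?M g \<psi>)"
  proof (rule riesz_test[OF Om(1) onb])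
    show "0 \<le> sqrt C" using C by simp
    fix \<psi> assume p: "test_fun \<Omega> \<psi>"
    have pC: "Cinf_on UNIV \<psi>" using p by (simp add: test_fun_def)
    show "?l (\<lambda>x. c * \<psi> x) = c * ?l \<psi>" for c
      by (simp add: pd_scale[OF pC i] inn_scale_right)
    show "?l (\<lambda>x. \<psi> x + \<theta> x) = ?l \<psi> + ?l \<theta>" if q: "test_fun \<Omega> \<theta>" for \<theta>
    proof -
      have "Cinf_on UNIV \<theta>" using q by (simp add: test_fun_def)
      then show ?thesis
        using inn_add_right[OF test_fun_pd_l2[OF p i Ol] test_fun_pd_l2[OF q i Ol] u']
        by (simp add: pd_add[OF pC _ i])
    qed
    let ?K = "closure {x. \<psi> x \<noteq> 0}"
    have K: "compact ?K" "?K \<subseteq> \<Omega>" using p by (auto simp: test_fun_def)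
    \<comment> \<open>The compact support has positive distance from the complement of \<Omega>, so
      short translates of it stay in \<Omega>.\<close>
    obtain \<epsilon> where e: "\<epsilon> > 0" "\<And>x y. x \<in> ?K \<Longrightarrow> dist x y < \<epsilon> \<Longrightarrow> y \<in> \<Omega>"
    proof -
      have "\<exists>d>0. \<forall>x\<in>?K. \<forall>y\<in>- \<Omega>. d \<le> dist x y"
        using separate_compact_closed[of ?K "- \<Omega>"] K Om(1) by (auto simp: closed_Compl)
      then show ?thesis using that by (metis ComplI not_le)
    qed
    have ni: "norm i = 1" using i by simp
    let ?H = "\<lambda>r. inn ?M u (\<lambda>y. \<psi> (y + r *\<^sub>R i))"
    have bd: "\<bar>(?H (- s) - ?H 0) / s\<bar> \<le> sqrt C * sqrt (sqnorm ?M \<psi>)" if s: "0 < s" "s < min \<epsilon> 1" for s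
    proof -
      let ?h = "s *\<^sub>R i" let ?W = "segset \<Omega> ?h" let ?D = "\<lambda>x. u (x + ?h) - u x"
      have oW: "open ?W" by (rule open_segset[OF Om(1)])
      have "?K \<subseteq> ?W"
      proof
        fix x assume x: "x \<in> ?K"
        have "x + t *\<^sub>R ?h \<in> \<Omega>" if "t \<in> {0..1}" for t
        proof (rule e(2)[OF x])
          have "t * s \<le> 1 * s" using that s by (intro mult_right_mono) auto
          moreover have "dist x (x + t *\<^sub>R ?h) = t * s" using that s by (simp add: dist_norm ni abs_mult)
          ultimately show "dist x (x + t *\<^sub>R ?h) < \<epsilon>" using s by linarith
        qed
        then show "x \<in> ?W" by (auto simp: segset_def)
      qed
      then have pW: "test_fun ?W \<psi>" using p by (auto simp: test_fun_def)
      have Dl: "l2 (lebesgue_on ?W) ?D" by (rule shift_identity(1)[OF Om(1) um u' pW])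
      have eq: "?H (- s) - ?H 0 = inn (lebesgue_on ?W) ?D \<psi>"
        using shift_identity(2)[OF Om(1) um u' pW] by simp
      have "sqn (lebesgue_on ?W) ?D \<le> ennreal (s\<^sup>2 * C)"
        unfolding sqn_def using dq[of s] s oW by (subst nn_integral_lebesgue_on) auto
      then have D: "sqnorm (lebesgue_on ?W) ?D \<le> s\<^sup>2 * C" using sqn_eq[OF Dl] C by simp
      have pp: "sqnorm (lebesgue_on ?W) \<psi> \<le> sqnorm ?M \<psi>"
        using inn_shift_le[OF oW Om(1) p, of 0] by simp
      have "\<bar>inn (lebesgue_on ?W) ?D \<psi>\<bar> \<le> sqrt (s\<^sup>2 * C) * sqrt (sqnorm ?M \<psi>)"
        by (rule order_trans[OF inn_CS_abs[OF Dl test_fun_l2[OF pW]]])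
           (use oW D pp in \<open>auto intro!: mult_mono real_sqrt_le_mono simp: inn_nonneg C\<close>)
      then show ?thesis unfolding eq using s(1) by (simp add: real_sqrt_mult pos_divide_le_eq mult_ac)
    qed
    have "((\<lambda>s. (?H (- s) - ?H 0) / s) \<longlongrightarrow> - inn ?M u (pd i \<psi>)) (at 0)"
    proof -
      have "(?H has_real_derivative inn ?M u (pd i \<psi>)) (at (- 0))"
        using translate_deriv_0[OF Om(2,1) u' p i] by simp
      moreover have "(uminus has_real_derivative - 1) (at (0::real))"
        by (auto intro!: derivative_eq_intros)
      ultimately have "((\<lambda>s. ?H (- s)) has_real_derivative inn ?M u (pd i \<psi>) * (- 1)) (at 0)"
        by (rule DERIV_chain2)
      then show ?thesis unfolding DERIV_def by simp
    qed
    then have "((\<lambda>s. \<bar>(?H (- s) - ?H 0) / s\<bar>) \<longlongrightarrow> \<bar>- inn ?M u (pd i \<psi>)\<bar>) (at_right 0)"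
      by (intro tendsto_rabs) (rule filterlim_mono, auto simp: at_le)
    then show "\<bar>?l \<psi>\<bar> \<le> sqrt C * sqrt (sqnorm ?M \<psi>)"
    proof (rule tendsto_upperbound)
      show "\<forall>\<^sub>F s in at_right 0. \<bar>(?H (- s) - ?H 0) / s\<bar> \<le> sqrt C * sqrt (sqnorm ?M \<psi>)"
        using e(1) bd by (intro eventually_at_rightI[of 0 "min \<epsilon> 1"]) auto
    qed simp
  qed
  then obtain g where g: "l2 ?M g" "sqnorm ?M g \<le> C" "\<And>\<psi>. test_fun \<Omega> \<psi> \<Longrightarrow> ?l \<psi> = inn ?M g \<psi>"
    using C by auto
  have "weak_partial \<Omega> u i g" unfolding weak_partial_def
  proof (intro allI impI)
    fix \<psi> assume "test_fun \<Omega> \<psi>"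
    from g(3)[OF this] show "(LINT x|lebesgue_on \<Omega>. u x * pd i \<psi> x) = - (LINT x|lebesgue_on \<Omega>. g x * \<psi> x)"
      unfolding inn_def by linarith
  qed
  then show ?thesis using g by (auto simp: L2_eq nsq_eq)
qed

section \<open>The embedding of \<open>H\<^sup>1\<close> into \<open>H\<^sup>\<eta>\<close> on smooth domains\<close>

text \<open>\<open>path_ok \<Omega> q i x h\<close>: one gets from \<open>x\<close> to \<open>x + h\<close> inside \<open>\<Omega>\<close> by moving \<open>q\<close> along \<open>i\<close>,
  then along the three axes, and back by \<open>q\<close>.\<close>

definition path_ok :: "pt set \<Rightarrow> real \<Rightarrow> pt \<Rightarrow> pt \<Rightarrow> pt \<Rightarrow> bool" where
  "path_ok \<Omega> q i x h \<longleftrightarrow>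
     x \<in> segset \<Omega> (q *\<^sub>R i) \<and>
     x + q *\<^sub>R i \<in> segset \<Omega> ((h $ 1) *\<^sub>R axis 1 1) \<and>
     x + q *\<^sub>R i + (h $ 1) *\<^sub>R axis 1 1 \<in> segset \<Omega> ((h $ 2) *\<^sub>R axis 2 1) \<and>
     x + q *\<^sub>R i + (h $ 1) *\<^sub>R axis 1 1 + (h $ 2) *\<^sub>R axis 2 1 \<in> segset \<Omega> ((h $ 3) *\<^sub>R axis 3 1) \<and>
     x + h \<in> segset \<Omega> (q *\<^sub>R i)"

lemma pt_decomp: "(h :: pt) = (h $ 1) *\<^sub>R axis 1 1 + (h $ 2) *\<^sub>R axis 2 1 + (h $ 3) *\<^sub>R axis 3 1"
  by (simp add: vec_eq_iff axis_def forall_3)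

lemma pt_Basis: "(axis 1 1 :: pt) \<in> Basis" "(axis 2 1 :: pt) \<in> Basis" "(axis 3 1 :: pt) \<in> Basis"
  by (auto simp: Basis_vec_def)

text \<open>The last hypothesis allows arbitrary offsets up to |h| along all three axes at once; it
  covers each axis move at every intermediate position.\<close>

lemma path_okI:
  fixes x h :: pt
  assumes "norm i = 1"
    and start: "\<And>t. 0 \<le> t \<Longrightarrow> t \<le> 1 \<Longrightarrow> x + (t * q) *\<^sub>R i \<in> \<Omega>"
    and "\<And>t. 0 \<le> t \<Longrightarrow> t \<le> 1 \<Longrightarrow> x + h + (t * q) *\<^sub>R i \<in> \<Omega>"
    and mid: "\<And>a b c. \<bar>a\<bar> \<le> norm h \<Longrightarrow> \<bar>b\<bar> \<le> norm h \<Longrightarrow> \<bar>c\<bar> \<le> norm h \<Longrightarrow>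
       x + q *\<^sub>R i + a *\<^sub>R axis 1 1 + b *\<^sub>R axis 2 1 + c *\<^sub>R axis 3 1 \<in> \<Omega>"
  shows "path_ok \<Omega> q i x h"
proof -
  have n: "\<bar>h $ k\<bar> \<le> norm h" for k by (rule component_le_norm_cart)
  have tn: "\<bar>t * h $ k\<bar> \<le> norm h" if "t \<in> {0..1}" for t k
  proof -
    have "\<bar>t * h $ k\<bar> \<le> 1 * norm h" unfolding abs_mult using that n[of k] by (intro mult_mono) auto
    then show ?thesis by simp
  qed
  show ?thesis unfolding path_ok_def segset_def
    using assms(2,3) mid[of "_ * h $ 1" 0 0] mid[of "h $ 1" "_ * h $ 2" 0] mid[of "h $ 1" "h $ 2" "_ * h $ 3"]
      n tn by auto
qed

lemma dist_add_le: "dist p (x + v) \<le> dist p x + norm (v :: 'a::real_normed_vector)"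
  using norm_triangle_ineq4[of "p - x" v] by (simp add: dist_norm algebra_simps)

text \<open>Inside \<Omega> no preliminary move is needed, so c = 0. Three axis moves of length
  below \<rho>/6 starting within \<rho>/2 of \<open>p\<close> stay in the ball of radius
  \<rho>.\<close>

lemma chart_interior:
  assumes "open \<Omega>" "p \<in> \<Omega>"
  shows "\<exists>V. \<exists>i\<in>Basis. \<exists>c \<delta>. open V \<and> p \<in> V \<and> \<delta> > 0 \<and>
    (\<forall>x h. x \<in> V \<inter> \<Omega> \<and> norm h < \<delta> \<and> x + h \<in> \<Omega> \<longrightarrow> path_ok \<Omega> (c * norm h) i x h)"
proof -
  obtain \<rho> where r: "\<rho> > 0" "ball p \<rho> \<subseteq> \<Omega>" using assms by (meson openE)
  have "path_ok \<Omega> (0 * norm h) (axis 1 1) x h" if "x \<in> ball p (\<rho>/2)" "norm h < \<rho>/6" "x + h \<in> \<Omega>" for x h :: pt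
  proof (rule path_okI)
    have d: "dist p x < \<rho>/2" using that by simp
    have xO: "x \<in> \<Omega>" using r d by (auto simp: subset_iff)
    then show "x + (t * (0 * norm h)) *\<^sub>R axis 1 1 \<in> \<Omega>" for t by simp
    show "x + h + (t * (0 * norm h)) *\<^sub>R axis 1 1 \<in> \<Omega>" for t using that by simp
    fix a b c assume *: "\<bar>a\<bar> \<le> norm h" "\<bar>b\<bar> \<le> norm h" "\<bar>c\<bar> \<le> norm h"
    let ?v = "a *\<^sub>R axis 1 1 + b *\<^sub>R axis 2 1 + c *\<^sub>R axis 3 1 :: pt"
    have "norm ?v \<le> norm (a *\<^sub>R axis 1 1 :: pt) + norm (b *\<^sub>R axis 2 1 :: pt) + norm (c *\<^sub>R axis 3 1 :: pt)"
      using norm_triangle_ineq[of "a *\<^sub>R axis 1 1 + b *\<^sub>R axis 2 1 :: pt" "c *\<^sub>R axis 3 1"]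
        norm_triangle_ineq[of "a *\<^sub>R axis 1 1 :: pt" "b *\<^sub>R axis 2 1"] by linarith
    then have "norm ?v \<le> \<bar>a\<bar> + \<bar>b\<bar> + \<bar>c\<bar>" by simp
    then have "norm ?v < \<rho>/2" using * that by linarith
    moreover have "dist p (x + ?v) \<le> dist p x + norm ?v" by (rule dist_add_le)
    ultimately have "dist p (x + ?v) < \<rho>" using d by linarith
    then show "x + (0 * norm h) *\<^sub>R axis 1 1 + a *\<^sub>R axis 1 1 + b *\<^sub>R axis 2 1 + c *\<^sub>R axis 3 1 \<in> \<Omega>"
      using r by (auto simp: subset_iff add.assoc)
  qed simp
  then show ?thesis using r pt_Basis
    by (intro exI[of _ "ball p (\<rho>/2)"] bexI[of _ "axis 1 1"] exI[of _ 0] exI[of _ "\<rho>/6"]) auto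
qed

lemma Cinf_segment_deriv:
  assumes g: "Cinf_on U g" "i \<in> Basis" and s: "\<And>t. t \<in> closed_segment 0 r \<Longrightarrow> x + t *\<^sub>R i \<in> U"
  shows "\<exists>z\<in>closed_segment 0 r. g (x + r *\<^sub>R i) - g x = r * pd i g (x + z *\<^sub>R i)"
proof -
  consider "r = 0" | "r > 0" | "r < 0" by linarith
  then show ?thesis
  proof cases
    case 1 then show ?thesis by auto
  next
    case 2
    have "\<exists>z. 0 < z \<and> z < r \<and> g (x + r *\<^sub>R i) - g (x + 0 *\<^sub>R i) = (r - 0) * pd i g (x + z *\<^sub>R i)"
      using 2 s by (intro MVT2 Cinf_line[OF g]) (auto simp: closed_segment_eq_real_ivl)
    then show ?thesis using 2 by (auto simp: closed_segment_eq_real_ivl)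
  next
    case 3
    have "\<exists>z. r < z \<and> z < 0 \<and> g (x + 0 *\<^sub>R i) - g (x + r *\<^sub>R i) = (0 - r) * pd i g (x + z *\<^sub>R i)"
      using 3 s by (intro MVT2 Cinf_line[OF g]) (auto simp: closed_segment_eq_real_ivl)
    then obtain z where z: "r < z" "z < 0" "g (x + 0 *\<^sub>R i) - g (x + r *\<^sub>R i) = (0 - r) * pd i g (x + z *\<^sub>R i)"
      by blast
    then have "g (x + r *\<^sub>R i) - g x = r * pd i g (x + z *\<^sub>R i)" by simp
    then show ?thesis using z by (intro bexI[of _ z]) (auto simp: closed_segment_eq_real_ivl)
  qed
qed

text \<open>The preliminary move goes inwards: along the axis \<open>i\<close> on which the defining
  function g has nonzero derivative, in the direction that decreases g. Travelling c|h| lowers g by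
  at least a c |h| = 3 M |h|, and the three axis moves raise it by at most M |h| each, so g stays
  negative all along the path.\<close>

lemma chart_boundary:
  assumes U: "open U" "p \<in> U" and g: "Cinf_on U g" and OU: "\<Omega> \<inter> U = {x\<in>U. g x < 0}"
    and i: "i \<in> Basis" "pd i g p \<noteq> 0"
  shows "\<exists>V. \<exists>i\<in>Basis. \<exists>c \<delta>. open V \<and> p \<in> V \<and> \<delta> > 0 \<and>
    (\<forall>x h. x \<in> V \<inter> \<Omega> \<and> norm h < \<delta> \<and> x + h \<in> \<Omega> \<longrightarrow> path_ok \<Omega> (c * norm h) i x h)"
proof -
  \<comment> \<open>Half of the derivative at \<open>p\<close> survives, by continuity, as a lower
    bound in a ball around \<open>p\<close>; \<open>M\<close> below bounds all three partial
    derivatives there.\<close>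
  define a where "a = \<bar>pd i g p\<bar> / 2"
  define \<sigma> where "\<sigma> = - sgn (pd i g p)"
  define M where "M = (\<Sum>b\<in>Basis. \<bar>pd b g p\<bar>) + 1"
  have a: "a > 0" using i by (simp add: a_def)
  have s1: "\<bar>\<sigma>\<bar> = 1" using i by (simp add: \<sigma>_def abs_sgn_eq)
  have cont: "isCont (pd b g) p" if "b \<in> Basis" for b
    using Cinf_pd(2)[OF g that] U by (simp add: continuous_on_eq_continuous_at)
  have near: "\<exists>d>0. \<forall>x\<in>ball p d. \<bar>pd b g x - pd b g p\<bar> < e" if "b \<in> Basis" "e > 0" for b e
    using cont[OF that(1)] that(2) unfolding continuous_at_eps_delta
    by (metis dist_commute dist_real_def mem_ball)
  obtain d1 where d1: "d1 > 0" "\<And>x. x \<in> ball p d1 \<Longrightarrow> \<bar>pd i g x - pd i g p\<bar> < a"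
    using near[OF i(1) a] by blast
  have "\<forall>b\<in>Basis. \<exists>d>0. \<forall>x\<in>ball p d. \<bar>pd b g x - pd b g p\<bar> < 1" using near by simp
  then obtain D where D: "\<And>b. b \<in> Basis \<Longrightarrow> D b > 0"
    "\<And>b x. b \<in> Basis \<Longrightarrow> x \<in> ball p (D b) \<Longrightarrow> \<bar>pd b g x - pd b g p\<bar> < 1" by metis
  obtain d2 where d2: "d2 > 0" "ball p d2 \<subseteq> U" using U by (meson openE)
  define \<rho> where "\<rho> = min d2 (min d1 (Min (D ` Basis)))"
  have r0: "\<rho> > 0" unfolding \<rho>_def using d1 d2 D by (simp add: Min_gr_iff)
  have rU: "ball p \<rho> \<subseteq> U" using d2 by (auto simp: \<rho>_def subset_iff)
  have pa: "\<sigma> * pd i g x \<le> - a" if "x \<in> ball p \<rho>" for x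
  proof -
    have "\<bar>pd i g x - pd i g p\<bar> < a" using that by (intro d1(2)) (auto simp: \<rho>_def)
    then show ?thesis using i(2) unfolding a_def \<sigma>_def by (auto simp: sgn_if abs_if split: if_splits)
  qed
  have pM: "\<bar>pd b g x\<bar> \<le> M" if "b \<in> Basis" "x \<in> ball p \<rho>" for b x
  proof -
    have "Min (D ` Basis) \<le> D b" using that by (intro Min_le) auto
    then have "\<bar>pd b g x - pd b g p\<bar> < 1" using that by (intro D(2)) (auto simp: \<rho>_def)
    moreover have "\<bar>pd b g p\<bar> \<le> (\<Sum>b\<in>Basis. \<bar>pd b g p\<bar>)" using that by (intro member_le_sum) auto
    ultimately show ?thesis unfolding M_def by linarith
  qed
  have M0: "M \<ge> 0" unfolding M_def by (simp add: sum_nonneg add_nonneg_nonneg)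
  have seg: "x + t *\<^sub>R b \<in> ball p \<rho>" if sg: "x \<in> ball p \<rho>" "x + r *\<^sub>R b \<in> ball p \<rho>" "t \<in> closed_segment 0 r" for x b t r
  proof -
    obtain v where v: "0 \<le> v" "v \<le> 1" "t = v * r" using sg(3) by (auto simp: closed_segment_def)
    then have "x + t *\<^sub>R b = (1 - v) *\<^sub>R x + v *\<^sub>R (x + r *\<^sub>R b)" by (simp add: algebra_simps)
    then have "x + t *\<^sub>R b \<in> closed_segment x (x + r *\<^sub>R b)"
      using v by (auto simp: closed_segment_def)
    then show ?thesis using convex_ball[of p \<rho>] sg(1,2) unfolding convex_contains_segment by blast
  qed
  have lip: "g (x + r *\<^sub>R b) \<le> g x + M * \<bar>r\<bar>" if lp: "b \<in> Basis" "x \<in> ball p \<rho>" "x + r *\<^sub>R b \<in> ball p \<rho>" for x r b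
  proof -
    obtain z where z: "z \<in> closed_segment 0 r" "g (x + r *\<^sub>R b) - g x = r * pd b g (x + z *\<^sub>R b)"
      using Cinf_segment_deriv[OF g lp(1), of r x] seg[OF lp(2,3)] rU by blast
    have "r * pd b g (x + z *\<^sub>R b) \<le> \<bar>r\<bar> * M"
    proof -
      have "r * pd b g (x + z *\<^sub>R b) \<le> \<bar>r\<bar> * \<bar>pd b g (x + z *\<^sub>R b)\<bar>"
        unfolding abs_mult[symmetric] by (rule abs_ge_self)
      also have "\<dots> \<le> \<bar>r\<bar> * M"
        by (rule mult_left_mono[OF pM[OF lp(1) seg[OF lp(2,3) z(1)]]]) simp
      finally show ?thesis .
    qed
    then show ?thesis using z(2) by (simp add: mult.commute)
  qed
  have dec: "g (x + (r * \<sigma>) *\<^sub>R i) \<le> g x - a * r" if dp: "r \<ge> 0" "x \<in> ball p \<rho>" "x + (r * \<sigma>) *\<^sub>R i \<in> ball p \<rho>" for x r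
  proof -
    obtain z where z: "z \<in> closed_segment 0 (r * \<sigma>)" "g (x + (r * \<sigma>) *\<^sub>R i) - g x = (r * \<sigma>) * pd i g (x + z *\<^sub>R i)"
      using Cinf_segment_deriv[OF g i(1), of "r * \<sigma>" x] seg[OF dp(2,3)] rU by blast
    have "r * (\<sigma> * pd i g (x + z *\<^sub>R i)) \<le> r * (- a)"
      by (rule mult_left_mono[OF pa[OF seg[OF dp(2,3) z(1)]] dp(1)])
    then show ?thesis using z(2) by (simp add: mult_ac)
  qed
  \<comment> \<open>The smallest depth per unit of |h| that pays for all three axis moves.\<close>
  define c where "c = 3 * M / a"
  have c0: "c \<ge> 0" using M0 a by (simp add: c_def)
  have ac: "a * c = 3 * M" using a by (simp add: c_def)
  \<comment> \<open>No point of the path is further than (c + 3)|h| from x, and with this \<delta>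
    the slightly larger (c + 4)|h| is below \<rho>/2.\<close>
  define \<delta> where "\<delta> = \<rho> / (2 * (c + 4))"
  have d0: "\<delta> > 0" using r0 c0 by (simp add: \<delta>_def)
  have inO: "y \<in> \<Omega>" if "y \<in> ball p \<rho>" "g y < 0" for y using that OU rU by auto
  have ni: "norm i = 1" "norm (axis k 1 :: pt) = 1" for k using i by auto
  have "path_ok \<Omega> ((c * \<sigma>) * norm h) i x h" if x: "x \<in> ball p (\<rho>/2)" "x \<in> \<Omega>" "norm h < \<delta>" "x + h \<in> \<Omega>" for x h
  proof -
    have hd: "(c + 4) * norm h < \<rho> / 2" using x(3) c0 unfolding \<delta>_def by (simp add: pos_less_divide_eq algebra_simps)
    have inb: "x + v \<in> ball p \<rho>" if "norm v \<le> (c + 4) * norm h" for v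
    proof -
      have "dist p (x + v) \<le> dist p x + norm v" by (rule dist_add_le)
      then show ?thesis using x(1) that hd by simp
    qed
    have ch: "t * (c * norm h) \<le> c * norm h" "0 \<le> t * (c * norm h)" if "0 \<le> t" "t \<le> 1" for t
      using mult_right_mono[OF that(2), of "c * norm h"] c0 that by auto
    have nq: "norm ((t * ((c * \<sigma>) * norm h)) *\<^sub>R i) = t * (c * norm h)" if "0 \<le> t" for t
      using that c0 s1 by (simp add: abs_mult ni)
    have gx: "g x < 0" "g (x + h) < 0"
    proof -
      have "x \<in> ball p \<rho>" using inb[of 0] c0 by simp
      then show "g x < 0" using OU rU x by auto
      have "x + h \<in> ball p \<rho>" using inb[of h] c0 by (simp add: mult_right_mono[of 1 "c + 4" "norm h", simplified])
      then show "g (x + h) < 0" using OU rU x by auto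
    qed
    show ?thesis
    proof (rule path_okI[OF ni(1)])
      fix t :: real assume t: "0 \<le> t" "t \<le> 1"
      have e: "t * ((c * \<sigma>) * norm h) = (t * (c * norm h)) * \<sigma>" by simp
      have b1: "x + (t * ((c * \<sigma>) * norm h)) *\<^sub>R i \<in> ball p \<rho>"
        using nq[OF t(1)] ch[OF t] by (intro inb) (simp add: distrib_right add_increasing2)
      show "x + (t * ((c * \<sigma>) * norm h)) *\<^sub>R i \<in> \<Omega>"
      proof (rule inO[OF b1])
        have "g (x + ((t * (c * norm h)) * \<sigma>) *\<^sub>R i) \<le> g x - a * (t * (c * norm h))"
          using inb[of 0] c0 ch[OF t] b1 by (intro dec) (auto simp: e)
        then show "g (x + (t * ((c * \<sigma>) * norm h)) *\<^sub>R i) < 0"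
          using gx mult_nonneg_nonneg[OF less_imp_le[OF a] ch(2)[OF t]] unfolding e by linarith
      qed
      have b2: "x + (h + (t * ((c * \<sigma>) * norm h)) *\<^sub>R i) \<in> ball p \<rho>"
        using nq[OF t(1)] ch[OF t] norm_triangle_ineq[of h "(t * ((c * \<sigma>) * norm h)) *\<^sub>R i"] norm_ge_zero[of h]
        by (intro inb) (unfold distrib_right, linarith)
      have b3: "x + h \<in> ball p \<rho>"
        using c0 mult_right_mono[of 1 "c + 4" "norm h"] by (intro inb) simp
      show "x + h + (t * ((c * \<sigma>) * norm h)) *\<^sub>R i \<in> \<Omega>"
      proof (rule inO)
        show "x + h + (t * ((c * \<sigma>) * norm h)) *\<^sub>R i \<in> ball p \<rho>" using b2 by (simp add: add.assoc)
        have "g (x + h + ((t * (c * norm h)) * \<sigma>) *\<^sub>R i) \<le> g (x + h) - a * (t * (c * norm h))"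
          using b3 ch[OF t] b2 by (intro dec) (auto simp: e add.assoc)
        then show "g (x + h + (t * ((c * \<sigma>) * norm h)) *\<^sub>R i) < 0"
          using gx mult_nonneg_nonneg[OF less_imp_le[OF a] ch(2)[OF t]] unfolding e by linarith
      qed
    next
      fix \<alpha> \<beta> \<gamma> assume *: "\<bar>\<alpha>\<bar> \<le> norm h" "\<bar>\<beta>\<bar> \<le> norm h" "\<bar>\<gamma>\<bar> \<le> norm h"
      let ?q = "(c * \<sigma>) * norm h"
      have e: "?q = (c * norm h) * \<sigma>" by simp
      have nq1: "norm (?q *\<^sub>R i) = c * norm h" using nq[of 1] by simp
      let ?x1 = "x + ?q *\<^sub>R i" let ?x2 = "?x1 + \<alpha> *\<^sub>R axis 1 1"
      let ?x3 = "?x2 + \<beta> *\<^sub>R axis 2 1" let ?x4 = "?x3 + \<gamma> *\<^sub>R axis 3 1"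
      have b1: "?x1 \<in> ball p \<rho>" using nq1 by (intro inb) (simp add: distrib_right)
      have "norm (?q *\<^sub>R i + \<alpha> *\<^sub>R axis 1 1) \<le> norm (?q *\<^sub>R i) + norm (\<alpha> *\<^sub>R axis 1 1 :: pt)" by (rule norm_triangle_ineq)
      then have n2: "norm (?q *\<^sub>R i + \<alpha> *\<^sub>R axis 1 1) \<le> c * norm h + \<bar>\<alpha>\<bar>" unfolding nq1 by simp
      have "norm (?q *\<^sub>R i + \<alpha> *\<^sub>R axis 1 1 + \<beta> *\<^sub>R axis 2 1) \<le> norm (?q *\<^sub>R i + \<alpha> *\<^sub>R axis 1 1) + norm (\<beta> *\<^sub>R axis 2 1 :: pt)" by (rule norm_triangle_ineq)
      then have n3: "norm (?q *\<^sub>R i + \<alpha> *\<^sub>R axis 1 1 + \<beta> *\<^sub>R axis 2 1) \<le> c * norm h + \<bar>\<alpha>\<bar> + \<bar>\<beta>\<bar>" using n2 by simp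
      have "norm (?q *\<^sub>R i + \<alpha> *\<^sub>R axis 1 1 + \<beta> *\<^sub>R axis 2 1 + \<gamma> *\<^sub>R axis 3 1)
         \<le> norm (?q *\<^sub>R i + \<alpha> *\<^sub>R axis 1 1 + \<beta> *\<^sub>R axis 2 1) + norm (\<gamma> *\<^sub>R axis 3 1 :: pt)" by (rule norm_triangle_ineq)
      then have n4: "norm (?q *\<^sub>R i + \<alpha> *\<^sub>R axis 1 1 + \<beta> *\<^sub>R axis 2 1 + \<gamma> *\<^sub>R axis 3 1) \<le> c * norm h + \<bar>\<alpha>\<bar> + \<bar>\<beta>\<bar> + \<bar>\<gamma>\<bar>"
        using n3 by simp
      have h0: "0 \<le> norm h" by simp
      have "norm (?q *\<^sub>R i + \<alpha> *\<^sub>R axis 1 1) \<le> (c + 4) * norm h" using n2 * h0 unfolding distrib_right by linarith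
      from inb[OF this] have b2: "?x2 \<in> ball p \<rho>" by (simp only: add.assoc)
      have "norm (?q *\<^sub>R i + \<alpha> *\<^sub>R axis 1 1 + \<beta> *\<^sub>R axis 2 1) \<le> (c + 4) * norm h" using n3 * h0 unfolding distrib_right by linarith
      from inb[OF this] have b3: "?x3 \<in> ball p \<rho>" by (simp only: add.assoc)
      have "norm (?q *\<^sub>R i + \<alpha> *\<^sub>R axis 1 1 + \<beta> *\<^sub>R axis 2 1 + \<gamma> *\<^sub>R axis 3 1) \<le> (c + 4) * norm h" using n4 * h0 unfolding distrib_right by linarith
      from inb[OF this] have b4: "?x4 \<in> ball p \<rho>" by (simp only: add.assoc)
      have g1: "g ?x1 \<le> g x - a * (c * norm h)"
        using inb[of 0] c0 b1 unfolding e by (intro dec) auto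
      have "a * (c * norm h) = 3 * (M * norm h)" using ac by (metis mult.assoc)
      then have g1': "g ?x1 \<le> g x - 3 * (M * norm h)" using g1 by linarith
      have m: "M * \<bar>\<alpha>\<bar> \<le> M * norm h" "M * \<bar>\<beta>\<bar> \<le> M * norm h" "M * \<bar>\<gamma>\<bar> \<le> M * norm h"
        using * M0 by (auto intro: mult_left_mono)
      have "g ?x4 < 0"
        using lip[OF pt_Basis(1) b1 b2] lip[OF pt_Basis(2) b2 b3] lip[OF pt_Basis(3) b3 b4] g1' m gx by linarith
      then show "x + ?q *\<^sub>R i + \<alpha> *\<^sub>R axis 1 1 + \<beta> *\<^sub>R axis 2 1 + \<gamma> *\<^sub>R axis 3 1 \<in> \<Omega>"
        by (rule inO[OF b4])
    qed
  qed
  then show ?thesis using r0 d0 i(1)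
    by (intro exI[of _ "ball p (\<rho>/2)"] bexI[of _ i] exI[of _ "c * \<sigma>"] exI[of _ \<delta>]) auto
qed

lemma smooth_domain_charts:
  assumes "smooth_domain \<Omega>" "p \<in> closure \<Omega>"
  shows "\<exists>V. \<exists>i\<in>Basis. \<exists>c \<delta>. open V \<and> p \<in> V \<and> \<delta> > 0 \<and>
    (\<forall>x h. x \<in> V \<inter> \<Omega> \<and> norm h < \<delta> \<and> x + h \<in> \<Omega> \<longrightarrow> path_ok \<Omega> (c * norm h) i x h)"
proof (cases "p \<in> \<Omega>")
  case True then show ?thesis using chart_interior assms(1) by (simp add: smooth_domain_def)
next
  case False
  then have "p \<in> frontier \<Omega>" using assms by (simp add: frontier_def smooth_domain_def interior_open)
  then obtain U g where U: "open U" "p \<in> U" "Cinf_on U g" "\<forall>x\<in>U. \<exists>i\<in>Basis. pd i g x \<noteq> 0"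
     "\<Omega> \<inter> U = {x\<in>U. g x < 0}" using assms(1) unfolding smooth_domain_def by blast
  then obtain i where "i \<in> Basis" "pd i g p \<noteq> 0" by blast
  from chart_boundary[OF U(1,2,3,5) this] show ?thesis .
qed

section \<open>Translation estimates in L^2 obtained from the charts\<close>

lemma sq_sum5: "(a + b + c + d + (e::real))\<^sup>2 \<le> 5 * (a\<^sup>2 + b\<^sup>2 + c\<^sup>2 + d\<^sup>2 + e\<^sup>2)"
proof -
  have "0 \<le> (a-b)\<^sup>2 + (a-c)\<^sup>2 + (a-d)\<^sup>2 + (a-e)\<^sup>2 + (b-c)\<^sup>2 + (b-d)\<^sup>2 + (b-e)\<^sup>2 + (c-d)\<^sup>2 + (c-e)\<^sup>2 + (d-e)\<^sup>2"
    by (intro add_nonneg_nonneg) auto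
  then show ?thesis by (simp add: power2_eq_square algebra_simps)
qed

definition dqi :: "'a::euclidean_space set \<Rightarrow> ('a \<Rightarrow> real) \<Rightarrow> 'a \<Rightarrow> 'a \<Rightarrow> ennreal" where
  "dqi \<Omega> u w x = indicator (segset \<Omega> w) x * ennreal ((u (x + w) - u x)\<^sup>2)"

lemma dqi_meas[measurable]:
  assumes "open \<Omega>" "u \<in> borel_measurable borel" shows "dqi \<Omega> u w \<in> borel_measurable borel"
proof -
  have [measurable]: "segset \<Omega> w \<in> sets borel" using open_segset[OF assms(1)] by auto
  note [measurable] = assms(2)
  show ?thesis unfolding dqi_def by measurable
qed

lemma ennreal_sum5:
  assumes "0 \<le> a" "0 \<le> b" "0 \<le> c" "0 \<le> d" "0 \<le> e"
  shows "5 * (ennreal a + ennreal b + ennreal c + ennreal d + ennreal e) = ennreal (5 * (a + b + c + d + e))"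
  using assms by (simp add: ennreal_mult)

text \<open>The increment over h telescopes along the five legs of the path. Each leg is evaluated
  at a translate of x, and translation invariance reduces its integral to a difference quotient
  estimate. Two legs have length |c||h| and three have length at most |h|, whence the factor 5(2 c^2
  + 3).\<close>

lemma chart_estimate:
  assumes Om: "open \<Omega>" and um[measurable]: "u \<in> borel_measurable borel" and i: "i \<in> Basis"
    and [measurable]: "V \<in> sets borel"
    and ok: "\<And>x. x \<in> V \<inter> \<Omega> \<Longrightarrow> x + h \<in> \<Omega> \<Longrightarrow> path_ok \<Omega> (c * norm h) i x h"
    and G: "0 \<le> G" and dq: "\<And>b s. b \<in> Basis \<Longrightarrow> (\<integral>\<^sup>+x. dqi \<Omega> u (s *\<^sub>R b) x \<partial>lborel) \<le> ennreal (s\<^sup>2 * G)"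
  shows "(\<integral>\<^sup>+x. indicator (V \<inter> \<Omega>) x * indicator \<Omega> (x + h) * ennreal ((u (x + h) - u x)\<^sup>2) \<partial>lborel)
     \<le> ennreal ((norm h)\<^sup>2 * (5 * (2 * c\<^sup>2 + 3) * G))"
proof -
  let ?q = "(c * norm h) *\<^sub>R i" let ?h1 = "(h $ 1) *\<^sub>R axis 1 1 :: pt"
  let ?h2 = "(h $ 2) *\<^sub>R axis 2 1 :: pt" let ?h3 = "(h $ 3) *\<^sub>R axis 3 1 :: pt"
  let ?F = "\<lambda>x. dqi \<Omega> u ?q x + dqi \<Omega> u ?h1 (x + ?q) + dqi \<Omega> u ?h2 (x + (?q + ?h1))
      + dqi \<Omega> u ?h3 (x + (?q + ?h1 + ?h2)) + dqi \<Omega> u ?q (x + h)"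
  note [measurable] = dqi_meas[OF Om um]
  have [measurable]: "\<Omega> \<in> sets borel" using Om by auto
  have "(\<integral>\<^sup>+x. indicator (V \<inter> \<Omega>) x * indicator \<Omega> (x + h) * ennreal ((u (x + h) - u x)\<^sup>2) \<partial>lborel)
    \<le> (\<integral>\<^sup>+x. 5 * ?F x \<partial>lborel)"
  proof (rule nn_integral_mono)
    fix x
    show "indicator (V \<inter> \<Omega>) x * indicator \<Omega> (x + h) * ennreal ((u (x + h) - u x)\<^sup>2) \<le> 5 * ?F x"
    proof (cases "x \<in> V \<inter> \<Omega> \<and> x + h \<in> \<Omega>")
      case True
      then have p: "path_ok \<Omega> (c * norm h) i x h" using ok by blast
      let ?x1 = "x + ?q" let ?x2 = "x + (?q + ?h1)" let ?x3 = "x + (?q + ?h1 + ?h2)"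
      let ?x4 = "x + h + ?q"
      have e: "?x1 + ?h1 = ?x2" "?x2 + ?h2 = ?x3" by (simp_all add: add.assoc)
      have e3: "?x3 + ?h3 = ?x4"
        using pt_decomp[of h] by (simp only: add_ac)
      have mem: "x \<in> segset \<Omega> ?q" "?x1 \<in> segset \<Omega> ?h1" "?x2 \<in> segset \<Omega> ?h2" "?x3 \<in> segset \<Omega> ?h3" "x + h \<in> segset \<Omega> ?q"
        using p unfolding path_ok_def by (simp_all only: add.assoc)
      have "u (x + h) - u x = (u ?x1 - u x) + (u ?x2 - u ?x1) + (u ?x3 - u ?x2) + (u ?x4 - u ?x3) + (- (u ?x4 - u (x + h)))" by simp
      then have "(u (x + h) - u x)\<^sup>2 \<le> 5 * ((u ?x1 - u x)\<^sup>2 + (u ?x2 - u ?x1)\<^sup>2 + (u ?x3 - u ?x2)\<^sup>2 + (u ?x4 - u ?x3)\<^sup>2 + (u ?x4 - u (x + h))\<^sup>2)"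
        using sq_sum5[of "u ?x1 - u x" "u ?x2 - u ?x1" "u ?x3 - u ?x2" "u ?x4 - u ?x3" "- (u ?x4 - u (x + h))"]
        by (simp only: power2_minus)
      then have "ennreal ((u (x + h) - u x)\<^sup>2) \<le> ennreal (5 * ((u ?x1 - u x)\<^sup>2 + (u ?x2 - u ?x1)\<^sup>2 + (u ?x3 - u ?x2)\<^sup>2 + (u ?x4 - u ?x3)\<^sup>2 + (u ?x4 - u (x + h))\<^sup>2))"
        by (rule ennreal_leI)
      also have "\<dots> = 5 * (ennreal ((u ?x1 - u x)\<^sup>2) + ennreal ((u ?x2 - u ?x1)\<^sup>2) + ennreal ((u ?x3 - u ?x2)\<^sup>2) + ennreal ((u ?x4 - u ?x3)\<^sup>2) + ennreal ((u ?x4 - u (x + h))\<^sup>2))"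
        by (intro ennreal_sum5[symmetric]) auto
      also have "\<dots> = 5 * ?F x" unfolding dqi_def e e3 using mem by simp
      finally show ?thesis using True by simp
    qed (auto simp: indicator_def)
  qed
  also have "\<dots> = 5 * ((\<integral>\<^sup>+x. dqi \<Omega> u ?q x \<partial>lborel) + (\<integral>\<^sup>+x. dqi \<Omega> u ?h1 x \<partial>lborel) + (\<integral>\<^sup>+x. dqi \<Omega> u ?h2 x \<partial>lborel)
      + (\<integral>\<^sup>+x. dqi \<Omega> u ?h3 x \<partial>lborel) + (\<integral>\<^sup>+x. dqi \<Omega> u ?q x \<partial>lborel))"
    by (simp add: nn_integral_cmult nn_integral_add nn_integral_shift dqi_meas[OF Om um])
  also have "\<dots> \<le> 5 * (ennreal ((c * norm h)\<^sup>2 * G) + ennreal ((norm h)\<^sup>2 * G) + ennreal ((norm h)\<^sup>2 * G)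
      + ennreal ((norm h)\<^sup>2 * G) + ennreal ((c * norm h)\<^sup>2 * G))"
  proof (intro mult_left_mono add_mono dq i)
    have s: "ennreal ((h $ k)\<^sup>2 * G) \<le> ennreal ((norm h)\<^sup>2 * G)" for k
      using component_le_norm_cart[of h k] G by (intro ennreal_leI mult_right_mono) (auto simp: abs_le_square_iff[symmetric])
    show "(\<integral>\<^sup>+x. dqi \<Omega> u ?h1 x \<partial>lborel) \<le> ennreal ((norm h)\<^sup>2 * G)" by (rule order_trans[OF dq[OF pt_Basis(1)] s])
    show "(\<integral>\<^sup>+x. dqi \<Omega> u ?h2 x \<partial>lborel) \<le> ennreal ((norm h)\<^sup>2 * G)" by (rule order_trans[OF dq[OF pt_Basis(2)] s])
    show "(\<integral>\<^sup>+x. dqi \<Omega> u ?h3 x \<partial>lborel) \<le> ennreal ((norm h)\<^sup>2 * G)" by (rule order_trans[OF dq[OF pt_Basis(3)] s])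
  qed simp
  also have "\<dots> = ennreal (5 * ((c * norm h)\<^sup>2 * G + (norm h)\<^sup>2 * G + (norm h)\<^sup>2 * G + (norm h)\<^sup>2 * G + (c * norm h)\<^sup>2 * G))"
    using G by (intro ennreal_sum5) auto
  also have "5 * ((c * norm h)\<^sup>2 * G + (norm h)\<^sup>2 * G + (norm h)\<^sup>2 * G + (norm h)\<^sup>2 * G + (c * norm h)\<^sup>2 * G)
     = (norm h)\<^sup>2 * (5 * (2 * c\<^sup>2 + 3) * G)" by (simp add: power_mult_distrib algebra_simps)
  finally show ?thesis .
qed

text \<open>Compactness of the closure of \<Omega> leaves finitely many charts; their estimates are
  added and the smallest admissible |h| is taken.\<close>

lemma shift_estimate:
  assumes sd: "smooth_domain \<Omega>" and um[measurable]: "u \<in> borel_measurable borel"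
    and G: "0 \<le> G" and dq: "\<And>b s. b \<in> Basis \<Longrightarrow> (\<integral>\<^sup>+x. dqi \<Omega> u (s *\<^sub>R b) x \<partial>lborel) \<le> ennreal (s\<^sup>2 * G)"
  shows "\<exists>C\<ge>0. \<exists>\<delta>>0. \<forall>h. norm h < \<delta> \<longrightarrow>
     (\<integral>\<^sup>+x. indicator \<Omega> x * indicator \<Omega> (x + h) * ennreal ((u (x + h) - u x)\<^sup>2) \<partial>lborel) \<le> ennreal (C * (norm h)\<^sup>2)"
proof -
  have Om: "open \<Omega>" "compact (closure \<Omega>)" using sd by (auto simp: smooth_domain_def)
  have [measurable]: "\<Omega> \<in> sets borel" using Om by auto
  define chart where "chart p V i c \<delta> \<longleftrightarrow> open V \<and> p \<in> V \<and> i \<in> Basis \<and> \<delta> > 0 \<and>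
    (\<forall>x h. x \<in> V \<inter> \<Omega> \<and> norm h < \<delta> \<and> x + h \<in> \<Omega> \<longrightarrow> path_ok \<Omega> (c * norm h) i x h)"
    for p :: pt and V i c \<delta>
  have "\<forall>p\<in>closure \<Omega>. \<exists>z. chart p (fst z) (fst (snd z)) (fst (snd (snd z))) (snd (snd (snd z)))"
  proof
    fix p assume "p \<in> closure \<Omega>"
    from smooth_domain_charts[OF sd this] obtain V i c \<delta> where "chart p V i c \<delta>"
      unfolding chart_def by blast
    then show "\<exists>z. chart p (fst z) (fst (snd z)) (fst (snd (snd z))) (snd (snd (snd z)))"
      by (intro exI[of _ "(V, i, c, \<delta>)"]) simp
  qed
  from bchoice[OF this] obtain z where
    z: "\<forall>p\<in>closure \<Omega>. chart p (fst (z p)) (fst (snd (z p))) (fst (snd (snd (z p)))) (snd (snd (snd (z p))))" ..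
  define V i c \<delta> where "V p = fst (z p)" and "i p = fst (snd (z p))" and "c p = fst (snd (snd (z p)))"
    and "\<delta> p = snd (snd (snd (z p)))" for p
  have V: "open (V p) \<and> p \<in> V p \<and> i p \<in> Basis \<and> \<delta> p > (0::real) \<and>
    (\<forall>x h. x \<in> V p \<inter> \<Omega> \<and> norm h < \<delta> p \<and> x + h \<in> \<Omega> \<longrightarrow> path_ok \<Omega> (c p * norm h) (i p) x h)"
    if "p \<in> closure \<Omega>" for p
    using bspec[OF z that] unfolding chart_def V_def i_def c_def \<delta>_def .
  obtain P where P: "P \<subseteq> closure \<Omega>" "finite P" "closure \<Omega> \<subseteq> (\<Union>p\<in>P. V p)"
    using compactE_image[OF Om(2), of "closure \<Omega>" V] V by blast
  \<comment> \<open>The element 1 ensures that the minimum is over a nonempty set.\<close>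
  define d where "d = Min (insert 1 (\<delta> ` P))"
  have d: "d > 0" "\<And>p. p \<in> P \<Longrightarrow> d \<le> \<delta> p"
    unfolding d_def using P V by (auto simp: Min_gr_iff subset_iff intro: Min_le)
  define C where "C = (\<Sum>p\<in>P. 5 * (2 * (c p)\<^sup>2 + 3) * G)"
  have C: "C \<ge> 0" unfolding C_def using G by (intro sum_nonneg mult_nonneg_nonneg) auto
  have "(\<integral>\<^sup>+x. indicator \<Omega> x * indicator \<Omega> (x + h) * ennreal ((u (x + h) - u x)\<^sup>2) \<partial>lborel) \<le> ennreal (C * (norm h)\<^sup>2)"
    if h: "norm h < d" for h
  proof -
    have Vm[measurable]: "V p \<in> sets borel" if "p \<in> P" for p using V that P by auto
    have "(\<integral>\<^sup>+x. indicator \<Omega> x * indicator \<Omega> (x + h) * ennreal ((u (x + h) - u x)\<^sup>2) \<partial>lborel)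
      \<le> (\<integral>\<^sup>+x. (\<Sum>p\<in>P. indicator (V p \<inter> \<Omega>) x * indicator \<Omega> (x + h) * ennreal ((u (x + h) - u x)\<^sup>2)) \<partial>lborel)"
    proof (rule nn_integral_mono)
      fix x
      show "indicator \<Omega> x * indicator \<Omega> (x + h) * ennreal ((u (x + h) - u x)\<^sup>2)
        \<le> (\<Sum>p\<in>P. indicator (V p \<inter> \<Omega>) x * indicator \<Omega> (x + h) * ennreal ((u (x + h) - u x)\<^sup>2))"
      proof (cases "x \<in> \<Omega>")
        case True
        then obtain p where p: "p \<in> P" "x \<in> V p" using P(3) closure_subset by blast
        have "indicator \<Omega> x * indicator \<Omega> (x + h) * ennreal ((u (x + h) - u x)\<^sup>2)
          = indicator (V p \<inter> \<Omega>) x * indicator \<Omega> (x + h) * ennreal ((u (x + h) - u x)\<^sup>2)"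
          using True p by simp
        also have "\<dots> \<le> (\<Sum>p\<in>P. indicator (V p \<inter> \<Omega>) x * indicator \<Omega> (x + h) * ennreal ((u (x + h) - u x)\<^sup>2))"
          by (rule member_le_sum[OF p(1) _ P(2)]) simp
        finally show ?thesis .
      qed simp
    qed
    also have "\<dots> = (\<Sum>p\<in>P. \<integral>\<^sup>+x. indicator (V p \<inter> \<Omega>) x * indicator \<Omega> (x + h) * ennreal ((u (x + h) - u x)\<^sup>2) \<partial>lborel)"
      by (rule nn_integral_sum) (use Vm in measurable)
    also have "\<dots> \<le> (\<Sum>p\<in>P. ennreal ((norm h)\<^sup>2 * (5 * (2 * (c p)\<^sup>2 + 3) * G)))"
    proof (rule sum_mono)
      fix p assume p: "p \<in> P"
      then have pc: "p \<in> closure \<Omega>" using P by blast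
      have "norm h < \<delta> p" using h d(2)[OF p] by simp
      then have "path_ok \<Omega> (c p * norm h) (i p) x h" if "x \<in> V p \<inter> \<Omega>" "x + h \<in> \<Omega>" for x
        using V[OF pc] that by blast
      then show "(\<integral>\<^sup>+x. indicator (V p \<inter> \<Omega>) x * indicator \<Omega> (x + h) * ennreal ((u (x + h) - u x)\<^sup>2) \<partial>lborel)
        \<le> ennreal ((norm h)\<^sup>2 * (5 * (2 * (c p)\<^sup>2 + 3) * G))"
        using V[OF pc] by (intro chart_estimate[OF Om(1) um _ Vm[OF p] _ G dq]) auto
    qed
    also have "\<dots> = ennreal (\<Sum>p\<in>P. (norm h)\<^sup>2 * (5 * (2 * (c p)\<^sup>2 + 3) * G))"
      using G by (intro sum_ennreal) auto
    also have "(\<Sum>p\<in>P. (norm h)\<^sup>2 * (5 * (2 * (c p)\<^sup>2 + 3) * G)) = C * (norm h)\<^sup>2"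
      unfolding C_def by (simp add: sum_distrib_left mult.commute sum_distrib_right)
    finally show ?thesis .
  qed
  then show ?thesis using C d(1) by blast
qed

text \<open>Dyadic shells: \<open>|h|\<^sup>-\<^sup>s\<close> is integrable near the origin of \<open>\<real>\<^sup>3\<close> for \<open>s < 3\<close>.\<close>

lemma radial_integrable:
  assumes s: "0 \<le> s" "s < 3" and d: "\<delta> > 0"
  shows "(\<integral>\<^sup>+(h::pt). indicator (ball 0 \<delta>) h * ennreal (norm h powr (- s)) \<partial>lborel) < \<infinity>"
proof -
  define r where "r k = \<delta> * (1/2) ^ k" for k :: nat
  have r0: "r k > 0" for k using d by (simp add: r_def)
  let ?c = "unit_ball_vol 3 * \<delta> ^ 3 * (\<delta> / 2) powr (- s)"
  have c0: "?c \<ge> 0" using d by simp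
  let ?t = "\<lambda>k. (r (Suc k)) powr (- s) * (unit_ball_vol 3 * r k ^ 3)"
  have t: "?t k = ?c * ((2 powr s) / 8) ^ k" for k
  proof -
    have "r (Suc k) powr (- s) = (\<delta> / 2) powr (- s) * (((1/2) ^ k) powr (- s))"
      using d by (simp add: r_def powr_mult[symmetric] mult_ac)
    also have "((1/2::real) ^ k) powr (- s) = (2 powr s) ^ k"
    proof -
      have "(1/2::real) ^ k = 2 powr (- real k)"
        by (simp add: powr_minus powr_realpow power_one_over inverse_eq_divide)
      then have "((1/2::real) ^ k) powr (- s) = 2 powr (s * real k)" by (simp add: powr_powr mult.commute)
      also have "\<dots> = (2 powr s) ^ k" by (simp add: powr_powr[symmetric] powr_realpow)
      finally show ?thesis .
    qed
    finally have "r (Suc k) powr (- s) = (\<delta> / 2) powr (- s) * (2 powr s) ^ k" .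
    moreover have "r k ^ 3 = \<delta> ^ 3 * (1/8) ^ k"
    proof -
      have "((1/2::real) ^ k) ^ 3 = ((1/2) ^ 3) ^ k" by (simp add: power_mult[symmetric] mult.commute)
      then show ?thesis by (simp add: r_def power_mult_distrib power3_eq_cube)
    qed
    ultimately show ?thesis by (simp add: power_divide)
  qed
  have "2 powr s < 2 powr (3::real)" using s by (intro powr_less_mono) auto
  \<comment> \<open>The k-th shell contributes a term of a geometric series with ratio 2^s/8: a
    factor 2^s from the singularity and 1/8 from the volume. The ratio is below 1 because s <
    3.\<close>
  then have q: "0 \<le> (2 powr s) / 8" "(2 powr s) / 8 < (1::real)" by auto
  have le: "(\<integral>\<^sup>+(h::pt). indicator (ball 0 \<delta>) h * ennreal (norm h powr (- s)) \<partial>lborel)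
    \<le> (\<integral>\<^sup>+(h::pt). (\<Sum>k. ennreal ((r (Suc k)) powr (- s)) * indicator (ball 0 (r k)) h) \<partial>lborel)"
  proof (rule nn_integral_mono)
    fix h :: pt
    show "indicator (ball 0 \<delta>) h * ennreal (norm h powr (- s)) \<le> (\<Sum>k. ennreal ((r (Suc k)) powr (- s)) * indicator (ball 0 (r k)) h)"
    proof (cases "h = 0 \<or> h \<notin> ball 0 \<delta>")
      case False
      then have h: "norm h > 0" "norm h < \<delta>" by auto
      have "\<exists>k. r k \<le> norm h"
      proof -
        have "(\<lambda>k. (1/2::real) ^ k) \<longlonglongrightarrow> 0" by (rule LIMSEQ_power_zero) simp
        then have "r \<longlonglongrightarrow> 0" unfolding r_def by (rule tendsto_mult_right_zero)
        then have "\<forall>\<^sub>F k in sequentially. r k < norm h"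
          by (rule order_tendstoD(2)) (use h in simp)
        then obtain k where "r k < norm h" by (auto dest: eventually_happens)
        then show ?thesis by (auto intro: less_imp_le)
      qed
      \<comment> \<open>The least radius not exceeding |h| locates the shell r(k+1) \<le> |h| < r(k)
        containing h.\<close>
      then have L: "r (LEAST k. r k \<le> norm h) \<le> norm h" by (rule LeastI_ex)
      have "(LEAST k. r k \<le> norm h) \<noteq> 0" using L h by (metis not_le power_0 r_def mult.right_neutral)
      then obtain k where k: "(LEAST k. r k \<le> norm h) = Suc k" by (metis not0_implies_Suc)
      have k1: "r (Suc k) \<le> norm h" using L k by simp
      have k2: "norm h < r k" using not_less_Least[of k "\<lambda>k. r k \<le> norm h"] k by simp
      have "norm h powr (- s) \<le> (r (Suc k)) powr (- s)"
        using k1 r0[of "Suc k"] s by (intro powr_mono2') auto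
      then have "indicator (ball 0 \<delta>) h * ennreal (norm h powr (- s)) \<le> ennreal ((r (Suc k)) powr (- s)) * indicator (ball 0 (r k)) h"
        using k2 h by (simp add: ennreal_leI)
      also have "\<dots> = (\<Sum>j\<in>{k}. ennreal ((r (Suc j)) powr (- s)) * indicator (ball 0 (r j)) h)"
        by (simp only: sum.insert finite.emptyI sum.empty add_0_right empty_iff not_False_eq_True)
      also have "\<dots> \<le> (\<Sum>k. ennreal ((r (Suc k)) powr (- s)) * indicator (ball 0 (r k)) h)"
        by (rule sum_le_suminf) auto
      finally show ?thesis .
    next
      case True
      then have "indicator (ball 0 \<delta>) h * ennreal (norm h powr (- s)) = 0" by (auto simp: indicator_def)
      then show ?thesis by (simp only: zero_le)
    qed
  qed
  have "(\<integral>\<^sup>+(h::pt). (\<Sum>k. ennreal ((r (Suc k)) powr (- s)) * indicator (ball 0 (r k)) h) \<partial>lborel)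
      = (\<Sum>k. \<integral>\<^sup>+(h::pt). ennreal ((r (Suc k)) powr (- s)) * indicator (ball 0 (r k)) h \<partial>lborel)"
    by (intro nn_integral_suminf borel_measurable_times_ennreal borel_measurable_const borel_measurable_indicator) simp
  moreover have "(\<integral>\<^sup>+(h::pt). ennreal ((r (Suc k)) powr (- s)) * indicator (ball 0 (r k)) h \<partial>lborel) = ennreal (?t k)" for k
  proof -
    have "(\<integral>\<^sup>+(h::pt). ennreal ((r (Suc k)) powr (- s)) * indicator (ball 0 (r k)) h \<partial>lborel)
        = ennreal ((r (Suc k)) powr (- s)) * emeasure lborel (ball (0::pt) (r k))"
      by (rule nn_integral_cmult_indicator) simp
    moreover have "emeasure lborel (ball (0::pt) (r k)) = ennreal (unit_ball_vol 3 * r k ^ 3)"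
      using emeasure_ball[of "r k" "0::pt"] r0[of k] by simp
    ultimately show ?thesis using r0[of k] by (simp add: ennreal_mult)
  qed
  moreover have "(\<Sum>k. ennreal (?t k)) = ennreal (\<Sum>k. ?t k)"
  proof (rule suminf_ennreal2)
    show "0 \<le> ?t k" for k using r0[of k] by (intro mult_nonneg_nonneg) auto
    show "summable ?t" unfolding t using q by (intro summable_mult summable_geometric) auto
  qed
  ultimately have "(\<integral>\<^sup>+(h::pt). indicator (ball 0 \<delta>) h * ennreal (norm h powr (- s)) \<partial>lborel) \<le> ennreal (\<Sum>k. ?t k)"
    using le by (simp only:)
  also have "ennreal (\<Sum>k. ?t k) < \<infinity>" by simp
  finally show ?thesis .
qed

text \<open>In the variables x and h = y - x the seminorm is the integral over h of |h|^(-3-2\<eta>)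
  times the squared norm of the increment. Near h = 0 the translation estimate C|h|^2 leaves
  |h|^(-1-2\<eta>), integrable because 1 + 2\<eta> < 3; away from 0 the increment is bounded by the
  L^2 norm, and h ranges over a bounded set because \<Omega> is bounded.\<close>

lemma H1_slobodeckij:
  assumes sd: "smooth_domain \<Omega>" and um[measurable]: "u \<in> borel_measurable borel" and u: "inH \<Omega> 1 u"
    and eta: "0 < \<eta>" "\<eta> < 1"
  shows "(\<integral>\<^sup>+x. (\<integral>\<^sup>+y. indicator \<Omega> x * indicator \<Omega> y * ennreal ((u x - u y)\<^sup>2 / (norm (x - y) powr (3 + 2 * \<eta>)))
                 \<partial>lborel) \<partial>lborel) < \<infinity>"
proof -
  have Om: "open \<Omega>" "bounded \<Omega>" using sd by (auto simp: smooth_domain_def)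
  have [measurable]: "\<Omega> \<in> sets borel" using Om by auto
  have L: "L2 \<Omega> u" "\<And>b. b \<in> Basis \<Longrightarrow> \<exists>g. L2 \<Omega> g \<and> weak_partial \<Omega> u b g"
    using u by (auto simp: inH_def sob_nsq_def split: if_splits)
  then obtain g where g: "\<And>b. b \<in> Basis \<Longrightarrow> L2 \<Omega> (g b)" "\<And>b. b \<in> Basis \<Longrightarrow> weak_partial \<Omega> u b (g b)" by metis
  define G where "G = (\<Sum>b\<in>Basis. nsq \<Omega> (g b))"
  have nn: "nsq \<Omega> v \<ge> 0" for v by (simp add: nsq_eq inn_nonneg)
  have G: "G \<ge> 0" unfolding G_def by (intro sum_nonneg nn)
  have dq: "(\<integral>\<^sup>+x. dqi \<Omega> u (s *\<^sub>R b) x \<partial>lborel) \<le> ennreal (s\<^sup>2 * G)" if b: "b \<in> Basis" for b s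
  proof -
    have "nsq \<Omega> (g b) \<le> G" unfolding G_def using b by (intro member_le_sum nn) auto
    then have "ennreal (s\<^sup>2 * nsq \<Omega> (g b)) \<le> ennreal (s\<^sup>2 * G)" by (intro ennreal_leI mult_left_mono) auto
    then show ?thesis unfolding dqi_def
      using difference_quotient_le[OF Om um L(1) g(1)[OF b] g(2)[OF b] b, of s] by (rule order_trans[rotated])
  qed
  obtain C \<delta> where C: "C \<ge> 0" "\<delta> > 0" and est: "\<And>h. norm h < \<delta> \<Longrightarrow>
     (\<integral>\<^sup>+x. indicator \<Omega> x * indicator \<Omega> (x + h) * ennreal ((u (x + h) - u x)\<^sup>2) \<partial>lborel) \<le> ennreal (C * (norm h)\<^sup>2)"
    using shift_estimate[OF sd um G dq] by blast
  obtain R where R: "R > 0" "\<And>x. x \<in> \<Omega> \<Longrightarrow> norm x \<le> R" using Om(2) by (auto simp: bounded_pos)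
  let ?I = "\<lambda>h. \<integral>\<^sup>+x. indicator \<Omega> x * indicator \<Omega> (x + h) * ennreal ((u (x + h) - u x)\<^sup>2) \<partial>lborel"
  let ?p = "3 + 2 * \<eta>"
  define N where "N = nsq \<Omega> u"
  have N: "(\<integral>\<^sup>+x. indicator \<Omega> x * ennreal ((u x)\<^sup>2) \<partial>lborel) = ennreal N"
    using sqn_eq[OF L(1)[unfolded L2_eq]] nn_integral_lebesgue_on[of \<Omega> "\<lambda>x. ennreal ((u x)\<^sup>2)"]
    by (simp add: sqn_def N_def nsq_eq)
  have N0: "N \<ge> 0" by (simp add: N_def nn)
  \<comment> \<open>The crude bound for large h: each of the two values is estimated separately by
    the norm of u.\<close>
  have I2: "?I h \<le> ennreal (4 * N)" for h
  proof -
    have "?I h \<le> (\<integral>\<^sup>+x. 2 * (indicator \<Omega> (x + h) * ennreal ((u (x + h))\<^sup>2)) + 2 * (indicator \<Omega> x * ennreal ((u x)\<^sup>2)) \<partial>lborel)"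
    proof (rule nn_integral_mono)
      fix x
      have "(u (x + h) - u x)\<^sup>2 \<le> 2 * (u (x + h))\<^sup>2 + 2 * (u x)\<^sup>2"
        using zero_le_power2[of "u (x + h) + u x"] by (simp add: power2_sum power2_diff)
      then have "ennreal ((u (x + h) - u x)\<^sup>2) \<le> ennreal (2 * (u (x + h))\<^sup>2 + 2 * (u x)\<^sup>2)" by (rule ennreal_leI)
      also have "\<dots> = 2 * ennreal ((u (x + h))\<^sup>2) + 2 * ennreal ((u x)\<^sup>2)" by (simp add: ennreal_mult)
      finally show "indicator \<Omega> x * indicator \<Omega> (x + h) * ennreal ((u (x + h) - u x)\<^sup>2) \<le>
         2 * (indicator \<Omega> (x + h) * ennreal ((u (x + h))\<^sup>2)) + 2 * (indicator \<Omega> x * ennreal ((u x)\<^sup>2))"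
        by (auto simp: indicator_def)
    qed
    also have "\<dots> = 2 * (\<integral>\<^sup>+x. indicator \<Omega> (x + h) * ennreal ((u (x + h))\<^sup>2) \<partial>lborel) + 2 * ennreal N"
      by (simp add: nn_integral_add nn_integral_cmult N)
    also have "(\<integral>\<^sup>+x. indicator \<Omega> (x + h) * ennreal ((u (x + h))\<^sup>2) \<partial>lborel) = ennreal N"
      using nn_integral_shift[of "\<lambda>x. indicator \<Omega> x * ennreal ((u x)\<^sup>2)" h] N by simp
    also have "2 * ennreal N + 2 * ennreal N = ennreal (4 * N)"
      using N0 by (simp flip: distrib_right add: ennreal_mult)
    finally show ?thesis .
  qed
  have "(\<integral>\<^sup>+x. (\<integral>\<^sup>+y. indicator \<Omega> x * indicator \<Omega> y * ennreal ((u x - u y)\<^sup>2 / (norm (x - y) powr ?p)) \<partial>lborel) \<partial>lborel)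
    = (\<integral>\<^sup>+x. (\<integral>\<^sup>+h. indicator \<Omega> x * indicator \<Omega> (x + h) * ennreal ((u x - u (x + h))\<^sup>2 / (norm (x - (x + h)) powr ?p)) \<partial>lborel) \<partial>lborel)"
  proof (rule nn_integral_cong)
    fix x :: pt
    show "(\<integral>\<^sup>+y. indicator \<Omega> x * indicator \<Omega> y * ennreal ((u x - u y)\<^sup>2 / (norm (x - y) powr ?p)) \<partial>lborel)
      = (\<integral>\<^sup>+h. indicator \<Omega> x * indicator \<Omega> (x + h) * ennreal ((u x - u (x + h))\<^sup>2 / (norm (x - (x + h)) powr ?p)) \<partial>lborel)"
      using nn_integral_shift[of "\<lambda>y. indicator \<Omega> x * indicator \<Omega> y * ennreal ((u x - u y)\<^sup>2 / (norm (x - y) powr ?p))" x]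
      by (simp add: add.commute)
  qed
  also have "\<dots> = (\<integral>\<^sup>+h. (\<integral>\<^sup>+x. indicator \<Omega> x * indicator \<Omega> (x + h) * ennreal ((u x - u (x + h))\<^sup>2 / (norm (x - (x + h)) powr ?p)) \<partial>lborel) \<partial>lborel)"
    by (rule lborel_pair.Fubini'[symmetric]) measurable
  also have "\<dots> = (\<integral>\<^sup>+h. ennreal (norm h powr (- ?p)) * ?I h \<partial>lborel)"
  proof (rule nn_integral_cong)
    fix h :: pt
    have "(\<integral>\<^sup>+x. indicator \<Omega> x * indicator \<Omega> (x + h) * ennreal ((u x - u (x + h))\<^sup>2 / (norm (x - (x + h)) powr ?p)) \<partial>lborel)
       = (\<integral>\<^sup>+x. ennreal (norm h powr (- ?p)) * (indicator \<Omega> x * indicator \<Omega> (x + h) * ennreal ((u (x + h) - u x)\<^sup>2)) \<partial>lborel)"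
    proof (rule nn_integral_cong)
      fix x
      have "(u x - u (x + h))\<^sup>2 / (norm (x - (x + h)) powr ?p) = norm h powr (- ?p) * (u (x + h) - u x)\<^sup>2"
        unfolding powr_minus divide_inverse by (simp add: power2_commute mult.commute)
      then show "indicator \<Omega> x * indicator \<Omega> (x + h) * ennreal ((u x - u (x + h))\<^sup>2 / (norm (x - (x + h)) powr ?p))
        = ennreal (norm h powr (- ?p)) * (indicator \<Omega> x * indicator \<Omega> (x + h) * ennreal ((u (x + h) - u x)\<^sup>2))"
        by (simp add: ennreal_mult indicator_def)
    qed
    then show "(\<integral>\<^sup>+x. indicator \<Omega> x * indicator \<Omega> (x + h) * ennreal ((u x - u (x + h))\<^sup>2 / (norm (x - (x + h)) powr ?p)) \<partial>lborel)
       = ennreal (norm h powr (- ?p)) * ?I h" by (simp add: nn_integral_cmult)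
  qed
  also have "\<dots> \<le> (\<integral>\<^sup>+(h::pt). ennreal C * (indicator (ball 0 \<delta>) h * ennreal (norm h powr (- (1 + 2 * \<eta>))))
      + ennreal (\<delta> powr (- ?p) * (4 * N)) * indicator (cball 0 (2 * R)) h \<partial>lborel)"
  proof (rule nn_integral_mono)
    fix h :: pt
    show "ennreal (norm h powr (- ?p)) * ?I h \<le> ennreal C * (indicator (ball 0 \<delta>) h * ennreal (norm h powr (- (1 + 2 * \<eta>))))
      + ennreal (\<delta> powr (- ?p) * (4 * N)) * indicator (cball 0 (2 * R)) h"
    proof (cases "norm h < \<delta>")
      case True
      have "ennreal (norm h powr (- ?p)) * ?I h \<le> ennreal (norm h powr (- ?p)) * ennreal (C * (norm h)\<^sup>2)"
        by (intro mult_left_mono est True) simp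
      also have "\<dots> = ennreal (norm h powr (- ?p) * (C * (norm h)\<^sup>2))" using C by (simp add: ennreal_mult)
      also have "norm h powr (- ?p) * (C * (norm h)\<^sup>2) = C * norm h powr (- (1 + 2 * \<eta>))"
      proof (cases "h = 0")
        case False
        have "norm h powr (- ?p) * (norm h)\<^sup>2 = norm h powr (- ?p) * norm h powr 2"
          using False by (simp add: powr_numeral)
        also have "\<dots> = norm h powr (- ?p + 2)" by (simp only: powr_add)
        also have "- ?p + 2 = - (1 + 2 * \<eta>)" by simp
        finally show ?thesis by simp
      qed simp
      finally show ?thesis using True C by (simp add: ennreal_mult add_increasing2)
    next
      case False
      show ?thesis
      proof (cases "norm h \<le> 2 * R")
        case True
        have "norm h powr (- ?p) \<le> \<delta> powr (- ?p)" using False C eta by (intro powr_mono2') auto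
        then have "ennreal (norm h powr (- ?p)) * ?I h \<le> ennreal (\<delta> powr (- ?p)) * ennreal (4 * N)"
          by (intro mult_mono I2 ennreal_leI) auto
        then show ?thesis using True False N0 by (simp add: ennreal_mult)
      next
        case F: False
        have "x \<notin> \<Omega> \<or> x + h \<notin> \<Omega>" for x
        proof (rule ccontr)
          assume "\<not> (x \<notin> \<Omega> \<or> x + h \<notin> \<Omega>)"
          then have "norm x \<le> R" "norm (x + h) \<le> R" using R by auto
          moreover have "norm h \<le> norm (x + h) + norm x" by norm
          ultimately show False using F by linarith
        qed
        then have "?I h = (\<integral>\<^sup>+(x::pt). 0 \<partial>lborel)" by (intro nn_integral_cong) (auto simp: indicator_def)
        then show ?thesis by simp
      qed
    qed
  qed
  also have "\<dots> = ennreal C * (\<integral>\<^sup>+(h::pt). indicator (ball 0 \<delta>) h * ennreal (norm h powr (- (1 + 2 * \<eta>))) \<partial>lborel)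
     + ennreal (\<delta> powr (- ?p) * (4 * N)) * emeasure lborel (cball (0::pt) (2 * R))"
  proof (subst nn_integral_add)
    have bm[measurable]: "(\<lambda>h::pt. indicator (ball 0 \<delta>) h * ennreal (norm h powr (- (1 + 2 * \<eta>)))) \<in> borel_measurable lborel"
      by (intro borel_measurable_times_ennreal borel_measurable_indicator measurable_compose[OF _ measurable_ennreal] powr_real_measurable) auto
    show m: "(\<lambda>h::pt. ennreal C * (indicator (ball 0 \<delta>) h * ennreal (norm h powr (- (1 + 2 * \<eta>))))) \<in> borel_measurable lborel"
      by (intro borel_measurable_times_ennreal[OF borel_measurable_const bm])
    show "(\<lambda>h::pt. ennreal (\<delta> powr (- ?p) * (4 * N)) * indicator (cball 0 (2 * R)) h) \<in> borel_measurable lborel"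
      by (intro borel_measurable_times_ennreal borel_measurable_const borel_measurable_indicator) simp
    show "(\<integral>\<^sup>+(h::pt). ennreal C * (indicator (ball 0 \<delta>) h * ennreal (norm h powr (- (1 + 2 * \<eta>)))) \<partial>lborel)
      + (\<integral>\<^sup>+(h::pt). ennreal (\<delta> powr (- ?p) * (4 * N)) * indicator (cball 0 (2 * R)) h \<partial>lborel)
      = ennreal C * (\<integral>\<^sup>+(h::pt). indicator (ball 0 \<delta>) h * ennreal (norm h powr (- (1 + 2 * \<eta>))) \<partial>lborel)
      + ennreal (\<delta> powr (- ?p) * (4 * N)) * emeasure lborel (cball (0::pt) (2 * R))"
      by (subst nn_integral_cmult[OF bm], subst nn_integral_cmult_indicator) auto
  qed
  also have "\<dots> < \<infinity>"
    using radial_integrable[of "1 + 2 * \<eta>" \<delta>] eta C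
    by (simp add: ennreal_mult_less_top emeasure_cball[OF mult_nonneg_nonneg[OF _ less_imp_le[OF R(1)]], of 2 "0::pt"])
  finally show ?thesis .
qed

section \<open>A uniform boundedness principle for quadratic functionals\<close>

text \<open>Homogeneity of degree two, a quasi-triangle inequality with factor 2 and lower
  semicontinuity along L^2 limits. These survive suprema and the value infinity, so they hold both
  for graph norms and for suprema of kernel seminorms.\<close>

definition lscq :: "'a measure \<Rightarrow> (('a \<Rightarrow> real) \<Rightarrow> ennreal) \<Rightarrow> bool" where
  "lscq M N \<longleftrightarrow> (\<forall>c u. l2 M u \<longrightarrow> N (\<lambda>x. c * u x) = ennreal (c\<^sup>2) * N u) \<and>
     (\<forall>u v. l2 M u \<and> l2 M v \<longrightarrow> N (\<lambda>x. u x + v x) \<le> 2 * N u + 2 * N v) \<and>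
     (\<forall>U u C. l2conv M U u \<and> (\<forall>n. N (U n) \<le> C) \<longrightarrow> N u \<le> C)"

lemma lscq_scale: "lscq M N \<Longrightarrow> l2 M u \<Longrightarrow> N (\<lambda>x. c * u x) = ennreal (c\<^sup>2) * N u"
  by (simp add: lscq_def)

lemma lscq_add: "lscq M N \<Longrightarrow> l2 M u \<Longrightarrow> l2 M v \<Longrightarrow> N (\<lambda>x. u x + v x) \<le> 2 * N u + 2 * N v"
  by (simp add: lscq_def)

lemma lscq_lsc: "lscq M N \<Longrightarrow> l2conv M U u \<Longrightarrow> (\<And>n. N (U n) \<le> C) \<Longrightarrow> N u \<le> C"
  unfolding lscq_def by blast

text \<open>The Baire category argument behind the closed graph theorem, for the complete space
  \<open>{N < \<infinity>}\<close>: if no constant exists, \<open>{P > n}\<close> is open and dense for every \<open>n\<close>.\<close>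

lemma quadratic_ubp:
  assumes N: "lscq M N" and P: "lscq M P"
    and dom: "\<And>u. l2 M u \<Longrightarrow> ennreal (sqnorm M u) \<le> N u"
    and fin: "\<And>u. l2 M u \<Longrightarrow> N u < \<infinity> \<Longrightarrow> P u < \<infinity>"
  shows "\<exists>C\<ge>0. \<forall>u. l2 M u \<and> N u < \<infinity> \<longrightarrow> P u \<le> ennreal C * N u"
proof (rule ccontr)
  assume "\<not> ?thesis"
  then have neg: "\<exists>u. l2 M u \<and> N u < \<infinity> \<and> ennreal C * N u < P u" if "0 \<le> C" for C
    using that by (meson not_le)
  have big: "\<exists>w. l2 M w \<and> N w \<le> ennreal \<rho> \<and> ennreal (real n) < P w" if rho: "\<rho> > 0" for \<rho> n
  proof -
    obtain v where v: "l2 M v" "N v < \<infinity>" "ennreal (real (Suc n) / \<rho>) * N v < P v"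
      using neg[of "real (Suc n) / \<rho>"] rho by auto
    have Pv: "P v < \<infinity>" by (rule fin[OF v(1,2)])
    define a where "a = enn2real (N v)"
    define b where "b = enn2real (P v)"
    have a: "N v = ennreal a" "a \<ge> 0" and b: "P v = ennreal b" "b \<ge> 0"
      using v(2) Pv by (auto simp: a_def b_def)
    have ab: "real (Suc n) / \<rho> * a < b"
    proof -
      have "ennreal (real (Suc n) / \<rho> * a) < ennreal b"
      proof -
        have "ennreal (real (Suc n) / \<rho> * a) = ennreal (real (Suc n) / \<rho>) * ennreal a"
          using a(2) rho by (intro ennreal_mult) auto
        then show ?thesis using v(3) unfolding a(1) b(1) by simp
      qed
      moreover have "0 \<le> real (Suc n) / \<rho> * a" using a(2) rho by simp
      ultimately show ?thesis by (simp only: ennreal_less_iff)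
    qed
    have "0 \<le> real (Suc n) / \<rho> * a" using a(2) rho by simp
    then have b0: "b > 0" using ab by linarith
    \<comment> \<open>Scales \<open>P\<close> to the value n + 1 exactly; the failure of the bound
      with constant (n + 1)/\<rho> then leaves \<open>N\<close> at most \<rho>.\<close>
    define c where "c = sqrt (real (Suc n) / b)"
    have c2: "c\<^sup>2 = real (Suc n) / b" using b0 by (simp add: c_def)
    have Pc: "P (\<lambda>x. c * v x) = ennreal (real (Suc n))"
      using lscq_scale[OF P v(1), of c] b b0 by (simp add: c2 flip: ennreal_mult)
    have "N (\<lambda>x. c * v x) = ennreal (real (Suc n) / b * a)"
    proof -
      have "ennreal (real (Suc n) / b * a) = ennreal (real (Suc n) / b) * ennreal a"
        using a(2) b0 by (intro ennreal_mult) auto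
      then show ?thesis using lscq_scale[OF N v(1), of c] unfolding c2 a(1) by simp
    qed
    moreover have "real (Suc n) / b * a \<le> \<rho>" using ab rho b0 by (simp add: field_simps)
    ultimately have "N (\<lambda>x. c * v x) \<le> ennreal \<rho>" by (simp add: ennreal_leI)
    then show ?thesis using Pc l2_scale[OF v(1), of c]
      by (intro exI[of _ "\<lambda>x. c * v x"]) (auto simp: ennreal_less_iff)
  qed
  \<comment> \<open>Since w is half of (x + w) minus half of (x - w), a large \<open>P w\<close>
    forces \<open>P\<close> to be large at x + w or at x - w. Both are as close to x as w is to 0,
    so no lower bound for \<open>P\<close> at x itself is used.\<close>
  have dense: "\<exists>y. l2 M y \<and> N (\<lambda>z. y z - x z) \<le> ennreal \<rho> \<and> ennreal (real n) < P y"
    if x: "l2 M x" and rho: "\<rho> > 0" for x \<rho> n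
  proof -
    obtain w where w: "l2 M w" "N w \<le> ennreal \<rho>" "ennreal (real n) < P w" using big[OF rho] by blast
    let ?p = "\<lambda>z. x z + w z" let ?m = "\<lambda>z. x z - w z"
    have l: "l2 M ?p" "l2 M ?m" using x w(1) by (auto intro: l2_add l2_diff)
    have "P (\<lambda>z. (1/2) * ?p z + (-1/2) * ?m z) \<le> 2 * P (\<lambda>z. (1/2) * ?p z) + 2 * P (\<lambda>z. (-1/2) * ?m z)"
      by (rule lscq_add[OF P l2_scale[OF l(1)] l2_scale[OF l(2)]])
    also have "(\<lambda>z. (1/2) * ?p z + (-1/2) * ?m z) = w" by (auto simp: fun_eq_iff field_simps)
    also have "2 * P (\<lambda>z. (1/2) * ?p z) + 2 * P (\<lambda>z. (-1/2) * ?m z) = (ennreal (1/2)) * P ?p + ennreal (1/2) * P ?m"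
    proof -
      have "(2::ennreal) * ennreal ((1/2)\<^sup>2) = ennreal (1/2)"
        by (subst ennreal_numeral[symmetric], subst ennreal_mult[symmetric]) (auto simp: power2_eq_square)
      then show ?thesis
        using lscq_scale[OF P l(1), of "1/2"] lscq_scale[OF P l(2), of "-1/2"]
        by (simp add: mult.assoc[symmetric] power2_eq_square)
    qed
    finally have h: "P w \<le> ennreal (1/2) * P ?p + ennreal (1/2) * P ?m" .
    have "ennreal (real n) < P ?p \<or> ennreal (real n) < P ?m"
    proof (rule ccontr)
      assume "\<not> ?thesis"
      then have "P ?p \<le> ennreal (real n)" "P ?m \<le> ennreal (real n)" by auto
      then have "ennreal (1/2) * P ?p + ennreal (1/2) * P ?m \<le> ennreal (1/2) * ennreal (real n) + ennreal (1/2) * ennreal (real n)"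
        by (intro add_mono mult_left_mono) auto
      also have "\<dots> = ennreal (real n)"
        by (subst (1 2) ennreal_mult[symmetric]) (auto simp flip: ennreal_plus)
      finally show False using h w(3) by simp
    qed
    moreover have "N (\<lambda>z. ?m z - x z) = N w"
      using lscq_scale[OF N w(1), of "-1"] by simp
    ultimately show ?thesis
    proof (elim disjE)
      assume "ennreal (real n) < P ?p" then show ?thesis using l w(2) by (intro exI[of _ ?p]) auto
    next
      assume "ennreal (real n) < P ?m" "N (\<lambda>z. ?m z - x z) = N w"
      then show ?thesis using l w(2) by (intro exI[of _ ?m]) auto
    qed
  qed
  \<comment> \<open>If this failed there would be points with \<open>P\<close> at most n tending to
    y in \<open>N\<close>, hence in L^2; lower semicontinuity then contradicts \<open>P y\<close>
    being above n.\<close>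
  have stable: "\<exists>\<rho>>0. \<forall>z. l2 M z \<and> N (\<lambda>t. z t - y t) \<le> ennreal \<rho> \<longrightarrow> ennreal (real n) < P z"
    if y: "l2 M y" "ennreal (real n) < P y" for y n
  proof (rule ccontr)
    assume "\<not> ?thesis"
    then have "\<forall>k. \<exists>z. l2 M z \<and> N (\<lambda>t. z t - y t) \<le> ennreal (inverse (real (Suc k))) \<and> P z \<le> ennreal (real n)"
      by (metis not_le inverse_positive_iff_positive of_nat_0_less_iff zero_less_Suc)
    then obtain Z where Z: "\<And>k. l2 M (Z k)" "\<And>k. N (\<lambda>t. Z k t - y t) \<le> ennreal (inverse (real (Suc k)))"
      "\<And>k. P (Z k) \<le> ennreal (real n)" by metis
    have le: "sqnorm M (\<lambda>t. Z k t - y t) \<le> inverse (real (Suc k))" for k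
      using order_trans[OF dom[OF l2_diff[OF Z(1) y(1)]] Z(2), of k]
      by (simp del: of_nat_Suc)
    have "(\<lambda>k. sqnorm M (\<lambda>t. Z k t - y t)) \<longlonglongrightarrow> 0"
    proof (rule tendsto_sandwich[OF _ _ tendsto_const LIMSEQ_inverse_real_of_nat])
      show "\<forall>\<^sub>F k in sequentially. sqnorm M (\<lambda>t. Z k t - y t) \<le> inverse (real (Suc k))"
        by (intro always_eventually allI le)
    qed (simp add: inn_nonneg)
    then have "l2conv M Z y" using Z(1) y(1) by (simp add: l2conv_def)
    from lscq_lsc[OF P this Z(3)] show False using y(2) by simp
  qed
  \<comment> \<open>Radii shrink by the factor 4 to absorb the factor 2 of the quasi-triangle
    inequality: 2(R/4) + 2(R/4) = R keeps all later points within R of the current one.\<close>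
  have step: "\<exists>y \<rho>'. l2 M y \<and> N (\<lambda>z. y z - x z) \<le> ennreal (\<rho> / 4) \<and> 0 < \<rho>' \<and> \<rho>' \<le> \<rho> / 4 \<and>
      (\<forall>z. l2 M z \<and> N (\<lambda>t. z t - y t) \<le> ennreal \<rho>' \<longrightarrow> ennreal (real n) < P z)"
    if x: "l2 M x" "0 < \<rho>" for x \<rho> n
  proof -
    obtain y where y: "l2 M y" "N (\<lambda>z. y z - x z) \<le> ennreal (\<rho> / 4)" "ennreal (real n) < P y"
      using dense[OF x(1), of "\<rho>/4" n] x(2) by auto
    obtain \<rho>' where r: "\<rho>' > 0" "\<And>z. l2 M z \<Longrightarrow> N (\<lambda>t. z t - y t) \<le> ennreal \<rho>' \<Longrightarrow> ennreal (real n) < P z"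
      using stable[OF y(1,3)] by blast
    have "N (\<lambda>t. z t - y t) \<le> ennreal \<rho>'" if "N (\<lambda>t. z t - y t) \<le> ennreal (min \<rho>' (\<rho>/4))" for z
      using that by (rule order_trans) (simp add: ennreal_leI)
    then show ?thesis using y r x(2) by (intro exI[of _ y] exI[of _ "min \<rho>' (\<rho>/4)"]) auto
  qed
  define Pr where "Pr z \<longleftrightarrow> l2 M (fst z) \<and> 0 < snd z" for z :: "('a \<Rightarrow> real) \<times> real"
  define Q where "Q n z z' \<longleftrightarrow> N (\<lambda>t. fst z' t - fst z t) \<le> ennreal (snd z / 4) \<and> snd z' \<le> snd z / 4 \<and>
      (\<forall>v. l2 M v \<and> N (\<lambda>t. v t - fst z' t) \<le> ennreal (snd z') \<longrightarrow> ennreal (real n) < P v)"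
    for n :: nat and z z' :: "('a \<Rightarrow> real) \<times> real"
  have "\<exists>f. \<forall>n. (Pr (f n) \<and> (n = 0 \<longrightarrow> f n = (\<lambda>x. 0, 1))) \<and> Q n (f n) (f (Suc n))"
  proof (rule dependent_nat_choice)
    show "\<exists>x. Pr x \<and> ((0::nat) = 0 \<longrightarrow> x = (\<lambda>x. 0, 1))" by (auto simp: Pr_def l2_zero)
    fix z and n :: nat assume "Pr z \<and> (n = 0 \<longrightarrow> z = (\<lambda>x. 0, 1))"
    then have "l2 M (fst z)" "0 < snd z" by (auto simp: Pr_def)
    from step[OF this, of n] obtain y \<rho>' where "l2 M y \<and> N (\<lambda>t. y t - fst z t) \<le> ennreal (snd z / 4) \<and> 0 < \<rho>' \<and> \<rho>' \<le> snd z / 4 \<and>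
      (\<forall>v. l2 M v \<and> N (\<lambda>t. v t - y t) \<le> ennreal \<rho>' \<longrightarrow> ennreal (real n) < P v)" by blast
    then show "\<exists>y. (Pr y \<and> (Suc n = 0 \<longrightarrow> y = (\<lambda>x. 0, 1))) \<and> Q n z y"
      by (intro exI[of _ "(y, \<rho>')"]) (auto simp: Pr_def Q_def)
  qed
  then obtain F where F: "\<And>n. Pr (F n)" "F 0 = (\<lambda>x. 0, 1)" "\<And>n. Q n (F n) (F (Suc n))" by metis
  define X where "X n = fst (F n)" for n
  define R where "R n = snd (F n)" for n
  have X: "l2 M (X n)" "0 < R n" for n using F(1)[of n] by (auto simp: Pr_def X_def R_def)
  have s: "N (\<lambda>t. X (Suc n) t - X n t) \<le> ennreal (R n / 4)" "R (Suc n) \<le> R n / 4"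
    "\<And>v. l2 M v \<Longrightarrow> N (\<lambda>t. v t - X (Suc n) t) \<le> ennreal (R (Suc n)) \<Longrightarrow> ennreal (real n) < P v" for n
    using F(3)[of n] by (auto simp: Q_def X_def R_def)
  have N0: "N (\<lambda>x. 0) = 0"
    using lscq_scale[OF N l2_zero, of 0] by simp
  have near: "N (\<lambda>t. X (n + k) t - X n t) \<le> ennreal (R n)" for n k
  proof (induction k arbitrary: n)
    case 0 show ?case by (simp add: N0)
  next
    case (Suc k)
    have "N (\<lambda>t. (X (Suc n + k) t - X (Suc n) t) + (X (Suc n) t - X n t))
      \<le> 2 * N (\<lambda>t. X (Suc n + k) t - X (Suc n) t) + 2 * N (\<lambda>t. X (Suc n) t - X n t)"
      by (intro lscq_add[OF N] l2_diff X)
    also have "\<dots> \<le> 2 * ennreal (R n / 4) + 2 * ennreal (R n / 4)"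
      using order_trans[OF Suc.IH[of "Suc n"] ennreal_leI[OF s(2)[of n]]] s(1)[of n]
      by (intro add_mono mult_left_mono) auto
    also have "\<dots> = ennreal (2 * (R n / 4) + 2 * (R n / 4))"
    proof -
      have "2 * ennreal (R n / 4) = ennreal (2 * (R n / 4))" using X(2)[of n] by (subst ennreal_mult) auto
      then show ?thesis using X(2)[of n] by (subst ennreal_plus) auto
    qed
    finally show ?case by simp
  qed
  have Rle: "R n \<le> (1/4) ^ n" for n
  proof (induction n)
    case 0 then show ?case using F(2) by (simp add: R_def)
  next
    case (Suc n) then show ?case using s(2)[of n] by simp
  qed
  have "\<exists>x. l2conv M X x"
  proof (rule Riesz_Fischer[OF X(1)])
    fix \<epsilon> :: real assume e: "\<epsilon> > 0"
    have "(\<lambda>n. 4 * (1/4::real) ^ n) \<longlonglongrightarrow> 4 * 0" by (intro tendsto_mult tendsto_const LIMSEQ_power_zero) simp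
    then have "\<forall>\<^sub>F n in sequentially. 4 * (1/4::real) ^ n < \<epsilon>" using e by (intro order_tendstoD(2)) auto
    then obtain K where K: "4 * (1/4::real) ^ K < \<epsilon>" by (auto dest: eventually_happens)
    have c: "sqnorm M (\<lambda>t. X n t - X K t) \<le> (1/4) ^ K" if "n \<ge> K" for n
    proof -
      from that obtain k where k: "n = K + k" by (auto simp: le_iff_add)
      have "ennreal (sqnorm M (\<lambda>t. X n t - X K t)) \<le> ennreal (R K)"
        unfolding k by (rule order_trans[OF dom near]) (intro l2_diff X)
      then have "sqnorm M (\<lambda>t. X n t - X K t) \<le> R K" using X(2)[of K] by simp
      then show ?thesis using Rle[of K] by linarith
    qed
    have "sqnorm M (\<lambda>t. X m t - X n t) < \<epsilon>" if "m \<ge> K" "n \<ge> K" for m n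
      using inn_diff_le[OF l2_diff[OF X(1) X(1)] l2_diff[OF X(1) X(1)], of m K n K]
        c[OF that(1)] c[OF that(2)] K by simp
    then show "\<exists>K. \<forall>m\<ge>K. \<forall>n\<ge>K. sqnorm M (\<lambda>t. X m t - X n t) < \<epsilon>" by blast
  qed
  then obtain x where x: "l2conv M X x" by blast
  then have xl: "l2 M x" by (simp add: l2conv_def)
  have lim: "N (\<lambda>t. x t - X n t) \<le> ennreal (R n)" for n
  proof (rule lscq_lsc[OF N])
    have sm: "strict_mono (\<lambda>k. n + k)" by (simp add: strict_mono_def)
    have "l2conv M (\<lambda>k t. X (n + k) t + (-1) * X n t) (\<lambda>t. x t + (-1) * X n t)"
      by (intro l2conv_add l2conv_subseq[OF x sm] l2conv_const l2_scale X)
    then show "l2conv M (\<lambda>k t. X (n + k) t - X n t) (\<lambda>t. x t - X n t)" by simp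
    show "N (\<lambda>t. X (n + k) t - X n t) \<le> ennreal (R n)" for k by (rule near)
  qed
  have "N x \<le> ennreal (R 0)" using lim[of 0] F(2) by (simp add: X_def)
  then have "P x < \<infinity>" by (intro fin xl) (simp add: le_less_trans)
  \<comment> \<open>The limit lies in all the nested neighbourhoods, so \<open>P\<close> exceeds
    every n there, although \<open>N\<close> and therefore \<open>P\<close> are finite at that
    point.\<close>
  moreover have "ennreal (real n) < P x" for n by (rule s(3)[OF xl lim])
  then have "P x = \<infinity>"
    by (metis ennreal_Ex_less_of_nat ennreal_of_nat_eq_real_of_nat infinity_ennreal_def less_top order.asym)
  ultimately show False by simp
qed

section \<open>Kernel seminorms\<close>

text \<open>The index space is left abstract: with pairs of points and the two projections it is a
  Slobodeckij integral, with single points and a translation it is a squared difference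
  quotient.\<close>

definition pk :: "'b measure \<Rightarrow> ('b \<Rightarrow> pt) \<Rightarrow> ('b \<Rightarrow> pt) \<Rightarrow> ('b \<Rightarrow> ennreal) \<Rightarrow> (pt \<Rightarrow> real) \<Rightarrow> ennreal" where
  "pk N X Y w u = (\<integral>\<^sup>+n. w n * ennreal ((u (X n) - u (Y n))\<^sup>2) \<partial>N)"

text \<open>The condition \<open>ac\<close> says that wherever the weight is nonzero both points lie
  in \<Omega> and avoid any prescribed null set almost surely. This makes the seminorm depend only
  on the almost-everywhere class of a function on \<Omega>, although it evaluates the function along
  maps.\<close>

locale kernel =
  fixes \<Omega> :: "pt set" and N :: "'b measure" and X Y :: "'b \<Rightarrow> pt" and w :: "'b \<Rightarrow> ennreal"
  assumes Om[measurable]: "\<Omega> \<in> sets borel"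
    and X[measurable]: "X \<in> measurable N borel" and Y[measurable]: "Y \<in> measurable N borel"
    and w[measurable]: "w \<in> borel_measurable N"
    and wfin: "w n \<noteq> \<infinity>"
    and ac: "\<And>A. A \<in> null_sets lborel \<Longrightarrow>
      AE n in N. w n \<noteq> 0 \<longrightarrow> X n \<in> \<Omega> \<and> Y n \<in> \<Omega> \<and> X n \<notin> A \<and> Y n \<notin> A"
begin

lemma AE_pull:
  assumes "AE x in lebesgue_on \<Omega>. Q x" shows "AE n in N. w n \<noteq> 0 \<longrightarrow> Q (X n) \<and> Q (Y n)"
proof -
  have "AE x in lborel. x \<in> \<Omega> \<longrightarrow> Q x" using assms AE_lebesgue_on_iff[OF Om] by simp
  then obtain A where A: "A \<in> null_sets lborel" "{x \<in> space lborel. \<not> (x \<in> \<Omega> \<longrightarrow> Q x)} \<subseteq> A"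
    by (auto simp: eventually_ae_filter)
  from ac[OF A(1)] show ?thesis using A(2) by (auto elim!: eventually_mono)
qed

lemma pk_cong: assumes "AE x in lebesgue_on \<Omega>. u x = v x" shows "pk N X Y w u = pk N X Y w v"
  unfolding pk_def
  by (rule nn_integral_cong_AE) (use AE_pull[OF assms] in \<open>auto elim!: eventually_mono\<close>)

lemma pk_scale: assumes [measurable]: "u \<in> borel_measurable borel"
  shows "pk N X Y w (\<lambda>x. c * u x) = ennreal (c\<^sup>2) * pk N X Y w u"
proof -
  have "pk N X Y w (\<lambda>x. c * u x) = (\<integral>\<^sup>+n. ennreal (c\<^sup>2) * (w n * ennreal ((u (X n) - u (Y n))\<^sup>2)) \<partial>N)"
    unfolding pk_def
  proof (rule nn_integral_cong)
    fix n
    have "(c * u (X n) - c * u (Y n))\<^sup>2 = c\<^sup>2 * (u (X n) - u (Y n))\<^sup>2"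
      by (simp add: power_mult_distrib flip: right_diff_distrib)
    then show "w n * ennreal ((c * u (X n) - c * u (Y n))\<^sup>2) = ennreal (c\<^sup>2) * (w n * ennreal ((u (X n) - u (Y n))\<^sup>2))"
      by (simp add: ennreal_mult mult_ac)
  qed
  then show ?thesis unfolding pk_def by (simp add: nn_integral_cmult)
qed

lemma sq_add_le: "((a::real) + b)\<^sup>2 \<le> 2 * a\<^sup>2 + 2 * b\<^sup>2"
  using zero_le_power2[of "a - b"] by (simp add: power2_sum power2_diff)

lemma pk_add: assumes [measurable]: "u \<in> borel_measurable borel" "v \<in> borel_measurable borel"
  shows "pk N X Y w (\<lambda>x. u x + v x) \<le> 2 * pk N X Y w u + 2 * pk N X Y w v"
proof -
  have "pk N X Y w (\<lambda>x. u x + v x) \<le> (\<integral>\<^sup>+n. 2 * (w n * ennreal ((u (X n) - u (Y n))\<^sup>2)) + 2 * (w n * ennreal ((v (X n) - v (Y n))\<^sup>2)) \<partial>N)"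
    unfolding pk_def
  proof (rule nn_integral_mono)
    fix n
    have "(u (X n) + v (X n) - (u (Y n) + v (Y n)))\<^sup>2 \<le> 2 * (u (X n) - u (Y n))\<^sup>2 + 2 * (v (X n) - v (Y n))\<^sup>2"
      using sq_add_le[of "u (X n) - u (Y n)" "v (X n) - v (Y n)"] by (simp add: algebra_simps)
    then have "ennreal ((u (X n) + v (X n) - (u (Y n) + v (Y n)))\<^sup>2) \<le> ennreal (2 * (u (X n) - u (Y n))\<^sup>2 + 2 * (v (X n) - v (Y n))\<^sup>2)"
      by (rule ennreal_leI)
    also have "\<dots> = 2 * ennreal ((u (X n) - u (Y n))\<^sup>2) + 2 * ennreal ((v (X n) - v (Y n))\<^sup>2)"
      by (simp add: ennreal_mult)
    finally have "w n * ennreal ((u (X n) + v (X n) - (u (Y n) + v (Y n)))\<^sup>2) \<le>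
       w n * (2 * ennreal ((u (X n) - u (Y n))\<^sup>2) + 2 * ennreal ((v (X n) - v (Y n))\<^sup>2))"
      by (rule mult_left_mono) simp
    then show "w n * ennreal ((u (X n) + v (X n) - (u (Y n) + v (Y n)))\<^sup>2) \<le>
       2 * (w n * ennreal ((u (X n) - u (Y n))\<^sup>2)) + 2 * (w n * ennreal ((v (X n) - v (Y n))\<^sup>2))"
      by (simp add: distrib_left mult_ac)
  qed
  also have "\<dots> = 2 * pk N X Y w u + 2 * pk N X Y w v"
    unfolding pk_def by (simp add: nn_integral_add nn_integral_cmult)
  finally show ?thesis .
qed

text \<open>Lower semicontinuity under pointwise convergence almost everywhere on \<Omega>. The
  weight must be finite for the product with the convergent factor to converge.\<close>

lemma pk_Fatou:
  assumes [measurable]: "\<And>n. U n \<in> borel_measurable borel"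
    and c: "AE x in lebesgue_on \<Omega>. (\<lambda>n. U n x) \<longlonglongrightarrow> u x" and C: "\<And>n. pk N X Y w (U n) \<le> C"
  shows "pk N X Y w u \<le> C"
proof -
  have "pk N X Y w u = (\<integral>\<^sup>+n. liminf (\<lambda>k. w n * ennreal ((U k (X n) - U k (Y n))\<^sup>2)) \<partial>N)"
    unfolding pk_def
  proof (rule nn_integral_cong_AE)
    show "AE n in N. w n * ennreal ((u (X n) - u (Y n))\<^sup>2) = liminf (\<lambda>k. w n * ennreal ((U k (X n) - U k (Y n))\<^sup>2))"
      using AE_pull[OF c]
    proof eventually_elim
      case (elim n)
      show ?case
      proof (cases "w n = 0")
        case False
        then have l: "(\<lambda>k. U k (X n)) \<longlonglongrightarrow> u (X n)" "(\<lambda>k. U k (Y n)) \<longlonglongrightarrow> u (Y n)" using elim by auto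
        have e: "(\<lambda>k. ennreal ((U k (X n) - U k (Y n))\<^sup>2)) \<longlonglongrightarrow> ennreal ((u (X n) - u (Y n))\<^sup>2)"
          by (intro tendsto_intros l)
        have "(\<lambda>k. w n * ennreal ((U k (X n) - U k (Y n))\<^sup>2)) \<longlonglongrightarrow> w n * ennreal ((u (X n) - u (Y n))\<^sup>2)"
          by (rule ennreal_tendsto_cmult) (use wfin[of n] e in \<open>auto simp: less_top\<close>)
        from lim_imp_Liminf[OF _ this] show ?thesis by (metis trivial_limit_sequentially)
      qed (simp add: Liminf_const)
    qed
  qed
  also have "\<dots> \<le> liminf (\<lambda>k. pk N X Y w (U k))"
    unfolding pk_def by (intro nn_integral_liminf) auto
  also have "\<dots> \<le> C"
    using Liminf_le[of sequentially "\<lambda>n. pk N X Y w (U n)" C] C by (simp add: Liminf_le)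
  finally show ?thesis .
qed

end

text \<open>A chosen Borel representative, so that kernel seminorms become functionals on all
  square-integrable functions and fit the boundedness principle.\<close>

definition rep :: "pt set \<Rightarrow> (pt \<Rightarrow> real) \<Rightarrow> pt \<Rightarrow> real" where
  "rep \<Omega> u = (SOME v. v \<in> borel_measurable borel \<and> (AE x in lebesgue_on \<Omega>. u x = v x))"

lemma rep: assumes "\<Omega> \<in> sets borel" "u \<in> borel_measurable (lebesgue_on \<Omega>)"
  shows "rep \<Omega> u \<in> borel_measurable borel" "AE x in lebesgue_on \<Omega>. u x = rep \<Omega> u x"
proof -
  have "\<exists>v. v \<in> borel_measurable borel \<and> (AE x in lebesgue_on \<Omega>. u x = v x)"
    using borel_rep[OF assms] by blast
  from someI_ex[OF this] show "rep \<Omega> u \<in> borel_measurable borel" "AE x in lebesgue_on \<Omega>. u x = rep \<Omega> u x"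
    unfolding rep_def by auto
qed

text \<open>The choice of representatives is not linear, but it is linear up to null sets, which
  \<open>pk_cong\<close> ignores. Lower semicontinuity comes from an almost everywhere convergent
  subsequence and Fatou.\<close>

lemma lscq_pk_SUP:
  assumes K: "\<And>k. k \<in> K \<Longrightarrow> kernel \<Omega> N (X k) (Y k) (w k)" and Ob: "\<Omega> \<in> sets borel"
  shows "lscq (lebesgue_on \<Omega>) (\<lambda>u. SUP k\<in>K. pk N (X k) (Y k) (w k) (rep \<Omega> u))"
proof -
  let ?M = "lebesgue_on \<Omega>"
  note r = rep[OF Ob l2_meas]
  have sc: "pk N (X k) (Y k) (w k) (rep \<Omega> (\<lambda>x. c * u x)) = ennreal (c\<^sup>2) * pk N (X k) (Y k) (w k) (rep \<Omega> u)"
    if "k \<in> K" "l2 ?M u" for k c u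
  proof -
    interpret kernel \<Omega> N "X k" "Y k" "w k" by (rule K[OF that(1)])
    have "AE x in ?M. rep \<Omega> (\<lambda>x. c * u x) x = c * rep \<Omega> u x"
      using r(2)[OF that(2)] r(2)[OF l2_scale[OF that(2), of c]] by eventually_elim simp
    from pk_cong[OF this] pk_scale[OF r(1)[OF that(2)]] show ?thesis by simp
  qed
  have ad: "pk N (X k) (Y k) (w k) (rep \<Omega> (\<lambda>x. u x + v x)) \<le> 2 * pk N (X k) (Y k) (w k) (rep \<Omega> u) + 2 * pk N (X k) (Y k) (w k) (rep \<Omega> v)"
    if "k \<in> K" "l2 ?M u" "l2 ?M v" for k u v
  proof -
    interpret kernel \<Omega> N "X k" "Y k" "w k" by (rule K[OF that(1)])
    have "AE x in ?M. rep \<Omega> (\<lambda>x. u x + v x) x = rep \<Omega> u x + rep \<Omega> v x"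
      using r(2)[OF that(2)] r(2)[OF that(3)] r(2)[OF l2_add[OF that(2,3)]] by eventually_elim simp
    from pk_cong[OF this] pk_add[OF r(1)[OF that(2)] r(1)[OF that(3)]] show ?thesis by simp
  qed
  have lsc: "pk N (X k) (Y k) (w k) (rep \<Omega> u) \<le> C"
    if k: "k \<in> K" and c: "l2conv ?M U u" and C: "\<And>n. pk N (X k) (Y k) (w k) (rep \<Omega> (U n)) \<le> C" for k U u C
  proof -
    interpret kernel \<Omega> N "X k" "Y k" "w k" by (rule K[OF k])
    have l: "l2 ?M (U n)" "l2 ?M u" for n using c by (auto simp: l2conv_def)
    obtain s :: "nat \<Rightarrow> nat" where s: "strict_mono s" "AE x in ?M. (\<lambda>n. U (s n) x) \<longlonglongrightarrow> u x"
      using l2conv_AE_subseq[OF c] by blast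
    have "AE x in ?M. \<forall>n. U (s n) x = rep \<Omega> (U (s n)) x" using r(2)[OF l(1)] by (simp add: AE_all_countable)
    then have "AE x in ?M. (\<lambda>n. rep \<Omega> (U (s n)) x) \<longlonglongrightarrow> rep \<Omega> u x" using s(2) r(2)[OF l(2)]
      by eventually_elim simp
    then show ?thesis by (rule pk_Fatou[rotated]) (use r(1)[OF l(1)] C in auto)
  qed
  show ?thesis unfolding lscq_def
  proof (intro conjI allI impI)
    fix c u assume "l2 ?M u"
    then have "(SUP k\<in>K. pk N (X k) (Y k) (w k) (rep \<Omega> (\<lambda>x. c * u x))) = (SUP k\<in>K. ennreal (c\<^sup>2) * pk N (X k) (Y k) (w k) (rep \<Omega> u))"
      by (intro SUP_cong refl sc) auto
    also have "\<dots> = ennreal (c\<^sup>2) * (SUP k\<in>K. pk N (X k) (Y k) (w k) (rep \<Omega> u))"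
      by (rule SUP_mult_left_ennreal[symmetric])
    finally show "(SUP k\<in>K. pk N (X k) (Y k) (w k) (rep \<Omega> (\<lambda>x. c * u x))) = ennreal (c\<^sup>2) * (SUP k\<in>K. pk N (X k) (Y k) (w k) (rep \<Omega> u))" .
  next
    fix u v assume uv: "l2 ?M u \<and> l2 ?M v"
    show "(SUP k\<in>K. pk N (X k) (Y k) (w k) (rep \<Omega> (\<lambda>x. u x + v x))) \<le>
       2 * (SUP k\<in>K. pk N (X k) (Y k) (w k) (rep \<Omega> u)) + 2 * (SUP k\<in>K. pk N (X k) (Y k) (w k) (rep \<Omega> v))"
    proof (rule SUP_least)
      fix k assume k: "k \<in> K"
      show "pk N (X k) (Y k) (w k) (rep \<Omega> (\<lambda>x. u x + v x)) \<le>
         2 * (SUP k\<in>K. pk N (X k) (Y k) (w k) (rep \<Omega> u)) + 2 * (SUP k\<in>K. pk N (X k) (Y k) (w k) (rep \<Omega> v))"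
        using uv k by (intro order_trans[OF ad] add_mono mult_left_mono SUP_upper) auto
    qed
  next
    fix U u C
    assume *: "l2conv ?M U u \<and> (\<forall>n. (SUP k\<in>K. pk N (X k) (Y k) (w k) (rep \<Omega> (U n))) \<le> C)"
    show "(SUP k\<in>K. pk N (X k) (Y k) (w k) (rep \<Omega> u)) \<le> C"
    proof (rule SUP_least)
      fix k assume k: "k \<in> K"
      have "pk N (X k) (Y k) (w k) (rep \<Omega> (U n)) \<le> C" for n
        using * k by (meson SUP_le_iff)
      then show "pk N (X k) (Y k) (w k) (rep \<Omega> u) \<le> C" using lsc[OF k] * by blast
    qed
  qed
qed

section \<open>Spectral data\<close>

lemma spectral_onb: "spectral \<Omega> lam e \<Longrightarrow> onb (lebesgue_on \<Omega>) e"
  unfolding spectral_def orthonormal_complete_def onb_def L2_eq ip_eq by blast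

text \<open>The power is defined by choosing an L^2 limit of partial sums; the limit exists by
  square summability of the coefficients, and its own coefficients are then forced.\<close>

lemma Apow_coef:
  assumes sp: "spectral \<Omega> lam e" and v: "v \<in> Vsp \<Omega> lam e s"
  shows "L2 \<Omega> (Apow \<Omega> lam e s v)" "ip \<Omega> (Apow \<Omega> lam e s v) (e j) = lam j powr s * ip \<Omega> v (e j)"
proof -
  interpret onb "lebesgue_on \<Omega>" e by (rule spectral_onb[OF sp])
  let ?c = "\<lambda>j. lam j powr s * ip \<Omega> v (e j)"
  have "summable (\<lambda>j. (?c j)\<^sup>2)" using v by (simp add: Vsp_def)
  from series_conv[OF this] obtain w0 where w0: "l2conv (lebesgue_on \<Omega>) (\<lambda>N x. \<Sum>j<N. ?c j * e j x) w0" by blast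
  have *: "l2conv (lebesgue_on \<Omega>) (\<lambda>N x. \<Sum>j<N. ?c j * e j x) w \<longleftrightarrow> L2 \<Omega> w \<and>
      (\<lambda>N. nsq \<Omega> (\<lambda>x. w x - (\<Sum>j<N. ?c j * e j x))) \<longlonglongrightarrow> 0" for w
    unfolding l2conv_def L2_eq nsq_eq by (subst inn_swap_sign) (auto simp: lincomb_l2)
  have "l2conv (lebesgue_on \<Omega>) (\<lambda>N x. \<Sum>j<N. ?c j * e j x) (Apow \<Omega> lam e s v)"
    using someI[of "\<lambda>w. L2 \<Omega> w \<and> (\<lambda>N. nsq \<Omega> (\<lambda>x. w x - (\<Sum>j<N. ?c j * e j x))) \<longlonglongrightarrow> 0", OF w0[unfolded *]]
    unfolding * Apow_def[symmetric] .
  then show "L2 \<Omega> (Apow \<Omega> lam e s v)" "ip \<Omega> (Apow \<Omega> lam e s v) (e j) = ?c j"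
    using series_coef by (auto simp: l2conv_def L2_eq ip_eq)
qed

text \<open>The kernel consists of the functions that have no component on a nonzero eigenvalue.
  Conversely such a function lies in the domain because all the weighted coefficients
  vanish.\<close>

lemma kerOp_iff:
  assumes sp: "spectral \<Omega> lam e"
  shows "v \<in> kerOp \<Omega> lam e \<longleftrightarrow> L2 \<Omega> v \<and> (\<forall>j. lam j \<noteq> 0 \<longrightarrow> ip \<Omega> v (e j) = 0)"
proof -
  interpret onb "lebesgue_on \<Omega>" e by (rule spectral_onb[OF sp])
  have l0: "lam j \<ge> 0" for j using sp by (simp add: spectral_def)
  show ?thesis
  proof
    assume k: "v \<in> kerOp \<Omega> lam e"
    then have v: "v \<in> Vsp \<Omega> lam e 1" and z: "AE x in lebesgue_on \<Omega>. Apow \<Omega> lam e 1 v x = 0" by (auto simp: kerOp_def)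
    have "lam j powr 1 * ip \<Omega> v (e j) = 0" for j
      using Apow_coef(2)[OF sp v, of j] inn_AE_zero[OF z] by (simp add: ip_eq)
    then show "L2 \<Omega> v \<and> (\<forall>j. lam j \<noteq> 0 \<longrightarrow> ip \<Omega> v (e j) = 0)" using v l0 by (auto simp: Vsp_def)
  next
    assume a: "L2 \<Omega> v \<and> (\<forall>j. lam j \<noteq> 0 \<longrightarrow> ip \<Omega> v (e j) = 0)"
    then have z: "lam j powr 1 * ip \<Omega> v (e j) = 0" for j by (cases "lam j = 0") auto
    have "summable (\<lambda>j. (lam j powr 1 * ip \<Omega> v (e j))\<^sup>2)" by (simp only: z) simp
    then have v: "v \<in> Vsp \<Omega> lam e 1" using a unfolding Vsp_def by blast
    have "AE x in lebesgue_on \<Omega>. Apow \<Omega> lam e 1 v x = 0"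
      using Apow_coef[OF sp v] z by (intro e_compl) (auto simp: L2_eq ip_eq)
    then show "v \<in> kerOp \<Omega> lam e" using v by (simp add: kerOp_def)
  qed
qed

lemma spectral_kernel_finite: assumes "spectral \<Omega> lam e" shows "finite {j. lam j = 0}"
proof -
  have "filterlim lam at_top sequentially" using assms by (simp add: spectral_def)
  then have "\<forall>\<^sub>F j in sequentially. lam j > 0" by (simp add: filterlim_at_top_dense)
  then obtain N where "\<And>j. j \<ge> N \<Longrightarrow> lam j > 0" by (auto simp: eventually_sequentially)
  then have "{j. lam j = 0} \<subseteq> {..<N}" by (metis (mono_tags, lifting) lessThan_iff less_irrefl mem_Collect_eq not_le subsetI)
  then show ?thesis by (rule finite_subset) simp
qed

text \<open>The finite Fourier sum over the zero eigenvalues has the defining property of the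
  projection, so the choice is not vacuous. Any other solution differs from it by an element of the
  kernel that is orthogonal to the kernel, hence to itself.\<close>

lemma orth_proj_eq:
  assumes sp: "spectral \<Omega> lam e" and v: "L2 \<Omega> v"
  shows "L2 \<Omega> (orth_proj \<Omega> (kerOp \<Omega> lam e) v)"
    and "AE x in lebesgue_on \<Omega>. orth_proj \<Omega> (kerOp \<Omega> lam e) v x = (\<Sum>j\<in>{j. lam j = 0}. ip \<Omega> v (e j) * e j x)"
proof -
  interpret onb "lebesgue_on \<Omega>" e by (rule spectral_onb[OF sp])
  let ?M = "lebesgue_on \<Omega>" let ?J = "{j. lam j = 0}" let ?K = "kerOp \<Omega> lam e"
  let ?q = "\<lambda>x. \<Sum>j\<in>?J. ip \<Omega> v (e j) * e j x"
  have J: "finite ?J" by (rule spectral_kernel_finite[OF sp])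
  have vl: "l2 ?M v" using v by (simp add: L2_eq)
  have ql: "l2 ?M ?q" by (rule lincomb_l2[OF J])
  have qc: "ip \<Omega> ?q (e k) = (if k \<in> ?J then ip \<Omega> v (e k) else 0)" for k
    using lincomb_coef[OF J, of "\<lambda>j. ip \<Omega> v (e j)" k] by (simp add: ip_eq)
  have qK: "?q \<in> ?K" using ql qc by (auto simp: kerOp_iff[OF sp] L2_eq)
  have orth: "ip \<Omega> (\<lambda>x. v x - ?q x) u = 0" if "u \<in> ?K" for u
  proof -
    have u: "l2 ?M u" "\<And>j. lam j \<noteq> 0 \<Longrightarrow> ip \<Omega> u (e j) = 0" using that by (auto simp: kerOp_iff[OF sp] L2_eq)
    have "(\<lambda>j. inn ?M (\<lambda>x. v x - ?q x) (e j) * inn ?M u (e j)) sums inn ?M (\<lambda>x. v x - ?q x) u"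
      by (rule parseval[OF l2_diff[OF vl ql] u(1)])
    moreover have "inn ?M (\<lambda>x. v x - ?q x) (e j) * inn ?M u (e j) = 0" for j
      using u(2)[of j] qc[of j] inn_diff_left[OF vl ql e_l2, of j]
      by (cases "lam j = 0") (simp_all add: ip_eq)
    ultimately have "(\<lambda>j. 0) sums inn ?M (\<lambda>x. v x - ?q x) u" by (simp only:)
    from sums_unique2[OF this sums_zero] show ?thesis unfolding ip_eq .
  qed
  have "\<exists>w. w \<in> ?K \<and> (\<forall>u\<in>?K. ip \<Omega> (\<lambda>x. v x - w x) u = 0)" using qK orth by blast
  from someI_ex[OF this] have w: "orth_proj \<Omega> ?K v \<in> ?K" "\<And>u. u \<in> ?K \<Longrightarrow> ip \<Omega> (\<lambda>x. v x - orth_proj \<Omega> ?K v x) u = 0"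
    unfolding orth_proj_def by auto
  let ?w = "orth_proj \<Omega> ?K v"
  show wL: "L2 \<Omega> ?w" using w(1) by (simp add: kerOp_iff[OF sp])
  then have wl: "l2 ?M ?w" by (simp add: L2_eq)
  have dK: "(\<lambda>x. ?w x - ?q x) \<in> ?K"
    using w(1) qK by (auto simp: kerOp_iff[OF sp] L2_eq ip_eq l2_diff inn_diff_left e_l2)
  have dl: "l2 ?M (\<lambda>x. ?w x - ?q x)" by (rule l2_diff[OF wl ql])
  have "inn ?M (\<lambda>x. v x - ?q x) (\<lambda>x. ?w x - ?q x) - inn ?M (\<lambda>x. v x - ?w x) (\<lambda>x. ?w x - ?q x) = 0"
    using orth[OF dK] w(2)[OF dK] by (simp add: ip_eq)
  moreover have "inn ?M (\<lambda>x. (v x - ?q x) - (v x - ?w x)) (\<lambda>x. ?w x - ?q x)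
      = inn ?M (\<lambda>x. v x - ?q x) (\<lambda>x. ?w x - ?q x) - inn ?M (\<lambda>x. v x - ?w x) (\<lambda>x. ?w x - ?q x)"
    by (rule inn_diff_left[OF l2_diff[OF vl ql] l2_diff[OF vl wl] dl])
  ultimately have "sqnorm ?M (\<lambda>x. ?w x - ?q x) = 0" by simp
  from inn_zero_AE[OF dl this] show "AE x in ?M. ?w x = ?q x" by auto
qed

text \<open>Lower semicontinuity holds because each finite partial sum is continuous along L^2
  limits and the norm is the limit of the partial sums.\<close>

lemma lscq_Vnsq:
  assumes sp: "spectral \<Omega> lam e"
  shows "lscq (lebesgue_on \<Omega>) (Vnsq \<Omega> lam e s)"
proof -
  interpret onb "lebesgue_on \<Omega>" e by (rule spectral_onb[OF sp])
  let ?M = "lebesgue_on \<Omega>"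
  have V: "Vnsq \<Omega> lam e s u = ennreal (sqnorm ?M u) + (\<Sum>j. ennreal ((lam j powr s * inn ?M u (e j))\<^sup>2))" if "l2 ?M u" for u
    using that by (simp add: Vnsq_def L2_eq nsq_eq ip_eq)
  show ?thesis unfolding lscq_def
  proof (intro conjI allI impI)
    fix c u assume u: "l2 ?M u"
    have i: "sqnorm ?M (\<lambda>x. c * u x) = c\<^sup>2 * sqnorm ?M u"
      by (simp add: inn_scale_left inn_scale_right power2_eq_square)
    have j: "(lam j powr s * inn ?M (\<lambda>x. c * u x) (e j))\<^sup>2 = c\<^sup>2 * (lam j powr s * inn ?M u (e j))\<^sup>2" for j
      by (simp add: inn_scale_left power_mult_distrib)
    show "Vnsq \<Omega> lam e s (\<lambda>x. c * u x) = ennreal (c\<^sup>2) * Vnsq \<Omega> lam e s u"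
      unfolding V[OF u] V[OF l2_scale[OF u]] i j
      by (simp add: ennreal_mult inn_nonneg distrib_left ennreal_suminf_cmult)
  next
    fix u v assume uv: "l2 ?M u \<and> l2 ?M v"
    then have l: "l2 ?M u" "l2 ?M v" by auto
    have a: "ennreal (sqnorm ?M (\<lambda>x. u x + v x)) \<le> 2 * ennreal (sqnorm ?M u) + 2 * ennreal (sqnorm ?M v)"
      using ennreal_leI[OF inn_add_le[OF l]] by (simp add: inn_nonneg ennreal_mult)
    have "(\<Sum>j. ennreal ((lam j powr s * inn ?M (\<lambda>x. u x + v x) (e j))\<^sup>2))
       \<le> (\<Sum>j. 2 * ennreal ((lam j powr s * inn ?M u (e j))\<^sup>2) + 2 * ennreal ((lam j powr s * inn ?M v (e j))\<^sup>2))"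
    proof (rule suminf_le)
      fix j
      have "(lam j powr s * inn ?M (\<lambda>x. u x + v x) (e j))\<^sup>2 \<le> 2 * (lam j powr s * inn ?M u (e j))\<^sup>2 + 2 * (lam j powr s * inn ?M v (e j))\<^sup>2"
        using kernel.sq_add_le inn_add_left[OF l e_l2, of j]
          zero_le_power2[of "lam j powr s * inn ?M u (e j) - lam j powr s * inn ?M v (e j)"]
        by (simp add: distrib_left power2_sum power2_diff)
      from ennreal_leI[OF this] show "ennreal ((lam j powr s * inn ?M (\<lambda>x. u x + v x) (e j))\<^sup>2) \<le>
         2 * ennreal ((lam j powr s * inn ?M u (e j))\<^sup>2) + 2 * ennreal ((lam j powr s * inn ?M v (e j))\<^sup>2)"
        by (simp add: ennreal_mult)
    qed auto
    also have "\<dots> = 2 * (\<Sum>j. ennreal ((lam j powr s * inn ?M u (e j))\<^sup>2)) + 2 * (\<Sum>j. ennreal ((lam j powr s * inn ?M v (e j))\<^sup>2))"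
      by (subst suminf_add[symmetric]) (auto simp: ennreal_suminf_cmult)
    finally have sm: "(\<Sum>j. ennreal ((lam j powr s * inn ?M (\<lambda>x. u x + v x) (e j))\<^sup>2))
       \<le> 2 * (\<Sum>j. ennreal ((lam j powr s * inn ?M u (e j))\<^sup>2)) + 2 * (\<Sum>j. ennreal ((lam j powr s * inn ?M v (e j))\<^sup>2))" .
    from add_mono[OF a sm]
    show "Vnsq \<Omega> lam e s (\<lambda>x. u x + v x) \<le> 2 * Vnsq \<Omega> lam e s u + 2 * Vnsq \<Omega> lam e s v"
      unfolding V[OF l(1)] V[OF l(2)] V[OF l2_add[OF l]] by (simp only: distrib_left add_ac)
  next
    fix U u C assume *: "l2conv ?M U u \<and> (\<forall>n. Vnsq \<Omega> lam e s (U n) \<le> C)"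
    then have c: "l2conv ?M U u" and l: "\<And>n. l2 ?M (U n)" "l2 ?M u" by (auto simp: l2conv_def)
    have fin: "ennreal (sqnorm ?M u) + (\<Sum>j<J. ennreal ((lam j powr s * inn ?M u (e j))\<^sup>2)) \<le> C" for J
    proof (rule LIMSEQ_le_const2)
      show "(\<lambda>n. ennreal (sqnorm ?M (U n)) + (\<Sum>j<J. ennreal ((lam j powr s * inn ?M (U n) (e j))\<^sup>2)))
         \<longlonglongrightarrow> ennreal (sqnorm ?M u) + (\<Sum>j<J. ennreal ((lam j powr s * inn ?M u (e j))\<^sup>2))"
        by (intro tendsto_add tendsto_sum tendsto_ennrealI tendsto_power tendsto_mult tendsto_const
            inn_self_tendsto[OF c] inn_tendsto[OF c] e_l2)
      show "\<exists>N. \<forall>n\<ge>N. ennreal (sqnorm ?M (U n)) + (\<Sum>j<J. ennreal ((lam j powr s * inn ?M (U n) (e j))\<^sup>2)) \<le> C"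
      proof (intro exI allI impI)
        fix n
        have "(\<Sum>j<J. ennreal ((lam j powr s * inn ?M (U n) (e j))\<^sup>2)) \<le> (\<Sum>j. ennreal ((lam j powr s * inn ?M (U n) (e j))\<^sup>2))"
          by (rule sum_le_suminf) auto
        then have "ennreal (sqnorm ?M (U n)) + (\<Sum>j<J. ennreal ((lam j powr s * inn ?M (U n) (e j))\<^sup>2)) \<le> Vnsq \<Omega> lam e s (U n)"
          unfolding V[OF l(1)] by (rule add_left_mono)
        also have "\<dots> \<le> C" using * by blast
        finally show "ennreal (sqnorm ?M (U n)) + (\<Sum>j<J. ennreal ((lam j powr s * inn ?M (U n) (e j))\<^sup>2)) \<le> C" .
      qed
    qed
    have "(\<lambda>J. ennreal (sqnorm ?M u) + (\<Sum>j<J. ennreal ((lam j powr s * inn ?M u (e j))\<^sup>2)))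
       \<longlonglongrightarrow> ennreal (sqnorm ?M u) + (\<Sum>j. ennreal ((lam j powr s * inn ?M u (e j))\<^sup>2))"
      by (intro tendsto_add tendsto_const summable_LIMSEQ) simp
    then show "Vnsq \<Omega> lam e s u \<le> C" unfolding V[OF l(2)]
      by (rule LIMSEQ_le_const2) (use fin in auto)
  qed
qed

lemma Vnsq_finite_iff:
  "Vnsq \<Omega> lam e s v < \<infinity> \<Longrightarrow> v \<in> Vsp \<Omega> lam e s"
  unfolding Vnsq_def Vsp_def
  by (auto split: if_splits intro!: summable_suminf_not_top)

text \<open>Turns finiteness of a family of seminorms on the whole space into one bound by the graph
  norm. The boundedness principle is applied to the supremum of the family, which makes the constant
  independent of the index.\<close>

lemma V_embedding:
  assumes sp: "spectral \<Omega> lam e" and Ob: "\<Omega> \<in> sets borel"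
    and K: "\<And>k. k \<in> K \<Longrightarrow> kernel \<Omega> N (X k) (Y k) (w k)"
    and fin: "\<And>v. v \<in> Vsp \<Omega> lam e s \<Longrightarrow> (SUP k\<in>K. pk N (X k) (Y k) (w k) (rep \<Omega> v)) < \<infinity>"
  shows "\<exists>C\<ge>0. \<forall>v k. k \<in> K \<and> Vnsq \<Omega> lam e s v < \<infinity> \<longrightarrow> pk N (X k) (Y k) (w k) (rep \<Omega> v) \<le> ennreal C * Vnsq \<Omega> lam e s v"
proof -
  have L: "l2 (lebesgue_on \<Omega>) v" if "Vnsq \<Omega> lam e s v < \<infinity>" for v
    using that by (auto simp: Vnsq_def L2_eq split: if_splits)
  obtain C where C: "C \<ge> 0" "\<And>v. l2 (lebesgue_on \<Omega>) v \<Longrightarrow> Vnsq \<Omega> lam e s v < \<infinity> \<Longrightarrow>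
      (SUP k\<in>K. pk N (X k) (Y k) (w k) (rep \<Omega> v)) \<le> ennreal C * Vnsq \<Omega> lam e s v"
  proof -
    have "ennreal (sqnorm (lebesgue_on \<Omega>) u) \<le> Vnsq \<Omega> lam e s u" if "l2 (lebesgue_on \<Omega>) u" for u
      using that by (simp add: Vnsq_def L2_eq nsq_eq)
    from quadratic_ubp[OF lscq_Vnsq[OF sp] lscq_pk_SUP[OF K Ob] this fin[OF Vnsq_finite_iff]]
    show ?thesis using that by blast
  qed
  have "pk N (X k) (Y k) (w k) (rep \<Omega> v) \<le> ennreal C * Vnsq \<Omega> lam e s v" if "k \<in> K" "Vnsq \<Omega> lam e s v < \<infinity>" for v k
    using C(2)[OF L[OF that(2)] that(2)] SUP_upper[OF that(1), of "\<lambda>k. pk N (X k) (Y k) (w k) (rep \<Omega> v)"] by (rule order_trans[rotated])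
  then show ?thesis using C(1) by blast
qed

section \<open>Sobolev norms as kernel seminorms\<close>

text \<open>Completeness of Lebesgue measure: a change on a null set preserves measurability. It is
  used for maps such as t -> \<open>sob_nsq\<close> of a section, whose measurability is visible
  only for a different expression that agrees almost everywhere.\<close>

lemma lebesgue_on_AE_measurable:
  assumes W: "W \<in> sets lebesgue" and f: "f \<in> measurable (lebesgue_on W) L"
    and ae: "AE x in lebesgue_on W. f x = g x" and g: "\<And>x. x \<in> W \<Longrightarrow> g x \<in> space L"
  shows "g \<in> measurable (lebesgue_on W) L"
proof (rule measurableI)
  show "g x \<in> space L" if "x \<in> space (lebesgue_on W)" for x using that g by simp
  fix A assume A: "A \<in> sets L"
  have "AE x in lebesgue. x \<in> W \<longrightarrow> f x = g x" using ae W by (subst (asm) AE_restrict_space_iff) auto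
  then have n: "{x. \<not> (x \<in> W \<longrightarrow> f x = g x)} \<in> null_sets lebesgue"
    unfolding completion.AE_iff_null_sets by simp
  let ?N = "{x. \<not> (x \<in> W \<longrightarrow> f x = g x)}"
  have s: "f -` A \<inter> W \<in> sets lebesgue"
    using measurable_sets[OF f A] W by (simp add: sets_restrict_space_iff)
  have gn: "g -` A \<inter> ?N \<in> null_sets lebesgue"
    by (rule completion.complete2[OF _ n]) auto
  have "g -` A \<inter> W = ((f -` A \<inter> W) - ?N) \<union> (g -` A \<inter> ?N)" by auto
  also have "\<dots> \<in> sets lebesgue" by (intro sets.Un sets.Diff s null_setsD2[OF n] null_setsD2[OF gn])
  finally have "g -` A \<inter> W \<in> sets lebesgue" .
  then show "g -` A \<inter> space (lebesgue_on W) \<in> sets (lebesgue_on W)"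
    using W by (simp add: sets_restrict_space_iff)
qed

lemma weak_partial_cong:
  assumes "open \<Omega>" "L2 \<Omega> u" "L2 \<Omega> v" "AE x in lebesgue_on \<Omega>. u x = v x" "i \<in> Basis"
  shows "weak_partial \<Omega> u i g \<longleftrightarrow> weak_partial \<Omega> v i g"
proof -
  have "(LINT x|lebesgue_on \<Omega>. u x * pd i \<psi> x) = (LINT x|lebesgue_on \<Omega>. v x * pd i \<psi> x)" if "test_fun \<Omega> \<psi>" for \<psi>
    using inn_cong_AE[of u "lebesgue_on \<Omega>" v "pd i \<psi>" "pd i \<psi>"] assms l2_meas[OF test_fun_pd_l2[OF that assms(5), of \<Omega>]]
    by (auto simp: inn_def L2_eq dest: l2_meas)
  then show ?thesis unfolding weak_partial_def by (simp cong: imp_cong)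
qed

lemma nsq_cong: assumes "L2 \<Omega> u" "L2 \<Omega> v" "AE x in lebesgue_on \<Omega>. u x = v x" shows "nsq \<Omega> u = nsq \<Omega> v"
  unfolding nsq_eq using assms by (intro inn_cong_AE) (auto simp: L2_eq dest: l2_meas)

text \<open>For \<eta> = 1 the two functions have literally the same weak derivatives, so even the
  chosen ones coincide.\<close>

lemma sob_nsq_cong:
  assumes Om: "open \<Omega>" and u: "L2 \<Omega> u" "L2 \<Omega> v" and ae: "AE x in lebesgue_on \<Omega>. u x = v x"
  shows "sob_nsq \<Omega> \<eta> u = sob_nsq \<Omega> \<eta> v"
proof (cases "\<eta> = 1")
  case True
  have w: "weak_partial \<Omega> u i = weak_partial \<Omega> v i" if "i \<in> Basis" for i
    using weak_partial_cong[OF Om u ae that] by (simp add: fun_eq_iff)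
  then show ?thesis using True u nsq_cong[OF u ae] unfolding sob_nsq_def by (simp cong: sum.cong ball_cong)
next
  case False
  have "(\<integral>\<^sup>+x. (\<integral>\<^sup>+y. ennreal ((u x - u y)\<^sup>2 / (norm (x - y) powr (3 + 2 * \<eta>))) \<partial>lebesgue_on \<Omega>) \<partial>lebesgue_on \<Omega>)
     = (\<integral>\<^sup>+x. (\<integral>\<^sup>+y. ennreal ((v x - v y)\<^sup>2 / (norm (x - y) powr (3 + 2 * \<eta>))) \<partial>lebesgue_on \<Omega>) \<partial>lebesgue_on \<Omega>)"
  proof (rule nn_integral_cong_AE)
    show "AE x in lebesgue_on \<Omega>. (\<integral>\<^sup>+y. ennreal ((u x - u y)\<^sup>2 / (norm (x - y) powr (3 + 2 * \<eta>))) \<partial>lebesgue_on \<Omega>)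
       = (\<integral>\<^sup>+y. ennreal ((v x - v y)\<^sup>2 / (norm (x - y) powr (3 + 2 * \<eta>))) \<partial>lebesgue_on \<Omega>)"
      using ae
    proof eventually_elim
      case (elim x)
      show ?case by (rule nn_integral_cong_AE) (use ae elim in \<open>auto elim!: eventually_mono\<close>)
    qed
  qed
  then show ?thesis using False u nsq_cong[OF u ae] unfolding sob_nsq_def by simp
qed

text \<open>On the diagonal the norm is 0, its power is 0 and the inverse is 0 by convention, so the
  weight is finite everywhere.\<close>

definition slob_w :: "pt set \<Rightarrow> real \<Rightarrow> pt \<times> pt \<Rightarrow> ennreal" where
  "slob_w \<Omega> \<eta> z = indicator \<Omega> (fst z) * indicator \<Omega> (snd z) * ennreal (inverse (norm (fst z - snd z) powr (3 + 2 * \<eta>)))"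

lemma AE_lborel_fst_snd:
  fixes A :: "pt set"
  assumes A: "A \<in> null_sets lborel"
  shows "AE z in (lborel :: (pt \<times> pt) measure). fst z \<notin> A \<and> snd z \<notin> A"
proof -
  have As[measurable]: "A \<in> sets borel" using A by (auto simp: null_sets_def)
  have e: "emeasure lborel A = 0" using A by auto
  have "emeasure (lborel \<Otimes>\<^sub>M lborel) (A \<times> (UNIV :: pt set)) = 0"
    using e by (subst lborel.emeasure_pair_measure_Times) auto
  then have n1: "A \<times> UNIV \<in> null_sets (lborel :: (pt \<times> pt) measure)"
    unfolding lborel_prod by (auto simp: null_sets_def intro!: borel_Times)
  have "emeasure (lborel \<Otimes>\<^sub>M lborel) ((UNIV :: pt set) \<times> A) = 0"
    using e by (subst lborel.emeasure_pair_measure_Times) auto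
  then have n2: "UNIV \<times> A \<in> null_sets (lborel :: (pt \<times> pt) measure)"
    unfolding lborel_prod by (auto simp: null_sets_def intro!: borel_Times)
  show ?thesis using AE_not_in[OF n1] AE_not_in[OF n2] by eventually_elim auto
qed

lemma slob_kernel: assumes "\<Omega> \<in> sets borel" shows "kernel \<Omega> lborel fst snd (slob_w \<Omega> \<eta>)"
proof
  note [measurable] = assms
  show "\<Omega> \<in> sets borel" by fact
  show "fst \<in> measurable lborel borel" "snd \<in> measurable lborel borel"
    by (auto intro!: borel_measurable_continuous_onI continuous_intros)
  then have [measurable]: "fst \<in> borel_measurable (borel :: (pt \<times> pt) measure)" "snd \<in> borel_measurable (borel :: (pt \<times> pt) measure)" by auto
  show "slob_w \<Omega> \<eta> \<in> borel_measurable lborel" unfolding slob_w_def by measurable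
  show "slob_w \<Omega> \<eta> n \<noteq> \<infinity>" for n unfolding slob_w_def by (auto simp: indicator_def)
  show "AE n in lborel. slob_w \<Omega> \<eta> n \<noteq> 0 \<longrightarrow> fst n \<in> \<Omega> \<and> snd n \<in> \<Omega> \<and> fst n \<notin> A \<and> snd n \<notin> A"
    if "A \<in> null_sets lborel" for A
    using AE_lborel_fst_snd[OF that] by eventually_elim (auto simp: slob_w_def indicator_def split: if_splits)
qed

lemma slob_pk:
  assumes [measurable]: "\<Omega> \<in> sets borel" "u \<in> borel_measurable borel"
  shows "pk lborel fst snd (slob_w \<Omega> \<eta>) u
    = (\<integral>\<^sup>+x. (\<integral>\<^sup>+y. indicator \<Omega> x * indicator \<Omega> y * ennreal ((u x - u y)\<^sup>2 / (norm (x - y) powr (3 + 2 * \<eta>))) \<partial>lborel) \<partial>lborel)"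
proof -
  have m: "(\<lambda>z::pt\<times>pt. indicator \<Omega> (fst z) * indicator \<Omega> (snd z) * ennreal ((u (fst z) - u (snd z))\<^sup>2 / (norm (fst z - snd z) powr (3 + 2 * \<eta>))))
     \<in> borel_measurable (lborel \<Otimes>\<^sub>M lborel)" by measurable
  have "pk lborel fst snd (slob_w \<Omega> \<eta>) u
    = (\<integral>\<^sup>+z. indicator \<Omega> (fst z) * indicator \<Omega> (snd z) * ennreal ((u (fst z) - u (snd z))\<^sup>2 / (norm (fst z - snd z) powr (3 + 2 * \<eta>))) \<partial>(lborel \<Otimes>\<^sub>M lborel))"
    unfolding pk_def lborel_prod slob_w_def
    by (intro nn_integral_cong) (auto simp: indicator_def divide_inverse ennreal_mult mult.commute)
  also have "\<dots> = (\<integral>\<^sup>+x. (\<integral>\<^sup>+y. indicator \<Omega> x * indicator \<Omega> y * ennreal ((u x - u y)\<^sup>2 / (norm (x - y) powr (3 + 2 * \<eta>))) \<partial>lborel) \<partial>lborel)"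
    using lborel.nn_integral_fst[OF m] by simp
  finally show ?thesis .
qed

lemma slob_sob:
  assumes Ob[measurable]: "\<Omega> \<in> sets borel" and um[measurable]: "u \<in> borel_measurable borel" and "\<eta> \<noteq> 1" and "L2 \<Omega> u"
  shows "sob_nsq \<Omega> \<eta> u = ennreal (nsq \<Omega> u) + pk lborel fst snd (slob_w \<Omega> \<eta>) u"
proof -
  have "(\<integral>\<^sup>+x. (\<integral>\<^sup>+y. ennreal ((u x - u y)\<^sup>2 / (norm (x - y) powr (3 + 2 * \<eta>))) \<partial>lebesgue_on \<Omega>) \<partial>lebesgue_on \<Omega>)
    = (\<integral>\<^sup>+x. (\<integral>\<^sup>+y. indicator \<Omega> x * indicator \<Omega> y * ennreal ((u x - u y)\<^sup>2 / (norm (x - y) powr (3 + 2 * \<eta>))) \<partial>lborel) \<partial>lborel)"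
    unfolding nn_integral_lebesgue_on[OF Ob]
    by (intro nn_integral_cong) (simp add: nn_integral_cmult[symmetric] mult.assoc)
  then show ?thesis using assms unfolding slob_pk[OF Ob um] sob_nsq_def by simp
qed

text \<open>The index \<open>k\<close> is a pair of direction and step length; the weight makes the
  kernel seminorm a squared difference quotient restricted to segments inside \<Omega>.\<close>

definition h1_w :: "pt set \<Rightarrow> pt \<times> real \<Rightarrow> pt \<Rightarrow> ennreal" where
  "h1_w \<Omega> k x = indicator (segset \<Omega> (snd k *\<^sub>R fst k)) x * ennreal (inverse ((snd k)\<^sup>2))"

lemma h1_kernel: assumes Om: "open \<Omega>"
  shows "kernel \<Omega> lborel (\<lambda>x. x + snd k *\<^sub>R fst k) (\<lambda>x. x) (h1_w \<Omega> k)"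
proof
  have [measurable]: "segset \<Omega> (snd k *\<^sub>R fst k) \<in> sets borel" using open_segset[OF Om] by auto
  show "\<Omega> \<in> sets borel" using Om by auto
  show "(\<lambda>x. x + snd k *\<^sub>R fst k) \<in> measurable lborel borel" "(\<lambda>x. x) \<in> measurable lborel borel" by auto
  show "h1_w \<Omega> k \<in> borel_measurable lborel" unfolding h1_w_def by measurable
  show "h1_w \<Omega> k n \<noteq> \<infinity>" for n unfolding h1_w_def by (auto simp: indicator_def)
  fix A :: "pt set" assume A: "A \<in> null_sets lborel"
  have As[measurable]: "A \<in> sets borel" using A by (auto simp: null_sets_def)
  have "(\<integral>\<^sup>+x. indicator A (x + snd k *\<^sub>R fst k) \<partial>lborel) = (\<integral>\<^sup>+x. indicator A x \<partial>lborel)"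
    by (rule nn_integral_shift[OF borel_measurable_indicator[OF As]])
  also have "\<dots> = 0" using A by (auto simp: null_sets_def)
  finally have "AE x in lborel. indicator A (x + snd k *\<^sub>R fst k) = (0::ennreal)"
    by (subst (asm) nn_integral_0_iff_AE) auto
  then show "AE n in lborel. h1_w \<Omega> k n \<noteq> 0 \<longrightarrow> n + snd k *\<^sub>R fst k \<in> \<Omega> \<and> n \<in> \<Omega> \<and> n + snd k *\<^sub>R fst k \<notin> A \<and> n \<notin> A"
    using AE_not_in[OF A]
  proof eventually_elim
    case (elim n)
    show ?case
    proof
      assume "h1_w \<Omega> k n \<noteq> 0"
      then have n: "n \<in> segset \<Omega> (snd k *\<^sub>R fst k)" unfolding h1_w_def
        by (cases "n \<in> segset \<Omega> (snd k *\<^sub>R fst k)") auto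
      have "n + snd k *\<^sub>R fst k \<notin> A" using elim(1) by (simp add: indicator_eq_0_iff)
      then show "n + snd k *\<^sub>R fst k \<in> \<Omega> \<and> n \<in> \<Omega> \<and> n + snd k *\<^sub>R fst k \<notin> A \<and> n \<notin> A"
        using segset_start[OF n] segset_end[OF n] elim(2) by blast
    qed
  qed
qed

lemma h1_pk:
  assumes Om: "open \<Omega>" and [measurable]: "u \<in> borel_measurable borel"
  shows "pk lborel (\<lambda>x. x + s *\<^sub>R i) (\<lambda>x. x) (h1_w \<Omega> (i, s)) u
    = ennreal (inverse (s\<^sup>2)) * (\<integral>\<^sup>+x. indicator (segset \<Omega> (s *\<^sub>R i)) x * ennreal ((u (x + s *\<^sub>R i) - u x)\<^sup>2) \<partial>lborel)"
proof -
  have [measurable]: "segset \<Omega> (s *\<^sub>R i) \<in> sets borel" using open_segset[OF Om] by auto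
  show ?thesis unfolding pk_def h1_w_def
    by (subst nn_integral_cmult[symmetric]) (auto intro!: nn_integral_cong simp: mult_ac)
qed

lemma sob1_weak:
  assumes "inH \<Omega> 1 u" "i \<in> Basis"
  shows "L2 \<Omega> u" "L2 \<Omega> (SOME g. L2 \<Omega> g \<and> weak_partial \<Omega> u i g)"
    "weak_partial \<Omega> u i (SOME g. L2 \<Omega> g \<and> weak_partial \<Omega> u i g)"
proof -
  have *: "L2 \<Omega> u \<and> (\<forall>i\<in>Basis. \<exists>g. L2 \<Omega> g \<and> weak_partial \<Omega> u i g)"
    using assms(1) unfolding inH_def sob_nsq_def by (auto split: if_splits)
  then have "\<exists>g. L2 \<Omega> g \<and> weak_partial \<Omega> u i g" using assms(2) by blast
  from someI_ex[OF this] show "L2 \<Omega> (SOME g. L2 \<Omega> g \<and> weak_partial \<Omega> u i g)"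
    "weak_partial \<Omega> u i (SOME g. L2 \<Omega> g \<and> weak_partial \<Omega> u i g)" by auto
  show "L2 \<Omega> u" using * by blast
qed

lemma sob1_eq: "inH \<Omega> 1 u \<Longrightarrow>
  sob_nsq \<Omega> 1 u = ennreal (nsq \<Omega> u + (\<Sum>i\<in>Basis. nsq \<Omega> (SOME g. L2 \<Omega> g \<and> weak_partial \<Omega> u i g)))"
  unfolding inH_def sob_nsq_def by (auto split: if_splits)

lemma h1_upper:
  assumes Om: "open \<Omega>" "bounded \<Omega>" and um: "u \<in> borel_measurable borel" and i: "i \<in> Basis" and s: "s \<noteq> 0"
  shows "pk lborel (\<lambda>x. x + s *\<^sub>R i) (\<lambda>x. x) (h1_w \<Omega> (i, s)) u \<le> sob_nsq \<Omega> 1 u"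
proof (cases "inH \<Omega> 1 u")
  case True
  let ?g = "\<lambda>i. SOME g. L2 \<Omega> g \<and> weak_partial \<Omega> u i g"
  note w = sob1_weak[OF True i]
  have nn: "nsq \<Omega> v \<ge> 0" for v by (simp add: nsq_eq inn_nonneg)
  have "pk lborel (\<lambda>x. x + s *\<^sub>R i) (\<lambda>x. x) (h1_w \<Omega> (i, s)) u \<le> ennreal (inverse (s\<^sup>2)) * ennreal (s\<^sup>2 * nsq \<Omega> (?g i))"
    unfolding h1_pk[OF Om(1) um] by (intro mult_left_mono difference_quotient_le Om um w i) simp
  also have "\<dots> = ennreal (nsq \<Omega> (?g i))" using s nn by (subst ennreal_mult[symmetric]) auto
  also have "\<dots> \<le> ennreal (nsq \<Omega> u + (\<Sum>i\<in>Basis. nsq \<Omega> (?g i)))"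
    using member_le_sum[of i Basis "\<lambda>i. nsq \<Omega> (?g i)"] i nn by (intro ennreal_leI add_increasing) auto
  finally show ?thesis using sob1_eq[OF True] by simp
next
  case False
  then have "sob_nsq \<Omega> 1 u = \<infinity>" by (simp add: inH_def less_top[symmetric])
  then show ?thesis by simp
qed

text \<open>Each of the three coordinate derivatives exists with squared norm at most C, which
  explains the 3 C.\<close>

lemma h1_lower:
  assumes Om: "open \<Omega>" "bounded \<Omega>" and um: "u \<in> borel_measurable borel" and u: "L2 \<Omega> u"
    and onb: "onb (lebesgue_on \<Omega>) e" and C: "0 \<le> C"
    and b: "\<And>i s. i \<in> Basis \<Longrightarrow> 0 < s \<Longrightarrow> s < 1 \<Longrightarrow> pk lborel (\<lambda>x. x + s *\<^sub>R i) (\<lambda>x. x) (h1_w \<Omega> (i, s)) u \<le> ennreal C"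
  shows "sob_nsq \<Omega> 1 u \<le> ennreal (nsq \<Omega> u + 3 * C)"
proof -
  have ex: "\<exists>g. L2 \<Omega> g \<and> weak_partial \<Omega> u i g \<and> nsq \<Omega> g \<le> C" if i: "i \<in> Basis" for i
  proof (rule difference_quotient_converse[OF Om um u i onb C])
    fix s :: real assume s: "0 < s" "s < 1"
    let ?I = "\<integral>\<^sup>+x. indicator (segset \<Omega> (s *\<^sub>R i)) x * ennreal ((u (x + s *\<^sub>R i) - u x)\<^sup>2) \<partial>lborel"
    have "?I = ennreal (s\<^sup>2) * (ennreal (inverse (s\<^sup>2)) * ?I)"
      using s by (simp add: mult.assoc[symmetric] ennreal_mult[symmetric])
    also have "\<dots> \<le> ennreal (s\<^sup>2) * ennreal C"
      using b[OF i s] unfolding h1_pk[OF Om(1) um] by (rule mult_left_mono) simp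
    also have "\<dots> = ennreal (s\<^sup>2 * C)" using C by (simp add: ennreal_mult)
    finally show "?I \<le> ennreal (s\<^sup>2 * C)" .
  qed
  then have "inH \<Omega> 1 u" using u unfolding inH_def sob_nsq_def by auto
  note w = sob1_weak[OF this]
  let ?g = "\<lambda>i. SOME g. L2 \<Omega> g \<and> weak_partial \<Omega> u i g"
  have "nsq \<Omega> (?g i) \<le> C" if i: "i \<in> Basis" for i
  proof -
    obtain g where g: "L2 \<Omega> g" "weak_partial \<Omega> u i g" "nsq \<Omega> g \<le> C" using ex[OF i] by blast
    have "AE x in lebesgue_on \<Omega>. ?g i x = g x"
      by (rule weak_partial_unique[OF Om(1) w(2)[OF i] g(1) w(3)[OF i] g(2)])
    from nsq_cong[OF w(2)[OF i] g(1) this] show ?thesis using g(3) by simp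
  qed
  then have "(\<Sum>i\<in>Basis. nsq \<Omega> (?g i)) \<le> of_nat (card (Basis :: pt set)) * C"
    by (rule sum_bounded_above)
  then have "(\<Sum>i\<in>Basis. nsq \<Omega> (?g i)) \<le> 3 * C" by simp
  then show ?thesis unfolding sob1_eq[OF \<open>inH \<Omega> 1 u\<close>] by (intro ennreal_leI add_left_mono)
qed

section \<open>Measurability in time of the Sobolev norms\<close>

lemma L2_section_meas:
  fixes U :: "real \<times> pt \<Rightarrow> real"
  assumes U: "U \<in> borel_measurable borel" shows "(\<lambda>x. U (t, x)) \<in> borel_measurable borel"
proof -
  have "U \<in> borel_measurable (borel \<Otimes>\<^sub>M borel)" using U by (simp add: borel_prod)
  then show ?thesis by measurable
qed

lemma nsq_section_meas:
  fixes U :: "real \<times> pt \<Rightarrow> real"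
  assumes U: "U \<in> borel_measurable borel" and [measurable]: "\<Omega> \<in> sets borel"
  shows "(\<lambda>t. nsq \<Omega> (\<lambda>x. U (t, x))) \<in> borel_measurable borel"
proof -
  have [measurable]: "U \<in> borel_measurable (borel \<Otimes>\<^sub>M borel)" using U by (simp add: borel_prod)
  have e: "nsq \<Omega> (\<lambda>x. U (t, x)) = (LINT x|lborel. indicator \<Omega> x * (U (t, x) * U (t, x)))" for t
    unfolding nsq_eq inn_def by (rule integral_lebesgue_on) measurable
  show ?thesis unfolding e by measurable
qed

lemma inn_section_meas:
  fixes U :: "real \<times> pt \<Rightarrow> real"
  assumes U: "U \<in> borel_measurable borel" and [measurable]: "\<Omega> \<in> sets borel" "v \<in> borel_measurable borel"
  shows "(\<lambda>t. inn (lebesgue_on \<Omega>) (\<lambda>x. U (t, x)) v) \<in> borel_measurable borel"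
proof -
  have [measurable]: "U \<in> borel_measurable (borel \<Otimes>\<^sub>M borel)" using U by (simp add: borel_prod)
  have e: "inn (lebesgue_on \<Omega>) (\<lambda>x. U (t, x)) v = (LINT x|lborel. indicator \<Omega> x * (U (t, x) * v x))" for t
    unfolding inn_def by (rule integral_lebesgue_on) measurable
  show ?thesis unfolding e by measurable
qed

lemma slob_meas:
  fixes U :: "real \<times> pt \<Rightarrow> real"
  assumes Ob[measurable]: "\<Omega> \<in> sets borel" and I: "I \<in> sets borel" and U: "U \<in> borel_measurable borel" and eta: "\<eta> \<noteq> 1"
    and L: "AE t in lebesgue_on I. L2 \<Omega> (\<lambda>x. U (t, x))"
  shows "(\<lambda>t. sob_nsq \<Omega> \<eta> (\<lambda>x. U (t, x))) \<in> borel_measurable (lebesgue_on I)"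
proof (rule lebesgue_on_AE_measurable)
  have Up[measurable]: "U \<in> borel_measurable (borel \<Otimes>\<^sub>M borel)" using U by (simp add: borel_prod)
  let ?f = "\<lambda>t. ennreal (nsq \<Omega> (\<lambda>x. U (t, x))) + pk lborel fst snd (slob_w \<Omega> \<eta>) (\<lambda>x. U (t, x))"
  have [measurable]: "(\<lambda>t. nsq \<Omega> (\<lambda>x. U (t, x))) \<in> borel_measurable borel" by (rule nsq_section_meas[OF U Ob])
  have "(\<lambda>t. pk lborel fst snd (slob_w \<Omega> \<eta>) (\<lambda>x. U (t, x))) \<in> borel_measurable borel"
    unfolding slob_pk[OF Ob L2_section_meas[OF U]] by measurable
  then have "?f \<in> borel_measurable borel" by measurable
  then show "?f \<in> borel_measurable (lebesgue_on I)"
    by (intro measurable_restrict_space1) (simp add: measurable_completion)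
  show "AE t in lebesgue_on I. ?f t = sob_nsq \<Omega> \<eta> (\<lambda>x. U (t, x))"
    using L by eventually_elim (simp add: slob_sob[OF Ob L2_section_meas[OF U] eta])
qed (use I in auto)

text \<open>The weak derivative of each section is picked by choice, with no evident dependence on
  t. By Parseval its squared norm is a countable sum of squared coefficients, and every coefficient
  is a limit of pairings of the section itself with derivatives of fixed test functions, which are
  measurable in t.\<close>

lemma h1_meas:
  fixes U :: "real \<times> pt \<Rightarrow> real"
  assumes Om: "open \<Omega>" and I: "I \<in> sets borel" and U: "U \<in> borel_measurable borel"
    and onb: "onb (lebesgue_on \<Omega>) e"
    and L: "AE t in lebesgue_on I. inH \<Omega> 1 (\<lambda>x. U (t, x))"
  shows "(\<lambda>t. sob_nsq \<Omega> 1 (\<lambda>x. U (t, x))) \<in> borel_measurable (lebesgue_on I)"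
proof -
  interpret onb "lebesgue_on \<Omega>" e by (rule onb)
  let ?M = "lebesgue_on \<Omega>"
  have Ob[measurable]: "\<Omega> \<in> sets borel" and Ol: "\<Omega> \<in> sets lebesgue" using Om by auto
  have "\<forall>j. \<exists>\<psi>. (\<forall>n. test_fun \<Omega> (\<psi> n)) \<and> l2conv ?M \<psi> (e j)"
    using test_dense[OF Om e_l2] by blast
  then obtain \<psi> where t: "\<And>j n. test_fun \<Omega> (\<psi> j n)" and cv: "\<And>j. l2conv ?M (\<psi> j) (e j)" by metis
  \<comment> \<open>The choice-free expression for the squared norm of the i-th weak derivative;
    \<open>\<psi> j n\<close> are test functions tending to \<open>e j\<close>.\<close>
  let ?D = "\<lambda>i u. \<Sum>j. ennreal ((lim (\<lambda>n. - inn ?M u (pd i (\<psi> j n))))\<^sup>2)"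
  have D: "ennreal (nsq \<Omega> g) = ?D i u" if w: "L2 \<Omega> g" "weak_partial \<Omega> u i g" for g i u
  proof -
    have gl: "l2 ?M g" using w(1) by (simp add: L2_eq)
    have "lim (\<lambda>n. - inn ?M u (pd i (\<psi> j n))) = inn ?M g (e j)" for j
    proof (rule limI)
      have "- inn ?M u (pd i (\<psi> j n)) = inn ?M (\<psi> j n) g" for n
        using w(2) t[of j n] unfolding weak_partial_def inn_def by (simp add: mult.commute)
      then show "(\<lambda>n. - inn ?M u (pd i (\<psi> j n))) \<longlonglongrightarrow> inn ?M g (e j)"
        using inn_tendsto[OF cv[of j] gl] by (simp add: inn_commute[of ?M g "e j"])
    qed
    then have "?D i u = (\<Sum>j. ennreal ((inn ?M g (e j))\<^sup>2))" by simp
    also have "\<dots> = ennreal (\<Sum>j. (inn ?M g (e j))\<^sup>2)"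
      using parseval_sq[OF gl] by (intro suminf_ennreal2) (auto simp: sums_iff)
    also have "\<dots> = ennreal (nsq \<Omega> g)" using parseval_sq[OF gl] by (simp add: sums_iff nsq_eq)
    finally show ?thesis by simp
  qed
  let ?f = "\<lambda>t. ennreal (nsq \<Omega> (\<lambda>x. U (t, x))) + (\<Sum>i\<in>Basis. ?D i (\<lambda>x. U (t, x)))"
  show ?thesis
  proof (rule lebesgue_on_AE_measurable)
    have m1: "(\<lambda>t. nsq \<Omega> (\<lambda>x. U (t, x))) \<in> borel_measurable borel" by (rule nsq_section_meas[OF U Ob])
    have m: "(\<lambda>s. inn ?M (\<lambda>x. U (s, x)) (pd i (\<psi> j n))) \<in> borel_measurable borel" if "i \<in> Basis" for i j n
    proof (rule inn_section_meas[OF U Ob])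
      have "Cinf_on UNIV (\<psi> j n)" using t[of j n] by (simp add: test_fun_def)
      from Cinf_pd(2)[OF this that] show "pd i (\<psi> j n) \<in> borel_measurable borel"
        by (rule borel_measurable_continuous_onI)
    qed
    have m2: "(\<lambda>t. ?D i (\<lambda>x. U (t, x))) \<in> borel_measurable borel" if "i \<in> Basis" for i
      by (intro borel_measurable_suminf_order measurable_compose[OF _ measurable_ennreal] borel_measurable_power
          borel_measurable_lim_metric borel_measurable_uminus m that)
    have "?f \<in> borel_measurable borel"
      by (intro borel_measurable_add measurable_compose[OF m1 measurable_ennreal] borel_measurable_sum m2)
    then show "?f \<in> borel_measurable (lebesgue_on I)"
      by (intro measurable_restrict_space1) (simp add: measurable_completion)
    show "AE t in lebesgue_on I. ?f t = sob_nsq \<Omega> 1 (\<lambda>x. U (t, x))"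
      using L
    proof eventually_elim
      case (elim t)
      let ?u = "\<lambda>x. U (t, x)"
      have nn: "nsq \<Omega> v \<ge> 0" for v by (simp add: nsq_eq inn_nonneg)
      have "(\<Sum>i\<in>Basis. ?D i ?u) = (\<Sum>i\<in>Basis. ennreal (nsq \<Omega> (SOME g. L2 \<Omega> g \<and> weak_partial \<Omega> ?u i g)))"
        by (intro sum.cong refl D[symmetric] sob1_weak(2,3)[OF elim])
      also have "\<dots> = ennreal (\<Sum>i\<in>Basis. nsq \<Omega> (SOME g. L2 \<Omega> g \<and> weak_partial \<Omega> ?u i g))"
        by (intro sum_ennreal nn)
      finally have S: "(\<Sum>i\<in>Basis. ?D i ?u) = ennreal (\<Sum>i\<in>Basis. nsq \<Omega> (SOME g. L2 \<Omega> g \<and> weak_partial \<Omega> ?u i g))" .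
      show ?case unfolding sob1_eq[OF elim] S by (intro ennreal_plus[symmetric] nn sum_nonneg)
    qed
  qed (use I in auto)
qed

text \<open>The common description of \<open>H\<^sup>\<eta>\<close> for \<open>0 < \<eta> < 1\<close> (one kernel) and \<open>\<eta> = 1\<close> (difference quotients).\<close>

locale sob_family =
  fixes \<Omega> :: "pt set" and \<eta> :: real and N :: "'b measure" and K :: "'k set"
    and X Y :: "'k \<Rightarrow> 'b \<Rightarrow> pt" and w :: "'k \<Rightarrow> 'b \<Rightarrow> ennreal"
  assumes Om: "open \<Omega>" "bounded \<Omega>"
    and sf: "sigma_finite_measure N"
    and kern: "\<And>k. k \<in> K \<Longrightarrow> kernel \<Omega> N (X k) (Y k) (w k)"
    and upper: "\<And>u k. u \<in> borel_measurable borel \<Longrightarrow> k \<in> K \<Longrightarrow> pk N (X k) (Y k) (w k) u \<le> sob_nsq \<Omega> \<eta> u"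
    and lower: "\<And>u C. u \<in> borel_measurable borel \<Longrightarrow> L2 \<Omega> u \<Longrightarrow> 0 \<le> C \<Longrightarrow>
       (\<And>k. k \<in> K \<Longrightarrow> pk N (X k) (Y k) (w k) u \<le> ennreal C) \<Longrightarrow> sob_nsq \<Omega> \<eta> u \<le> ennreal (nsq \<Omega> u + 3 * C)"
    and H1: "\<And>u. u \<in> borel_measurable borel \<Longrightarrow> inH \<Omega> 1 u \<Longrightarrow> inH \<Omega> \<eta> u"
    and sob_meas: "\<And>U I. I \<in> sets borel \<Longrightarrow> U \<in> borel_measurable borel \<Longrightarrow>
       AE t in lebesgue_on I. L2 \<Omega> (\<lambda>x. U (t, x)) \<and> inH \<Omega> \<eta> (\<lambda>x. U (t, x)) \<Longrightarrow>
       (\<lambda>t::real. sob_nsq \<Omega> \<eta> (\<lambda>x. U (t, x))) \<in> borel_measurable (lebesgue_on I)"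

lemma slob_family:
  assumes sd: "smooth_domain \<Omega>" and eta: "0 < \<eta>" "\<eta> < 1"
  shows "sob_family \<Omega> \<eta> lborel {()} (\<lambda>_. fst) (\<lambda>_. snd) (\<lambda>_. slob_w \<Omega> \<eta>)"
proof (rule sob_family.intro)
  show Om: "open \<Omega>" "bounded \<Omega>" using sd by (auto simp: smooth_domain_def)
  have Ob: "\<Omega> \<in> sets borel" using Om by auto
  have e1: "\<eta> \<noteq> 1" using eta by simp
  show "sigma_finite_measure (lborel :: (pt \<times> pt) measure)" by (rule lborel.sigma_finite_measure_axioms)
  show "kernel \<Omega> lborel fst snd (slob_w \<Omega> \<eta>)" by (rule slob_kernel[OF Ob])
  fix u :: "pt \<Rightarrow> real" assume um: "u \<in> borel_measurable borel"
  show "pk lborel fst snd (slob_w \<Omega> \<eta>) u \<le> sob_nsq \<Omega> \<eta> u"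
  proof (cases "L2 \<Omega> u")
    case True then show ?thesis by (simp add: slob_sob[OF Ob um e1])
  next
    case False then show ?thesis using e1 by (simp add: sob_nsq_def)
  qed
  show "sob_nsq \<Omega> \<eta> u \<le> ennreal (nsq \<Omega> u + 3 * C)"
    if "L2 \<Omega> u" "0 \<le> C" "\<And>k. k \<in> {()} \<Longrightarrow> pk lborel fst snd (slob_w \<Omega> \<eta>) u \<le> ennreal C" for C
  proof -
    have nn: "nsq \<Omega> u \<ge> 0" by (simp add: nsq_eq inn_nonneg)
    have "sob_nsq \<Omega> \<eta> u \<le> ennreal (nsq \<Omega> u) + ennreal C"
      unfolding slob_sob[OF Ob um e1 that(1)] using that(3) by (intro add_left_mono) simp
    also have "\<dots> = ennreal (nsq \<Omega> u + C)" using nn that(2) by simp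
    also have "\<dots> \<le> ennreal (nsq \<Omega> u + 3 * C)" using that(2) by (intro ennreal_leI) simp
    finally show ?thesis .
  qed
  show "inH \<Omega> \<eta> u" if "inH \<Omega> 1 u"
  proof -
    have "L2 \<Omega> u" using that unfolding inH_def sob_nsq_def by (auto split: if_splits)
    then show ?thesis unfolding inH_def slob_sob[OF Ob um e1 \<open>L2 \<Omega> u\<close>] slob_pk[OF Ob um]
      using H1_slobodeckij[OF sd um that eta] by simp
  qed
next
  fix U :: "real \<times> pt \<Rightarrow> real" and I :: "real set"
  assume I: "I \<in> sets borel" and U: "U \<in> borel_measurable borel"
    and a: "AE t in lebesgue_on I. L2 \<Omega> (\<lambda>x. U (t, x)) \<and> inH \<Omega> \<eta> (\<lambda>x. U (t, x))"
  have Ob: "\<Omega> \<in> sets borel" using sd by (auto simp: smooth_domain_def)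
  show "(\<lambda>t. sob_nsq \<Omega> \<eta> (\<lambda>x. U (t, x))) \<in> borel_measurable (lebesgue_on I)"
    by (rule slob_meas[OF Ob I U]) (use eta a in auto)
qed

lemma h1_family:
  assumes Om: "open \<Omega>" "bounded \<Omega>" and onb: "onb (lebesgue_on \<Omega>) e"
  shows "sob_family \<Omega> 1 lborel (Basis \<times> {0<..<1}) (\<lambda>k x. x + snd k *\<^sub>R fst k) (\<lambda>_ x. x) (h1_w \<Omega>)"
proof (rule sob_family.intro)
  show "open \<Omega>" "bounded \<Omega>" by fact+
  show "sigma_finite_measure (lborel :: pt measure)" by (rule lborel.sigma_finite_measure_axioms)
  show "kernel \<Omega> lborel (\<lambda>x. x + snd k *\<^sub>R fst k) (\<lambda>x. x) (h1_w \<Omega> k)" if "k \<in> Basis \<times> {0<..<1}" for k by (rule h1_kernel[OF Om(1)])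
  fix u :: "pt \<Rightarrow> real" assume um: "u \<in> borel_measurable borel"
  show "pk lborel (\<lambda>x. x + snd k *\<^sub>R fst k) (\<lambda>x. x) (h1_w \<Omega> k) u \<le> sob_nsq \<Omega> 1 u" if "k \<in> Basis \<times> {0<..<1}" for k
    using h1_upper[OF Om um, of "fst k" "snd k"] that by auto
  show "sob_nsq \<Omega> 1 u \<le> ennreal (nsq \<Omega> u + 3 * C)"
    if "L2 \<Omega> u" "0 \<le> C" "\<And>k. k \<in> Basis \<times> {0<..<1} \<Longrightarrow> pk lborel (\<lambda>x. x + snd k *\<^sub>R fst k) (\<lambda>x. x) (h1_w \<Omega> k) u \<le> ennreal C" for C
  proof (rule h1_lower[OF Om um that(1) onb that(2)])
    fix i :: pt and s :: real assume "i \<in> Basis" "0 < s" "s < 1"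
    then show "pk lborel (\<lambda>x. x + s *\<^sub>R i) (\<lambda>x. x) (h1_w \<Omega> (i, s)) u \<le> ennreal C"
      using that(3)[of "(i, s)"] by simp
  qed
next
  fix U :: "real \<times> pt \<Rightarrow> real" and I :: "real set"
  assume I: "I \<in> sets borel" and U: "U \<in> borel_measurable borel"
    and a: "AE t in lebesgue_on I. L2 \<Omega> (\<lambda>x. U (t, x)) \<and> inH \<Omega> 1 (\<lambda>x. U (t, x))"
  show "(\<lambda>t. sob_nsq \<Omega> 1 (\<lambda>x. U (t, x))) \<in> borel_measurable (lebesgue_on I)"
    by (rule h1_meas[OF Om(1) I U onb]) (use a in auto)
qed

section \<open>Functions of time and space\<close>

text \<open>Extension by zero from (0,T) x \<Omega> to the whole space: integrals over the domain
  become integrals for \<open>lborel\<close>, where Fubini and product measurability apply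
  directly.\<close>

definition bt :: "pt set \<Rightarrow> real \<Rightarrow> (real \<times> pt \<Rightarrow> real) \<Rightarrow> bool" where
  "bt \<Omega> T U \<longleftrightarrow> U \<in> borel_measurable borel \<and> integrable lborel (\<lambda>p. (U p)\<^sup>2) \<and>
     (\<forall>t x. \<not> (t \<in> {0<..<T} \<and> x \<in> \<Omega>) \<longrightarrow> U (t, x) = 0)"

lemma Ioo_finite: "emeasure lborel {a<..<b::real} < top"
  by (cases "a \<le> b") auto

lemma integrable_product:
  fixes f :: "'a::euclidean_space \<Rightarrow> real" and g :: "'b::euclidean_space \<Rightarrow> real"
  assumes f: "integrable lborel f" and g: "integrable lborel g"
  shows "integrable (lborel \<Otimes>\<^sub>M lborel) (\<lambda>p. f (fst p) * g (snd p))"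
proof (rule lborel_pair.Fubini_integrable)
  have [measurable]: "f \<in> borel_measurable borel" "g \<in> borel_measurable borel"
    using borel_measurable_integrable[OF f] borel_measurable_integrable[OF g] by auto
  show "(\<lambda>p. f (fst p) * g (snd p)) \<in> borel_measurable (lborel \<Otimes>\<^sub>M lborel)" by measurable
  show "integrable lborel (\<lambda>x. LINT y|lborel. norm (f (fst (x, y)) * g (snd (x, y))))"
    using integrable_abs[OF f] by (simp add: abs_mult)
qed (use g in simp)

lemma l2_product:
  fixes c :: "real \<Rightarrow> real" and v :: "pt \<Rightarrow> real"
  assumes c: "l2 lborel c" and v: "l2 lborel v"
  shows "l2 lborel (\<lambda>p. c (fst p) * v (snd p))"
proof -
  have [measurable]: "c \<in> borel_measurable borel" "v \<in> borel_measurable borel" using l2_meas[OF c] l2_meas[OF v] by auto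
  have "(\<lambda>p. c (fst p) * v (snd p)) \<in> borel_measurable (borel \<Otimes>\<^sub>M borel)" by measurable
  then show ?thesis
    using integrable_product[of "\<lambda>t. (c t)\<^sup>2" "\<lambda>x. (v x)\<^sup>2"] c v
    by (simp add: l2_def lborel_prod borel_prod power_mult_distrib)
qed

lemma indicator_l2: "l2 lborel (indicator {a<..<b} :: real \<Rightarrow> real)"
  by (simp add: l2_def power2_eq_square Ioo_finite flip: indicator_inter_arith)

lemma const_l2:
  assumes "bounded \<Omega>" "\<Omega> \<in> sets borel" shows "l2 (lebesgue_on \<Omega>) (\<lambda>x::'a::euclidean_space. c)"
proof -
  obtain K where K: "compact K" "\<Omega> \<subseteq> K" using assms(1)
    by (meson bounded_closure closure_subset compact_closure)
  have "integrable (lebesgue_on \<Omega>) (indicator K :: 'a \<Rightarrow> real)"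
    using assms(2) K(1) by (intro indicator_integrable_lebesgue_on) auto
  then have "integrable (lebesgue_on \<Omega>) (\<lambda>x. 1 :: real)"
    by (rule Bochner_Integration.integrable_cong[THEN iffD1, rotated 2]) (use K(2) in auto)
  then show ?thesis using integrable_mult_right[of "c\<^sup>2" "lebesgue_on \<Omega>" "\<lambda>x. 1"] by (simp add: l2_def)
qed

lemma bt_out: "bt \<Omega> T U \<Longrightarrow> x \<notin> \<Omega> \<Longrightarrow> U (t, x) = 0" "bt \<Omega> T U \<Longrightarrow> t \<notin> {0<..<T} \<Longrightarrow> U (t, x) = 0"
  by (auto simp: bt_def)

lemma bt_meas: "bt \<Omega> T U \<Longrightarrow> U \<in> borel_measurable borel"
  by (simp add: bt_def)

lemma bt_meas_pair: "bt \<Omega> T U \<Longrightarrow> U \<in> borel_measurable (borel \<Otimes>\<^sub>M borel)"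
  by (simp add: bt_def borel_prod)

lemma bt_sec_meas: "bt \<Omega> T U \<Longrightarrow> (\<lambda>x. U (t, x)) \<in> borel_measurable borel"
  by (simp add: L2_section_meas bt_meas)

lemma AE_lborel_pair:
  assumes "AE p in (lborel :: (real \<times> pt) measure). Q p"
  shows "AE t in lborel. AE x in lborel. Q (t, x)"
  using lborel_pair.AE_pair[of Q] assms unfolding lborel_prod .

text \<open>Passing from "for almost every t, almost every x" to the opposite order requires the
  relation to be measurable in the pair. It is the step from equations at fixed times to scalar
  inclusions at fixed points.\<close>

lemma AE_lborel_swap:
  fixes Q :: "real \<Rightarrow> pt \<Rightarrow> bool"
  assumes "AE t in lborel. AE x in lborel. Q t x" and [measurable]: "Measurable.pred (borel \<Otimes>\<^sub>M borel) (\<lambda>(t, x). Q t x)"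
  shows "AE x in lborel. AE t in lborel. Q t x"
proof (subst lborel_pair.AE_commute[symmetric])
  have s: "sets (lborel \<Otimes>\<^sub>M lborel :: (real \<times> pt) measure) = sets (borel \<Otimes>\<^sub>M borel)"
    by (intro sets_pair_measure_cong) auto
  have "{p \<in> space (borel \<Otimes>\<^sub>M borel). case p of (t, x) \<Rightarrow> Q t x} \<in> sets (borel \<Otimes>\<^sub>M borel)"
    using assms(2) by (simp only: pred_def)
  then show "{x \<in> space (lborel \<Otimes>\<^sub>M lborel). Q (fst x) (snd x)} \<in> sets (lborel \<Otimes>\<^sub>M lborel)"
    unfolding s by (simp add: space_pair_measure case_prod_unfold)
qed (rule assms(1))

lemma bt_rep:
  assumes Om: "open \<Omega>" and u: "L2T \<Omega> T u"
  shows "\<exists>U. bt \<Omega> T U \<and> (AE t in lebesgue_on {0<..<T}. AE x in lebesgue_on \<Omega>. u t x = U (t, x))"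
proof -
  let ?W = "{0<..<T} \<times> \<Omega>"
  have Wb: "?W \<in> sets borel" using Om by (intro borel_open open_Times) auto
  have Ob: "\<Omega> \<in> sets borel" using Om by auto
  have l: "l2 (lebesgue_on ?W) (case_prod u)" using u by (simp add: L2T_def l2_def case_prod_unfold)
  obtain U where U: "U \<in> borel_measurable borel" "\<forall>p. p \<notin> ?W \<longrightarrow> U p = 0" "AE p in lebesgue_on ?W. case_prod u p = U p"
    using borel_rep[OF Wb l2_meas[OF l]] by blast
  have "l2 (lebesgue_on ?W) U" by (rule l2_cong_AE[OF l borel_meas_lebesgue_on[OF U(1)] U(3)])
  then have "integrable lborel (\<lambda>p. indicator ?W p * (U p)\<^sup>2)"
    using integrable_lebesgue_on[OF Wb, of "\<lambda>p. (U p)\<^sup>2"] U(1) by (simp add: l2_def)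
  moreover have "(\<lambda>p. indicator ?W p * (U p)\<^sup>2) = (\<lambda>p. (U p)\<^sup>2)"
  proof (rule ext)
    fix p show "indicator ?W p * (U p)\<^sup>2 = (U p)\<^sup>2" using U(2)[rule_format, of p] by (cases "p \<in> ?W") (simp_all del: mem_Times_iff)
  qed
  ultimately have "integrable lborel (\<lambda>p. (U p)\<^sup>2)" by simp
  moreover have "U (t, x) = 0" if "\<not> (t \<in> {0<..<T} \<and> x \<in> \<Omega>)" for t x using U(2) that by auto
  ultimately have b: "bt \<Omega> T U" using U(1) unfolding bt_def by blast
  have "AE p in lborel. p \<in> ?W \<longrightarrow> case_prod u p = U p" using U(3) AE_lebesgue_on_iff[OF Wb] by simp
  from AE_lborel_pair[OF this] have "AE t in lebesgue_on {0<..<T}. AE x in lborel. (t, x) \<in> ?W \<longrightarrow> u t x = U (t, x)"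
    by (subst AE_lebesgue_on_iff) (auto elim!: eventually_mono)
  moreover have "AE t in lebesgue_on {0<..<T}. t \<in> {0<..<T}" by (subst AE_lebesgue_on_iff) auto
  ultimately have "AE t in lebesgue_on {0<..<T}. AE x in lebesgue_on \<Omega>. u t x = U (t, x)"
    by eventually_elim (auto simp: AE_lebesgue_on_iff[OF Ob])
  then show ?thesis using b by blast
qed

lemma bt_L2_eq:
  assumes Ob: "\<Omega> \<in> sets borel" and b: "bt \<Omega> T U"
  shows "L2 \<Omega> (\<lambda>x. U (t, x)) \<longleftrightarrow> integrable lborel (\<lambda>x. (U (t, x))\<^sup>2)"
proof -
  note m[measurable] = bt_sec_meas[OF b, of t]
  have "(\<lambda>x. indicator \<Omega> x * (U (t, x))\<^sup>2) = (\<lambda>x. (U (t, x))\<^sup>2)"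
    using bt_out(1)[OF b] by (auto simp: indicator_def fun_eq_iff)
  then show ?thesis unfolding L2_def using integrable_lebesgue_on[OF Ob, of "\<lambda>x. (U (t, x))\<^sup>2"] borel_meas_lebesgue_on[OF m] by simp
qed

lemma bt_L2: assumes "\<Omega> \<in> sets borel" "bt \<Omega> T U" shows "AE t in lborel. L2 \<Omega> (\<lambda>x. U (t, x))"
proof -
  have "integrable (lborel \<Otimes>\<^sub>M lborel) (\<lambda>p. (U p)\<^sup>2)" using assms(2) by (simp add: bt_def lborel_prod)
  from lborel_pair.AE_integrable_fst'[OF this] show ?thesis by (simp add: bt_L2_eq[OF assms])
qed

lemma bt_inn_eq:
  assumes "\<Omega> \<in> sets borel" "bt \<Omega> T U" and v: "v \<in> borel_measurable borel"
  shows "inn (lebesgue_on \<Omega>) (\<lambda>x. U (t, x)) v = (LINT x|lborel. U (t, x) * v x)"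
proof -
  note m[measurable] = bt_sec_meas[OF assms(2), of t] v
  have "inn (lebesgue_on \<Omega>) (\<lambda>x. U (t, x)) v = (LINT x|lborel. indicator \<Omega> x * (U (t, x) * v x))"
    unfolding inn_def by (rule integral_lebesgue_on[OF assms(1)]) measurable
  also have "\<dots> = (LINT x|lborel. U (t, x) * v x)"
    using bt_out(1)[OF assms(2)] by (intro Bochner_Integration.integral_cong) (auto simp: indicator_def)
  finally show ?thesis .
qed

lemma bt_nsq_integrable:
  assumes "\<Omega> \<in> sets borel" "bt \<Omega> T U"
  shows "integrable lborel (\<lambda>t. nsq \<Omega> (\<lambda>x. U (t, x)))"
proof -
  have "integrable (lborel \<Otimes>\<^sub>M lborel) (\<lambda>p. (U p)\<^sup>2)" using assms(2) by (simp add: bt_def lborel_prod)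
  from lborel_pair.integrable_fst'[OF this]
  show ?thesis unfolding nsq_eq bt_inn_eq[OF assms bt_sec_meas[OF assms(2)]] by (simp add: power2_eq_square)
qed

lemma bt_inn_l2:
  assumes Ob: "\<Omega> \<in> sets borel" and U: "bt \<Omega> T U" and v: "v \<in> borel_measurable borel" "L2 \<Omega> v"
  shows "l2 lborel (\<lambda>t. inn (lebesgue_on \<Omega>) (\<lambda>x. U (t, x)) v)"
proof -
  have m: "(\<lambda>t. inn (lebesgue_on \<Omega>) (\<lambda>x. U (t, x)) v) \<in> borel_measurable borel"
    by (rule inn_section_meas[OF bt_meas[OF U] Ob v(1)])
  have "integrable lborel (\<lambda>t. (inn (lebesgue_on \<Omega>) (\<lambda>x. U (t, x)) v)\<^sup>2)"
  proof (rule Bochner_Integration.integrable_bound)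
    show "integrable lborel (\<lambda>t. nsq \<Omega> (\<lambda>x. U (t, x)) * nsq \<Omega> v)"
      using bt_nsq_integrable[OF Ob U] by simp
    show "AE t in lborel. norm ((inn (lebesgue_on \<Omega>) (\<lambda>x. U (t, x)) v)\<^sup>2) \<le> norm (nsq \<Omega> (\<lambda>x. U (t, x)) * nsq \<Omega> v)"
      using bt_L2[OF Ob U]
    proof eventually_elim
      case (elim t)
      then show ?case using inn_CS[of "lebesgue_on \<Omega>" "\<lambda>x. U (t, x)" v] v(2) by (simp add: L2_eq nsq_eq abs_mult inn_nonneg)
    qed
  qed (use m in measurable)
  then show ?thesis using m by (simp add: l2_def)
qed

lemma bt_time_sections:
  assumes "bt \<Omega> T U"
  shows "AE x in lborel. l2 lborel (\<lambda>t. U (t, x))"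
proof -
  have "integrable (lborel \<Otimes>\<^sub>M lborel) (case_prod (\<lambda>t x. (U (t, x))\<^sup>2))"
    using assms by (simp add: bt_def lborel_prod case_prod_unfold)
  from lborel_pair.AE_integrable_snd[OF this] show ?thesis
  proof eventually_elim
    case (elim x)
    note [measurable] = bt_meas_pair[OF assms]
    have "(\<lambda>t. U (t, x)) \<in> borel_measurable borel" by measurable
    then show ?case using elim by (simp add: l2_def)
  qed
qed

section \<open>Primitives and weak derivatives in time\<close>

lemma l2_interval_integrable:
  fixes f :: "real \<Rightarrow> real"
  assumes f: "l2 lborel f" shows "integrable lborel (\<lambda>s. indicator {a<..<b} s * f s)"
proof -
  have "l2 lborel (indicator {a<..<b} :: real \<Rightarrow> real)"
  proof -
    have "integrable lborel (indicator {a<..<b} :: real \<Rightarrow> real)"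
      by (intro integrable_real_indicator) (auto simp: Ioo_finite)
    then show ?thesis by (simp add: l2_def power2_eq_square flip: indicator_inter_arith)
  qed
  then show ?thesis using f by (rule l2_mult)
qed

text \<open>For t \<le> 0 the interval is empty and the value is 0; only nonnegative t
  matter.\<close>

definition prim :: "(real \<Rightarrow> real) \<Rightarrow> real \<Rightarrow> real" where
  "prim f t = (LINT s|lborel. indicator {0<..<t} s * f s)"

lemma prim_bound:
  assumes f: "l2 lborel f" and t: "0 \<le> t"
  shows "(prim f t)\<^sup>2 \<le> t * (LINT s|lborel. (f s)\<^sup>2)"
proof -
  have i: "integrable lborel (indicator {0<..<t} :: real \<Rightarrow> real)"
    by (intro integrable_real_indicator) (auto simp: Ioo_finite)
  have "l2 lborel (indicator {0<..<t} :: real \<Rightarrow> real)"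
    using i by (simp add: l2_def power2_eq_square flip: indicator_inter_arith)
  from inn_CS[OF this f] show ?thesis
    using t i by (simp add: inn_def prim_def power2_eq_square flip: indicator_inter_arith)
qed

lemma prim_meas:
  assumes [measurable]: "f \<in> borel_measurable borel" shows "prim f \<in> borel_measurable borel"
proof -
  have e: "prim f = (\<lambda>t. LINT s|lborel. of_bool (0 < s \<and> s < t) * f s)"
    unfolding prim_def by (intro ext Bochner_Integration.integral_cong) (auto simp: indicator_def)
  show ?thesis unfolding e by measurable
qed

lemma deriv_eq_pd: assumes "test_fun S \<zeta>" shows "deriv \<zeta> t = pd 1 \<zeta> t"
proof -
  have "Cinf_on UNIV \<zeta>" using assms by (simp add: test_fun_def)
  from Cinf_line[OF this, of 1 0 t] have "(\<zeta> has_real_derivative pd 1 \<zeta> t) (at t)" by simp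
  then show ?thesis by (rule DERIV_imp_deriv)
qed

text \<open>Integration by parts without differentiating the primitive: Fubini on the triangle 0 < s
  < t < T leaves the integral of the derivative of \<zeta> from s to T, which is -\<zeta>(s) since
  \<zeta> vanishes at T.\<close>

lemma prim_parts:
  assumes T: "T > 0" and f: "l2 lborel f" and z: "test_fun {0<..<T} \<zeta>"
  shows "(LINT t|lborel. indicator {0<..<T} t * (prim f t * pd 1 \<zeta> t)) = - (LINT t|lborel. indicator {0<..<T} t * (f t * \<zeta> t))"
proof -
  have C: "Cinf_on UNIV \<zeta>" using z by (simp add: test_fun_def)
  have fm[measurable]: "f \<in> borel_measurable borel" using l2_meas[OF f] by simp
  have cz: "continuous_on UNIV (pd 1 \<zeta>)" by (rule Cinf_pd(2)[OF C]) simp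
  then have [measurable]: "pd 1 \<zeta> \<in> borel_measurable borel" by (rule borel_measurable_continuous_onI)
  obtain K where K: "K \<ge> 0" "\<And>x. \<bar>pd 1 \<zeta> x\<bar> \<le> K" using test_fun_pd_bounded[OF z, of 1] by auto
  have out: "\<zeta> t = 0" if "t \<notin> {0<..<T}" for t
    using that z closure_support[of t \<zeta>] unfolding test_fun_def by blast
  \<comment> \<open>The integrand on the triangle, written with a truth value so that it is visibly
    measurable in the pair.\<close>
  let ?F = "\<lambda>s t. of_bool (0 < s \<and> s < t \<and> t < T) * (f s * pd 1 \<zeta> t)"
  have fi: "integrable lborel (\<lambda>s. indicator {0<..<T} s * f s)" by (rule l2_interval_integrable[OF f])
  have Fi: "integrable (lborel \<Otimes>\<^sub>M lborel) (case_prod ?F)"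
  proof (rule Bochner_Integration.integrable_bound)
    show "integrable (lborel \<Otimes>\<^sub>M lborel) (\<lambda>(s, t). (indicator {0<..<T} s * f s) * (K * indicator {0<..<T} t))"
      using integrable_product[OF fi, of "\<lambda>t. K * indicator {0<..<T} t"]
      by (simp add: case_prod_unfold Ioo_finite)
    show "AE p in lborel \<Otimes>\<^sub>M lborel. norm (case_prod ?F p) \<le> norm (case p of (s, t) \<Rightarrow> (indicator {0<..<T} s * f s) * (K * indicator {0<..<T} t))"
    proof (intro AE_I2)
      fix p :: "real \<times> real"
      obtain s t where p: "p = (s, t)" by (cases p)
      have "\<bar>f s\<bar> * \<bar>pd 1 \<zeta> t\<bar> \<le> \<bar>f s\<bar> * K" by (intro mult_left_mono K) auto
      then show "norm (case_prod ?F p) \<le> norm (case p of (s, t) \<Rightarrow> (indicator {0<..<T} s * f s) * (K * indicator {0<..<T} t))"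
        using K(1) by (auto simp: p abs_mult indicator_def)
    qed
  qed measurable
  have "(LINT t|lborel. indicator {0<..<T} t * (prim f t * pd 1 \<zeta> t)) = (LINT t|lborel. LINT s|lborel. ?F s t)"
  proof (rule Bochner_Integration.integral_cong[OF refl])
    fix t
    have "(LINT s|lborel. ?F s t) = (LINT s|lborel. (indicator {0<..<T} t * pd 1 \<zeta> t) * (indicator {0<..<t} s * f s))"
      by (rule Bochner_Integration.integral_cong) (auto simp: indicator_def)
    then show "indicator {0<..<T} t * (prim f t * pd 1 \<zeta> t) = (LINT s|lborel. ?F s t)"
      by (simp add: prim_def)
  qed
  also have "\<dots> = (LINT s|lborel. LINT t|lborel. ?F s t)"
    by (rule lborel_pair.Fubini_integral[OF Fi])
  also have "\<dots> = (LINT s|lborel. - (indicator {0<..<T} s * (f s * \<zeta> s)))"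
  proof (rule Bochner_Integration.integral_cong[OF refl])
    fix s
    show "(LINT t|lborel. ?F s t) = - (indicator {0<..<T} s * (f s * \<zeta> s))"
    proof (cases "s \<in> {0<..<T}")
      case True
      have "(LINT t|lborel. ?F s t) = (LINT t|lborel. f s * (pd 1 \<zeta> t * indicator {s..T} t))"
      proof (rule integral_cong_AE)
        show "AE t in lborel. ?F s t = f s * (pd 1 \<zeta> t * indicator {s..T} t)"
          using AE_lborel_singleton[of s] AE_lborel_singleton[of T]
          by eventually_elim (use True in \<open>auto simp: indicator_def\<close>)
      qed measurable
      also have "\<dots> = f s * (LINT t|lborel. pd 1 \<zeta> t * indicator {s..T} t)" by simp
      also have "(LINT t|lborel. pd 1 \<zeta> t * indicator {s..T} t) = \<zeta> T - \<zeta> s"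
      proof (rule integral_FTC_Icc_real)
        show "s \<le> T" using True by simp
        show "(\<zeta> has_real_derivative pd 1 \<zeta> x) (at x)" for x
          using Cinf_line[OF C, of 1 0 x] by simp
        show "isCont (pd 1 \<zeta>) x" for x using cz by (simp add: continuous_on_eq_continuous_at)
      qed
      finally show ?thesis using True out[of T] by simp
    next
      case False
      then have "(LINT t|lborel. ?F s t) = (LINT t|(lborel :: real measure). 0)"
        by (intro Bochner_Integration.integral_cong[OF refl]) auto
      then show ?thesis using False by simp
    qed
  qed
  finally show ?thesis by simp
qed

text \<open>A zero weak derivative makes every increment z(x + s) - z(x) vanish almost everywhere,
  by the difference quotient estimate with g = 0. Integrating over all s gives z(y) = z(x) for
  almost all pairs, and one good x supplies the constant.\<close>

lemma weak_deriv_zero_const: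
  fixes z :: "real \<Rightarrow> real"
  assumes T: "T > 0" and zm[measurable]: "z \<in> borel_measurable borel" and z: "l2 (lebesgue_on {0<..<T}) z"
    and w: "\<And>\<psi>. test_fun {0<..<T} \<psi> \<Longrightarrow> inn (lebesgue_on {0<..<T}) z (pd 1 \<psi>) = 0"
  shows "\<exists>c. AE t in lebesgue_on {0<..<T}. z t = c"
proof -
  let ?I = "{0<..<T}"
  let ?g = "\<lambda>(x::real) y. indicator ?I x * indicator ?I y * ennreal ((z y - z x)\<^sup>2)"
  have zero: "(\<integral>\<^sup>+x. ?g x (x + s) \<partial>lborel) = 0" for s :: real
  proof -
    have "(\<integral>\<^sup>+x. indicator (segset ?I (s *\<^sub>R 1)) x * ennreal ((z (x + s *\<^sub>R 1) - z x)\<^sup>2) \<partial>lborel)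
      \<le> ennreal (s\<^sup>2 * sqnorm (lebesgue_on ?I) (\<lambda>x. 0))"
      by (rule difference_quotient_general[OF _ _ zm z l2_zero]) (use w in \<open>auto simp: inn_def\<close>)
    \<comment> \<open>On an interval the segment condition reduces to its two endpoints, by
      convexity.\<close>
    moreover have "segset ?I (s *\<^sub>R 1) = {x. x \<in> ?I \<and> x + s \<in> ?I}"
    proof (intro equalityI subsetI)
      fix x assume "x \<in> {x. x \<in> ?I \<and> x + s \<in> ?I}"
      then have x: "x \<in> ?I" "x + s \<in> ?I" by auto
      have "x + t *\<^sub>R (s *\<^sub>R 1) \<in> ?I" if t: "t \<in> {0..1}" for t
      proof -
        have e: "x + t *\<^sub>R (s *\<^sub>R 1) = (1 - t) *\<^sub>R x + t *\<^sub>R (x + s)" by (simp add: algebra_simps)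
        have "convex ?I" by (rule convex_real_interval)
        then show ?thesis unfolding e using t x by (intro convexD) auto
      qed
      then show "x \<in> segset ?I (s *\<^sub>R 1)" by (simp add: segset_def)
    next
      fix x assume "x \<in> segset ?I (s *\<^sub>R 1)"
      from segset_start[OF this] segset_end[OF this] show "x \<in> {x. x \<in> ?I \<and> x + s \<in> ?I}" by simp
    qed
    moreover have "?g x (x + s) = indicator {x. x \<in> ?I \<and> x + s \<in> ?I} x * ennreal ((z (x + s *\<^sub>R 1) - z x)\<^sup>2)" for x
      by (auto simp: indicator_def)
    ultimately show ?thesis by (simp add: inn_def)
  qed
  have "(\<integral>\<^sup>+x. (\<integral>\<^sup>+y. ?g x y \<partial>lborel) \<partial>lborel) = (\<integral>\<^sup>+x. (\<integral>\<^sup>+s. ?g x (s + x) \<partial>lborel) \<partial>lborel)"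
  proof (rule nn_integral_cong)
    fix x
    have "(\<lambda>y. ?g x y) \<in> borel_measurable borel" by measurable
    from nn_integral_shift[OF this, of x] show "(\<integral>\<^sup>+y. ?g x y \<partial>lborel) = (\<integral>\<^sup>+s. ?g x (s + x) \<partial>lborel)" by simp
  qed
  also have "\<dots> = (\<integral>\<^sup>+s. (\<integral>\<^sup>+x. ?g x (x + s) \<partial>lborel) \<partial>lborel)"
    by (subst lborel_pair.Fubini') (auto simp: add.commute)
  also have "\<dots> = 0" by (simp add: zero)
  finally have "AE x in lborel. (\<integral>\<^sup>+y. ?g x y \<partial>lborel) = 0"
    by (subst (asm) nn_integral_0_iff_AE) measurable
  moreover have "\<not> (AE x in lborel. x \<notin> ?I)"
  proof
    assume "AE x in lborel. x \<notin> ?I"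
    then have "?I \<in> null_sets lborel"
      by (rule AE_iff_null_sets[THEN iffD2, rotated]) simp
    then show False using T by (simp add: null_sets_def)
  qed
  ultimately have "\<exists>x. x \<in> ?I \<and> (\<integral>\<^sup>+y. ?g x y \<partial>lborel) = 0"
    by (metis (mono_tags, lifting) eventually_mono)
  then obtain x where x: "x \<in> ?I" "(\<integral>\<^sup>+y. ?g x y \<partial>lborel) = 0" by blast
  have "AE y in lborel. ?g x y = 0" using x(2) by (subst (asm) nn_integral_0_iff_AE) measurable
  then have "AE y in lborel. y \<in> ?I \<longrightarrow> z y = z x"
    by eventually_elim (use x(1) in \<open>auto simp: indicator_def\<close>)
  then show ?thesis by (intro exI[of _ "z x"]) (simp add: AE_lebesgue_on_iff)
qed

lemma l2_restrict: assumes "l2 lborel f" "W \<in> sets borel" shows "l2 (lebesgue_on W) (f :: 'a::euclidean_space \<Rightarrow> real)"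
proof -
  have m: "f \<in> borel_measurable borel" using l2_meas[OF assms(1)] by simp
  have "integrable lborel (\<lambda>x. indicator W x * (f x)\<^sup>2)"
    using assms integrable_mult_indicator[of W lborel "\<lambda>x. (f x)\<^sup>2"] by (simp add: l2_def)
  then show ?thesis using integrable_lebesgue_on[OF assms(2), of "\<lambda>x. (f x)\<^sup>2"] m borel_meas_lebesgue_on[OF m]
    by (simp add: l2_def)
qed

text \<open>Subtracting the primitive of the weak derivative leaves a function with zero weak
  derivative, hence a constant.\<close>

lemma du_Bois_Reymond:
  assumes T: "T > 0" and w: "l2 lborel w" and w': "l2 lborel w'"
    and d: "\<And>\<zeta>. test_fun {0<..<T} \<zeta> \<Longrightarrow>
      (LINT t|lebesgue_on {0<..<T}. w t * deriv \<zeta> t) = - (LINT t|lebesgue_on {0<..<T}. w' t * \<zeta> t)"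
  shows "\<exists>c. AE t in lebesgue_on {0<..<T}. w t = c + prim w' t"
proof -
  let ?I = "{0<..<T}"
  have m[measurable]: "w \<in> borel_measurable borel" "w' \<in> borel_measurable borel" using l2_meas[OF w] l2_meas[OF w'] by auto
  have pm[measurable]: "prim w' \<in> borel_measurable borel" by (rule prim_meas) measurable
  have wl: "l2 (lebesgue_on ?I) w" by (rule l2_restrict[OF w]) simp
  have pl: "l2 (lebesgue_on ?I) (prim w')"
  proof -
    have "l2 (lebesgue_on ?I) (\<lambda>x. sqrt (T * (LINT s|lborel. (w' s)\<^sup>2)))" by (rule const_l2) auto
    then show ?thesis
    proof (rule l2_dominated)
      show "prim w' \<in> borel_measurable (lebesgue_on ?I)" by (rule borel_meas_lebesgue_on[OF pm])
      show "AE x in lebesgue_on ?I. \<bar>prim w' x\<bar> \<le> \<bar>sqrt (T * (LINT s|lborel. (w' s)\<^sup>2))\<bar>"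
      proof (intro AE_I2)
        fix x assume "x \<in> space (lebesgue_on ?I)"
        then have x: "0 < x" "x < T" by auto
        have "(prim w' x)\<^sup>2 \<le> x * (LINT s|lborel. (w' s)\<^sup>2)" using prim_bound[OF w', of x] x by simp
        also have "\<dots> \<le> T * (LINT s|lborel. (w' s)\<^sup>2)" using x by (intro mult_right_mono) auto
        finally show "\<bar>prim w' x\<bar> \<le> \<bar>sqrt (T * (LINT s|lborel. (w' s)\<^sup>2))\<bar>"
          using real_sqrt_le_mono by fastforce
      qed
    qed
  qed
  have "\<exists>c. AE t in lebesgue_on ?I. w t - prim w' t = c"
  proof (rule weak_deriv_zero_const[OF T _ l2_diff[OF wl pl]])
    fix \<psi> assume p: "test_fun ?I \<psi>"
    have pdl: "l2 (lebesgue_on ?I) (pd 1 \<psi>)" by (rule test_fun_pd_l2[OF p]) auto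
    have C: "Cinf_on UNIV \<psi>" using p by (simp add: test_fun_def)
    have [measurable]: "\<psi> \<in> borel_measurable borel" "pd 1 \<psi> \<in> borel_measurable borel"
      using Cinf_cont[OF C] Cinf_pd(2)[OF C, of 1] by (auto intro: borel_measurable_continuous_onI)
    have "inn (lebesgue_on ?I) (prim w') (pd 1 \<psi>) = (LINT t|lborel. indicator ?I t * (prim w' t * pd 1 \<psi> t))"
      unfolding inn_def by (rule integral_lebesgue_on) measurable
    also have "\<dots> = - (LINT t|lborel. indicator ?I t * (w' t * \<psi> t))" by (rule prim_parts[OF T w' p])
    also have "(LINT t|lborel. indicator ?I t * (w' t * \<psi> t)) = (LINT t|lebesgue_on ?I. w' t * \<psi> t)"
      by (rule integral_lebesgue_on[symmetric]) measurable
    also have "- \<dots> = inn (lebesgue_on ?I) w (pd 1 \<psi>)"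
      using d[OF p] by (simp add: inn_def deriv_eq_pd[OF p])
    finally show "inn (lebesgue_on ?I) (\<lambda>t. w t - prim w' t) (pd 1 \<psi>) = 0"
      using inn_diff_left[OF wl pl pdl] by simp
  qed measurable
  then obtain c where "AE t in lebesgue_on ?I. w t - prim w' t = c" by blast
  then have "AE t in lebesgue_on ?I. w t = c + prim w' t" by eventually_elim simp
  then show ?thesis by blast
qed

section \<open>The solution as the primitive of its time derivative\<close>

lemma L2_AE_transfer:
  assumes Om: "\<Omega> \<in> sets borel" and U: "U \<in> borel_measurable borel" "L2 \<Omega> U" and ae: "AE x in lebesgue_on \<Omega>. u x = U x"
  shows "L2 \<Omega> u"
proof -
  have W: "\<Omega> \<in> sets lebesgue" using Om by (simp add: sets_completionI_sets)
  have "AE x in lebesgue_on \<Omega>. U x = u x" using ae by auto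
  from lebesgue_on_AE_measurable[OF W borel_meas_lebesgue_on[OF U(1)] this] have "u \<in> borel_measurable (lebesgue_on \<Omega>)" by simp
  then show ?thesis using l2_cong_AE[of "lebesgue_on \<Omega>" U u] U(2) ae by (simp add: L2_eq eq_commute)
qed

lemma ip_cong: assumes "L2 \<Omega> u" "L2 \<Omega> u'" "L2 \<Omega> v" "L2 \<Omega> v'" "AE x in lebesgue_on \<Omega>. u x = u' x" "AE x in lebesgue_on \<Omega>. v x = v' x"
  shows "ip \<Omega> u v = ip \<Omega> u' v'"
  unfolding ip_eq using assms by (intro inn_cong_AE) (auto simp: L2_eq dest: l2_meas)

text \<open>\<open>U\<close> and \<open>D\<close> are Borel representatives of the solution and its time derivative.\<close>

lemma coefficient_primitive:
  assumes Om: "open \<Omega>" and T: "T > 0"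
    and U: "bt \<Omega> T U" "AE t in lebesgue_on {0<..<T}. AE x in lebesgue_on \<Omega>. \<phi> t x = U (t, x)"
    and D: "bt \<Omega> T D" "AE t in lebesgue_on {0<..<T}. AE x in lebesgue_on \<Omega>. d\<phi> t x = D (t, x)"
    and td: "time_deriv \<Omega> T \<phi> d\<phi>" and iv: "init_val \<Omega> T \<phi> \<phi>0" and p0: "L2 \<Omega> \<phi>0"
    and v: "v \<in> borel_measurable borel" "L2 \<Omega> v"
  shows "AE t in lebesgue_on {0<..<T}. ip \<Omega> (\<lambda>x. U (t, x)) v = ip \<Omega> \<phi>0 v + prim (\<lambda>s. ip \<Omega> (\<lambda>x. D (s, x)) v) t"
proof -
  let ?I = "{0<..<T}"
  have Ob: "\<Omega> \<in> sets borel" using Om by auto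
  have Il: "?I \<in> sets lebesgue" "?I \<in> sets borel" by auto
  let ?w = "\<lambda>t. ip \<Omega> (\<lambda>x. U (t, x)) v" let ?w' = "\<lambda>t. ip \<Omega> (\<lambda>x. D (t, x)) v"
  have wl: "l2 lborel ?w" "l2 lborel ?w'" unfolding ip_eq by (rule bt_inn_l2[OF Ob U(1) v], rule bt_inn_l2[OF Ob D(1) v])
  have m: "?w \<in> borel_measurable borel" "?w' \<in> borel_measurable borel" using l2_meas[OF wl(1)] l2_meas[OF wl(2)] by auto
  have LU: "AE t in lebesgue_on ?I. L2 \<Omega> (\<lambda>x. U (t, x))" using bt_L2[OF Ob U(1)] by (subst AE_lebesgue_on_iff) (auto elim: eventually_mono)
  have LD: "AE t in lebesgue_on ?I. L2 \<Omega> (\<lambda>x. D (t, x))" using bt_L2[OF Ob D(1)] by (subst AE_lebesgue_on_iff) (auto elim: eventually_mono)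
  have Lphi: "AE t in lebesgue_on ?I. L2 \<Omega> (\<phi> t)"
    using LU U(2) by eventually_elim (rule L2_AE_transfer[OF Ob bt_sec_meas[OF U(1)]])
  have eU: "AE t in lebesgue_on ?I. ?w t = ip \<Omega> (\<phi> t) v"
    using LU Lphi U(2) by eventually_elim (rule ip_cong, use v(2) in auto)
  have eD: "AE t in lebesgue_on ?I. ?w' t = ip \<Omega> (d\<phi> t) v"
    using LD D(2)
  proof eventually_elim
    case (elim t)
    then have "L2 \<Omega> (d\<phi> t)" by (rule L2_AE_transfer[OF Ob bt_sec_meas[OF D(1)]])
    then show ?case using elim v(2) by (intro ip_cong) auto
  qed
  note m1 = lebesgue_on_AE_measurable[OF Il(1) borel_meas_lebesgue_on[OF m(1)] eU]
  note m2 = lebesgue_on_AE_measurable[OF Il(1) borel_meas_lebesgue_on[OF m(2)] eD]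
  have "\<exists>c. AE t in lebesgue_on ?I. ?w t = c + prim ?w' t"
  proof (rule du_Bois_Reymond[OF T wl])
    fix \<zeta> assume z: "test_fun ?I \<zeta>"
    have C: "Cinf_on UNIV \<zeta>" using z by (simp add: test_fun_def)
    have zm: "\<zeta> \<in> borel_measurable (lebesgue_on ?I)" "deriv \<zeta> \<in> borel_measurable (lebesgue_on ?I)"
      using Cinf_cont[OF C] Cinf_pd(2)[OF C, of 1] deriv_eq_pd[OF z]
      by (auto intro!: borel_meas_lebesgue_on borel_measurable_continuous_onI cong: continuous_on_cong)
    have "(LINT t|lebesgue_on ?I. ?w t * deriv \<zeta> t) = (LINT t|lebesgue_on ?I. ip \<Omega> (\<phi> t) v * deriv \<zeta> t)"
      using eU by (intro integral_cong_AE borel_measurable_times zm m1 borel_meas_lebesgue_on m(1)) (auto elim: eventually_mono)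
    also have "\<dots> = - (LINT t|lebesgue_on ?I. ip \<Omega> (d\<phi> t) v * \<zeta> t)"
      using td z v(2) unfolding time_deriv_def by blast
    also have "(LINT t|lebesgue_on ?I. ip \<Omega> (d\<phi> t) v * \<zeta> t) = (LINT t|lebesgue_on ?I. ?w' t * \<zeta> t)"
      using eD by (intro integral_cong_AE borel_measurable_times zm m2 borel_meas_lebesgue_on m(2)) (auto elim: eventually_mono)
    finally show "(LINT t|lebesgue_on ?I. ?w t * deriv \<zeta> t) = - (LINT t|lebesgue_on ?I. ?w' t * \<zeta> t)" .
  qed
  then obtain c where c: "AE t in lebesgue_on ?I. ?w t = c + prim ?w' t" by blast
  obtain N where N: "N \<in> null_sets lborel" "((\<lambda>t. nsq \<Omega> (\<lambda>x. \<phi> t x - \<phi>0 x)) \<longlongrightarrow> 0) (at 0 within (?I - N))"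
    using iv unfolding init_val_def by blast
  have "AE t in lebesgue_on ?I. t \<notin> N"
    using AE_not_in[OF N(1)] by (subst AE_lebesgue_on_iff) (auto elim: eventually_mono)
  then have "AE t in lebesgue_on ?I. t \<notin> N \<and> L2 \<Omega> (\<phi> t) \<and> ?w t = ip \<Omega> (\<phi> t) v \<and> ?w t = c + prim ?w' t"
    using Lphi eU c by eventually_elim simp
  then have aeG: "AE t in lborel. t \<in> ?I \<longrightarrow> t \<notin> N \<and> L2 \<Omega> (\<phi> t) \<and> ?w t = ip \<Omega> (\<phi> t) v \<and> ?w t = c + prim ?w' t"
    unfolding AE_lebesgue_on_iff[OF Il(2)] .
  \<comment> \<open>The times at which all the almost-everywhere statements hold together. They
    accumulate at 0, and along them the coefficient tends both to that of \<phi>0, by the initial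
    condition, and to c, because the primitive is at most sqrt(t S); so c is the initial
    coefficient.\<close>
  define G where "G = {t \<in> ?I - N. L2 \<Omega> (\<phi> t) \<and> ?w t = ip \<Omega> (\<phi> t) v \<and> ?w t = c + prim ?w' t}"
  have Gne: "\<exists>t\<in>G. t < d" if "d > 0" for d
  proof (rule ccontr)
    assume n: "\<not> ?thesis"
    have "AE t in lborel. t \<notin> {0<..<min d T}"
      using aeG by eventually_elim (use n in \<open>auto simp: G_def\<close>)
    then have "{0<..<min d T} \<in> null_sets lborel"
      by (rule AE_iff_null_sets[THEN iffD2, rotated]) simp
    then show False using T that by (simp add: null_sets_def)
  qed
  have nt: "at 0 within G \<noteq> bot"
  proof -
    have "0 islimpt G" unfolding islimpt_approachable
    proof (intro allI impI)
      fix e :: real assume "e > 0"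
      then obtain t where "t \<in> G" "t < e" using Gne by blast
      then show "\<exists>x'\<in>G. x' \<noteq> 0 \<and> dist x' 0 < e" by (intro bexI[of _ t]) (auto simp: G_def)
    qed
    then show ?thesis by (simp add: trivial_limit_within)
  qed
  have l1: "((\<lambda>t. ?w t - ip \<Omega> \<phi>0 v) \<longlongrightarrow> 0) (at 0 within G)"
  proof (rule Lim_null_comparison)
    show "\<forall>\<^sub>F t in at 0 within G. norm (?w t - ip \<Omega> \<phi>0 v) \<le> sqrt (nsq \<Omega> (\<lambda>x. \<phi> t x - \<phi>0 x)) * sqrt (nsq \<Omega> v)"
    proof (rule eventually_at_topological[THEN iffD2], intro exI[of _ UNIV] conjI ballI impI)
      fix t assume "t \<in> G"
      then have t: "L2 \<Omega> (\<phi> t)" "?w t = ip \<Omega> (\<phi> t) v" by (auto simp: G_def)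
      show "norm (?w t - ip \<Omega> \<phi>0 v) \<le> sqrt (nsq \<Omega> (\<lambda>x. \<phi> t x - \<phi>0 x)) * sqrt (nsq \<Omega> v)"
        using inn_CS_abs[of "lebesgue_on \<Omega>" "\<lambda>x. \<phi> t x - \<phi>0 x" v] t p0 v(2)
        by (simp add: L2_eq nsq_eq ip_eq l2_diff inn_diff_left)
    qed auto
    have "((\<lambda>t. sqrt (nsq \<Omega> (\<lambda>x. \<phi> t x - \<phi>0 x)) * sqrt (nsq \<Omega> v)) \<longlongrightarrow> sqrt 0 * sqrt (nsq \<Omega> v)) (at 0 within (?I - N))"
      by (intro tendsto_intros N(2))
    then have "((\<lambda>t. sqrt (nsq \<Omega> (\<lambda>x. \<phi> t x - \<phi>0 x)) * sqrt (nsq \<Omega> v)) \<longlongrightarrow> sqrt 0 * sqrt (nsq \<Omega> v)) (at 0 within G)"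
      by (rule tendsto_within_subset) (auto simp: G_def)
    then show "((\<lambda>t. sqrt (nsq \<Omega> (\<lambda>x. \<phi> t x - \<phi>0 x)) * sqrt (nsq \<Omega> v)) \<longlongrightarrow> 0) (at 0 within G)" by simp
  qed
  have l2: "((\<lambda>t. ?w t - c) \<longlongrightarrow> 0) (at 0 within G)"
  proof (rule Lim_null_comparison)
    let ?S = "LINT s|lborel. (?w' s)\<^sup>2"
    show "\<forall>\<^sub>F t in at 0 within G. norm (?w t - c) \<le> sqrt (t * ?S)"
    proof (rule eventually_at_topological[THEN iffD2], intro exI[of _ UNIV] conjI ballI impI)
      fix t assume "t \<in> G"
      then have t: "0 < t" "?w t - c = prim ?w' t" by (auto simp: G_def)
      show "norm (?w t - c) \<le> sqrt (t * ?S)"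
        unfolding t(2) using prim_bound[OF wl(2), of t] t(1) by (simp add: real_le_rsqrt)
    qed auto
    have "((\<lambda>t. sqrt (t * ?S)) \<longlongrightarrow> sqrt (0 * ?S)) (at 0 within G)" by (intro tendsto_intros)
    then show "((\<lambda>t. sqrt (t * ?S)) \<longlongrightarrow> 0) (at 0 within G)" by simp
  qed
  have "((\<lambda>t. (?w t - ip \<Omega> \<phi>0 v) - (?w t - c)) \<longlongrightarrow> 0 - 0) (at 0 within G)" by (intro tendsto_diff l1 l2)
  then have "((\<lambda>t. c - ip \<Omega> \<phi>0 v) \<longlongrightarrow> 0) (at 0 within G)" by simp
  then have "c - ip \<Omega> \<phi>0 v = 0" using nt by (simp add: tendsto_const_iff)
  then show ?thesis using c by simp
qed

lemma prim_section_meas: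
  assumes "bt \<Omega> T D" shows "(\<lambda>(t, x). prim (\<lambda>s. D (s, x)) t) \<in> borel_measurable (borel \<Otimes>\<^sub>M borel)"
proof -
  note [measurable] = bt_meas_pair[OF assms]
  have e: "(\<lambda>(t, x). prim (\<lambda>s. D (s, x)) t) = (\<lambda>(t, x). LINT s|lborel. of_bool (0 < s \<and> s < t) * D (s, x))"
    unfolding prim_def by (intro ext) (auto intro!: Bochner_Integration.integral_cong simp: indicator_def)
  show ?thesis unfolding e by measurable
qed

lemma prim_section_L2:
  assumes Ob: "\<Omega> \<in> sets borel" and D: "bt \<Omega> T D" and t: "0 \<le> t"
  shows "L2 \<Omega> (\<lambda>x. prim (\<lambda>s. D (s, x)) t)"
proof -
  note [measurable] = bt_meas_pair[OF D]
  have m: "(\<lambda>x. prim (\<lambda>s. D (s, x)) t) \<in> borel_measurable borel"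
    using measurable_compose[OF measurable_Pair1' prim_section_meas[OF D], of t] by simp
  have i: "integrable lborel (\<lambda>x. t * (LINT s|lborel. (D (s, x))\<^sup>2))"
  proof -
    have "integrable (lborel \<Otimes>\<^sub>M lborel) (case_prod (\<lambda>s x. (D (s, x))\<^sup>2))"
      using D by (simp add: bt_def lborel_prod case_prod_unfold)
    from lborel_pair.integrable_snd[OF this] show ?thesis by simp
  qed
  have "integrable lborel (\<lambda>x. (prim (\<lambda>s. D (s, x)) t)\<^sup>2)"
  proof (rule Bochner_Integration.integrable_bound[OF i])
    show "AE x in lborel. norm ((prim (\<lambda>s. D (s, x)) t)\<^sup>2) \<le> norm (t * (LINT s|lborel. (D (s, x))\<^sup>2))"
      using bt_time_sections[OF D]
    proof eventually_elim
      case (elim x)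
      have "(prim (\<lambda>s. D (s, x)) t)\<^sup>2 \<le> t * (LINT s|lborel. (D (s, x))\<^sup>2)" by (rule prim_bound[OF elim t])
      then show ?case by simp
    qed
  qed (use m in measurable)
  then have "l2 lborel (\<lambda>x. prim (\<lambda>s. D (s, x)) t)" using m by (simp add: l2_def)
  then show ?thesis unfolding L2_eq by (rule l2_restrict[OF _ Ob])
qed

text \<open>Fubini: taking the primitive in time commutes with pairing in space.\<close>

lemma prim_section_inn:
  assumes Ob[measurable]: "\<Omega> \<in> sets borel" and D: "bt \<Omega> T D" and t: "0 \<le> t" and v[measurable]: "v \<in> borel_measurable borel" and vL: "L2 \<Omega> v"
  shows "ip \<Omega> (\<lambda>x. prim (\<lambda>s. D (s, x)) t) v = prim (\<lambda>s. ip \<Omega> (\<lambda>x. D (s, x)) v) t"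
proof -
  note Dm[measurable] = bt_meas_pair[OF D]
  have [measurable]: "(\<lambda>x. prim (\<lambda>s. D (s, x)) t) \<in> borel_measurable borel"
    using measurable_compose[OF measurable_Pair1' prim_section_meas[OF D], of t] by simp
  let ?F = "\<lambda>s x. of_bool (0 < s \<and> s < t) * (D (s, x) * (indicator \<Omega> x * v x))"
  have "integrable lborel (\<lambda>x. (indicator \<Omega> x * v x)\<^sup>2)"
    using vL integrable_lebesgue_on[OF Ob, of "\<lambda>x. (v x)\<^sup>2"]
    by (simp add: L2_def power_mult_distrib power2_eq_square[of "indicator \<Omega> _"] flip: indicator_inter_arith)
  then have vl: "l2 lborel (\<lambda>x. indicator \<Omega> x * v x)" by (simp add: l2_def)
  have "l2 lborel D" using D by (simp add: bt_def l2_def)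
  from l2_mult[OF this l2_product[OF indicator_l2 vl, of 0 t]]
  have "integrable (lborel \<Otimes>\<^sub>M lborel) (\<lambda>p. D p * (indicator {0<..<t} (fst p) * (indicator \<Omega> (snd p) * v (snd p))))"
    by (simp add: lborel_prod)
  also have "(\<lambda>p. D p * (indicator {0<..<t} (fst p) * (indicator \<Omega> (snd p) * v (snd p)))) = case_prod ?F"
    by (auto simp: fun_eq_iff indicator_def)
  finally have Fi: "integrable (lborel \<Otimes>\<^sub>M lborel) (case_prod ?F)" .
  have "ip \<Omega> (\<lambda>x. prim (\<lambda>s. D (s, x)) t) v = (LINT x|lborel. indicator \<Omega> x * (prim (\<lambda>s. D (s, x)) t * v x))"
    unfolding ip_def by (rule integral_lebesgue_on[OF Ob]) measurable
  also have "\<dots> = (LINT x|lborel. LINT s|lborel. ?F s x)"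
  proof (rule Bochner_Integration.integral_cong[OF refl])
    fix x
    have "(LINT s|lborel. ?F s x) = (LINT s|lborel. (indicator \<Omega> x * v x) * (indicator {0<..<t} s * D (s, x)))"
      by (rule Bochner_Integration.integral_cong) (auto simp: indicator_def)
    then show "indicator \<Omega> x * (prim (\<lambda>s. D (s, x)) t * v x) = (LINT s|lborel. ?F s x)" by (simp add: prim_def)
  qed
  also have "\<dots> = (LINT s|lborel. LINT x|lborel. ?F s x)"
    by (rule lborel_pair.Fubini_integral[OF Fi])
  also have "\<dots> = prim (\<lambda>s. ip \<Omega> (\<lambda>x. D (s, x)) v) t"
    unfolding prim_def
  proof (rule Bochner_Integration.integral_cong[OF refl])
    fix s
    have "ip \<Omega> (\<lambda>x. D (s, x)) v = (LINT x|lborel. indicator \<Omega> x * (D (s, x) * v x))"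
      unfolding ip_def by (rule integral_lebesgue_on[OF Ob]) measurable
    moreover have "(LINT x|lborel. ?F s x) = (LINT x|lborel. indicator {0<..<t} s * (indicator \<Omega> x * (D (s, x) * v x)))"
      by (rule Bochner_Integration.integral_cong) (auto simp: indicator_def)
    ultimately show "(LINT x|lborel. ?F s x) = indicator {0<..<t} s * ip \<Omega> (\<lambda>x. D (s, x)) v" by simp
  qed
  finally show ?thesis .
qed

text \<open>The identity is known for each Fourier coefficient with its own exceptional set of
  times. Countably many coefficients give one common null set, and completeness of the system turns
  equality of coefficients into equality almost everywhere in x.\<close>

lemma pointwise_primitive:
  assumes Om: "open \<Omega>" and T: "T > 0" and onb: "onb (lebesgue_on \<Omega>) e"
    and U: "bt \<Omega> T U" "AE t in lebesgue_on {0<..<T}. AE x in lebesgue_on \<Omega>. \<phi> t x = U (t, x)"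
    and D: "bt \<Omega> T D" "AE t in lebesgue_on {0<..<T}. AE x in lebesgue_on \<Omega>. d\<phi> t x = D (t, x)"
    and td: "time_deriv \<Omega> T \<phi> d\<phi>" and iv: "init_val \<Omega> T \<phi> \<phi>0"
    and p0: "L2 \<Omega> \<phi>0" "P0 \<in> borel_measurable borel" "AE x in lebesgue_on \<Omega>. \<phi>0 x = P0 x"
  shows "AE t in lebesgue_on {0<..<T}. AE x in lebesgue_on \<Omega>. U (t, x) = P0 x + prim (\<lambda>s. D (s, x)) t"
proof -
  interpret onb "lebesgue_on \<Omega>" e by (rule onb)
  let ?M = "lebesgue_on \<Omega>"
  have Ob: "\<Omega> \<in> sets borel" using Om by auto
  have P0L: "L2 \<Omega> P0"
    using l2_cong_AE[of ?M \<phi>0 P0] p0 borel_meas_lebesgue_on[OF p0(2)] by (simp add: L2_eq)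
  have er: "rep \<Omega> (e j) \<in> borel_measurable borel" "AE x in ?M. e j x = rep \<Omega> (e j) x" for j
    using rep[OF Ob l2_meas[OF e_l2]] by auto
  have erL: "L2 \<Omega> (rep \<Omega> (e j))" for j
    using l2_cong_AE[OF e_l2 borel_meas_lebesgue_on[OF er(1)] er(2)] by (simp add: L2_eq)
  have ipe: "ip \<Omega> u (rep \<Omega> (e j)) = ip \<Omega> u (e j)" if "L2 \<Omega> u" for u j
    using that erL er(2)[of j] by (intro ip_cong) (auto simp: L2_eq e_l2)
  have "AE t in lebesgue_on {0<..<T}. \<forall>j. ip \<Omega> (\<lambda>x. U (t, x)) (rep \<Omega> (e j)) = ip \<Omega> \<phi>0 (rep \<Omega> (e j)) + prim (\<lambda>s. ip \<Omega> (\<lambda>x. D (s, x)) (rep \<Omega> (e j))) t"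
    using coefficient_primitive[OF Om T U D td iv p0(1) er(1) erL] by (simp add: AE_all_countable)
  moreover have "AE t in lebesgue_on {0<..<T}. L2 \<Omega> (\<lambda>x. U (t, x))"
    using bt_L2[OF Ob U(1)] by (subst AE_lebesgue_on_iff) (auto elim: eventually_mono)
  moreover have "AE t in lebesgue_on {0<..<T}. 0 < t" by (subst AE_lebesgue_on_iff) auto
  ultimately show ?thesis
  proof eventually_elim
    case (elim t)
    have L: "L2 \<Omega> (\<lambda>x. prim (\<lambda>s. D (s, x)) t)" using elim(3) by (intro prim_section_L2[OF Ob D(1)]) simp
    have Ls: "l2 ?M (\<lambda>x. P0 x + prim (\<lambda>s. D (s, x)) t)" using P0L L by (simp add: L2_eq l2_add)
    show ?case
    proof (rule AE_eq_coef)
      show "l2 ?M (\<lambda>x. U (t, x))" using elim(2) by (simp add: L2_eq)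
      show "l2 ?M (\<lambda>x. P0 x + prim (\<lambda>s. D (s, x)) t)" by (rule Ls)
      fix j
      have "ip \<Omega> (\<lambda>x. U (t, x)) (e j) = ip \<Omega> \<phi>0 (rep \<Omega> (e j)) + ip \<Omega> (\<lambda>x. prim (\<lambda>s. D (s, x)) t) (rep \<Omega> (e j))"
        using elim(1,3) ipe[OF elim(2), of j] prim_section_inn[OF Ob D(1) _ er(1) erL, of t j] by simp
      also have "ip \<Omega> \<phi>0 (rep \<Omega> (e j)) = ip \<Omega> P0 (rep \<Omega> (e j))"
        using p0 P0L erL by (intro ip_cong) auto
      also have "ip \<Omega> P0 (rep \<Omega> (e j)) + ip \<Omega> (\<lambda>x. prim (\<lambda>s. D (s, x)) t) (rep \<Omega> (e j))
          = ip \<Omega> (\<lambda>x. P0 x + prim (\<lambda>s. D (s, x)) t) (rep \<Omega> (e j))"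
        using inn_add_left[of ?M P0 "\<lambda>x. prim (\<lambda>s. D (s, x)) t" "rep \<Omega> (e j)"] P0L L erL by (simp add: L2_eq ip_eq)
      also have "\<dots> = ip \<Omega> (\<lambda>x. P0 x + prim (\<lambda>s. D (s, x)) t) (e j)"
        by (rule ipe) (use Ls in \<open>simp add: L2_eq\<close>)
      finally show "inn ?M (\<lambda>x. U (t, x)) (e j) = inn ?M (\<lambda>x. P0 x + prim (\<lambda>s. D (s, x)) t) (e j)"
        by (simp add: ip_eq)
    qed
  qed
qed

section \<open>From the variational inequality to the inclusion\<close>

text \<open>Separability of any set S seen through countably many real coordinates: pick one element
  of S in each nonempty cylinder with finitely many rational centres. No topology on S is needed,
  and quantities that are merely lower semicontinuous may serve as coordinates.\<close>

lemma countable_coordinate_dense: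
  fixes d :: "'a \<Rightarrow> nat \<Rightarrow> real"
  shows "\<exists>C\<subseteq>S. countable C \<and> (\<forall>x\<in>S. \<exists>c. (\<forall>n. c n \<in> C) \<and> (\<forall>k. (\<lambda>n. d (c n) k) \<longlonglongrightarrow> d x k))"
proof -
  \<comment> \<open>At level n only the first n coordinates are constrained, with precision 1/(n +
    1); each fixed coordinate is controlled from some level on.\<close>
  define good where "good n q y \<longleftrightarrow> y \<in> S \<and> (\<forall>k<n. \<bar>d y k - of_rat (q ! k)\<bar> < inverse (real (Suc n)))"
    for n and q :: "rat list" and y
  define pick where "pick z = (SOME y. good (fst z) (snd z) y)" for z
  let ?C = "pick ` {z. \<exists>y. good (fst z) (snd z) y}"
  have pg: "good (fst z) (snd z) (pick z)" if "\<exists>y. good (fst z) (snd z) y" for z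
    unfolding pick_def by (rule someI_ex[OF that])
  have "\<exists>c. (\<forall>n. c n \<in> ?C) \<and> (\<forall>k. (\<lambda>n. d (c n) k) \<longlonglongrightarrow> d x k)" if x: "x \<in> S" for x
  proof -
    have "\<exists>q. good n q x" for n
    proof -
      have "\<exists>r. \<bar>d x k - of_rat r\<bar> < inverse (real (Suc n))" for k
      proof -
        have "d x k - inverse (real (Suc n)) < d x k" by simp
        from of_rat_dense[OF this] obtain r where "d x k - inverse (real (Suc n)) < of_rat r" "of_rat r < d x k" by blast
        then show ?thesis by (intro exI[of _ r]) (simp only: abs_less_iff, linarith)
      qed
      then obtain r where "\<And>k. \<bar>d x k - of_rat (r k)\<bar> < inverse (real (Suc n))" by metis
      then show ?thesis using x by (intro exI[of _ "map r [0..<n]"]) (simp add: good_def)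
    qed
    then obtain q where q: "\<And>n. good n (q n) x" by metis
    define c where "c n = pick (n, q n)" for n
    have g: "good n (q n) (c n)" for n using pg[of "(n, q n)"] q by (auto simp: c_def)
    have "c n \<in> ?C" for n unfolding c_def using q by (intro imageI) auto
    moreover have "(\<lambda>n. d (c n) k) \<longlonglongrightarrow> d x k" for k
    proof (rule LIM_zero_cancel, rule Lim_null_comparison)
      show "\<forall>\<^sub>F n in sequentially. norm (d (c n) k - d x k) \<le> 2 * inverse (real (Suc n))"
      proof (rule eventually_sequentiallyI[of "Suc k"])
        fix n assume "Suc k \<le> n"
        then have "\<bar>d (c n) k - of_rat (q n ! k)\<bar> < inverse (real (Suc n))" "\<bar>d x k - of_rat (q n ! k)\<bar> < inverse (real (Suc n))"
          using g[of n] q[of n] by (auto simp: good_def)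
        then show "norm (d (c n) k - d x k) \<le> 2 * inverse (real (Suc n))" unfolding real_norm_def by linarith
      qed
      have "(\<lambda>n. 2 * inverse (real (Suc n))) \<longlonglongrightarrow> 2 * 0" by (intro tendsto_intros LIMSEQ_inverse_real_of_nat)
      then show "(\<lambda>n. 2 * inverse (real (Suc n))) \<longlonglongrightarrow> 0" by simp
    qed
    ultimately show ?thesis by blast
  qed
  moreover have "?C \<subseteq> S" using pg by (auto simp: good_def)
  moreover have "countable ?C" by (intro countable_image) (rule countableI_type)
  ultimately show ?thesis by blast
qed

section \<open>The convex integral functional\<close>

lemma bh_meas: assumes "bhat_ok bh" shows "(\<lambda>s. e2ennreal (bh s)) \<in> borel_measurable borel"
proof -
  have "bh \<in> borel_measurable borel"
  proof (rule borel_measurableI_le)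
    fix y
    have "closed {s. bh s \<le> y}"
    proof (cases y)
      case (real c) then show ?thesis using assms by (simp add: bhat_ok_def)
    next
      case MInf
      have "0 \<le> bh s" for s using assms by (simp add: bhat_ok_def)
      then have "{s. bh s \<le> y} = {}" using MInf by (auto simp: ereal_infty_less_eq2)
      then show ?thesis by simp
    qed simp
    then show "{x \<in> space borel. bh x \<le> y} \<in> sets borel" by simp
  qed
  then show ?thesis by measurable
qed

lemma intB_nonneg: "0 \<le> intB \<Omega> bh v"
  unfolding intB_def by (rule enn2ereal_nonneg)

lemma bh_nonneg: "bhat_ok bh \<Longrightarrow> 0 \<le> bh s"
  by (simp add: bhat_ok_def)

lemma intB_zero: assumes "bhat_ok bh" shows "intB \<Omega> bh (\<lambda>x. 0) = 0"
  using assms by (simp add: intB_def bhat_ok_def zero_ennreal.rep_eq zero_ennreal.abs_eq[symmetric])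

lemma intB_finite:
  assumes bh: "bhat_ok bh" and v: "v \<in> borel_measurable (lebesgue_on \<Omega>)" and fin: "intB \<Omega> bh v < \<infinity>"
  shows "AE x in lebesgue_on \<Omega>. bh (v x) \<noteq> \<infinity>" "integrable (lebesgue_on \<Omega>) (\<lambda>x. real_of_ereal (bh (v x)))"
    "intB \<Omega> bh v = ereal (LINT x|lebesgue_on \<Omega>. real_of_ereal (bh (v x)))"
proof -
  let ?M = "lebesgue_on \<Omega>"
  note bm[measurable] = bh_meas[OF bh]
  have m: "(\<lambda>x. e2ennreal (bh (v x))) \<in> borel_measurable ?M" by (rule measurable_compose[OF v bm])
  have f: "(\<integral>\<^sup>+x. e2ennreal (bh (v x)) \<partial>?M) \<noteq> \<infinity>"
    using fin unfolding intB_def by (auto simp: less_ennreal.rep_eq top_ereal_def)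
  have ae: "AE x in ?M. e2ennreal (bh (v x)) \<noteq> \<infinity>"
    by (rule nn_integral_PInf_AE[OF m f])
  then show ae': "AE x in ?M. bh (v x) \<noteq> \<infinity>"
    by eventually_elim auto
  have e: "AE x in ?M. e2ennreal (bh (v x)) = ennreal (real_of_ereal (bh (v x)))"
    using ae'
  proof eventually_elim
    case (elim x)
    then have "bh (v x) = ereal (real_of_ereal (bh (v x)))" using bh_nonneg[OF bh, of "v x"] by (cases "bh (v x)") auto
    then show ?case by (metis e2ennreal_ereal)
  qed
  have rm: "(\<lambda>x. real_of_ereal (bh (v x))) \<in> borel_measurable ?M"
  proof -
    have "(\<lambda>x. enn2real (e2ennreal (bh (v x)))) \<in> borel_measurable ?M" using m by measurable
    moreover have "enn2real (e2ennreal (bh s)) = real_of_ereal (bh s)" for s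
      using bh_nonneg[OF bh, of s] by (simp add: enn2real_def enn2ereal_e2ennreal)
    ultimately show ?thesis by simp
  qed
  have nn: "0 \<le> real_of_ereal (bh s)" for s using bh_nonneg[OF bh, of s] by (rule real_of_ereal_pos)
  have n: "(\<integral>\<^sup>+x. ennreal (real_of_ereal (bh (v x))) \<partial>?M) = (\<integral>\<^sup>+x. e2ennreal (bh (v x)) \<partial>?M)"
    using e by (intro nn_integral_cong_AE) auto
  show i: "integrable ?M (\<lambda>x. real_of_ereal (bh (v x)))"
    using f by (intro integrableI_nonneg[OF rm]) (auto simp: nn n less_top)
  have "(\<integral>\<^sup>+x. e2ennreal (bh (v x)) \<partial>?M) = ennreal (LINT x|?M. real_of_ereal (bh (v x)))"
    using nn_integral_eq_integral[OF i] nn n by simp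
  then show "intB \<Omega> bh v = ereal (LINT x|?M. real_of_ereal (bh (v x)))"
    unfolding intB_def using nn by (simp add: enn2ereal_ennreal integral_nonneg_AE)
qed

lemma intB_eq:
  assumes bh: "bhat_ok bh" and ae: "AE x in lebesgue_on \<Omega>. bh (v x) \<noteq> \<infinity>"
    and i: "integrable (lebesgue_on \<Omega>) (\<lambda>x. real_of_ereal (bh (v x)))"
  shows "intB \<Omega> bh v = ereal (LINT x|lebesgue_on \<Omega>. real_of_ereal (bh (v x)))"
proof -
  let ?M = "lebesgue_on \<Omega>"
  have nn: "0 \<le> real_of_ereal (bh s)" for s using bh_nonneg[OF bh, of s] by (rule real_of_ereal_pos)
  have "AE x in ?M. e2ennreal (bh (v x)) = ennreal (real_of_ereal (bh (v x)))"
    using ae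
  proof eventually_elim
    case (elim x)
    then have "bh (v x) = ereal (real_of_ereal (bh (v x)))" using bh_nonneg[OF bh, of "v x"] by (cases "bh (v x)") auto
    then show ?case by (metis e2ennreal_ereal)
  qed
  then have "(\<integral>\<^sup>+x. e2ennreal (bh (v x)) \<partial>?M) = (\<integral>\<^sup>+x. ennreal (real_of_ereal (bh (v x))) \<partial>?M)"
    by (rule nn_integral_cong_AE)
  also have "\<dots> = ennreal (LINT x|?M. real_of_ereal (bh (v x)))"
    using nn_integral_eq_integral[OF i] nn by simp
  finally show ?thesis unfolding intB_def using nn by (simp add: enn2ereal_ennreal integral_nonneg_AE)
qed

text \<open>The exceptional null set of the variational inequality depends on the test function; a countable
  set of test functions that is dense in the epigraph topology suffices.\<close>

lemma vi_all_tests: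
  assumes onb: "onb (lebesgue_on \<Omega>) e"
    and vi: "\<And>v. L2 \<Omega> v \<Longrightarrow> AE t in Tm. intB \<Omega> bh (p t) \<le> ereal (ip \<Omega> (\<xi> t) (\<lambda>x. p t x - v x)) + intB \<Omega> bh v"
    and L: "AE t in Tm. L2 \<Omega> (\<xi> t)" "AE t in Tm. L2 \<Omega> (p t)"
  shows "AE t in Tm. \<forall>v. L2 \<Omega> v \<longrightarrow> intB \<Omega> bh (p t) \<le> ereal (ip \<Omega> (\<xi> t) (\<lambda>x. p t x - v x)) + intB \<Omega> bh v"
proof -
  let ?M = "lebesgue_on \<Omega>"
  interpret onb ?M e by (rule onb)
  define S where "S = {v. L2 \<Omega> v \<and> intB \<Omega> bh v < \<infinity>}"
  \<comment> \<open>Coordinate 0 is the squared norm, coordinate 1 the convex functional, and the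
    rest are the Fourier coefficients. Convergence of all of them means strong convergence of the
    test functions together with convergence of the functional, just what the inequality needs to
    pass to the limit.\<close>
  define d where "d v k = (if k = 0 then nsq \<Omega> v else if k = 1 then real_of_ereal (intB \<Omega> bh v) else ip \<Omega> v (e (k - 2)))" for v and k :: nat
  obtain C where C: "C \<subseteq> S" "countable C" "\<And>v. v \<in> S \<Longrightarrow> \<exists>c. (\<forall>n. c n \<in> C) \<and> (\<forall>k. (\<lambda>n. d (c n) k) \<longlonglongrightarrow> d v k)"
    using countable_coordinate_dense[of S d] by blast
  have "AE t in Tm. \<forall>v\<in>C. intB \<Omega> bh (p t) \<le> ereal (ip \<Omega> (\<xi> t) (\<lambda>x. p t x - v x)) + intB \<Omega> bh v"
    using C(1,2) vi by (subst AE_ball_countable) (auto simp: S_def)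
  then show ?thesis using L
  proof eventually_elim
    case (elim t)
    have l: "l2 ?M (\<xi> t)" "l2 ?M (p t)" using elim by (auto simp: L2_eq)
    show ?case
    proof (intro allI impI)
      fix v assume v: "L2 \<Omega> v"
      then have vl: "l2 ?M v" by (simp add: L2_eq)
      show "intB \<Omega> bh (p t) \<le> ereal (ip \<Omega> (\<xi> t) (\<lambda>x. p t x - v x)) + intB \<Omega> bh v"
      proof (cases "intB \<Omega> bh v < \<infinity>")
        case False
        then have "intB \<Omega> bh v = \<infinity>" by simp
        then show ?thesis by simp
      next
        case True
        then have "v \<in> S" using v by (simp add: S_def)
        then obtain c where c: "\<And>n. c n \<in> C" "\<And>k. (\<lambda>n. d (c n) k) \<longlonglongrightarrow> d v k" using C(3) by blast
        have cS: "L2 \<Omega> (c n)" "intB \<Omega> bh (c n) < \<infinity>" for n using c(1)[of n] C(1) by (auto simp: S_def)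
        have cl: "l2 ?M (c n)" for n using cS(1) by (simp add: L2_eq)
        have conv: "l2conv ?M c v"
        proof (rule l2conv_from_coef[OF cl vl])
          show "(\<lambda>n. inn ?M (c n) (e j)) \<longlonglongrightarrow> inn ?M v (e j)" for j
            using c(2)[of "j + 2"] by (simp add: d_def ip_eq)
          show "(\<lambda>n. sqnorm ?M (c n)) \<longlonglongrightarrow> sqnorm ?M v"
            using c(2)[of 0] by (simp add: d_def nsq_eq)
        qed
        have re: "intB \<Omega> bh w = ereal (real_of_ereal (intB \<Omega> bh w))" if "intB \<Omega> bh w < \<infinity>" for w
          using that intB_nonneg[of \<Omega> bh w] by (cases "intB \<Omega> bh w") auto
        have ex: "ip \<Omega> (\<xi> t) (\<lambda>x. p t x - w x) = inn ?M (p t) (\<xi> t) - inn ?M w (\<xi> t)" if "l2 ?M w" for w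
          using inn_diff_right[OF l(2) that l(1)] by (simp add: ip_eq inn_commute)
        have "(\<lambda>n. (inn ?M (p t) (\<xi> t) - inn ?M (c n) (\<xi> t)) + real_of_ereal (intB \<Omega> bh (c n)))
           \<longlonglongrightarrow> (inn ?M (p t) (\<xi> t) - inn ?M v (\<xi> t)) + real_of_ereal (intB \<Omega> bh v)"
        proof -
          have "(\<lambda>n. real_of_ereal (intB \<Omega> bh (c n))) \<longlonglongrightarrow> real_of_ereal (intB \<Omega> bh v)"
            using c(2)[of 1] by (simp add: d_def)
          then show ?thesis by (intro tendsto_add tendsto_diff tendsto_const inn_tendsto[OF conv l(1)])
        qed
        then have lim: "(\<lambda>n. ereal ((inn ?M (p t) (\<xi> t) - inn ?M (c n) (\<xi> t)) + real_of_ereal (intB \<Omega> bh (c n))))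
           \<longlonglongrightarrow> ereal ((inn ?M (p t) (\<xi> t) - inn ?M v (\<xi> t)) + real_of_ereal (intB \<Omega> bh v))"
          by (rule tendsto_ereal)
        have "intB \<Omega> bh (p t) \<le> ereal ((inn ?M (p t) (\<xi> t) - inn ?M (c n) (\<xi> t)) + real_of_ereal (intB \<Omega> bh (c n)))" for n
          using elim(1) c(1)[of n] re[OF cS(2)] ex[OF cl] by (metis plus_ereal.simps(1))
        then have "intB \<Omega> bh (p t) \<le> ereal ((inn ?M (p t) (\<xi> t) - inn ?M v (\<xi> t)) + real_of_ereal (intB \<Omega> bh v))"
          by (intro LIMSEQ_le_const[OF lim]) auto
        then show ?thesis using re[OF True] ex[OF vl] by (metis plus_ereal.simps(1))
      qed
    qed
  qed
qed

text \<open>Localization: replace \<open>p\<close> by a constant \<open>z\<close> on the set where the pointwise inequality fails.\<close>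

lemma vi_subdiff:
  assumes Om: "open \<Omega>" "bounded \<Omega>" and bh: "bhat_ok bh" and p: "L2 \<Omega> p" and xi: "L2 \<Omega> \<xi>"
    and vi: "\<And>v. L2 \<Omega> v \<Longrightarrow> intB \<Omega> bh p \<le> ereal (ip \<Omega> \<xi> (\<lambda>x. p x - v x)) + intB \<Omega> bh v"
  shows "AE x in lebesgue_on \<Omega>. subdiff bh (p x) (\<xi> x)"
proof -
  let ?M = "lebesgue_on \<Omega>"
  let ?r = "\<lambda>s. real_of_ereal (bh s)"
  have Ob: "\<Omega> \<in> sets borel" using Om by auto
  have pl: "l2 ?M p" and xl: "l2 ?M \<xi>" using p xi by (auto simp: L2_eq)
  note [measurable] = l2_meas[OF pl] l2_meas[OF xl]
  have one: "l2 ?M (\<lambda>x. c)" for c by (rule const_l2[OF Om(2) Ob])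
  \<comment> \<open>The test function 0 is admissible with functional value 0, which makes the
    functional finite at p.\<close>
  have "intB \<Omega> bh p \<le> ereal (ip \<Omega> \<xi> (\<lambda>x. p x - 0)) + 0"
    using vi[of "\<lambda>x. 0"] one[of 0] intB_zero[OF bh] by (simp add: L2_eq)
  then have "intB \<Omega> bh p < \<infinity>" by (auto simp: less_top intro: le_less_trans)
  note pf = intB_finite[OF bh l2_meas[OF pl] this]
  have nonn: "0 \<le> ?r s" for s using bh_nonneg[OF bh, of s] by (rule real_of_ereal_pos)
  have key: "AE x in ?M. ?r (p x) + \<xi> x * (z - p x) \<le> ?r z" if z: "bh z \<noteq> \<infinity>" for z
  proof -
    define h where "h x = ?r (p x) + \<xi> x * (z - p x) - ?r z" for x
    have zp: "l2 ?M (\<lambda>x. z - p x)" by (rule l2_diff[OF one pl])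
    have hi: "integrable ?M h" unfolding h_def
      using pf(2) l2_mult[OF xl zp] l2_mult[OF one[of "?r z"] one[of 1]] by simp
    have [measurable]: "h \<in> borel_measurable ?M" using hi by simp
    define A where "A = {x \<in> space ?M. 0 < h x}"
    have Am[measurable]: "A \<in> sets ?M" unfolding A_def by measurable
    define v where "v x = (if x \<in> A then z else p x)" for x
    have vm: "v \<in> borel_measurable ?M" unfolding v_def by measurable
    have vl: "l2 ?M v"
    proof -
      have "l2 ?M (\<lambda>x. \<bar>z\<bar> + \<bar>p x\<bar>)"
        using l2_dominated[OF pl, of "\<lambda>x. \<bar>p x\<bar>"] by (intro l2_add one) auto
      then show ?thesis by (rule l2_dominated[OF _ vm]) (auto simp: v_def)
    qed
    have ri: "integrable ?M (\<lambda>x. ?r (v x))"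
    proof -
      have "integrable ?M (\<lambda>x. indicator A x * ?r z + indicator (- A) x * ?r (p x))"
      proof (rule Bochner_Integration.integrable_add)
        show "integrable ?M (\<lambda>x. indicator A x * ?r z)"
          using integrable_mult_indicator[OF Am, of "\<lambda>x. ?r z"] l2_mult[OF one[of "?r z"] one[of 1]] by simp
        have "integrable ?M (\<lambda>x. ?r (p x) - indicator A x * ?r (p x))"
          using integrable_mult_indicator[OF Am pf(2)] pf(2) by simp
        then show "integrable ?M (\<lambda>x. indicator (- A) x * ?r (p x))"
          by (rule Bochner_Integration.integrable_cong[THEN iffD1, rotated 2]) (auto simp: indicator_def)
      qed
      then show ?thesis
        by (rule Bochner_Integration.integrable_cong[THEN iffD1, rotated 2]) (auto simp: indicator_def v_def)
    qed
    have "AE x in ?M. bh (v x) \<noteq> \<infinity>" using pf(1) by eventually_elim (auto simp: v_def z)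
    note vB = intB_eq[OF bh this ri]
    have dl: "l2 ?M (\<lambda>x. p x - v x)" by (rule l2_diff[OF pl vl])
    have "intB \<Omega> bh p \<le> ereal (ip \<Omega> \<xi> (\<lambda>x. p x - v x)) + intB \<Omega> bh v"
      using vl by (intro vi) (simp add: L2_eq)
    then have "(LINT x|?M. ?r (p x)) \<le> (LINT x|?M. \<xi> x * (p x - v x)) + (LINT x|?M. ?r (v x))"
      unfolding pf(3) vB by (simp add: ip_def)
    then have "(LINT x|?M. ?r (p x) - \<xi> x * (p x - v x) - ?r (v x)) \<le> 0"
      using pf(2) ri l2_mult[OF xl dl] by simp
    moreover have "(LINT x|?M. ?r (p x) - \<xi> x * (p x - v x) - ?r (v x)) = (LINT x|?M. indicator A x * h x)"
      by (rule Bochner_Integration.integral_cong) (auto simp: v_def h_def indicator_def algebra_simps)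
    \<comment> \<open>Outside \<open>A\<close> the test function equals p and nothing remains of the
      inequality; on \<open>A\<close> the integrand h is positive by definition, so a nonpositive
      integral forces it to vanish almost everywhere there.\<close>
    ultimately have le: "(LINT x|?M. indicator A x * h x) \<le> 0" by simp
    have nn: "0 \<le> indicator A x * h x" for x by (auto simp: A_def indicator_def)
    have ii: "integrable ?M (\<lambda>x. indicator A x * h x)" using integrable_mult_indicator[OF Am hi] by simp
    have "(LINT x|?M. indicator A x * h x) = 0" by (intro antisym le integral_nonneg_AE) (simp add: nn)
    then have "AE x in ?M. indicator A x * h x = 0"
      using integral_nonneg_eq_0_iff_AE[OF ii] nn by simp
    moreover have "AE x in ?M. x \<in> space ?M" by (rule AE_space)
    ultimately show ?thesis
      by eventually_elim (auto simp: A_def h_def indicator_def not_less split: if_splits)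
  qed
  \<comment> \<open>The exceptional set in x still depends on z. Countably many z suffice if they
    are dense together with their values of \<open>bh\<close>, since \<open>bh\<close> itself need
    not be continuous.\<close>
  define d where "d z k = (if k = 0 then z else ?r z)" for z and k :: nat
  obtain C where C: "C \<subseteq> {z. bh z \<noteq> \<infinity>}" "countable C"
    "\<And>z. bh z \<noteq> \<infinity> \<Longrightarrow> \<exists>c. (\<forall>n. c n \<in> C) \<and> (\<forall>k. (\<lambda>n. d (c n) k) \<longlonglongrightarrow> d z k)"
    using countable_coordinate_dense[of "{z. bh z \<noteq> \<infinity>}" d] by blast
  have "AE x in ?M. \<forall>z\<in>C. ?r (p x) + \<xi> x * (z - p x) \<le> ?r z"
    using C(1,2) key by (subst AE_ball_countable) auto
  then show ?thesis using pf(1)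
  proof eventually_elim
    case (elim x)
    have fin: "bh s = ereal (?r s)" if "bh s \<noteq> \<infinity>" for s
      using that bh_nonneg[OF bh, of s] by (cases "bh s") auto
    show ?case unfolding subdiff_def
    proof (intro conjI allI)
      show "bh (p x) \<noteq> \<infinity>" by (rule elim(2))
      fix z
      show "bh (p x) + ereal (\<xi> x * (z - p x)) \<le> bh z"
      proof (cases "bh z = \<infinity>")
        case False
        then obtain c where c: "\<And>n. c n \<in> C" "\<And>k. (\<lambda>n. d (c n) k) \<longlonglongrightarrow> d z k" using C(3) by blast
        have "c \<longlonglongrightarrow> z" "(\<lambda>n. ?r (c n)) \<longlonglongrightarrow> ?r z" using c(2)[of 0] c(2)[of 1] by (auto simp: d_def)
        then have "?r (p x) + \<xi> x * (z - p x) \<le> ?r z"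
        proof (elim LIMSEQ_le[rotated])
          assume "c \<longlonglongrightarrow> z"
          then show "(\<lambda>n. ?r (p x) + \<xi> x * (c n - p x)) \<longlonglongrightarrow> ?r (p x) + \<xi> x * (z - p x)"
            by (intro tendsto_add tendsto_mult tendsto_diff tendsto_const)
          show "\<exists>N. \<forall>n\<ge>N. ?r (p x) + \<xi> x * (c n - p x) \<le> ?r (c n)" using elim(1) c(1) by auto
        qed
        then show ?thesis using fin[OF elim(2)] fin[OF False] by (metis ereal_less_eq(3) plus_ereal.simps(1))
      qed simp
    qed
  qed
qed

lemma lipschitz_comp_L2:
  assumes Om: "open \<Omega>" "bounded \<Omega>" and lip: "\<exists>L. \<forall>x y. \<bar>\<pi> x - \<pi> y\<bar> \<le> L * \<bar>x - y\<bar>" and u: "L2 \<Omega> u"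
  shows "L2 \<Omega> (\<lambda>x. \<pi> (u x))"
proof -
  let ?M = "lebesgue_on \<Omega>"
  obtain L where L: "\<And>x y. \<bar>\<pi> x - \<pi> y\<bar> \<le> L * \<bar>x - y\<bar>" using lip by blast
  have Ob: "\<Omega> \<in> sets borel" using Om by auto
  have ul: "l2 ?M u" using u by (simp add: L2_eq)
  have pm: "\<pi> \<in> borel_measurable borel"
  proof (rule borel_measurable_continuous_onI, rule lipschitz_on_continuous_on, rule lipschitz_onI)
    show "dist (\<pi> x) (\<pi> y) \<le> \<bar>L\<bar> * dist x y" for x y
      using L[of x y] mult_right_mono[OF abs_ge_self[of L], of "\<bar>x - y\<bar>"] by (simp add: dist_real_def)
  qed simp
  have one: "l2 ?M (\<lambda>x. c)" for c by (rule const_l2[OF Om(2) Ob])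
  have "l2 ?M (\<lambda>x. \<bar>\<pi> 0\<bar> + L * \<bar>u x\<bar>)"
    using l2_dominated[OF ul, of "\<lambda>x. \<bar>u x\<bar>"] l2_meas[OF ul] by (intro l2_add one l2_scale) auto
  then show ?thesis unfolding L2_eq
  proof (rule l2_dominated)
    show "(\<lambda>x. \<pi> (u x)) \<in> borel_measurable ?M" by (rule measurable_compose[OF l2_meas[OF ul] pm])
    show "AE x in ?M. \<bar>\<pi> (u x)\<bar> \<le> \<bar>\<bar>\<pi> 0\<bar> + L * \<bar>u x\<bar>\<bar>"
    proof (intro AE_I2)
      fix x show "\<bar>\<pi> (u x)\<bar> \<le> \<bar>\<bar>\<pi> 0\<bar> + L * \<bar>u x\<bar>\<bar>" using L[of "u x" 0] by simp
    qed
  qed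
qed

lemma ereal_rearrange:
  fixes B C :: ereal
  assumes "0 \<le> B" "0 \<le> C" "ereal a + B + ereal b \<le> ereal c + C"
  shows "B \<le> ereal (c - a - b) + C"
  using assms by (cases B; cases C) auto

text \<open>All terms except the convex functional are collected into one function paired with
  \<phi> - v, so the inequality says exactly that this function is a subgradient. Finiteness of the
  functional is not known beforehand, hence the rearrangement is done in the extended reals.\<close>

lemma limsol_inclusion:
  assumes Om: "open \<Omega>" "bounded \<Omega>" and onb: "onb (lebesgue_on \<Omega>) e" and spB: "spectral \<Omega> lam' e'"
    and bh: "bhat_ok bh" and lip: "\<exists>L. \<forall>x y. \<bar>\<pi> x - \<pi> y\<bar> \<le> L * \<bar>x - y\<bar>"
    and sol: "limsol \<Omega> T lam e lam' e' r \<tau> bh \<pi> f \<phi>0 \<phi> d\<phi> \<mu>"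
    and L: "AE t in lebesgue_on {0<..<T}. L2 \<Omega> (\<phi> t)" "AE t in lebesgue_on {0<..<T}. L2 \<Omega> (d\<phi> t)"
      "AE t in lebesgue_on {0<..<T}. L2 \<Omega> (\<mu> t)" "AE t in lebesgue_on {0<..<T}. L2 \<Omega> (f t)"
  shows "AE t in lebesgue_on {0<..<T}. AE x in lebesgue_on \<Omega>. subdiff bh (\<phi> t x)
     (\<mu> t x + f t x - \<tau> * d\<phi> t x - \<phi> t x + orth_proj \<Omega> (kerOp \<Omega> lam' e') (\<phi> t) x - \<pi> (\<phi> t x))"
proof -
  let ?M = "lebesgue_on \<Omega>" let ?P = "\<lambda>t. orth_proj \<Omega> (kerOp \<Omega> lam' e') (\<phi> t)"
  let ?xi = "\<lambda>t x. \<mu> t x + f t x - \<tau> * d\<phi> t x - \<phi> t x + ?P t x - \<pi> (\<phi> t x)"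
  have xL: "L2 \<Omega> (?xi t)" if "L2 \<Omega> (\<phi> t)" "L2 \<Omega> (d\<phi> t)" "L2 \<Omega> (\<mu> t)" "L2 \<Omega> (f t)" for t
    using that orth_proj_eq(1)[OF spB that(1)] lipschitz_comp_L2[OF Om lip that(1)]
    unfolding L2_eq by (intro l2_add l2_diff l2_scale) auto
  have xiL: "AE t in lebesgue_on {0<..<T}. L2 \<Omega> (?xi t)"
    using L by eventually_elim (rule xL)
  have "AE t in lebesgue_on {0<..<T}. intB \<Omega> bh (\<phi> t) \<le> ereal (ip \<Omega> (?xi t) (\<lambda>x. \<phi> t x - v x)) + intB \<Omega> bh v" if v: "L2 \<Omega> v" for v
  proof -
    have "AE t in lebesgue_on {0<..<T}.
        ereal (\<tau> * ip \<Omega> (d\<phi> t) (\<lambda>x. \<phi> t x - v x) + ip \<Omega> (\<lambda>x. \<phi> t x - ?P t x) (\<lambda>x. \<phi> t x - v x))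
        + intB \<Omega> bh (\<phi> t) + ereal (ip \<Omega> (\<lambda>x. \<pi> (\<phi> t x) - f t x) (\<lambda>x. \<phi> t x - v x))
        \<le> ereal (ip \<Omega> (\<mu> t) (\<lambda>x. \<phi> t x - v x)) + intB \<Omega> bh v"
      using sol v unfolding limsol_def by blast
    then show ?thesis using L
    proof eventually_elim
      case (elim t)
      let ?d = "\<lambda>x. \<phi> t x - v x"
      have l: "l2 ?M (\<phi> t)" "l2 ?M (d\<phi> t)" "l2 ?M (\<mu> t)" "l2 ?M (f t)" "l2 ?M (?P t)" "l2 ?M (\<lambda>x. \<pi> (\<phi> t x))" "l2 ?M ?d"
        using elim v orth_proj_eq(1)[OF spB elim(2)] lipschitz_comp_L2[OF Om lip elim(2)]
        by (auto simp: L2_eq l2_diff)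
      have i: "integrable ?M (\<lambda>x. u x * ?d x)" if "l2 ?M u" for u by (rule l2_mult[OF that l(7)])
      have "ip \<Omega> (?xi t) ?d = ip \<Omega> (\<mu> t) ?d - (\<tau> * ip \<Omega> (d\<phi> t) ?d + ip \<Omega> (\<lambda>x. \<phi> t x - ?P t x) ?d) - ip \<Omega> (\<lambda>x. \<pi> (\<phi> t x) - f t x) ?d"
      proof -
        have "ip \<Omega> (?xi t) ?d = (LINT x|?M. \<mu> t x * ?d x - (\<tau> * (d\<phi> t x * ?d x) + (\<phi> t x - ?P t x) * ?d x) - (\<pi> (\<phi> t x) - f t x) * ?d x)"
          unfolding ip_def by (intro Bochner_Integration.integral_cong) (auto simp: algebra_simps)
        also have "\<dots> = ip \<Omega> (\<mu> t) ?d - (\<tau> * ip \<Omega> (d\<phi> t) ?d + ip \<Omega> (\<lambda>x. \<phi> t x - ?P t x) ?d) - ip \<Omega> (\<lambda>x. \<pi> (\<phi> t x) - f t x) ?d"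
          unfolding ip_def
          using i[OF l(3)] i[OF l(2)] i[OF l2_diff[OF l(1,5)]] i[OF l2_diff[OF l(6,4)]]
          by (simp only: Bochner_Integration.integral_diff Bochner_Integration.integral_add integral_mult_right_zero
              Bochner_Integration.integrable_add Bochner_Integration.integrable_diff integrable_mult_right)
        finally show ?thesis .
      qed
      then show ?case using ereal_rearrange[OF intB_nonneg intB_nonneg elim(1)] by simp
    qed
  qed
  from vi_all_tests[OF onb this xiL L(1)]
  have "AE t in lebesgue_on {0<..<T}. \<forall>v. L2 \<Omega> v \<longrightarrow> intB \<Omega> bh (\<phi> t) \<le> ereal (ip \<Omega> (?xi t) (\<lambda>x. \<phi> t x - v x)) + intB \<Omega> bh v" .
  then show ?thesis using L(1) xiL
    by eventually_elim (rule vi_subdiff[OF Om bh], auto)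
qed

section \<open>A Gronwall estimate for differences\<close>

lemma prim_sub: assumes "l2 lborel f" "l2 lborel g" shows "prim (\<lambda>s. f s - g s) t = prim f t - prim g t"
  unfolding prim_def right_diff_distrib by (intro Bochner_Integration.integral_diff l2_interval_integrable assms)

text \<open>The square of an integral is a double integral over a square, which by symmetry is twice
  the integral over the triangle b < a, the diagonal being null. This stands in for the chain rule
  for absolutely continuous functions.\<close>

lemma prim_square:
  assumes f: "l2 lborel f" shows "prim (\<lambda>t. f t * prim f t) s = (prim f s)\<^sup>2 / 2"
proof -
  have [measurable]: "f \<in> borel_measurable borel" using l2_meas[OF f] by simp
  let ?N = "lborel \<Otimes>\<^sub>M (lborel :: real measure)"
  let ?f = "\<lambda>a. indicator {0<..<s} a * f a"
  have i: "integrable lborel ?f" by (rule l2_interval_integrable[OF f])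
  have pi: "integrable (lborel \<Otimes>\<^sub>M lborel) (\<lambda>(a, b). ?f a * ?f b)"
    using integrable_product[OF i i] by (simp add: case_prod_unfold)
  let ?k = "\<lambda>a b. indicator {b. b < a} b * (?f a * ?f b)"
  have ki: "integrable (lborel \<Otimes>\<^sub>M lborel) (\<lambda>(a, b). ?k a b)"
    by (rule Bochner_Integration.integrable_bound[OF pi]) (measurable, auto simp: indicator_def abs_mult)
  have ki': "integrable (lborel \<Otimes>\<^sub>M lborel) (\<lambda>(a, b). ?k b a)"
    by (rule Bochner_Integration.integrable_bound[OF pi]) (measurable, auto simp: indicator_def abs_mult)
  have inner: "(LINT b|lborel. ?k a b) = indicator {0<..<s} a * (f a * prim f a)" for a
  proof -
    have "(LINT b|lborel. ?k a b) = (LINT b|lborel. (indicator {0<..<s} a * f a) * (indicator {0<..<a} b * f b))"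
      by (intro Bochner_Integration.integral_cong) (auto simp: indicator_def)
    then show ?thesis by (simp add: prim_def)
  qed
  have "(prim f s)\<^sup>2 = (LINT a|lborel. LINT b|lborel. ?f a * ?f b)"
    by (simp add: prim_def power2_eq_square)
  also have "\<dots> = (LINT p|?N. (case p of (a, b) \<Rightarrow> ?f a * ?f b))"
    using lborel_pair.integral_fst'[OF pi] by simp
  also have "\<dots> = (LINT p|?N. (case p of (a, b) \<Rightarrow> ?k a b) + (case p of (a, b) \<Rightarrow> ?k b a))"
  proof (rule integral_cong_AE)
    have "AE a in lborel. AE b in lborel. b \<noteq> (a :: real)" by (intro AE_I2 AE_lborel_singleton)
    moreover have "{p \<in> space ?N. snd p \<noteq> fst p} \<in> sets ?N" by measurable
    ultimately have "AE p in ?N. snd p \<noteq> fst p" by (intro lborel_pair.AE_pair_measure) simp_all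
    then show "AE p in ?N. (case p of (a, b) \<Rightarrow> ?f a * ?f b) = (case p of (a, b) \<Rightarrow> ?k a b) + (case p of (a, b) \<Rightarrow> ?k b a)"
      by eventually_elim (auto simp: indicator_def split: prod.splits)
  qed measurable
  also have "\<dots> = (LINT p|?N. (case p of (a, b) \<Rightarrow> ?k a b)) + (LINT p|?N. (case p of (a, b) \<Rightarrow> ?k b a))"
    by (rule Bochner_Integration.integral_add[OF ki ki'])
  also have "(LINT p|?N. (case p of (a, b) \<Rightarrow> ?k a b)) = (LINT a|lborel. LINT b|lborel. ?k a b)"
    using lborel_pair.integral_fst'[OF ki] by simp
  also have "(LINT p|?N. (case p of (a, b) \<Rightarrow> ?k b a)) = (LINT b|lborel. LINT a|lborel. ?k b a)"
    using lborel_pair.integral_snd[OF ki'] by simp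
  also have "(LINT a|lborel. LINT b|lborel. ?k a b) + (LINT b|lborel. LINT a|lborel. ?k b a) = 2 * prim (\<lambda>t. f t * prim f t) s"
    unfolding inner by (simp add: prim_def[of "\<lambda>t. f t * prim f t"])
  finally show ?thesis by simp
qed

text \<open>An integral form for bounded measurable z, without continuity. The supremum E of
  exp(-2Kt) z(t) is finite by the bound B; inserting z \<le> E exp(2Kt) into the inequality halves
  E, so E \<le> c + E/2, and the factors 2c and exp(2KT) result.\<close>

lemma gronwall:
  assumes K: "K > 0" and c: "0 \<le> c" and z: "z \<in> borel_measurable borel" "\<And>t. 0 \<le> z t"
    and B: "\<And>t. t \<in> {0..T} \<Longrightarrow> z t \<le> B" and ineq: "\<And>t. t \<in> {0..T} \<Longrightarrow> z t \<le> c + K * prim z t"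
    and t: "t \<in> {0..T}"
  shows "z t \<le> 2 * c * exp (2 * K * T)"
proof -
  let ?F = "\<lambda>t. exp (- (2 * K * t)) * z t"
  define E where "E = (SUP t\<in>{0..T}. ?F t)"
  have bdd: "bdd_above (?F ` {0..T})"
  proof (rule bdd_aboveI2)
    fix s assume s: "s \<in> {0..T}"
    have "?F s \<le> 1 * z s" using K s z(2) by (intro mult_right_mono) auto
    then show "?F s \<le> B" using B[OF s] by simp
  qed
  have FE: "?F s \<le> E" if "s \<in> {0..T}" for s unfolding E_def by (rule cSUP_upper[OF that bdd])
  have E0: "0 \<le> E" by (rule order_trans[OF _ FE[OF t]]) (simp add: z(2))
  have zE: "z s \<le> E * exp (2 * K * s)" if "s \<in> {0..T}" for s
  proof -
    have "z s = ?F s * exp (2 * K * s)" by (simp add: exp_minus field_simps)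
    also have "\<dots> \<le> E * exp (2 * K * s)" by (intro mult_right_mono FE that) simp
    finally show ?thesis .
  qed
  have "?F s \<le> c + E / 2" if s: "s \<in> {0..T}" for s
  proof -
    have FTC: "(LINT r|lborel. exp (2 * K * r) * indicator {0..s} r) = exp (2 * K * s) / (2 * K) - exp (2 * K * 0) / (2 * K)"
    proof (rule integral_FTC_Icc_real)
      show "((\<lambda>r. exp (2 * K * r) / (2 * K)) has_real_derivative exp (2 * K * x)) (at x)" for x
        using K by (auto intro!: derivative_eq_intros simp: field_simps)
    qed (use s in \<open>auto intro!: continuous_intros\<close>)
    have ie: "integrable lborel (\<lambda>r. exp (2 * K * r) * indicator {0..s} r)"
      by (rule borel_integrable_atLeastAtMost) (auto intro!: continuous_intros)
    have "prim z s \<le> (LINT r|lborel. E * (exp (2 * K * r) * indicator {0..s} r))"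
      unfolding prim_def
    proof (rule integral_mono_AE'[OF integrable_mult_right[OF ie]]; intro AE_I2)
      fix r show "indicator {0<..<s} r * z r \<le> E * (exp (2 * K * r) * indicator {0..s} r)"
        using zE[of r] s E0 by (auto simp: indicator_def)
    qed (simp add: E0)
    also have "\<dots> = E * (exp (2 * K * s) / (2 * K) - 1 / (2 * K))" using FTC by simp
    also have "\<dots> \<le> E * (exp (2 * K * s) / (2 * K))" using K E0 by (intro mult_left_mono) auto
    finally have "K * prim z s \<le> E * exp (2 * K * s) / 2" using K by (simp add: field_simps)
    then have "z s \<le> c + E * exp (2 * K * s) / 2" using ineq[OF s] by simp
    then have "?F s \<le> exp (- (2 * K * s)) * (c + E * exp (2 * K * s) / 2)" by (rule mult_left_mono) simp
    also have "\<dots> = exp (- (2 * K * s)) * c + E / 2" by (simp add: exp_minus field_simps)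
    also have "\<dots> \<le> 1 * c + E / 2" using K s c by (intro add_right_mono mult_right_mono) auto
    finally show ?thesis by simp
  qed
  then have "E \<le> c + E / 2" unfolding E_def using t by (intro cSUP_least) auto
  then have "E * exp (2 * K * t) \<le> 2 * c * exp (2 * K * T)" using c K t by (intro mult_mono) auto
  then show ?thesis using zE[OF t] by simp
qed

lemma subdiff_monotone:
  assumes bh: "bhat_ok bh" and "subdiff bh a \<xi>" "subdiff bh b \<zeta>" shows "0 \<le> (\<xi> - \<zeta>) * (a - b)"
proof -
  have f: "bh a \<noteq> \<infinity>" "bh b \<noteq> \<infinity>" and 1: "bh a + ereal (\<xi> * (b - a)) \<le> bh b" and 2: "bh b + ereal (\<zeta> * (a - b)) \<le> bh a"
    using assms(2,3) unfolding subdiff_def by auto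
  obtain x y where "bh a = ereal x" "bh b = ereal y"
    using f bh_nonneg[OF bh, of a] bh_nonneg[OF bh, of b] by (cases "bh a"; cases "bh b") auto
  then show ?thesis using 1 2 by (simp add: algebra_simps)
qed

text \<open>Each \<open>x\<close> gives a scalar differential inclusion; monotonicity lets two of them be compared.\<close>

lemma inclusion_pair:
  fixes d1 d2 g1 g2 \<pi> :: "real \<Rightarrow> real" and p1 p2 T L \<tau> :: real
  assumes tau: "\<tau> > 0" and bh: "bhat_ok bh" and L: "L > 0" "\<And>x y. \<bar>\<pi> x - \<pi> y\<bar> \<le> L * \<bar>x - y\<bar>"
    and d: "l2 lborel d1" "l2 lborel d2" and g: "l2 lborel g1" "l2 lborel g2"
    and i1: "AE t in lborel. t \<in> {0<..<T} \<longrightarrow> subdiff bh (p1 + prim d1 t) (g1 t - \<tau> * d1 t - (p1 + prim d1 t) - \<pi> (p1 + prim d1 t))"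
    and i2: "AE t in lborel. t \<in> {0<..<T} \<longrightarrow> subdiff bh (p2 + prim d2 t) (g2 t - \<tau> * d2 t - (p2 + prim d2 t) - \<pi> (p2 + prim d2 t))"
    and t: "0 \<le> t" "t \<le> T"
  shows "((p1 + prim d1 t) - (p2 + prim d2 t))\<^sup>2 \<le>
     2 * exp (2 * ((2 * L + 1) / \<tau>) * T) * (1 + 1 / \<tau>) * ((p1 - p2)\<^sup>2 + (LINT s|lborel. (g1 s - g2 s)\<^sup>2))"
proof -
  define d g where "d s = d1 s - d2 s" and "g s = g1 s - g2 s" for s
  \<comment> \<open>In the constant, 2 L comes from the Lipschitz bound for \<pi>, the 1 from
    splitting 2 g \<delta> \<le> g^2 + \<delta>^2, and the division by \<tau> from the coefficient
    of the time derivative.\<close>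
  let ?p = "p1 - p2" let ?S = "LINT s|lborel. (g s)\<^sup>2" let ?K = "(2 * L + 1) / \<tau>"
  define \<delta> where "\<delta> s = ?p + prim d s" for s
  have dl: "l2 lborel d" and gl: "l2 lborel g" unfolding d_def[abs_def] g_def[abs_def] by (intro l2_diff assms)+
  have \<delta>: "\<delta> s = (p1 + prim d1 s) - (p2 + prim d2 s)" for s
    unfolding \<delta>_def d_def[abs_def] prim_sub[OF d] by simp
  have [measurable]: "d \<in> borel_measurable borel" using l2_meas[OF dl] by simp
  have dm[measurable]: "\<delta> \<in> borel_measurable borel" unfolding \<delta>_def[abs_def] by (intro borel_measurable_add borel_measurable_const prim_meas) simp
  let ?B = "2 * ?p\<^sup>2 + 2 * (T * (LINT s|lborel. (d s)\<^sup>2))"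
  have B: "(\<delta> s)\<^sup>2 \<le> ?B" if "s \<in> {0..T}" for s
  proof -
    have "(prim d s)\<^sup>2 \<le> s * (LINT s|lborel. (d s)\<^sup>2)" using that by (intro prim_bound[OF dl]) simp
    also have "\<dots> \<le> T * (LINT s|lborel. (d s)\<^sup>2)" using that by (intro mult_right_mono) auto
    finally show ?thesis using zero_le_power2[of "?p - prim d s"] unfolding \<delta>_def power2_sum[of ?p "prim d s"] power2_diff[of ?p "prim d s"] by linarith
  qed
  have il: "l2 lborel (\<lambda>r. indicator {0<..<s} r * \<delta> r)" if "s \<in> {0..T}" for s
    unfolding l2_def
  proof (rule conjI[OF _ Bochner_Integration.integrable_bound[where f = "\<lambda>r. indicator {0<..<s} r * ?B"]])
    show "AE r in lborel. norm ((indicator {0<..<s} r * \<delta> r)\<^sup>2) \<le> norm (indicator {0<..<s} r * ?B)"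
    proof (intro AE_I2)
      fix r show "norm ((indicator {0<..<s} r * \<delta> r)\<^sup>2) \<le> norm (indicator {0<..<s} r * ?B)"
        using B[of r] that by (auto simp: indicator_def)
    qed
    show "integrable lborel (\<lambda>r. indicator {0<..<s} r * ?B)"
      by (intro integrable_mult_left integrable_real_indicator) (auto simp: Ioo_finite)
  qed measurable
  have ineq: "(\<delta> s)\<^sup>2 \<le> (?p\<^sup>2 + ?S / \<tau>) + ?K * prim (\<lambda>r. (\<delta> r)\<^sup>2) s" if s: "s \<in> {0..T}" for s
  proof -
    let ?i = "\<lambda>r. indicator {0<..<s} r :: real"
    have i: "integrable lborel (\<lambda>r. ?i r * (d r * \<delta> r))" "integrable lborel (\<lambda>r. ?i r * (\<delta> r)\<^sup>2)" "integrable lborel (\<lambda>r. ?i r * d r)"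
      using l2_mult[OF dl il[OF s]] l2_mult[OF il[OF s] il[OF s]] l2_interval_integrable[OF dl]
      by (simp_all add: mult_ac power2_eq_square flip: indicator_inter_arith)
    have e: "(\<lambda>r. ?i r * (d r * prim d r)) = (\<lambda>r. ?i r * (d r * \<delta> r) - ?p * (?i r * d r))" by (auto simp: \<delta>_def algebra_simps)
    \<comment> \<open>Since \<delta> is p plus the primitive of d, this relation and
      \<open>prim_square\<close> yield that \<delta>(s)^2 is p^2 plus twice the integral of d
      \<delta>.\<close>
    have "prim (\<lambda>r. d r * prim d r) s = (LINT r|lborel. ?i r * (d r * \<delta> r)) - ?p * prim d s"
      unfolding prim_def[of "\<lambda>r. d r * prim d r"] e using i by (simp add: prim_def[of d])
    then have "(\<delta> s)\<^sup>2 = ?p\<^sup>2 + 2 * (LINT r|lborel. ?i r * (d r * \<delta> r))"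
      unfolding prim_square[OF dl] \<delta>_def[of s] power2_sum by simp
    also have "2 * (LINT r|lborel. ?i r * (d r * \<delta> r)) \<le> (LINT r|lborel. ?K * (?i r * (\<delta> r)\<^sup>2) + (g r)\<^sup>2 / \<tau>)"
      unfolding integral_mult_right_zero[symmetric]
    proof (rule integral_mono_AE)
      show "AE r in lborel. 2 * (?i r * (d r * \<delta> r)) \<le> ?K * (?i r * (\<delta> r)\<^sup>2) + (g r)\<^sup>2 / \<tau>"
        using i1 i2
      proof eventually_elim
        case (elim r)
        show ?case
        proof (cases "r \<in> {0<..<s}")
          case True
          define u v where "u = p1 + prim d1 r" and "v = p2 + prim d2 r"
          have e: "\<delta> r = u - v" unfolding \<delta> u_def v_def by simp
          \<comment> \<open>Monotonicity at the two states: the unknown selections of \<beta>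
            disappear from the estimate with a favourable sign.\<close>
          have "0 \<le> ((g1 r - \<tau> * d1 r - u - \<pi> u) - (g2 r - \<tau> * d2 r - v - \<pi> v)) * (u - v)"
            using elim s True unfolding u_def v_def by (intro subdiff_monotone[OF bh]) auto
          then have 1: "\<tau> * (d r * \<delta> r) \<le> g r * \<delta> r - (\<delta> r)\<^sup>2 - (\<pi> u - \<pi> v) * \<delta> r"
            unfolding e d_def g_def by (simp add: algebra_simps power2_eq_square)
          have "- ((\<pi> u - \<pi> v) * \<delta> r) \<le> \<bar>\<pi> u - \<pi> v\<bar> * \<bar>\<delta> r\<bar>" by (metis abs_ge_minus_self abs_mult)
          also have "\<dots> \<le> (L * \<bar>\<delta> r\<bar>) * \<bar>\<delta> r\<bar>" unfolding e by (intro mult_right_mono L(2)) simp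
          also have "\<dots> = L * (\<delta> r)\<^sup>2" by (simp add: power2_eq_square)
          finally have 2: "- ((\<pi> u - \<pi> v) * \<delta> r) \<le> L * (\<delta> r)\<^sup>2" .
          have "2 * (\<tau> * (d r * \<delta> r)) \<le> (2 * L + 1) * (\<delta> r)\<^sup>2 + (g r)\<^sup>2"
            using 1 2 sum_squares_bound[of "g r" "\<delta> r"] zero_le_power2[of "\<delta> r"] unfolding distrib_right mult_1 mult.assoc by linarith
          then show ?thesis using True tau by (simp add: field_simps)
        qed (use tau in simp)
      qed
      show "integrable lborel (\<lambda>r. ?K * (?i r * (\<delta> r)\<^sup>2) + (g r)\<^sup>2 / \<tau>)"
        using gl by (intro Bochner_Integration.integrable_add integrable_mult_right i integrable_divide) (auto simp: l2_def)
    qed (intro integrable_mult_right i)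
    also have "\<dots> = ?K * prim (\<lambda>r. (\<delta> r)\<^sup>2) s + ?S / \<tau>"
      using gl i(2) unfolding prim_def by (subst Bochner_Integration.integral_add) (auto simp: l2_def)
    finally show ?thesis by simp
  qed
  have S0: "0 \<le> ?S" by simp
  have "(\<delta> t)\<^sup>2 \<le> 2 * (?p\<^sup>2 + ?S / \<tau>) * exp (2 * ?K * T)"
    by (rule gronwall[OF _ _ _ _ B ineq]) (use tau L t S0 in auto)
  also have "\<dots> \<le> 2 * ((1 + 1 / \<tau>) * (?p\<^sup>2 + ?S)) * exp (2 * ?K * T)"
  proof (intro mult_right_mono mult_left_mono)
    have "0 \<le> ?p\<^sup>2 / \<tau>" using tau by simp
    then show "?p\<^sup>2 + ?S / \<tau> \<le> (1 + 1 / \<tau>) * (?p\<^sup>2 + ?S)" using S0 by (simp add: algebra_simps)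
  qed auto
  finally show ?thesis unfolding \<delta> g_def by (simp add: mult_ac)
qed

section \<open>Regularity\<close>

lemma (in kernel) pk_sum:
  assumes "finite J" "\<And>j. j \<in> J \<Longrightarrow> u j \<in> borel_measurable borel"
  shows "pk N X Y w (\<lambda>x. \<Sum>j\<in>J. u j x) \<le> 2 ^ card J * (\<Sum>j\<in>J. pk N X Y w (u j))"
  using assms
proof (induction rule: finite_induct)
  case empty then show ?case by (simp add: pk_def)
next
  case (insert j J)
  have "(\<lambda>x. \<Sum>i\<in>insert j J. u i x) = (\<lambda>x. u j x + (\<Sum>i\<in>J. u i x))" using insert by simp
  then have "pk N X Y w (\<lambda>x. \<Sum>i\<in>insert j J. u i x) \<le> 2 * pk N X Y w (u j) + 2 * pk N X Y w (\<lambda>x. \<Sum>i\<in>J. u i x)"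
    using insert.prems by (simp only:) (intro pk_add borel_measurable_sum, auto)
  also have "\<dots> \<le> 2 * (2 ^ card J * pk N X Y w (u j)) + 2 * (2 ^ card J * (\<Sum>i\<in>J. pk N X Y w (u i)))"
  proof (intro add_mono mult_left_mono insert.IH)
    have "1 * pk N X Y w (u j) \<le> 2 ^ card J * pk N X Y w (u j)" by (intro mult_right_mono one_le_power) auto
    then show "pk N X Y w (u j) \<le> 2 ^ card J * pk N X Y w (u j)" by simp
  qed (use insert.prems in auto)
  also have "\<dots> = 2 ^ card (insert j J) * (\<Sum>i\<in>insert j J. pk N X Y w (u i))"
    using insert by (simp add: distrib_left mult.assoc)
  finally show ?case .
qed

lemma kernel_pair_estimate:
  assumes k: "kernel \<Omega> N X Y w" and sf: "sigma_finite_measure N" and C: "0 \<le> C"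
    and P: "P \<in> borel_measurable borel" and P0: "P0 \<in> borel_measurable borel"
    and g: "g \<in> borel_measurable (borel \<Otimes>\<^sub>M borel)"
    and est: "AE x in lebesgue_on \<Omega>. Q x"
      "\<And>x y. Q x \<Longrightarrow> Q y \<Longrightarrow> (P x - P y)\<^sup>2 \<le> C * ((P0 x - P0 y)\<^sup>2 + (LINT s|lborel. (g (s, x) - g (s, y))\<^sup>2))"
      "\<And>x. Q x \<Longrightarrow> l2 lborel (\<lambda>s::real. g (s, x))"
  shows "pk N X Y w P \<le> ennreal C * (pk N X Y w P0 + (\<integral>\<^sup>+s. pk N X Y w (\<lambda>x. g (s, x)) \<partial>lborel))"
proof -
  interpret kernel \<Omega> N X Y w by (rule k)
  interpret N: sigma_finite_measure N by (rule sf)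
  interpret pair_sigma_finite lborel N by (rule pair_sigma_finite.intro[OF lborel.sigma_finite_measure_axioms sf])
  note [measurable] = P P0 g
  let ?h = "\<lambda>n s. ennreal ((g (s, X n) - g (s, Y n))\<^sup>2)"
  have hm: "(\<lambda>(s, n). w n * ?h n s) \<in> borel_measurable (lborel \<Otimes>\<^sub>M N)" by measurable
  have hm1[measurable]: "(\<lambda>n. \<integral>\<^sup>+s. ?h n s \<partial>lborel) \<in> borel_measurable N" by measurable
  have "pk N X Y w P \<le> (\<integral>\<^sup>+n. ennreal C * (w n * ennreal ((P0 (X n) - P0 (Y n))\<^sup>2)) + ennreal C * (w n * (\<integral>\<^sup>+s. ?h n s \<partial>lborel)) \<partial>N)"
    unfolding pk_def
  proof (rule nn_integral_mono_AE)
    show "AE n in N. w n * ennreal ((P (X n) - P (Y n))\<^sup>2) \<le>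
       ennreal C * (w n * ennreal ((P0 (X n) - P0 (Y n))\<^sup>2)) + ennreal C * (w n * (\<integral>\<^sup>+s. ?h n s \<partial>lborel))"
      using AE_pull[OF est(1)]
    proof eventually_elim
      case (elim n)
      show ?case
      proof (cases "w n = 0")
        case False
        then have q: "Q (X n)" "Q (Y n)" using elim by auto
        have gl: "l2 lborel (\<lambda>s. g (s, X n) - g (s, Y n))" by (intro l2_diff est(3) q)
        have I: "(\<integral>\<^sup>+s. ?h n s \<partial>lborel) = ennreal (LINT s|lborel. (g (s, X n) - g (s, Y n))\<^sup>2)"
          using gl by (intro nn_integral_eq_integral) (auto simp: l2_def)
        have S0: "0 \<le> (LINT s|lborel. (g (s, X n) - g (s, Y n))\<^sup>2)" by simp
        have "ennreal ((P (X n) - P (Y n))\<^sup>2) \<le> ennreal (C * ((P0 (X n) - P0 (Y n))\<^sup>2 + (LINT s|lborel. (g (s, X n) - g (s, Y n))\<^sup>2)))"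
          by (intro ennreal_leI est(2) q)
        also have "\<dots> = ennreal C * (ennreal ((P0 (X n) - P0 (Y n))\<^sup>2) + (\<integral>\<^sup>+s. ?h n s \<partial>lborel))"
          unfolding I using C S0 by (subst ennreal_mult) auto
        finally have "w n * ennreal ((P (X n) - P (Y n))\<^sup>2) \<le> w n * (ennreal C * (ennreal ((P0 (X n) - P0 (Y n))\<^sup>2) + (\<integral>\<^sup>+s. ?h n s \<partial>lborel)))"
          by (rule mult_left_mono) simp
        then show ?thesis by (simp add: distrib_left mult_ac)
      qed simp
    qed
  qed
  also have "\<dots> = ennreal C * pk N X Y w P0 + ennreal C * (\<integral>\<^sup>+n. w n * (\<integral>\<^sup>+s. ?h n s \<partial>lborel) \<partial>N)"
    unfolding pk_def by (simp add: nn_integral_add nn_integral_cmult)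
  also have "(\<integral>\<^sup>+n. w n * (\<integral>\<^sup>+s. ?h n s \<partial>lborel) \<partial>N) = (\<integral>\<^sup>+n. (\<integral>\<^sup>+s. w n * ?h n s \<partial>lborel) \<partial>N)"
    by (intro nn_integral_cong nn_integral_cmult[symmetric]) measurable
  also have "\<dots> = (\<integral>\<^sup>+s. pk N X Y w (\<lambda>x. g (s, x)) \<partial>lborel)"
    unfolding pk_def by (rule Fubini'[OF hm])
  finally show ?thesis by (simp add: distrib_left)
qed

section \<open>Borel representatives of a solution and joint measurability of the inclusion\<close>

lemma bt_add: assumes "bt \<Omega> T U" "bt \<Omega> T V" shows "bt \<Omega> T (\<lambda>p. U p + V p)"
proof -
  have "l2 lborel U" "l2 lborel V" using assms by (auto simp: bt_def l2_def)
  from l2_add[OF this] show ?thesis using assms by (auto simp: bt_def l2_def)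
qed

lemma bt_sum: assumes "finite J" "\<And>j. j \<in> J \<Longrightarrow> bt \<Omega> T (U j)" shows "bt \<Omega> T (\<lambda>p. \<Sum>j\<in>J. U j p)"
  using assms by (induction rule: finite_induct) (auto simp: bt_add, simp add: bt_def)

lemma bt_product:
  assumes "l2 lborel c" "l2 lborel v" "\<And>t. t \<notin> {0<..<T} \<Longrightarrow> c t = 0" "\<And>x. x \<notin> \<Omega> \<Longrightarrow> v x = 0"
  shows "bt \<Omega> T (\<lambda>p. c (fst p) * v (snd p))"
  using l2_product[OF assms(1,2)] assms(3,4) by (auto simp: bt_def l2_def)

text \<open>The graph of \<beta> is closed because \<open>bh\<close> is lower semicontinuous. This
  makes the inclusion a Borel relation in (t, x), which the exchange of the almost-everywhere
  quantifiers requires.\<close>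

lemma subdiff_closed:
  assumes bh: "bhat_ok bh" shows "closed {p. subdiff bh (fst p) (snd p)}"
  unfolding closed_sequential_limits
proof (intro allI impI)
  fix q l assume a: "(\<forall>n. q n \<in> {p. subdiff bh (fst p) (snd p)}) \<and> q \<longlonglongrightarrow> l"
  have s: "\<And>n. subdiff bh (fst (q n)) (snd (q n))" and c: "(\<lambda>n. fst (q n)) \<longlonglongrightarrow> fst l" "(\<lambda>n. snd (q n)) \<longlonglongrightarrow> snd l"
    using a by (auto intro: tendsto_fst tendsto_snd)
  have le: "bh (fst l) \<le> ereal (z' - snd l * (z - fst l))" if z: "bh z = ereal z'" for z z'
  proof (rule ereal_le_epsilon2)
    fix \<epsilon> :: real assume "0 < \<epsilon>"
    \<comment> \<open>The bounds on \<open>bh\<close> at the approximating points vary with n; the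
      margin \<epsilon> puts them eventually into one closed sublevel set.\<close>
    let ?S = "{s. bh s \<le> ereal (z' - snd l * (z - fst l) + \<epsilon>)}"
    have "(\<lambda>n. z' - snd (q n) * (z - fst (q n))) \<longlonglongrightarrow> z' - snd l * (z - fst l)" by (intro tendsto_intros c)
    then have "\<forall>\<^sub>F n in sequentially. z' - snd (q n) * (z - fst (q n)) < z' - snd l * (z - fst l) + \<epsilon>"
      by (rule order_tendstoD(2)) (use \<open>0 < \<epsilon>\<close> in simp)
    then have "\<forall>\<^sub>F n in sequentially. fst (q n) \<in> ?S"
    proof eventually_elim
      case (elim n)
      have "bh (fst (q n)) + ereal (snd (q n) * (z - fst (q n))) \<le> ereal z'" and "bh (fst (q n)) \<noteq> \<infinity>"
        using s[of n] z unfolding subdiff_def by metis+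
      then show ?case using elim bh_nonneg[OF bh, of "fst (q n)"] by (cases "bh (fst (q n))") auto
    qed
    moreover have "closed ?S" using bh by (simp add: bhat_ok_def)
    ultimately have "fst l \<in> ?S"
      using Lim_in_closed_set[OF _ _ sequentially_bot c(1)] by blast
    then show "bh (fst l) \<le> ereal (z' - snd l * (z - fst l)) + ereal \<epsilon>" by simp
  qed
  have "bh 0 = ereal 0" using bh by (simp add: bhat_ok_def zero_ereal_def)
  from le[OF this] have fin: "bh (fst l) \<noteq> \<infinity>" by auto
  have "bh (fst l) + ereal (snd l * (z - fst l)) \<le> bh z" for z
    using le[of z] fin bh_nonneg[OF bh, of z] by (cases "bh z"; cases "bh (fst l)") auto
  then show "l \<in> {p. subdiff bh (fst p) (snd p)}" using fin by (simp add: subdiff_def)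
qed

lemma bt_scale: "bt \<Omega> T U \<Longrightarrow> bt \<Omega> T (\<lambda>p. c * U p)"
  using l2_scale[of lborel U c] by (auto simp: bt_def l2_def)

lemma bt_diff: assumes "bt \<Omega> T U" "bt \<Omega> T V" shows "bt \<Omega> T (\<lambda>p. U p - V p)"
  using bt_add[OF assms(1) bt_scale[OF assms(2), of "-1"]] by simp

text \<open>A solution with its data replaced by Borel functions that vanish outside \<open>(0, T) \<times> \<Omega>\<close>.\<close>

locale limsol_rep =
  fixes \<Omega> :: "pt set" and T r \<tau> :: real and lam lam' :: "nat \<Rightarrow> real" and e e' :: "nat \<Rightarrow> pt \<Rightarrow> real"
    and bh :: "real \<Rightarrow> ereal" and \<pi> :: "real \<Rightarrow> real"
    and f \<phi> d\<phi> \<mu> :: "real \<Rightarrow> pt \<Rightarrow> real" and \<phi>0 :: "pt \<Rightarrow> real" and U D M F :: "real \<times> pt \<Rightarrow> real"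
  assumes Om: "open \<Omega>" "bounded \<Omega>" and T: "T > 0" and tau: "\<tau> > 0"
    and specA: "spectral \<Omega> lam e" and specB: "spectral \<Omega> lam' e'"
    and bh: "bhat_ok bh" and lip: "\<exists>L. \<forall>x y. \<bar>\<pi> x - \<pi> y\<bar> \<le> L * \<bar>x - y\<bar>"
    and sol: "limsol \<Omega> T lam e lam' e' r \<tau> bh \<pi> f \<phi>0 \<phi> d\<phi> \<mu>" and p0: "L2 \<Omega> \<phi>0"
    and U: "bt \<Omega> T U" "AE t in lebesgue_on {0<..<T}. AE x in lebesgue_on \<Omega>. \<phi> t x = U (t, x)"
    and D: "bt \<Omega> T D" "AE t in lebesgue_on {0<..<T}. AE x in lebesgue_on \<Omega>. d\<phi> t x = D (t, x)"
    and M: "bt \<Omega> T M" "AE t in lebesgue_on {0<..<T}. AE x in lebesgue_on \<Omega>. \<mu> t x = M (t, x)"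
    and F: "bt \<Omega> T F" "AE t in lebesgue_on {0<..<T}. AE x in lebesgue_on \<Omega>. f t x = F (t, x)"

lemma limsol_rep_exists:
  assumes "open \<Omega>" "bounded \<Omega>" "T > 0" "\<tau> > 0" "spectral \<Omega> lam e" "spectral \<Omega> lam' e'" "bhat_ok bh"
    "\<exists>L. \<forall>x y. \<bar>\<pi> x - \<pi> y\<bar> \<le> L * \<bar>x - y\<bar>" "limsol \<Omega> T lam e lam' e' r \<tau> bh \<pi> f \<phi>0 \<phi> d\<phi> \<mu>" "L2 \<Omega> \<phi>0"
    and F: "bt \<Omega> T F" "AE t in lebesgue_on {0<..<T}. AE x in lebesgue_on \<Omega>. f t x = F (t, x)"
  shows "\<exists>U D M. limsol_rep \<Omega> T r \<tau> lam lam' e e' bh \<pi> f \<phi> d\<phi> \<mu> \<phi>0 U D M F"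
proof -
  have "L2T \<Omega> T \<phi>" "L2T \<Omega> T d\<phi>" "L2T \<Omega> T \<mu>"
    using assms(9) by (auto simp: limsol_def time_deriv_def L2T_X_def)
  from this[THEN bt_rep[OF assms(1)]] show ?thesis using assms
    by (elim exE conjE) (intro exI limsol_rep.intro; assumption)
qed

context limsol_rep
begin

lemma Ob[measurable]: "\<Omega> \<in> sets borel" using Om by auto

lemma bt_section_L2: assumes "bt \<Omega> T V" shows "AE t in lebesgue_on {0<..<T}. L2 \<Omega> (\<lambda>x. V (t, x))"
  using bt_L2[OF Ob assms] by (auto simp: AE_lebesgue_on_iff)

lemma L2_data:
  "AE t in lebesgue_on {0<..<T}. L2 \<Omega> (\<phi> t)" "AE t in lebesgue_on {0<..<T}. L2 \<Omega> (d\<phi> t)"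
  "AE t in lebesgue_on {0<..<T}. L2 \<Omega> (\<mu> t)" "AE t in lebesgue_on {0<..<T}. L2 \<Omega> (f t)"
proof -
  have "AE t in lebesgue_on {0<..<T}. L2 \<Omega> (u t)"
    if "bt \<Omega> T V" "AE t in lebesgue_on {0<..<T}. AE x in lebesgue_on \<Omega>. u t x = V (t, x)" for u V
    using bt_section_L2[OF that(1)] that(2)
    by eventually_elim (rule L2_AE_transfer[OF Ob bt_sec_meas[OF that(1)]])
  then show "AE t in lebesgue_on {0<..<T}. L2 \<Omega> (\<phi> t)" "AE t in lebesgue_on {0<..<T}. L2 \<Omega> (d\<phi> t)"
    "AE t in lebesgue_on {0<..<T}. L2 \<Omega> (\<mu> t)" "AE t in lebesgue_on {0<..<T}. L2 \<Omega> (f t)"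
    using U D M F by blast+
qed

definition h :: "nat \<Rightarrow> pt \<Rightarrow> real" where "h j x = indicator \<Omega> x * rep \<Omega> (e' j) x"

text \<open>A Borel representative of P\<phi>: the chosen projection has no measurability in t of
  its own, but it agrees with this finite sum of products of functions of t and of x.\<close>

definition Q :: "real \<times> pt \<Rightarrow> real" where
  "Q p = (\<Sum>j\<in>{j. lam' j = 0}. ip \<Omega> (\<lambda>x. U (fst p, x)) (h j) * h j (snd p))"

definition \<Xi> :: "real \<times> pt \<Rightarrow> real" where
  "\<Xi> p = M p + F p + Q p - \<tau> * D p - U p - \<pi> (U p)"

lemma h: "h j \<in> borel_measurable borel" "AE x in lebesgue_on \<Omega>. e' j x = h j x" "L2 \<Omega> (h j)" "l2 lborel (h j)"
proof -
  have el: "L2 \<Omega> (e' j)" using specB by (auto simp: spectral_def orthonormal_complete_def)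
  note rp = rep[OF Ob, of "e' j"]
  have em: "e' j \<in> borel_measurable (lebesgue_on \<Omega>)" using el by (simp add: L2_def)
  note [measurable] = rp(1)[OF em]
  show m[measurable]: "h j \<in> borel_measurable borel" unfolding h_def by measurable
  have "AE x in lebesgue_on \<Omega>. x \<in> \<Omega>" using AE_space[of "lebesgue_on \<Omega>"] by simp
  then show ae: "AE x in lebesgue_on \<Omega>. e' j x = h j x"
    using rp(2)[OF em] by eventually_elim (simp add: h_def)
  show L: "L2 \<Omega> (h j)"
    using l2_cong_AE[OF el[unfolded L2_eq] borel_meas_lebesgue_on[OF m] ae] by (simp add: L2_eq)
  have "integrable lborel (\<lambda>x. indicator \<Omega> x * (h j x)\<^sup>2)"
    using L integrable_lebesgue_on[OF Ob, of "\<lambda>x. (h j x)\<^sup>2"] by (simp add: L2_def)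
  then have "integrable lborel (\<lambda>x. (h j x)\<^sup>2)"
    by (rule Bochner_Integration.integrable_cong[THEN iffD1, rotated 2]) (auto simp: h_def indicator_def)
  then show "l2 lborel (h j)" by (simp add: l2_def)
qed

lemma Q_coef: "l2 lborel (\<lambda>t. ip \<Omega> (\<lambda>x. U (t, x)) (h j))"
  using bt_inn_l2[OF Ob U(1) h(1,3)] by (simp add: ip_eq)

lemma Q_bt: "bt \<Omega> T Q"
proof -
  have "ip \<Omega> (\<lambda>x. U (t, x)) (h j) = 0" if "t \<notin> {0<..<T}" for t j
    using bt_out(2)[OF U(1) that] by (simp add: ip_def)
  moreover have "h j x = 0" if "x \<notin> \<Omega>" for j x using that by (simp add: h_def)
  ultimately show ?thesis
    unfolding Q_def[abs_def] using spectral_kernel_finite[OF specB] Q_coef h(4)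
    by (intro bt_sum bt_product) auto
qed

lemma Q_eq: "AE t in lebesgue_on {0<..<T}. AE x in lebesgue_on \<Omega>. orth_proj \<Omega> (kerOp \<Omega> lam' e') (\<phi> t) x = Q (t, x)"
  using U(2) L2_data(1) bt_section_L2[OF U(1)]
proof eventually_elim
  case (elim t)
  have el: "L2 \<Omega> (e' j)" for j using specB by (auto simp: spectral_def orthonormal_complete_def)
  have c: "ip \<Omega> (\<phi> t) (e' j) = ip \<Omega> (\<lambda>x. U (t, x)) (h j)" for j
    by (rule ip_cong[OF elim(2,3) el h(3) elim(1) h(2)])
  have "AE x in lebesgue_on \<Omega>. \<forall>j. e' j x = h j x" using h(2) by (simp add: AE_all_countable)
  with orth_proj_eq(2)[OF specB elim(2)] show ?case
    by eventually_elim (simp add: Q_def c)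
qed

lemma inclusion: "AE t in lebesgue_on {0<..<T}. AE x in lebesgue_on \<Omega>. subdiff bh (U (t, x)) (\<Xi> (t, x))"
  using limsol_inclusion[OF Om spectral_onb[OF specA] specB bh lip sol L2_data] U(2) D(2) M(2) F(2) Q_eq
proof eventually_elim
  case (elim t)
  show ?case using elim
  proof eventually_elim
    case (elim x)
    have "\<Xi> (t, x) = \<mu> t x + f t x - \<tau> * d\<phi> t x - \<phi> t x + orth_proj \<Omega> (kerOp \<Omega> lam' e') (\<phi> t) x - \<pi> (\<phi> t x)"
      using elim by (simp add: \<Xi>_def)
    then show ?case using elim(1,2) by simp
  qed
qed

lemma pi_meas: "\<pi> \<in> borel_measurable borel"
proof -
  obtain L where "\<forall>x y. \<bar>\<pi> x - \<pi> y\<bar> \<le> L * \<bar>x - y\<bar>" using lip by blast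
  then have "continuous_on UNIV \<pi>"
    using order_trans[OF _ mult_right_mono[of L "max L 0"]]
    by (intro lipschitz_on_continuous_on[of "max L 0"] lipschitz_onI) (auto simp: dist_real_def)
  then show ?thesis by (simp add: borel_measurable_continuous_onI)
qed

lemma pi_lipschitz: "\<exists>L>0. \<forall>x y. \<bar>\<pi> x - \<pi> y\<bar> \<le> L * \<bar>x - y\<bar>"
proof -
  obtain L where L: "\<forall>x y. \<bar>\<pi> x - \<pi> y\<bar> \<le> L * \<bar>x - y\<bar>" using lip by blast
  have "\<bar>\<pi> x - \<pi> y\<bar> \<le> max L 1 * \<bar>x - y\<bar>" for x y
    by (rule order_trans[OF L[rule_format] mult_right_mono]) auto
  then show ?thesis by (intro exI[of _ "max L 1"]) auto
qed

lemma P0: "rep \<Omega> \<phi>0 \<in> borel_measurable borel" "AE x in lebesgue_on \<Omega>. \<phi>0 x = rep \<Omega> \<phi>0 x"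
  using rep[OF Ob] p0 by (auto simp: L2_def)

lemma U_primitive: "AE t in lebesgue_on {0<..<T}. AE x in lebesgue_on \<Omega>. U (t, x) = rep \<Omega> \<phi>0 x + prim (\<lambda>s. D (s, x)) t"
  using pointwise_primitive[OF Om(1) T spectral_onb[OF specA] U D _ _ p0 P0] sol by (auto simp: limsol_def)

text \<open>Besides exchanging the quantifiers, \<open>U\<close> is replaced by the initial value
  plus the primitive of \<open>D\<close>: a representative defined for every t, to which the scalar
  Gronwall estimate applies.\<close>

lemma pointwise_inclusion:
  "AE x in lebesgue_on \<Omega>. AE t in lborel. t \<in> {0<..<T} \<longrightarrow>
     subdiff bh (rep \<Omega> \<phi>0 x + prim (\<lambda>s. D (s, x)) t)
       (M (t, x) + F (t, x) + Q (t, x) - \<tau> * D (t, x) - (rep \<Omega> \<phi>0 x + prim (\<lambda>s. D (s, x)) t) - \<pi> (rep \<Omega> \<phi>0 x + prim (\<lambda>s. D (s, x)) t))"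
proof -
  let ?u = "\<lambda>t x. rep \<Omega> \<phi>0 x + prim (\<lambda>s. D (s, x)) t"
  let ?\<xi> = "\<lambda>t x. M (t, x) + F (t, x) + Q (t, x) - \<tau> * D (t, x) - ?u t x - \<pi> (?u t x)"
  note [measurable] = bt_meas_pair[OF U(1)] bt_meas_pair[OF D(1)] bt_meas_pair[OF M(1)] bt_meas_pair[OF F(1)]
    bt_meas_pair[OF Q_bt] prim_section_meas[OF D(1)] pi_meas P0(1)
  have "AE t in lebesgue_on {0<..<T}. AE x in lebesgue_on \<Omega>. subdiff bh (?u t x) (?\<xi> t x)"
    using inclusion U_primitive
  proof eventually_elim
    case (elim t)
    then show ?case by eventually_elim (simp add: \<Xi>_def)
  qed
  then have a: "AE t in lborel. AE x in lborel. t \<in> {0<..<T} \<and> x \<in> \<Omega> \<longrightarrow> subdiff bh (?u t x) (?\<xi> t x)"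
    by (auto simp: AE_lebesgue_on_iff)
  have S: "{p. subdiff bh (fst p) (snd p)} \<in> sets borel" by (intro borel_closed subdiff_closed bh)
  have um: "(\<lambda>(t, x). ?u t x) \<in> borel_measurable (borel \<Otimes>\<^sub>M borel)" by measurable
  have xm: "(\<lambda>(t, x). ?\<xi> t x) \<in> borel_measurable (borel \<Otimes>\<^sub>M borel)" by measurable
  have pm: "(\<lambda>p. (?u (fst p) (snd p), ?\<xi> (fst p) (snd p))) \<in> measurable (borel \<Otimes>\<^sub>M borel) borel"
    using um xm by (intro borel_measurable_Pair) (simp_all add: case_prod_unfold)
  have [measurable]: "Measurable.pred (borel \<Otimes>\<^sub>M borel) (\<lambda>p. subdiff bh (?u (fst p) (snd p)) (?\<xi> (fst p) (snd p)))"
    using measurable_sets[OF pm S] unfolding pred_def by (simp add: vimage_def space_pair_measure Int_def)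
  have "Measurable.pred (borel \<Otimes>\<^sub>M borel) (\<lambda>(t, x). t \<in> {0<..<T} \<and> x \<in> \<Omega> \<longrightarrow> subdiff bh (?u t x) (?\<xi> t x))"
    unfolding case_prod_unfold by measurable
  from AE_lborel_swap[OF a this]
  show ?thesis unfolding AE_lebesgue_on_iff[OF Ob] by eventually_elim auto
qed

lemma sob_section:
  "AE t in lebesgue_on {0<..<T}. sob_nsq \<Omega> \<eta> (\<phi> t) = sob_nsq \<Omega> \<eta> (\<lambda>x. U (t, x))"
  using U(2) L2_data(1) bt_section_L2[OF U(1)]
  by eventually_elim (rule sob_nsq_cong[OF Om(1)])

text \<open>Applies the scalar comparison to almost every pair of points seen by the kernel, with
  forcing M + F + Q; the constant is the same for every pair, every kernel and every t.\<close>

lemma kernel_bound: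
  assumes k: "kernel \<Omega> N X Y w" and sf: "sigma_finite_measure N"
    and L: "L > 0" "\<And>x y. \<bar>\<pi> x - \<pi> y\<bar> \<le> L * \<bar>x - y\<bar>"
    and t: "0 \<le> t" "t \<le> T"
  shows "pk N X Y w (\<lambda>x. rep \<Omega> \<phi>0 x + prim (\<lambda>s. D (s, x)) t) \<le> ennreal (2 * exp (2 * ((2 * L + 1) / \<tau>) * T) * (1 + 1 / \<tau>)) *
    (pk N X Y w (rep \<Omega> \<phi>0) + (\<integral>\<^sup>+s. pk N X Y w (\<lambda>x. M (s, x) + F (s, x) + Q (s, x)) \<partial>lborel))"
proof -
  let ?G = "\<lambda>p. M p + F p + Q p"
  have G: "bt \<Omega> T ?G" by (intro bt_add M F Q_bt)
  let ?q = "\<lambda>x. l2 lborel (\<lambda>t. ?G (t, x)) \<and> l2 lborel (\<lambda>t. D (t, x)) \<and> (AE t in lborel. t \<in> {0<..<T} \<longrightarrow>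
     subdiff bh (rep \<Omega> \<phi>0 x + prim (\<lambda>s. D (s, x)) t)
       (?G (t, x) - \<tau> * D (t, x) - (rep \<Omega> \<phi>0 x + prim (\<lambda>s. D (s, x)) t) - \<pi> (rep \<Omega> \<phi>0 x + prim (\<lambda>s. D (s, x)) t)))"
  show ?thesis
  proof (rule kernel_pair_estimate[OF k sf _ _ P0(1) bt_meas_pair[OF G], where Q = ?q])
    show "0 \<le> 2 * exp (2 * ((2 * L + 1) / \<tau>) * T) * (1 + 1 / \<tau>)" using tau by simp
    show "(\<lambda>x. rep \<Omega> \<phi>0 x + prim (\<lambda>s. D (s, x)) t) \<in> borel_measurable borel"
      using measurable_compose[OF measurable_Pair1' prim_section_meas[OF D(1)], of t] P0(1) by simp
    have "AE x in lebesgue_on \<Omega>. l2 lborel (\<lambda>t. ?G (t, x))" "AE x in lebesgue_on \<Omega>. l2 lborel (\<lambda>t. D (t, x))"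
      using bt_time_sections[OF G] bt_time_sections[OF D(1)] by (auto simp: AE_lebesgue_on_iff)
    with pointwise_inclusion show "AE x in lebesgue_on \<Omega>. ?q x" by eventually_elim blast
  next
    fix x y assume "?q x" "?q y"
    then show "((rep \<Omega> \<phi>0 x + prim (\<lambda>s. D (s, x)) t) - (rep \<Omega> \<phi>0 y + prim (\<lambda>s. D (s, y)) t))\<^sup>2
      \<le> 2 * exp (2 * ((2 * L + 1) / \<tau>) * T) * (1 + 1 / \<tau>) *
        ((rep \<Omega> \<phi>0 x - rep \<Omega> \<phi>0 y)\<^sup>2 + (LINT s|lborel. (?G (s, x) - ?G (s, y))\<^sup>2))"
      by (intro inclusion_pair[OF tau bh L _ _ _ _ _ _ t]) auto
  qed auto
qed

text \<open>Two applications of the quasi-triangle inequality give the factors 4, 4 and 2 for the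
  three parts of the forcing; the projection contributes finitely many fixed functions with
  time-dependent coefficients.\<close>

lemma kernel_data_bound:
  assumes k: "kernel \<Omega> N X Y w" and Cm: "0 \<le> Cm"
    and Mb: "AE s in lebesgue_on {0<..<T}. pk N X Y w (\<lambda>x. M (s, x)) \<le> ennreal Cm * V s"
    and Fb: "AE s in lebesgue_on {0<..<T}. pk N X Y w (\<lambda>x. F (s, x)) \<le> S s"
    and hb: "\<And>j. lam' j = 0 \<Longrightarrow> pk N X Y w (h j) \<le> b j"
  shows "(\<integral>\<^sup>+s. pk N X Y w (\<lambda>x. M (s, x) + F (s, x) + Q (s, x)) \<partial>lborel) \<le>
    (\<integral>\<^sup>+s. 4 * (ennreal Cm * V s) + 4 * S s + 2 * (2 ^ card {j. lam' j = 0} *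
       (\<Sum>j\<in>{j. lam' j = 0}. ennreal ((ip \<Omega> (\<lambda>x. U (s, x)) (h j))\<^sup>2) * b j)) \<partial>lebesgue_on {0<..<T})"
    (is "_ \<le> (\<integral>\<^sup>+s. ?R s \<partial>_)")
proof -
  interpret kernel \<Omega> N X Y w by (rule k)
  let ?J = "{j. lam' j = 0}"
  let ?p = "\<lambda>s. pk N X Y w (\<lambda>x. M (s, x) + F (s, x) + Q (s, x))"
  have "?p s = 0" if "s \<notin> {0<..<T}" for s
    using bt_out(2)[OF M(1) that] bt_out(2)[OF F(1) that] bt_out(2)[OF Q_bt that] by (simp add: pk_def)
  then have "(\<integral>\<^sup>+s. ?p s \<partial>lborel) = (\<integral>\<^sup>+s. indicator {0<..<T} s * ?p s \<partial>lborel)"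
    by (intro nn_integral_cong) (auto simp: indicator_def)
  also have "\<dots> = (\<integral>\<^sup>+s. ?p s \<partial>lebesgue_on {0<..<T})" by (subst nn_integral_lebesgue_on) auto
  also have "\<dots> \<le> (\<integral>\<^sup>+s. ?R s \<partial>lebesgue_on {0<..<T})"
  proof (rule nn_integral_mono_AE)
    show "AE s in lebesgue_on {0<..<T}. ?p s \<le> ?R s"
      using Mb Fb
    proof eventually_elim
      case (elim s)
      note sm = bt_sec_meas[OF M(1), of s] bt_sec_meas[OF F(1), of s] bt_sec_meas[OF Q_bt, of s]
      have "?p s \<le> 2 * pk N X Y w (\<lambda>x. M (s, x) + F (s, x)) + 2 * pk N X Y w (\<lambda>x. Q (s, x))"
        using sm by (intro pk_add borel_measurable_add)
      also have "\<dots> \<le> 2 * (2 * (ennreal Cm * V s) + 2 * S s) + 2 * (2 ^ card ?J * (\<Sum>j\<in>?J. ennreal ((ip \<Omega> (\<lambda>x. U (s, x)) (h j))\<^sup>2) * b j))"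
      proof (intro add_mono mult_left_mono)
        have "pk N X Y w (\<lambda>x. M (s, x) + F (s, x)) \<le> 2 * pk N X Y w (\<lambda>x. M (s, x)) + 2 * pk N X Y w (\<lambda>x. F (s, x))"
          using sm by (intro pk_add)
        also have "\<dots> \<le> 2 * (ennreal Cm * V s) + 2 * S s" by (intro add_mono mult_left_mono elim) auto
        finally show "pk N X Y w (\<lambda>x. M (s, x) + F (s, x)) \<le> 2 * (ennreal Cm * V s) + 2 * S s" .
        have "pk N X Y w (\<lambda>x. Q (s, x)) \<le> 2 ^ card ?J * (\<Sum>j\<in>?J. pk N X Y w (\<lambda>x. ip \<Omega> (\<lambda>x. U (s, x)) (h j) * h j x))"
          unfolding Q_def fst_conv snd_conv
          by (intro pk_sum spectral_kernel_finite[OF specB] borel_measurable_times borel_measurable_const h(1))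
        also have "\<dots> \<le> 2 ^ card ?J * (\<Sum>j\<in>?J. ennreal ((ip \<Omega> (\<lambda>x. U (s, x)) (h j))\<^sup>2) * b j)"
          using hb by (intro mult_left_mono sum_mono) (auto simp: pk_scale[OF h(1)] intro: mult_left_mono)
        finally show "pk N X Y w (\<lambda>x. Q (s, x)) \<le> 2 ^ card ?J * (\<Sum>j\<in>?J. ennreal ((ip \<Omega> (\<lambda>x. U (s, x)) (h j))\<^sup>2) * b j)" .
      qed auto
      finally show ?case by (simp add: distrib_left mult.assoc[symmetric])
    qed
  qed
  finally show ?thesis .
qed

theorem regularity:
  assumes fam: "sob_family \<Omega> \<eta> N K X Y w"
    and VB: "\<exists>n::nat. n > 0 \<and> Vsp \<Omega> lam' e' (real n) \<subseteq> {v. inH \<Omega> 1 v}"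
    and VA: "Vsp \<Omega> lam e (2 * r) \<subseteq> {v. inH \<Omega> \<eta> v}"
    and f: "L2T_X \<Omega> T (sob_nsq \<Omega> \<eta>) f" and \<phi>0: "inH \<Omega> \<eta> \<phi>0"
  shows "L2T_X \<Omega> T (sob_nsq \<Omega> \<eta>) \<phi>"
proof -
  interpret sob_family \<Omega> \<eta> N K X Y w by (rule fam)
  let ?I = "lebesgue_on {0<..<T}" let ?J = "{j. lam' j = 0}" let ?V = "Vnsq \<Omega> lam e (2 * r)"
  obtain L where L: "L > 0" "\<And>x y. \<bar>\<pi> x - \<pi> y\<bar> \<le> L * \<bar>x - y\<bar>" using pi_lipschitz by blast
  have muV: "L2T_X \<Omega> T ?V \<mu>" and pT: "L2T \<Omega> T \<phi>" using sol by (auto simp: limsol_def time_deriv_def)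
  have rep_sob: "sob_nsq \<Omega> \<eta> (rep \<Omega> v) = sob_nsq \<Omega> \<eta> v" if "L2 \<Omega> v" for v
  proof -
    have vm: "v \<in> borel_measurable (lebesgue_on \<Omega>)" using that by (simp add: L2_def)
    note rv = rep[OF Ob vm]
    have "L2 \<Omega> (rep \<Omega> v)" using l2_cong_AE[OF that[unfolded L2_eq] borel_meas_lebesgue_on[OF rv(1)] rv(2)] by (simp add: L2_eq)
    then show ?thesis using sob_nsq_cong[OF Om(1) that _ rv(2)] by simp
  qed
  \<comment> \<open>The inclusion of V_A^(2r) becomes a bound uniform over the kernels, so it can be
    integrated over the time values of \<mu>.\<close>
  have "\<exists>C\<ge>0. \<forall>v k. k \<in> K \<and> ?V v < \<infinity> \<longrightarrow> pk N (X k) (Y k) (w k) (rep \<Omega> v) \<le> ennreal C * ?V v"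
  proof (rule V_embedding[OF specA Ob kern])
    fix v assume v: "v \<in> Vsp \<Omega> lam e (2 * r)"
    then have vL: "L2 \<Omega> v" by (simp add: Vsp_def)
    have "rep \<Omega> v \<in> borel_measurable borel" using rep(1)[OF Ob] vL by (simp add: L2_def)
    then have "(SUP k\<in>K. pk N (X k) (Y k) (w k) (rep \<Omega> v)) \<le> sob_nsq \<Omega> \<eta> (rep \<Omega> v)"
      by (intro SUP_least upper)
    also have "\<dots> < \<infinity>" using VA v unfolding rep_sob[OF vL] by (auto simp: inH_def)
    finally show "(SUP k\<in>K. pk N (X k) (Y k) (w k) (rep \<Omega> v)) < \<infinity>" .
  qed
  then obtain Cm where Cm: "0 \<le> Cm" "\<And>v k. k \<in> K \<Longrightarrow> ?V v < \<infinity> \<Longrightarrow> pk N (X k) (Y k) (w k) (rep \<Omega> v) \<le> ennreal Cm * ?V v"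
    by blast
  have Mb: "AE s in ?I. pk N (X k) (Y k) (w k) (\<lambda>x. M (s, x)) \<le> ennreal Cm * ?V (\<mu> s)" if k: "k \<in> K" for k
  proof -
    have "AE s in ?I. ?V (\<mu> s) < \<infinity>" using muV by (simp add: L2T_X_def)
    then show ?thesis using M(2) L2_data(3)
    proof eventually_elim
      case (elim s)
      have "AE x in lebesgue_on \<Omega>. \<mu> s x = rep \<Omega> (\<mu> s) x" using elim(3) by (intro rep(2)[OF Ob]) (simp add: L2_def)
      with elim(2) have "AE x in lebesgue_on \<Omega>. M (s, x) = rep \<Omega> (\<mu> s) x" by eventually_elim simp
      from kernel.pk_cong[OF kern[OF k] this] show ?case using Cm(2)[OF k elim(1)] by simp
    qed
  qed
  have Fb: "AE s in ?I. pk N (X k) (Y k) (w k) (\<lambda>x. F (s, x)) \<le> sob_nsq \<Omega> \<eta> (f s)" if k: "k \<in> K" for k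
    using F(2) L2_data(4) bt_section_L2[OF F(1)]
  proof eventually_elim
    case (elim s)
    show ?case using upper[OF bt_sec_meas[OF F(1)] k, of s] sob_nsq_cong[OF Om(1) elim(2,3,1)] by simp
  qed
  \<comment> \<open>An eigenfunction for the eigenvalue 0 lies in every V_B^n: its single nonzero
    coefficient is multiplied by a power of 0. Thus it belongs to H^1, and from there to
    H^\<eta>.\<close>
  have hfin: "sob_nsq \<Omega> \<eta> (h j) < \<infinity>" if "lam' j = 0" for j
  proof -
    obtain n :: nat where n: "n > 0" "Vsp \<Omega> lam' e' (real n) \<subseteq> {v. inH \<Omega> 1 v}" using VB by blast
    have el: "L2 \<Omega> (e' j)" and on: "\<And>i. ip \<Omega> (e' j) (e' i) = (if j = i then 1 else 0)"
      using specB by (auto simp: spectral_def orthonormal_complete_def)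
    have "(\<lambda>i. (lam' i powr real n * ip \<Omega> (e' j) (e' i))\<^sup>2) = (\<lambda>i. 0)"
      using that by (auto simp: on fun_eq_iff)
    then have "e' j \<in> Vsp \<Omega> lam' e' (real n)" using el by (simp add: Vsp_def)
    then have "inH \<Omega> 1 (h j)" using n(2) sob_nsq_cong[OF Om(1) el h(3) h(2), of 1] by (auto simp: inH_def)
    then show ?thesis using H1[OF h(1)] by (simp add: inH_def)
  qed
  let ?R = "\<lambda>s. 4 * (ennreal Cm * ?V (\<mu> s)) + 4 * sob_nsq \<Omega> \<eta> (f s) + 2 * (2 ^ card ?J *
       (\<Sum>j\<in>?J. ennreal ((ip \<Omega> (\<lambda>x. U (s, x)) (h j))\<^sup>2) * sob_nsq \<Omega> \<eta> (h j)))"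
  \<comment> \<open>One bound for all kernels and all times. The independence of k matters for
    \<eta> = 1, where the weak derivative is recovered from a supremum over directions and step
    lengths.\<close>
  let ?Z = "ennreal (2 * exp (2 * ((2 * L + 1) / \<tau>) * T) * (1 + 1 / \<tau>)) * (sob_nsq \<Omega> \<eta> \<phi>0 + (\<integral>\<^sup>+s. ?R s \<partial>?I))"
  have bound: "pk N (X k) (Y k) (w k) (\<lambda>x. rep \<Omega> \<phi>0 x + prim (\<lambda>s. D (s, x)) t) \<le> ?Z"
    if k: "k \<in> K" and t: "t \<in> {0<..<T}" for k t
  proof -
    have "pk N (X k) (Y k) (w k) (rep \<Omega> \<phi>0) \<le> sob_nsq \<Omega> \<eta> \<phi>0" using upper[OF P0(1) k] by (simp add: rep_sob p0)
    moreover have "(\<integral>\<^sup>+s. pk N (X k) (Y k) (w k) (\<lambda>x. M (s, x) + F (s, x) + Q (s, x)) \<partial>lborel) \<le> (\<integral>\<^sup>+s. ?R s \<partial>?I)"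
      by (rule kernel_data_bound[OF kern[OF k] Cm(1) Mb[OF k] Fb[OF k]]) (rule upper[OF h(1) k])
    ultimately show ?thesis
      using t by (intro order_trans[OF kernel_bound[OF kern[OF k] sf L]] mult_left_mono add_mono) auto
  qed
  have Zfin: "?Z < \<infinity>"
  proof -
    have [measurable]: "(\<lambda>s. ?V (\<mu> s)) \<in> borel_measurable ?I" "(\<lambda>s. sob_nsq \<Omega> \<eta> (f s)) \<in> borel_measurable ?I"
      using muV f by (auto simp: L2T_X_def)
    have [measurable]: "(\<lambda>s. ip \<Omega> (\<lambda>x. U (s, x)) (h j)) \<in> borel_measurable ?I" for j
      using l2_meas[OF Q_coef[of j]] by (intro borel_meas_lebesgue_on) simp
    have c: "(\<integral>\<^sup>+s. ennreal ((ip \<Omega> (\<lambda>x. U (s, x)) (h j))\<^sup>2) \<partial>?I) < \<infinity>" for j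
    proof -
      have "(\<integral>\<^sup>+s. ennreal ((ip \<Omega> (\<lambda>x. U (s, x)) (h j))\<^sup>2) \<partial>?I) = sqn ?I (\<lambda>s. ip \<Omega> (\<lambda>x. U (s, x)) (h j))"
        by (simp add: sqn_def)
      also have "\<dots> < \<infinity>" using l2_restrict[OF Q_coef, of "{0<..<T}" j] by (simp add: l2_iff_sqn)
      finally show ?thesis .
    qed
    have "(\<integral>\<^sup>+s. ?R s \<partial>?I) = 4 * (ennreal Cm * (\<integral>\<^sup>+s. ?V (\<mu> s) \<partial>?I)) + 4 * (\<integral>\<^sup>+s. sob_nsq \<Omega> \<eta> (f s) \<partial>?I)
      + 2 * (2 ^ card ?J * (\<Sum>j\<in>?J. (\<integral>\<^sup>+s. ennreal ((ip \<Omega> (\<lambda>x. U (s, x)) (h j))\<^sup>2) \<partial>?I) * sob_nsq \<Omega> \<eta> (h j)))"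
      by (simp add: nn_integral_add nn_integral_cmult nn_integral_sum nn_integral_multc)
    also have "\<dots> < \<infinity>"
      using muV f c hfin
      by (auto simp: L2T_X_def ennreal_mult_eq_top_iff less_top[symmetric] spectral_kernel_finite[OF specB] power_eq_top_ennreal)
    finally have "(\<integral>\<^sup>+s. ?R s \<partial>?I) < \<infinity>" .
    then show ?thesis using \<phi>0 by (simp add: inH_def ennreal_mult_less_top)
  qed
  then obtain C where C: "0 \<le> C" "?Z = ennreal C" by (cases ?Z) auto
  \<comment> \<open>Uniform kernel bounds convert back into a Sobolev bound at almost every time;
    the L^2 norm is the only part that still depends on t.\<close>
  have b: "AE t in ?I. sob_nsq \<Omega> \<eta> (\<lambda>x. U (t, x)) \<le> ennreal (nsq \<Omega> (\<lambda>x. U (t, x)) + 3 * C)"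
  proof -
    have "AE t in ?I. t \<in> {0<..<T}" using AE_space[of ?I] by simp
    then show ?thesis using U_primitive bt_section_L2[OF U(1)]
    proof eventually_elim
      case (elim t)
      show ?case
      proof (rule lower[OF bt_sec_meas[OF U(1)] elim(3) C(1)])
        fix k assume k: "k \<in> K"
        show "pk N (X k) (Y k) (w k) (\<lambda>x. U (t, x)) \<le> ennreal C"
          using kernel.pk_cong[OF kern[OF k] elim(2)] bound[OF k elim(1)] C(2) by simp
      qed
    qed
  qed
  have fin: "AE t in ?I. sob_nsq \<Omega> \<eta> (\<phi> t) < \<infinity>"
    using b sob_section[of \<eta>] by eventually_elim (auto intro: le_less_trans)
  have meas: "(\<lambda>t. sob_nsq \<Omega> \<eta> (\<phi> t)) \<in> borel_measurable ?I"
  proof (rule lebesgue_on_AE_measurable)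
    show "(\<lambda>t. sob_nsq \<Omega> \<eta> (\<lambda>x. U (t, x))) \<in> borel_measurable ?I"
    proof (rule sob_meas[OF _ bt_meas[OF U(1)]])
      show "AE t in ?I. L2 \<Omega> (\<lambda>x. U (t, x)) \<and> inH \<Omega> \<eta> (\<lambda>x. U (t, x))"
        using bt_section_L2[OF U(1)] b by eventually_elim (auto simp: inH_def intro: le_less_trans)
    qed simp
    show "AE t in ?I. sob_nsq \<Omega> \<eta> (\<lambda>x. U (t, x)) = sob_nsq \<Omega> \<eta> (\<phi> t)"
      using sob_section[of \<eta>] by eventually_elim simp
  qed auto
  have "(\<integral>\<^sup>+t. sob_nsq \<Omega> \<eta> (\<phi> t) \<partial>?I) \<le> (\<integral>\<^sup>+t. ennreal (nsq \<Omega> (\<lambda>x. U (t, x)) + 3 * C) \<partial>?I)"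
  proof (rule nn_integral_mono_AE)
    show "AE t in ?I. sob_nsq \<Omega> \<eta> (\<phi> t) \<le> ennreal (nsq \<Omega> (\<lambda>x. U (t, x)) + 3 * C)"
      using b sob_section[of \<eta>] by eventually_elim simp
  qed
  also have "\<dots> < \<infinity>"
  proof -
    have nm: "(\<lambda>t. nsq \<Omega> (\<lambda>x. U (t, x))) \<in> borel_measurable borel" by (rule nsq_section_meas[OF bt_meas[OF U(1)] Ob])
    have "integrable lborel (\<lambda>t. indicator {0<..<T} t *\<^sub>R nsq \<Omega> (\<lambda>x. U (t, x)))"
      by (rule integrable_mult_indicator[OF _ bt_nsq_integrable[OF Ob U(1)]]) simp
    moreover have "integrable lborel (\<lambda>t. indicator {0<..<T} t * (3 * C))"
      by (intro integrable_mult_left integrable_real_indicator) (auto simp: Ioo_finite)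
    ultimately have "integrable lborel (\<lambda>t. indicator {0<..<T} t * (nsq \<Omega> (\<lambda>x. U (t, x)) + 3 * C))"
      by (simp add: distrib_left)
    then have "integrable ?I (\<lambda>t. nsq \<Omega> (\<lambda>x. U (t, x)) + 3 * C)"
      using nm by (subst integrable_lebesgue_on) auto
    from Bochner_Integration.integrable_norm[OF this]
    show ?thesis using C(1) by (simp add: integrable_iff_bounded nsq_eq inn_nonneg)
  qed
  finally show ?thesis using pT fin meas by (simp add: L2T_X_def)
qed

end

section \<open>Uniqueness\<close>

lemma bt_l2: "bt \<Omega> T U \<Longrightarrow> l2 lborel U"
  by (simp add: bt_def l2_def)

lemma bt_ip_integrable:
  assumes Ob: "\<Omega> \<in> sets borel" and U: "bt \<Omega> T U" and V: "bt \<Omega> T V"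
  shows "integrable lborel (\<lambda>t. ip \<Omega> (\<lambda>x. U (t, x)) (\<lambda>x. V (t, x)))"
proof -
  have "integrable (lborel \<Otimes>\<^sub>M lborel) (\<lambda>p. U p * V p)"
    using l2_mult[OF bt_l2[OF U] bt_l2[OF V]] by (simp add: lborel_prod)
  from lborel_pair.integrable_fst'[OF this]
  show ?thesis by (simp add: ip_eq bt_inn_eq[OF Ob U bt_sec_meas[OF V]])
qed

text \<open>The energy identity for \<open>\<integral>\<^sub>0\<^sup>s (\<partial>\<^sub>t U, U)\<close>, integrated first in time and then in space.\<close>

lemma bt_energy:
  assumes Ob: "\<Omega> \<in> sets borel" and U: "bt \<Omega> T U" and D: "bt \<Omega> T D" and s: "0 \<le> s" "s \<le> T"
    and UD: "AE t in lebesgue_on {0<..<T}. AE x in lebesgue_on \<Omega>. U (t, x) = prim (\<lambda>r. D (r, x)) t"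
  shows "prim (\<lambda>t. ip \<Omega> (\<lambda>x. D (t, x)) (\<lambda>x. U (t, x))) s = nsq \<Omega> (\<lambda>x. prim (\<lambda>r. D (r, x)) s) / 2"
proof -
  note [measurable] = bt_meas_pair[OF U] bt_meas_pair[OF D] Ob
  let ?k = "\<lambda>t x. indicator {0<..<s} t * (D (t, x) * U (t, x))"
  have DU: "integrable (lborel \<Otimes>\<^sub>M lborel) (\<lambda>p. D p * U p)"
    using l2_mult[OF bt_l2[OF D] bt_l2[OF U]] by (simp add: lborel_prod)
  have ki: "integrable (lborel \<Otimes>\<^sub>M lborel) (\<lambda>(t, x). ?k t x)"
    by (rule Bochner_Integration.integrable_bound[OF DU]) (measurable, auto simp: indicator_def)
  have Pm[measurable]: "(\<lambda>(t, x). prim (\<lambda>r. D (r, x)) t) \<in> borel_measurable (borel \<Otimes>\<^sub>M borel)"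
    by (rule prim_section_meas[OF D])
  have z: "prim (\<lambda>r. D (r, x)) t = 0" if "x \<notin> \<Omega>" for x t
    using bt_out(1)[OF D that] by (simp add: prim_def)
  have "AE t in lborel. AE x in lborel. t \<in> {0<..<T} \<longrightarrow> U (t, x) = prim (\<lambda>r. D (r, x)) t"
  proof -
    have "AE t in lborel. t \<in> {0<..<T} \<longrightarrow> (AE x in lborel. x \<in> \<Omega> \<longrightarrow> U (t, x) = prim (\<lambda>r. D (r, x)) t)"
      using UD by (simp add: AE_lebesgue_on_iff Ob)
    then show ?thesis
    proof eventually_elim
      case (elim t)
      show ?case
      proof (cases "t \<in> {0<..<T}")
        case True
        then have "AE x in lborel. x \<in> \<Omega> \<longrightarrow> U (t, x) = prim (\<lambda>r. D (r, x)) t" using elim by blast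
        then show ?thesis by eventually_elim (use z bt_out(1)[OF U] in metis)
      next
        case False then show ?thesis by (intro AE_I2) blast
      qed
    qed
  qed
  from AE_lborel_swap[OF this]
  have UDx: "AE x in lborel. AE t in lborel. t \<in> {0<..<T} \<longrightarrow> U (t, x) = prim (\<lambda>r. D (r, x)) t"
    by measurable
  have "prim (\<lambda>t. ip \<Omega> (\<lambda>x. D (t, x)) (\<lambda>x. U (t, x))) s = (LINT t|lborel. LINT x|lborel. ?k t x)"
    unfolding prim_def by (simp add: ip_eq bt_inn_eq[OF Ob D bt_sec_meas[OF U]])
  also have "\<dots> = (LINT x|lborel. LINT t|lborel. ?k t x)"
    using lborel_pair.Fubini_integral[OF ki] by simp
  also have "\<dots> = (LINT x|lborel. (prim (\<lambda>r. D (r, x)) s)\<^sup>2 / 2)"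
  proof (rule integral_cong_AE)
    show "AE x in lborel. (LINT t|lborel. ?k t x) = (prim (\<lambda>r. D (r, x)) s)\<^sup>2 / 2"
      using UDx bt_time_sections[OF D]
    proof eventually_elim
      case (elim x)
      have "(LINT t|lborel. ?k t x) = prim (\<lambda>t. D (t, x) * prim (\<lambda>r. D (r, x)) t) s"
        unfolding prim_def[of "\<lambda>t. D (t, x) * prim (\<lambda>r. D (r, x)) t"]
      proof (rule integral_cong_AE)
        show "AE t in lborel. ?k t x = indicator {0<..<s} t * (D (t, x) * prim (\<lambda>r. D (r, x)) t)"
          using elim(1) by eventually_elim (use s in \<open>auto simp: indicator_def\<close>)
      qed measurable
      then show ?case by (simp add: prim_square[OF elim(2)])
    qed
  qed measurable
  also have "\<dots> = nsq \<Omega> (\<lambda>x. prim (\<lambda>r. D (r, x)) s) / 2"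
  proof -
    have "nsq \<Omega> (\<lambda>x. prim (\<lambda>r. D (r, x)) s) = (LINT x|lborel. indicator \<Omega> x * (prim (\<lambda>r. D (r, x)) s)\<^sup>2)"
      unfolding nsq_eq inn_def power2_eq_square by (rule integral_lebesgue_on[OF Ob]) measurable
    also have "\<dots> = (LINT x|lborel. (prim (\<lambda>r. D (r, x)) s)\<^sup>2)"
      by (intro Bochner_Integration.integral_cong) (auto simp: indicator_def z)
    finally show ?thesis by simp
  qed
  finally show ?thesis .
qed

context limsol_rep
begin

text \<open>The function \<Xi> solves the equation by its definition; what has to be checked is its
  square integrability on (0,T) x \<Omega>, where \<pi>(\<phi>) grows at most linearly and the
  domain is bounded.\<close>

lemma selection:
  "\<exists>\<xi>. L2T \<Omega> T \<xi> \<and> (AE t in lebesgue_on {0<..<T}. AE x in lebesgue_on \<Omega>. subdiff bh (\<phi> t x) (\<xi> t x) \<and>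
      \<tau> * d\<phi> t x + \<phi> t x - orth_proj \<Omega> (kerOp \<Omega> lam' e') (\<phi> t) x + \<xi> t x + \<pi> (\<phi> t x) = \<mu> t x + f t x)"
proof (intro exI[of _ "\<lambda>t x. \<Xi> (t, x)"] conjI)
  let ?W = "{0<..<T} \<times> \<Omega>"
  have Wb: "?W \<in> sets borel" "bounded ?W" using Om by (auto intro!: borel_open open_Times bounded_Times)
  obtain L where L: "L > 0" "\<And>x y. \<bar>\<pi> x - \<pi> y\<bar> \<le> L * \<bar>x - y\<bar>" using pi_lipschitz by blast
  have r: "l2 (lebesgue_on ?W) V" if "bt \<Omega> T V" for V by (rule l2_restrict[OF bt_l2[OF that] Wb(1)])
  have "l2 (lebesgue_on ?W) (\<lambda>p. \<pi> (U p))"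
  proof (rule l2_dominated)
    have "l2 (lebesgue_on ?W) (\<lambda>p. \<bar>U p\<bar>)"
      using l2_meas[OF r[OF U(1)]] by (intro l2_dominated[OF r[OF U(1)]]) auto
    then show "l2 (lebesgue_on ?W) (\<lambda>p. \<bar>\<pi> 0\<bar> + L * \<bar>U p\<bar>)" by (intro l2_add l2_scale const_l2 Wb)
    show "(\<lambda>p. \<pi> (U p)) \<in> borel_measurable (lebesgue_on ?W)"
      by (rule measurable_compose[OF l2_meas[OF r[OF U(1)]] pi_meas])
    show "AE p in lebesgue_on ?W. \<bar>\<pi> (U p)\<bar> \<le> \<bar>\<bar>\<pi> 0\<bar> + L * \<bar>U p\<bar>\<bar>"
    proof (rule AE_I2)
      fix p show "\<bar>\<pi> (U p)\<bar> \<le> \<bar>\<bar>\<pi> 0\<bar> + L * \<bar>U p\<bar>\<bar>" using L(2)[of "U p" 0] by simp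
    qed
  qed
  then have "l2 (lebesgue_on ?W) \<Xi>"
    unfolding \<Xi>_def[abs_def] by (intro l2_add l2_diff l2_scale r[OF M(1)] r[OF F(1)] r[OF D(1)] r[OF U(1)] r[OF Q_bt])
  then show "L2T \<Omega> T (\<lambda>t x. \<Xi> (t, x))" by (simp add: L2T_def l2_def case_prod_unfold)
  show "AE t in lebesgue_on {0<..<T}. AE x in lebesgue_on \<Omega>. subdiff bh (\<phi> t x) (\<Xi> (t, x)) \<and>
      \<tau> * d\<phi> t x + \<phi> t x - orth_proj \<Omega> (kerOp \<Omega> lam' e') (\<phi> t) x + \<Xi> (t, x) + \<pi> (\<phi> t x) = \<mu> t x + f t x"
    using inclusion U(2) D(2) M(2) F(2) Q_eq
  proof eventually_elim
    case (elim t)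
    then show ?case by eventually_elim (simp add: \<Xi>_def)
  qed
qed

definition g :: "nat \<Rightarrow> pt \<Rightarrow> real" where "g j = rep \<Omega> (e j)"

lemma e_L2: "L2 \<Omega> (e j)" using specA by (auto simp: spectral_def orthonormal_complete_def)

lemma g: "g j \<in> borel_measurable borel" "AE x in lebesgue_on \<Omega>. e j x = g j x" "L2 \<Omega> (g j)"
proof -
  have em: "e j \<in> borel_measurable (lebesgue_on \<Omega>)" using e_L2 by (simp add: L2_def)
  show "g j \<in> borel_measurable borel" "AE x in lebesgue_on \<Omega>. e j x = g j x"
    unfolding g_def by (rule rep[OF Ob em])+
  then show "L2 \<Omega> (g j)"
    using l2_cong_AE[OF e_L2[unfolded L2_eq] borel_meas_lebesgue_on] by (simp add: L2_eq)
qed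

text \<open>Testing with an eigenfunction leaves a single term of the Parseval sum, in which the two
  powers r combine into 2r. In this form the weak equation is a scalar relation for each
  mode.\<close>

lemma mode_equation:
  "AE t in lebesgue_on {0<..<T}. ip \<Omega> (\<lambda>x. D (t, x)) (g j) + lam j powr (2 * r) * ip \<Omega> (\<lambda>x. M (t, x)) (g j) = 0"
proof -
  interpret A: onb "lebesgue_on \<Omega>" e by (rule spectral_onb[OF specA])
  have on: "ip \<Omega> (e j) (e i) = (if j = i then 1 else 0)" for i
    using specA by (auto simp: spectral_def orthonormal_complete_def)
  have "summable (\<lambda>i. (lam i powr r * ip \<Omega> (e j) (e i))\<^sup>2)"
    by (rule summable_finite[of "{j}"]) (auto simp: on)
  then have ej: "e j \<in> Vsp \<Omega> lam e r" using e_L2 by (simp add: Vsp_def)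
  have "AE t in lebesgue_on {0<..<T}. ip \<Omega> (d\<phi> t) (e j) + ip \<Omega> (Apow \<Omega> lam e r (\<mu> t)) (Apow \<Omega> lam e r (e j)) = 0"
    using sol ej by (auto simp: limsol_def)
  moreover have "AE t in lebesgue_on {0<..<T}. Vnsq \<Omega> lam e (2 * r) (\<mu> t) < \<infinity>"
    using sol by (auto simp: limsol_def L2T_X_def)
  ultimately show ?thesis using D(2) M(2) L2_data(2,3) bt_section_L2[OF D(1)] bt_section_L2[OF M(1)]
  proof eventually_elim
    case (elim t)
    have mu: "\<mu> t \<in> Vsp \<Omega> lam e (2 * r)" using elim(2) by (rule Vnsq_finite_iff)
    have pw: "lam i powr (2 * r) = (lam i powr r)\<^sup>2" for i by (simp add: power2_eq_square flip: powr_add)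
    \<comment> \<open>Membership in V^(2r) implies membership in V^r: with a the r-th power of the
      eigenvalue, a^2 \<le> 1 + a^4.\<close>
    have "summable (\<lambda>i. (lam i powr r * ip \<Omega> (\<mu> t) (e i))\<^sup>2)"
    proof (rule summable_comparison_test')
      show "summable (\<lambda>i. (ip \<Omega> (\<mu> t) (e i))\<^sup>2 + (lam i powr (2 * r) * ip \<Omega> (\<mu> t) (e i))\<^sup>2)"
        using A.bessel[of "\<mu> t"] mu by (intro summable_add) (auto simp: Vsp_def L2_eq ip_eq)
      fix i
      let ?a = "lam i powr r" let ?m = "ip \<Omega> (\<mu> t) (e i)"
      have "?a\<^sup>2 \<le> 1 + (?a\<^sup>2)\<^sup>2" using sum_squares_bound[of 1 "?a\<^sup>2"] zero_le_power2[of ?a] unfolding power_one mult_1_right by linarith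
      from mult_right_mono[OF this, of "?m\<^sup>2"]
      show "norm ((?a * ?m)\<^sup>2) \<le> ?m\<^sup>2 + (lam i powr (2 * r) * ?m)\<^sup>2"
        by (simp add: pw power_mult_distrib distrib_right)
    qed
    then have muV: "\<mu> t \<in> Vsp \<Omega> lam e r" using mu by (simp add: Vsp_def)
    note c = Apow_coef[OF specA muV] and c' = Apow_coef[OF specA ej]
    have "(\<lambda>i. ip \<Omega> (Apow \<Omega> lam e r (\<mu> t)) (e i) * ip \<Omega> (Apow \<Omega> lam e r (e j)) (e i)) sums
        ip \<Omega> (Apow \<Omega> lam e r (\<mu> t)) (Apow \<Omega> lam e r (e j))"
      using A.parseval c(1) c'(1) by (simp add: L2_eq ip_eq)
    moreover have "(\<lambda>i. ip \<Omega> (Apow \<Omega> lam e r (\<mu> t)) (e i) * ip \<Omega> (Apow \<Omega> lam e r (e j)) (e i)) sums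
        (\<Sum>i\<in>{j}. ip \<Omega> (Apow \<Omega> lam e r (\<mu> t)) (e i) * ip \<Omega> (Apow \<Omega> lam e r (e j)) (e i))"
      by (rule sums_finite) (auto simp: c' on)
    ultimately have "ip \<Omega> (Apow \<Omega> lam e r (\<mu> t)) (Apow \<Omega> lam e r (e j)) = lam j powr (2 * r) * ip \<Omega> (\<mu> t) (e j)"
      using sums_unique2 by (fastforce simp: c c' on pw power2_eq_square)
    moreover have "ip \<Omega> (d\<phi> t) (e j) = ip \<Omega> (\<lambda>x. D (t, x)) (g j)" "ip \<Omega> (\<mu> t) (e j) = ip \<Omega> (\<lambda>x. M (t, x)) (g j)"
      by (rule ip_cong[OF elim(5,7) e_L2 g(3) elim(3) g(2)], rule ip_cong[OF elim(6,8) e_L2 g(3) elim(4) g(2)])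
    ultimately show ?case using elim(1) by simp
  qed
qed

end

lemma onb_cong_AE:
  assumes e: "onb M e" and g: "\<And>j. l2 M (g j)" "\<And>j. AE x in M. e j x = g j x" shows "onb M g"
proof -
  interpret onb M e by (rule e)
  have c: "inn M v (g j) = inn M v (e j)" if "l2 M v" for v j
    using g(2)[of j] by (intro inn_cong_AE l2_meas that g(1) e_l2) auto
  show ?thesis
  proof (rule onb.intro)
    show "inn M (g i) (g j) = (if i = j then 1 else 0)" for i j
      using c[OF g(1), of i j] c[OF e_l2, of j i] e_on[of j i] inn_commute[of M "g i" "e j"] by (auto simp: eq_commute)
    show "AE x in M. v x = 0" if "l2 M v" "\<And>j. inn M v (g j) = 0" for v
      using that c by (intro e_compl) auto
  qed (rule g(1))
qed

lemma bt_mode_primitive: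
  assumes Ob: "\<Omega> \<in> sets borel" and U: "bt \<Omega> T U" and D: "bt \<Omega> T D" and v: "v \<in> borel_measurable borel" "L2 \<Omega> v"
    and UD: "AE t in lebesgue_on {0<..<T}. AE x in lebesgue_on \<Omega>. U (t, x) = prim (\<lambda>r. D (r, x)) t"
  shows "AE t in lborel. t \<in> {0<..<T} \<longrightarrow> ip \<Omega> (\<lambda>x. U (t, x)) v = prim (\<lambda>s. ip \<Omega> (\<lambda>x. D (s, x)) v) t"
proof -
  have "AE t in lborel. t \<in> {0<..<T} \<longrightarrow> (AE x in lebesgue_on \<Omega>. U (t, x) = prim (\<lambda>r. D (r, x)) t)"
    using UD by (simp add: AE_lebesgue_on_iff)
  then show ?thesis using bt_L2[OF Ob U]
  proof eventually_elim
    case (elim t)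
    have "ip \<Omega> (\<lambda>x. U (t, x)) v = ip \<Omega> (\<lambda>x. prim (\<lambda>r. D (r, x)) t) v" if "t \<in> {0<..<T}"
      using that elim prim_section_L2[OF Ob D, of t] by (intro ip_cong v) auto
    then show ?case using prim_section_inn[OF Ob D _ v, of t] by simp
  qed
qed

text \<open>Mode by mode, \<open>(\<mu>, \<phi>)\<close> is a negative multiple of the derivative of a square.\<close>

lemma bt_dissipation:
  assumes Ob: "\<Omega> \<in> sets borel" and U: "bt \<Omega> T U" and D: "bt \<Omega> T D" and M: "bt \<Omega> T M" and s: "0 \<le> s" "s \<le> T"
    and UD: "AE t in lebesgue_on {0<..<T}. AE x in lebesgue_on \<Omega>. U (t, x) = prim (\<lambda>r. D (r, x)) t"
    and g: "onb (lebesgue_on \<Omega>) g" "\<And>j. g j \<in> borel_measurable borel" and \<kappa>: "\<And>j. 0 \<le> \<kappa> j"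
    and mode: "\<And>j. AE t in lebesgue_on {0<..<T}. ip \<Omega> (\<lambda>x. D (t, x)) (g j) + \<kappa> j * ip \<Omega> (\<lambda>x. M (t, x)) (g j) = 0"
  shows "prim (\<lambda>t. ip \<Omega> (\<lambda>x. M (t, x)) (\<lambda>x. U (t, x))) s \<le> 0"
proof -
  interpret onb "lebesgue_on \<Omega>" g by (rule g)
  define u d m where "u j t = ip \<Omega> (\<lambda>x. U (t, x)) (g j)" and "d j t = ip \<Omega> (\<lambda>x. D (t, x)) (g j)"
    and "m j t = ip \<Omega> (\<lambda>x. M (t, x)) (g j)" for j t
  have gL: "L2 \<Omega> (g j)" for j using e_l2 by (simp add: L2_eq)
  have l: "l2 lborel (u j)" "l2 lborel (d j)" "l2 lborel (m j)" for j
    using bt_inn_l2[OF Ob _ g(2) gL] U D M by (auto simp: u_def[abs_def] d_def[abs_def] m_def[abs_def] ip_eq)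
  have [measurable]: "u j \<in> borel_measurable borel" "d j \<in> borel_measurable borel" "m j \<in> borel_measurable borel" for j
    using l[of j, THEN l2_meas] by auto
  have [measurable]: "prim (d j) \<in> borel_measurable borel" for j by (rule prim_meas) measurable
  have up: "AE t in lborel. t \<in> {0<..<T} \<longrightarrow> u j t = prim (d j) t" for j
    using bt_mode_primitive[OF Ob U D g(2) gL UD] by (simp add: u_def d_def[abs_def])
  have md: "AE t in lborel. t \<in> {0<..<T} \<longrightarrow> d j t + \<kappa> j * m j t = 0" for j
    using mode[of j] by (simp add: AE_lebesgue_on_iff d_def m_def)
  have neg: "(LINT t|lborel. indicator {0<..<s} t * (m j t * u j t)) \<le> 0" for j
  proof (cases "\<kappa> j = 0")
    case True
    \<comment> \<open>For a mode with \<kappa> = 0 the equation says that the coefficient is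
      constant in time; it starts from 0 and so contributes nothing.\<close>
    have "prim (d j) t = 0" if "t \<le> T" for t
      unfolding prim_def
    proof (rule integral_eq_zero_AE)
      show "AE r in lborel. indicator {0<..<t} r * d j r = 0"
        using md[of j] by eventually_elim (use that True in \<open>auto simp: indicator_def\<close>)
    qed
    note p0 = this
    have "AE t in lborel. indicator {0<..<s} t * (m j t * u j t) = 0"
      using up[of j] by eventually_elim (use s p0 in \<open>auto simp: indicator_def\<close>)
    from integral_eq_zero_AE[OF this] show ?thesis by simp
  next
    case False
    \<comment> \<open>Here the coefficient of M is -1/\<kappa> times the derivative of the
      coefficient of U, and the product is the derivative of a square with a negative
      factor.\<close>
    have "(LINT t|lborel. indicator {0<..<s} t * (m j t * u j t)) = (LINT t|lborel. (- 1 / \<kappa> j) * (indicator {0<..<s} t * (d j t * prim (d j) t)))"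
    proof (rule integral_cong_AE)
      show "AE t in lborel. indicator {0<..<s} t * (m j t * u j t) = (- 1 / \<kappa> j) * (indicator {0<..<s} t * (d j t * prim (d j) t))"
        using md[of j] up[of j]
      proof eventually_elim
        case (elim t)
        show ?case
        proof (cases "t \<in> {0<..<s}")
          case True
          then have "t \<in> {0<..<T}" using s by auto
          then have "d j t = - \<kappa> j * m j t" "u j t = prim (d j) t" using elim by auto
          then show ?thesis using True False by simp
        qed simp
      qed
    qed measurable
    also have "\<dots> = (- 1 / \<kappa> j) * ((prim (d j) s)\<^sup>2 / 2)"
      using prim_square[OF l(2), of j s] by (simp only: prim_def[of "\<lambda>t. d j t * prim (d j) t"] integral_mult_right_zero)
    also have "\<dots> \<le> 0" using \<kappa>[of j] by (simp add: divide_nonneg_nonneg)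
    finally show ?thesis .
  qed
  let ?S = "\<lambda>N t. \<Sum>j<N. indicator {0<..<s} t * (m j t * u j t)"
  have LM: "AE t in lborel. L2 \<Omega> (\<lambda>x. M (t, x))" and LU: "AE t in lborel. L2 \<Omega> (\<lambda>x. U (t, x))"
    using bt_L2[OF Ob] M U by auto
  have MU: "integrable lborel (\<lambda>t. ip \<Omega> (\<lambda>x. M (t, x)) (\<lambda>x. U (t, x)))" by (rule bt_ip_integrable[OF Ob M U])
  \<comment> \<open>The sum over modes may be taken inside the time integral: Bessel bounds the
    partial sums by the squared norms, which are integrable in time.\<close>
  have "(\<lambda>N. LINT t|lborel. ?S N t) \<longlonglongrightarrow> (LINT t|lborel. indicator {0<..<s} t * ip \<Omega> (\<lambda>x. M (t, x)) (\<lambda>x. U (t, x)))"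
  proof (rule integral_dominated_convergence[where w = "\<lambda>t. nsq \<Omega> (\<lambda>x. M (t, x)) + nsq \<Omega> (\<lambda>x. U (t, x))"])
    show "(\<lambda>t. indicator {0<..<s} t * ip \<Omega> (\<lambda>x. M (t, x)) (\<lambda>x. U (t, x))) \<in> borel_measurable lborel"
      using borel_measurable_integrable[OF MU] by measurable
    show "integrable lborel (\<lambda>t. nsq \<Omega> (\<lambda>x. M (t, x)) + nsq \<Omega> (\<lambda>x. U (t, x)))"
      by (intro Bochner_Integration.integrable_add bt_nsq_integrable[OF Ob M] bt_nsq_integrable[OF Ob U])
    show "AE t in lborel. (\<lambda>N. ?S N t) \<longlonglongrightarrow> indicator {0<..<s} t * ip \<Omega> (\<lambda>x. M (t, x)) (\<lambda>x. U (t, x))"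
      using LM LU
    proof eventually_elim
      case (elim t)
      have "(\<lambda>j. m j t * u j t) sums ip \<Omega> (\<lambda>x. M (t, x)) (\<lambda>x. U (t, x))"
        using parseval elim by (simp add: m_def u_def ip_eq L2_eq)
      from sums_mult[OF this, of "indicator {0<..<s} t"] show ?case by (simp add: sums_def)
    qed
    show "AE t in lborel. norm (?S N t) \<le> nsq \<Omega> (\<lambda>x. M (t, x)) + nsq \<Omega> (\<lambda>x. U (t, x))" for N
      using LM LU
    proof eventually_elim
      case (elim t)
      have "norm (?S N t) \<le> (\<Sum>j<N. (m j t)\<^sup>2 + (u j t)\<^sup>2)"
      proof (rule order_trans[OF norm_sum sum_mono])
        fix j
        have "2 * (\<bar>m j t\<bar> * \<bar>u j t\<bar>) \<le> (m j t)\<^sup>2 + (u j t)\<^sup>2" using sum_squares_bound[of "\<bar>m j t\<bar>" "\<bar>u j t\<bar>"] by (simp add: mult.assoc)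
        moreover have "0 \<le> \<bar>m j t\<bar> * \<bar>u j t\<bar>" by simp
        ultimately have "\<bar>m j t\<bar> * \<bar>u j t\<bar> \<le> (m j t)\<^sup>2 + (u j t)\<^sup>2" by linarith
        then show "norm (indicator {0<..<s} t * (m j t * u j t)) \<le> (m j t)\<^sup>2 + (u j t)\<^sup>2"
          by (simp add: indicator_def abs_mult)
      qed
      also have "\<dots> = (\<Sum>j<N. (m j t)\<^sup>2) + (\<Sum>j<N. (u j t)\<^sup>2)" by (rule sum.distrib)
      also have "\<dots> \<le> nsq \<Omega> (\<lambda>x. M (t, x)) + nsq \<Omega> (\<lambda>x. U (t, x))"
      proof -
        have "(\<Sum>j<N. (ip \<Omega> v (g j))\<^sup>2) \<le> nsq \<Omega> v" if "L2 \<Omega> v" for v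
          using parseval_sq[of v] that sum_le_suminf[of "\<lambda>j. (ip \<Omega> v (g j))\<^sup>2" "{..<N}"]
          by (auto simp: L2_eq ip_eq nsq_eq sums_iff)
        then show ?thesis using elim unfolding m_def u_def by (intro add_mono)
      qed
      finally show ?case .
    qed
  qed measurable
  moreover have "(LINT t|lborel. ?S N t) \<le> 0" for N
  proof -
    have "integrable lborel (\<lambda>t. indicator {0<..<s} t * (m j t * u j t))" for j
      using integrable_mult_indicator[OF _ l2_mult[OF l(3,1)], of "{0<..<s}"] by simp
    then have "(LINT t|lborel. ?S N t) = (\<Sum>j<N. LINT t|lborel. indicator {0<..<s} t * (m j t * u j t))"
      by (intro Bochner_Integration.integral_sum)
    then show ?thesis using neg by (simp add: sum_nonpos)
  qed
  ultimately show ?thesis unfolding prim_def using LIMSEQ_le_const2 by blast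
qed

lemma (in limsol_rep) bases: "onb (lebesgue_on \<Omega>) g" "onb (lebesgue_on \<Omega>) h"
  using onb_cong_AE[OF spectral_onb[OF specA], of g] onb_cong_AE[OF spectral_onb[OF specB], of h] g h by (auto simp: L2_eq)

lemma partial_projection_le:
  assumes h: "onb (lebesgue_on \<Omega>) h" and v: "L2 \<Omega> v" and J: "finite J"
  shows "ip \<Omega> (\<lambda>x. \<Sum>j\<in>J. ip \<Omega> v (h j) * h j x) v \<le> nsq \<Omega> v"
proof -
  interpret onb "lebesgue_on \<Omega>" h by (rule h)
  note l = v[unfolded L2_eq]
  have "ip \<Omega> (\<lambda>x. \<Sum>j\<in>J. ip \<Omega> v (h j) * h j x) v = (\<Sum>j\<in>J. (inn (lebesgue_on \<Omega>) v (h j))\<^sup>2)"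
    unfolding ip_eq using lincomb_inn[OF J l] by (simp add: power2_eq_square)
  also have "\<dots> \<le> nsq \<Omega> v"
    using parseval_sq[OF l] sum_le_suminf[OF _ J, of "\<lambda>j. (inn (lebesgue_on \<Omega>) v (h j))\<^sup>2"]
    by (auto simp: nsq_eq sums_iff)
  finally show ?thesis .
qed

theorem mu_unique:
  assumes a: "limsol_rep \<Omega> T r \<tau> lam lam' e e' bh \<pi> f \<phi>1 d\<phi>1 \<mu>1 \<phi>0 U1 D1 M1 F"
    and b: "limsol_rep \<Omega> T r \<tau> lam lam' e e' bh \<pi> f \<phi>2 d\<phi>2 \<mu>2 \<phi>0 U2 D2 M2 F"
    and single: "\<And>x y1 y2. subdiff bh x y1 \<Longrightarrow> subdiff bh x y2 \<Longrightarrow> y1 = y2"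
  shows "AE t in lebesgue_on {0<..<T}. AE x in lebesgue_on \<Omega>. \<mu>1 t x = \<mu>2 t x"
proof -
  interpret A: limsol_rep \<Omega> T r \<tau> lam lam' e e' bh \<pi> f \<phi>1 d\<phi>1 \<mu>1 \<phi>0 U1 D1 M1 F by (rule a)
  interpret B: limsol_rep \<Omega> T r \<tau> lam lam' e e' bh \<pi> f \<phi>2 d\<phi>2 \<mu>2 \<phi>0 U2 D2 M2 F by (rule b)
  interpret G: onb "lebesgue_on \<Omega>" A.g by (rule A.bases)
  let ?I = "lebesgue_on {0<..<T}" let ?O = "lebesgue_on \<Omega>"
  define U D M where "U p = U1 p - U2 p" and "D p = D1 p - D2 p" and "M p = M1 p - M2 p" for p
  have bt: "bt \<Omega> T U" "bt \<Omega> T D" "bt \<Omega> T M"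
    unfolding U_def[abs_def] D_def[abs_def] M_def[abs_def] by (intro bt_diff A.U B.U A.D B.D A.M B.M)+
  note Ob = A.Ob
  have UD: "AE t in ?I. AE x in ?O. U (t, x) = prim (\<lambda>s. D (s, x)) t"
    using A.U_primitive B.U_primitive
  proof eventually_elim
    case (elim t)
    have "AE x in ?O. l2 lborel (\<lambda>s. D1 (s, x))" "AE x in ?O. l2 lborel (\<lambda>s. D2 (s, x))"
      using bt_time_sections[OF A.D(1)] bt_time_sections[OF B.D(1)] by (auto simp: AE_lebesgue_on_iff)
    with elim show ?case by eventually_elim (simp add: U_def D_def prim_sub)
  qed
  have mode: "AE t in ?I. ip \<Omega> (\<lambda>x. D (t, x)) (A.g j) + lam j powr (2 * r) * ip \<Omega> (\<lambda>x. M (t, x)) (A.g j) = 0" for j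
    using A.mode_equation[of j] B.mode_equation[of j] A.bt_section_L2[OF A.D(1)] A.bt_section_L2[OF B.D(1)]
      A.bt_section_L2[OF A.M(1)] A.bt_section_L2[OF B.M(1)]
  proof eventually_elim
    case (elim t)
    have "ip \<Omega> (\<lambda>x. D (t, x)) (A.g j) = ip \<Omega> (\<lambda>x. D1 (t, x)) (A.g j) - ip \<Omega> (\<lambda>x. D2 (t, x)) (A.g j)"
      "ip \<Omega> (\<lambda>x. M (t, x)) (A.g j) = ip \<Omega> (\<lambda>x. M1 (t, x)) (A.g j) - ip \<Omega> (\<lambda>x. M2 (t, x)) (A.g j)"
      using elim A.g(3)[of j] by (auto simp: D_def M_def ip_eq L2_eq intro!: inn_diff_left)
    note d = this
    have "ip \<Omega> (\<lambda>x. D (t, x)) (A.g j) + lam j powr (2 * r) * ip \<Omega> (\<lambda>x. M (t, x)) (A.g j)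
      = (ip \<Omega> (\<lambda>x. D1 (t, x)) (A.g j) + lam j powr (2 * r) * ip \<Omega> (\<lambda>x. M1 (t, x)) (A.g j))
      - (ip \<Omega> (\<lambda>x. D2 (t, x)) (A.g j) + lam j powr (2 * r) * ip \<Omega> (\<lambda>x. M2 (t, x)) (A.g j))"
      unfolding d right_diff_distrib by linarith
    then show ?case using elim(1,2) by simp
  qed
  obtain L where L: "L > 0" "\<And>x y. \<bar>\<pi> x - \<pi> y\<bar> \<le> L * \<bar>x - y\<bar>" using A.pi_lipschitz by blast
  have Qd: "A.Q (t, x) - B.Q (t, x) = (\<Sum>j\<in>{j. lam' j = 0}. ip \<Omega> (\<lambda>x. U (t, x)) (A.h j) * A.h j x)"
    if "L2 \<Omega> (\<lambda>x. U1 (t, x))" "L2 \<Omega> (\<lambda>x. U2 (t, x))" for t x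
  proof -
    have "ip \<Omega> (\<lambda>x. U (t, x)) (A.h j) = ip \<Omega> (\<lambda>x. U1 (t, x)) (A.h j) - ip \<Omega> (\<lambda>x. U2 (t, x)) (A.h j)" for j
      using that A.h(3)[of j] by (auto simp: U_def ip_eq L2_eq intro!: inn_diff_left)
    then show ?thesis by (simp add: A.Q_def B.Q_def left_diff_distrib sum_subtractf)
  qed
  \<comment> \<open>The difference of the two inclusions is multiplied by U and integrated over
    \<Omega>: monotonicity removes \<beta>, the projection term has a sign, and \<pi> costs L times
    the squared norm. The pairing of M with U is kept, because it has a sign only after integration
    in time.\<close>
  have energy: "AE t in ?I. \<tau> * ip \<Omega> (\<lambda>x. D (t, x)) (\<lambda>x. U (t, x)) \<le> ip \<Omega> (\<lambda>x. M (t, x)) (\<lambda>x. U (t, x)) + L * nsq \<Omega> (\<lambda>x. U (t, x))"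
    using A.inclusion B.inclusion A.bt_section_L2[OF A.U(1)] A.bt_section_L2[OF B.U(1)]
      A.bt_section_L2[OF bt(1)] A.bt_section_L2[OF bt(2)] A.bt_section_L2[OF bt(3)]
  proof eventually_elim
    case (elim t)
    let ?u = "\<lambda>x. U (t, x)" let ?d = "\<lambda>x. D (t, x)" let ?m = "\<lambda>x. M (t, x)"
    let ?q = "\<lambda>x. \<Sum>j\<in>{j. lam' j = 0}. ip \<Omega> ?u (A.h j) * A.h j x"
    have l: "l2 ?O ?u" "l2 ?O ?d" "l2 ?O ?m" "l2 ?O ?q"
      using elim(5-7) A.h(3) spectral_kernel_finite[OF A.specB] by (auto simp: L2_eq intro!: l2_lincomb)
    note i = l2_mult[OF l(1,1)] l2_mult[OF l(2,1)] l2_mult[OF l(3,1)] l2_mult[OF l(4,1)]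
    have "(LINT x|?O. \<tau> * (?d x * ?u x)) \<le> (LINT x|?O. ?m x * ?u x + ?q x * ?u x - ?u x * ?u x + L * (?u x * ?u x))"
    proof (rule integral_mono_AE)
      show "AE x in ?O. \<tau> * (?d x * ?u x) \<le> ?m x * ?u x + ?q x * ?u x - ?u x * ?u x + L * (?u x * ?u x)"
        using elim(1,2)
      proof eventually_elim
        case (elim x)
        let ?p = "\<pi> (U1 (t, x)) - \<pi> (U2 (t, x))"
        have "0 \<le> (A.\<Xi> (t, x) - B.\<Xi> (t, x)) * (U1 (t, x) - U2 (t, x))" by (rule subdiff_monotone[OF A.bh elim])
        also have "A.\<Xi> (t, x) - B.\<Xi> (t, x) = ?m x + ?q x - \<tau> * ?d x - ?u x - ?p"
          using Qd[OF \<open>L2 \<Omega> (\<lambda>x. U1 (t, x))\<close> \<open>L2 \<Omega> (\<lambda>x. U2 (t, x))\<close>, of x]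
          by (simp add: A.\<Xi>_def B.\<Xi>_def U_def D_def M_def algebra_simps)
        finally have "0 \<le> (?m x + ?q x - \<tau> * ?d x - ?u x - ?p) * ?u x" by (simp add: U_def)
        moreover have "- (?p * ?u x) \<le> L * (?u x * ?u x)"
        proof -
          have "- (?p * ?u x) \<le> \<bar>?p\<bar> * \<bar>?u x\<bar>" by (metis abs_ge_minus_self abs_mult)
          also have "\<dots> \<le> (L * \<bar>?u x\<bar>) * \<bar>?u x\<bar>" unfolding U_def by (intro mult_right_mono L(2)) simp
          finally show ?thesis by (simp add: mult.assoc)
        qed
        ultimately show ?case by (simp add: left_diff_distrib distrib_right mult.assoc)
      qed
    qed (intro Bochner_Integration.integrable_add Bochner_Integration.integrable_diff integrable_mult_right i)+
    also have "\<dots> = ip \<Omega> ?m ?u + ip \<Omega> ?q ?u - nsq \<Omega> ?u + L * nsq \<Omega> ?u"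
      unfolding nsq_def ip_def using i[unfolded ip_def]
      by (simp only: Bochner_Integration.integral_add Bochner_Integration.integral_diff integral_mult_right_zero
          Bochner_Integration.integrable_add Bochner_Integration.integrable_diff integrable_mult_right)
    also have "\<dots> \<le> ip \<Omega> ?m ?u + L * nsq \<Omega> ?u"
      using partial_projection_le[OF A.bases(2) elim(5) spectral_kernel_finite[OF A.specB]] by simp
    finally show ?case by (simp add: ip_def)
  qed
  define y where "y t = nsq \<Omega> (\<lambda>x. U (t, x))" for t
  have yi: "integrable lborel y" unfolding y_def[abs_def] by (rule bt_nsq_integrable[OF Ob bt(1)])
  note id = bt_ip_integrable[OF Ob bt(2,1)] and im = bt_ip_integrable[OF Ob bt(3,1)]
  \<comment> \<open>On the left the energy identity yields half the squared norm at time s, and on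
    the right the dissipation inequality removes the term with M.\<close>
  have step: "nsq \<Omega> (\<lambda>x. prim (\<lambda>r. D (r, x)) s) \<le> 2 * L / \<tau> * prim y s" if s: "0 \<le> s" "s \<le> T" for s
  proof -
    have ind: "integrable lborel (\<lambda>t. indicator {0<..<s} t * k t)" if "integrable lborel k" for k :: "real \<Rightarrow> real"
      using integrable_mult_indicator[OF _ that, of "{0<..<s}"] by simp
    have "\<tau> * prim (\<lambda>t. ip \<Omega> (\<lambda>x. D (t, x)) (\<lambda>x. U (t, x))) s
      = (LINT t|lborel. \<tau> * (indicator {0<..<s} t * ip \<Omega> (\<lambda>x. D (t, x)) (\<lambda>x. U (t, x))))"
      by (simp add: prim_def)
    also have "\<dots> \<le> (LINT t|lborel. indicator {0<..<s} t * ip \<Omega> (\<lambda>x. M (t, x)) (\<lambda>x. U (t, x)) + L * (indicator {0<..<s} t * y t))"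
    proof (rule integral_mono_AE)
      have "AE t in lborel. t \<in> {0<..<T} \<longrightarrow> \<tau> * ip \<Omega> (\<lambda>x. D (t, x)) (\<lambda>x. U (t, x)) \<le> ip \<Omega> (\<lambda>x. M (t, x)) (\<lambda>x. U (t, x)) + L * y t"
        using energy by (simp add: AE_lebesgue_on_iff y_def)
      then show "AE t in lborel. \<tau> * (indicator {0<..<s} t * ip \<Omega> (\<lambda>x. D (t, x)) (\<lambda>x. U (t, x)))
        \<le> indicator {0<..<s} t * ip \<Omega> (\<lambda>x. M (t, x)) (\<lambda>x. U (t, x)) + L * (indicator {0<..<s} t * y t)"
        by eventually_elim (use s in \<open>auto simp: indicator_def\<close>)
    qed (intro Bochner_Integration.integrable_add integrable_mult_right ind id im yi)+
    also have "\<dots> = prim (\<lambda>t. ip \<Omega> (\<lambda>x. M (t, x)) (\<lambda>x. U (t, x))) s + L * prim y s"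
      unfolding prim_def using ind[OF im] ind[OF yi] by simp
    also have "\<dots> \<le> L * prim y s"
    proof -
      have "prim (\<lambda>t. ip \<Omega> (\<lambda>x. M (t, x)) (\<lambda>x. U (t, x))) s \<le> 0"
        by (rule bt_dissipation[OF Ob bt s UD A.bases(1) A.g(1) _ mode]) simp
      then show ?thesis by simp
    qed
    finally show ?thesis using bt_energy[OF Ob bt(1,2) s UD] A.tau by (simp add: field_simps)
  qed
  define z where "z s = nsq \<Omega> (\<lambda>x. prim (\<lambda>r. D (r, x)) s)" for s
  have yz: "AE t in lborel. t \<in> {0<..<T} \<longrightarrow> y t = z t"
  proof -
    have "AE t in lborel. t \<in> {0<..<T} \<longrightarrow> (AE x in ?O. U (t, x) = prim (\<lambda>s. D (s, x)) t)"
      using UD by (simp add: AE_lebesgue_on_iff)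
    then show ?thesis using bt_L2[OF Ob bt(1)]
      by eventually_elim (auto simp: y_def z_def intro!: nsq_cong prim_section_L2[OF Ob bt(2)])
  qed
  have [measurable]: "y \<in> borel_measurable borel" using borel_measurable_integrable[OF yi] by simp
  have zm[measurable]: "z \<in> borel_measurable borel"
    using nsq_section_meas[OF prim_section_meas[OF bt(2), unfolded borel_prod] Ob] by (simp add: z_def[abs_def])
  have z0: "z s = 0" if s: "s \<in> {0..T}" for s
  proof -
    \<comment> \<open>Both solutions start from the same \<phi>0, so Gronwall applies with additive
      constant 0. It is applied to the norm of the primitive, which is defined at every time, rather
      than to \<open>y\<close>.\<close>
    have "z s \<le> 2 * 0 * exp (2 * (2 * L / \<tau>) * T)"
    proof (rule gronwall[OF _ _ zm _ _ _ s])
      show "0 \<le> z s" for s by (simp add: z_def nsq_eq inn_nonneg)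
      fix s assume s: "s \<in> {0..T}"
      have st: "z s \<le> 2 * L / \<tau> * prim y s" unfolding z_def using step s by simp
      have "prim y s \<le> (LINT t|lborel. y t)"
        unfolding prim_def by (rule integral_mono_AE'[OF yi]) (auto simp: indicator_def y_def nsq_eq inn_nonneg)
      then have "2 * L / \<tau> * prim y s \<le> 2 * L / \<tau> * (LINT t|lborel. y t)" by (rule mult_left_mono) (use L A.tau in simp)
      then show "z s \<le> 2 * L / \<tau> * (LINT t|lborel. y t)" using st by simp
      have "prim y s = prim z s"
        unfolding prim_def
      proof (rule integral_cong_AE)
        show "AE t in lborel. indicator {0<..<s} t * y t = indicator {0<..<s} t * z t"
          using yz by eventually_elim (use s in \<open>auto simp: indicator_def\<close>)
      qed measurable
      then show "z s \<le> 0 + 2 * L / \<tau> * prim z s" using st by simp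
    qed (use L A.tau in auto)
    moreover have "0 \<le> z s" by (simp add: z_def nsq_eq inn_nonneg)
    ultimately show ?thesis by simp
  qed
  have y0: "AE t in ?I. y t = 0" unfolding AE_lebesgue_on_iff[OF borel_open[OF open_greaterThanLessThan]]
    using yz by eventually_elim (use z0 in auto)
  have modes: "AE t in ?I. \<forall>j. ip \<Omega> (\<lambda>x. D (t, x)) (A.g j) + lam j powr (2 * r) * ip \<Omega> (\<lambda>x. M (t, x)) (A.g j) = 0"
    using mode by (simp add: AE_all_countable)
  show ?thesis
    using y0 modes A.M(2) B.M(2) A.inclusion B.inclusion A.bt_section_L2[OF A.U(1)] A.bt_section_L2[OF B.U(1)]
      A.bt_section_L2[OF bt(1)] A.bt_section_L2[OF bt(2)] A.bt_section_L2[OF bt(3)]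
  proof eventually_elim
    case (elim t)
    have u0: "AE x in ?O. U (t, x) = 0"
      using inn_zero_AE[of ?O "\<lambda>x. U (t, x)"] elim(1,9) by (simp add: y_def nsq_eq L2_eq)
    have q0: "A.Q (t, x) = B.Q (t, x)" for x
      using Qd[OF elim(7,8), of x] inn_AE_zero[OF u0] by (simp add: ip_eq)
    \<comment> \<open>With equal first components, single-valuedness of \<beta> equates the two
      selections; all remaining terms cancel except M and \<tau> D.\<close>
    have md: "AE x in ?O. M (t, x) = \<tau> * D (t, x)"
      using u0 elim(5,6)
    proof eventually_elim
      case (elim x)
      have "U1 (t, x) = U2 (t, x)" using elim(1) by (simp add: U_def)
      moreover from this have "A.\<Xi> (t, x) = B.\<Xi> (t, x)" using single elim(2,3) by simp
      ultimately show ?case using q0[of x] by (simp add: A.\<Xi>_def B.\<Xi>_def M_def D_def algebra_simps)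
    qed
    have "ip \<Omega> (\<lambda>x. M (t, x)) (A.g j) = 0" for j
    proof -
      have "ip \<Omega> (\<lambda>x. M (t, x)) (A.g j) = ip \<Omega> (\<lambda>x. \<tau> * D (t, x)) (A.g j)"
        using elim(10,11) md A.g(3) by (intro ip_cong) (auto simp: L2_eq intro: l2_scale)
      then have m: "ip \<Omega> (\<lambda>x. M (t, x)) (A.g j) = \<tau> * ip \<Omega> (\<lambda>x. D (t, x)) (A.g j)"
        by (simp add: ip_eq inn_scale_left)
      \<comment> \<open>Inserting M = \<tau> D into the mode equation gives a strictly positive
        factor 1 + \<tau> \<lambda>^(2r), also for the zero eigenvalue; hence even the mean value of
        \<mu> is determined.\<close>
      then have "ip \<Omega> (\<lambda>x. D (t, x)) (A.g j) * (1 + lam j powr (2 * r) * \<tau>) = 0"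
        using elim(2)[rule_format, of j] by (simp add: algebra_simps)
      moreover have "1 + lam j powr (2 * r) * \<tau> > 0" using A.tau by (simp add: add_pos_nonneg)
      ultimately show ?thesis using m by simp
    qed
    then have "AE x in ?O. M (t, x) = 0" using elim(11) by (intro G.e_compl) (auto simp: L2_eq ip_eq)
    with elim(3,4) show ?case by eventually_elim (simp add: M_def)
  qed
qed

theorem theorem2p11:
  fixes \<Omega> :: "pt set" and T r \<sigma>0 \<tau> \<eta> :: real
    and lam lam' :: "nat \<Rightarrow> real" and e e' :: "nat \<Rightarrow> pt \<Rightarrow> real"
    and bh :: "real \<Rightarrow> ereal" and pih \<pi> :: "real \<Rightarrow> real"
    and f \<phi> d\<phi> \<mu> :: "real \<Rightarrow> pt \<Rightarrow> real" and \<phi>0 :: "pt \<Rightarrow> real"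
  assumes dom: "smooth_domain \<Omega>"
    and T: "T > 0" and r: "r > 0" and \<sigma>0: "\<sigma>0 > 0" and \<tau>: "\<tau> > 0"
    and specA: "spectral \<Omega> lam e" and specB: "spectral \<Omega> lam' e'"
    and lam1: "lam 0 > 0 \<or> (lam 0 = 0 \<and> lam 0 < lam 1 \<and> (\<exists>c. AE x in lebesgue_on \<Omega>. e 0 x = c))"
    and constB: "lam 0 = 0 \<Longrightarrow> \<forall>\<sigma>\<in>{0<..<\<sigma>0}. \<forall>c. (\<lambda>x. c) \<in> Vsp \<Omega> lam' e' \<sigma>"
    and bh: "bhat_ok bh"
    and pih: "\<forall>s. (pih has_real_derivative \<pi> s) (at s)"
    and \<pi>lip: "\<exists>L. \<forall>x y. \<bar>\<pi> x - \<pi> y\<bar> \<le> L * \<bar>x - y\<bar>"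
    and Fcoer: "Liminf at_infinity (\<lambda>s. (bh s + ereal (pih s)) / ereal (s\<^sup>2)) > 0"
    and \<phi>0L1: "intB \<Omega> bh \<phi>0 < \<infinity>"
    and VB: "\<exists>n::nat. n > 0 \<and> Vsp \<Omega> lam' e' (real n) \<subseteq> {v. inH \<Omega> 1 v}"
    and \<eta>: "0 < \<eta>" "\<eta> \<le> 1"
    and VA: "Vsp \<Omega> lam e (2 * r) \<subseteq> {v. inH \<Omega> \<eta> v}"
    and f: "L2T_X \<Omega> T (sob_nsq \<Omega> \<eta>) f"
    and \<phi>0: "inH \<Omega> \<eta> \<phi>0"
    and sol: "limsol \<Omega> T lam e lam' e' r \<tau> bh \<pi> f \<phi>0 \<phi> d\<phi> \<mu>"
  shows "L2T_X \<Omega> T (sob_nsq \<Omega> \<eta>) \<phi>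
    \<and> (\<exists>\<xi>. L2T \<Omega> T \<xi> \<and>
         (AE t in lebesgue_on {0<..<T}. AE x in lebesgue_on \<Omega>.
            subdiff bh (\<phi> t x) (\<xi> t x) \<and>
            \<tau> * d\<phi> t x + \<phi> t x - orth_proj \<Omega> (kerOp \<Omega> lam' e') (\<phi> t) x + \<xi> t x + \<pi> (\<phi> t x)
              = \<mu> t x + f t x))
    \<and> ((\<forall>x y1 y2. subdiff bh x y1 \<and> subdiff bh x y2 \<longrightarrow> y1 = y2) \<longrightarrow>
         (\<forall>\<phi>1 d\<phi>1 \<mu>1 \<phi>2 d\<phi>2 \<mu>2.
            limsol \<Omega> T lam e lam' e' r \<tau> bh \<pi> f \<phi>0 \<phi>1 d\<phi>1 \<mu>1 \<and>
            limsol \<Omega> T lam e lam' e' r \<tau> bh \<pi> f \<phi>0 \<phi>2 d\<phi>2 \<mu>2 \<longrightarrow>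
            (AE t in lebesgue_on {0<..<T}. AE x in lebesgue_on \<Omega>. \<mu>1 t x = \<mu>2 t x)))"
proof -
  have Om: "open \<Omega>" "bounded \<Omega>" using dom by (auto simp: smooth_domain_def)
  have p0: "L2 \<Omega> \<phi>0" using \<phi>0 by (auto simp: inH_def sob_nsq_def split: if_splits)
  have "L2T \<Omega> T f" using f by (simp add: L2T_X_def)
  from bt_rep[OF Om(1) this] obtain F where F: "bt \<Omega> T F"
    "AE t in lebesgue_on {0<..<T}. AE x in lebesgue_on \<Omega>. f t x = F (t, x)" by blast
  note ex = limsol_rep_exists[OF Om T \<tau> specA specB bh \<pi>lip _ p0 F]
  obtain U D M where "limsol_rep \<Omega> T r \<tau> lam lam' e e' bh \<pi> f \<phi> d\<phi> \<mu> \<phi>0 U D M F" using ex[OF sol] by blast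
  then interpret limsol_rep \<Omega> T r \<tau> lam lam' e e' bh \<pi> f \<phi> d\<phi> \<mu> \<phi>0 U D M F .
  \<comment> \<open>The two cases differ only in the kernel family: difference quotients for \<eta>
    = 1, one Slobodeckij kernel otherwise.\<close>
  have "L2T_X \<Omega> T (sob_nsq \<Omega> \<eta>) \<phi>"
  proof (cases "\<eta> = 1")
    case True
    then show ?thesis using regularity[OF h1_family[OF Om spectral_onb[OF specA]] VB] VA f \<phi>0 by simp
  next
    case False
    then show ?thesis using regularity[OF slob_family[OF dom] VB VA f \<phi>0] \<eta> by simp
  qed
  moreover have "AE t in lebesgue_on {0<..<T}. AE x in lebesgue_on \<Omega>. \<mu>1 t x = \<mu>2 t x"
    if single: "\<forall>x y1 y2. subdiff bh x y1 \<and> subdiff bh x y2 \<longrightarrow> y1 = y2"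
      and s: "limsol \<Omega> T lam e lam' e' r \<tau> bh \<pi> f \<phi>0 \<phi>1 d\<phi>1 \<mu>1" "limsol \<Omega> T lam e lam' e' r \<tau> bh \<pi> f \<phi>0 \<phi>2 d\<phi>2 \<mu>2"
    for \<phi>1 d\<phi>1 \<mu>1 \<phi>2 d\<phi>2 \<mu>2
  proof -
    obtain U1 D1 M1 where 1: "limsol_rep \<Omega> T r \<tau> lam lam' e e' bh \<pi> f \<phi>1 d\<phi>1 \<mu>1 \<phi>0 U1 D1 M1 F" using ex[OF s(1)] by blast
    obtain U2 D2 M2 where 2: "limsol_rep \<Omega> T r \<tau> lam lam' e e' bh \<pi> f \<phi>2 d\<phi>2 \<mu>2 \<phi>0 U2 D2 M2 F" using ex[OF s(2)] by blast
    show ?thesis by (rule mu_unique[OF 1 2]) (use single in blast)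
  qed
  ultimately show ?thesis using selection by blast
qed

end
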